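(* Up to equiaffine transformations of $\mathbb{R}^3$, the only helicoidal indefinite improper affine spheres with complete non-flat affine metric are the surfaces $\psi_{a,c,m}=(\psi_1,\psi_2,\psi_3):\mathbb{R}^2\to\mathbb{R}^3$, $(s,t)\mapsto\psi_{a,c,m}(s,t)$, $$\psi_1=\tfrac14 e^{s-t}\big(e^{2t}(a+2c+m)-a+2c-m\big),$$ $$\psi_2=\tfrac1{4c}e^{-s-t}\big(e^{2t}(-a+2c+m)+a+2c-m\big),$$ $$\psi_3=as+\frac{e^{-2t}\big(-a^2+(-2c+m)^2\big)+e^{2t}\big(a^2-(2c+m)^2\big)+4\,(a^2+4c^2-m^2)\,t}{16c},$$ with $a\in\mathbb{R}$, $c>0$, $m>0$ satisfying $$4cm>|4c^2+m^2-a^2| .$$ That is, each such $\psi_{a,c,m}$ is a helicoidal indefinite improper affine sphere with complete non-flat affine metric, and every helicoidal indefinite improper affine sphere with complete non-flat affine metric is, up to an equiaffine transformation, one of them.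
   Context: $[\cdot,\cdot,\cdot]$ is the determinant in $\mathbb{R}^3$. An equiaffine transformation of $\mathbb{R}^3$ is a map $v\mapsto Av+v_0$ with $A\in SL(3,\mathbb{R})$, $v_0\in\mathbb{R}^3$. An indefinite improper affine sphere is an immersion $\psi:\Sigma\to\mathbb{R}^3$ of a (connected) surface with constant affine normal $\xi$, i.e. transversal to a constant vector $\xi\neq0$, such that the symmetric bilinear form $h$ (the affine metric) defined by $D_X d\psi(Y)=d\psi(\nabla_XY)+h(X,Y)\xi$, with $D$ the flat connection of $\mathbb{R}^3$, is a Lorentzian metric and $\sqrt{h(X,Y)^2-h(X,X)h(Y,Y)}=|[d\psi(X),d\psi(Y),\xi]|$ for all tangent vectors $X,Y$. Completeness and flatness refer to the Lorentzian metric $h$. It is helicoidal if it is invariant under a (non-trivial) one-parameter group $\{T^s:s\in\mathbb{R}\}$ of equiaffine transformations of $\mathbb{R}^3$. The surfaces $\psi_{a,c,m}$ have affine normal $\xi=(0,0,1)$ and are invariant under the group $$T_{3a}^s(v)=\begin{pmatrix} e^s & 0 & 0 \\ 0 & e^{-s} & 0 \\ 0 & 0 & 1 \end{pmatrix} v+\begin{pmatrix} 0 \\ 0 \\ a s \end{pmatrix}.$$ Up to a vertical translation, $\psi_{a,c,m}$ is the indefinite improper affine sphere with affine normal $(0,0,1)$ that contains the orbit $\alpha(s)=(ce^s,e^{-s},as)$ with $h(\alpha',\alpha')=m$. Surfaces are identified up to reparametrization. *)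

theory Defs
  imports "HOL-Analysis.Analysis"
begin

section \<open>Smooth surfaces\<close>

primrec C_k_on :: "nat \<Rightarrow> 'a::euclidean_space set \<Rightarrow> ('a \<Rightarrow> 'b::real_normed_vector) \<Rightarrow> bool" where
  "C_k_on 0 S f \<longleftrightarrow> continuous_on S f"
| "C_k_on (Suc k) S f \<longleftrightarrow>
     (\<exists>f'. (\<forall>x\<in>S. (f has_derivative f' x) (at x)) \<and> (\<forall>v. C_k_on k S (\<lambda>x. f' x v)))"

text \<open>\<open>C\<^sup>\<infinity>\<close>; only meaningful for open \<open>S\<close>.\<close>
definition smooth_on :: "'a::euclidean_space set \<Rightarrow> ('a \<Rightarrow> 'b::real_normed_vector) \<Rightarrow> bool" where
  "smooth_on S f \<longleftrightarrow> (\<forall>k. C_k_on k S f)"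

text \<open>A chart is a pair \<open>(U, \<phi>)\<close> with \<open>\<phi>\<close> relevant only on \<open>U\<close>.\<close>
type_synonym 'p chart = "'p set \<times> ('p \<Rightarrow> real^2)"

definition chart_image :: "'p chart \<Rightarrow> (real^2) set" where
  "chart_image c = snd c ` fst c"

text \<open>The expression \<open>f \<circ> \<phi>\<^sup>-\<^sup>1\<close> of a map \<open>f\<close> in a chart.\<close>
definition in_chart :: "'p chart \<Rightarrow> ('p \<Rightarrow> 'b) \<Rightarrow> real^2 \<Rightarrow> 'b" where
  "in_chart c f = f \<circ> inv_into (fst c) (snd c)"

text \<open>A connected two-dimensional \<open>C\<^sup>\<infinity>\<close> manifold, given by its topology and an
  (arbitrary, not necessarily maximal) atlas.\<close>
definition smooth_surface :: "'p topology \<Rightarrow> 'p chart set \<Rightarrow> bool" where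
  "smooth_surface X A \<longleftrightarrow>
     Hausdorff_space X \<and> second_countable X \<and> connected_space X \<and> topspace X \<noteq> {} \<and>
     (\<forall>(U, \<phi>)\<in>A. openin X U \<and> open (\<phi> ` U) \<and>
        homeomorphic_map (subtopology X U) (top_of_set (\<phi> ` U)) \<phi>) \<and>
     (\<Union>(U, \<phi>)\<in>A. U) = topspace X \<and>
     (\<forall>(U, \<phi>)\<in>A. \<forall>(V, \<theta>)\<in>A. smooth_on (\<phi> ` (U \<inter> V)) (in_chart (U, \<phi>) \<theta>))"

definition plane_atlas :: "(real^2) chart set" where
  "plane_atlas = {(UNIV, \<lambda>p. p)}"

definition smooth_map ::
  "'p topology \<Rightarrow> 'p chart set \<Rightarrow> 'q topology \<Rightarrow> 'q chart set \<Rightarrow> ('p \<Rightarrow> 'q) \<Rightarrow> bool" where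
  "smooth_map X A Y B F \<longleftrightarrow> continuous_map X Y F \<and>
     (\<forall>(U, \<phi>)\<in>A. \<forall>(V, \<theta>)\<in>B.
        smooth_on (\<phi> ` {p \<in> U. F p \<in> V}) (in_chart (U, \<phi>) (\<theta> \<circ> F)))"

definition diffeomorphism ::
  "'p topology \<Rightarrow> 'p chart set \<Rightarrow> 'q topology \<Rightarrow> 'q chart set \<Rightarrow> ('p \<Rightarrow> 'q) \<Rightarrow> bool" where
  "diffeomorphism X A Y B F \<longleftrightarrow> smooth_map X A Y B F \<and>
     (\<exists>G. smooth_map Y B X A G \<and> (\<forall>p\<in>topspace X. G (F p) = p) \<and> (\<forall>q\<in>topspace Y. F (G q) = q))"

definition is_reparametrization ::
  "'p topology \<Rightarrow> 'p chart set \<Rightarrow> ('p \<Rightarrow> 'b) \<Rightarrow>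
   'q topology \<Rightarrow> 'q chart set \<Rightarrow> ('q \<Rightarrow> 'b) \<Rightarrow> bool" where
  "is_reparametrization X A f Y B f' \<longleftrightarrow>
     (\<exists>F. diffeomorphism X A Y B F \<and> (\<forall>p\<in>topspace X. f p = f' (F p)))"

definition smooth_immersion :: "'p chart set \<Rightarrow> ('p \<Rightarrow> real^3) \<Rightarrow> bool" where
  "smooth_immersion A f \<longleftrightarrow>
     (\<forall>c\<in>A. smooth_on (chart_image c) (in_chart c f) \<and>
        (\<forall>u\<in>chart_image c. inj (frechet_derivative (in_chart c f) (at u))))"


section \<open>Lorentzian metrics on a surface\<close>

text \<open>A field of bilinear forms, given by its coefficient matrix \<open>(g\<^sub>i\<^sub>j)\<close> at each point of
  the image of each chart.\<close>
type_synonym 'p metric = "'p chart \<Rightarrow> real^2 \<Rightarrow> real^2^2"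

definition form :: "real^2^2 \<Rightarrow> real^2 \<Rightarrow> real^2 \<Rightarrow> real" where
  "form G v w = v \<bullet> (G *v w)"

definition lorentzian_form :: "real^2^2 \<Rightarrow> bool" where
  "lorentzian_form G \<longleftrightarrow> transpose G = G \<and>
     (\<exists>v w. form G v v = 1 \<and> form G w w = -1 \<and> form G v w = 0)"

definition partial :: "2 \<Rightarrow> (real^2 \<Rightarrow> 'b::real_normed_vector) \<Rightarrow> real^2 \<Rightarrow> 'b" where
  "partial i f u = frechet_derivative f (at u) (axis i 1)"

text \<open>\<open>christoffel G k i j\<close> is \<open>\<Gamma>\<^sup>k\<^sub>i\<^sub>j\<close> of the Levi-Civita connection of the metric with
  coefficients \<open>G\<close>.\<close>
definition christoffel :: "(real^2 \<Rightarrow> real^2^2) \<Rightarrow> 2 \<Rightarrow> 2 \<Rightarrow> 2 \<Rightarrow> real^2 \<Rightarrow> real" where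
  "christoffel G k i j u = (\<Sum>l\<in>UNIV. matrix_inv (G u) $ k $ l *
     (partial i (\<lambda>x. G x $ j $ l) u + partial j (\<lambda>x. G x $ i $ l) u
       - partial l (\<lambda>x. G x $ i $ j) u)) / 2"

text \<open>\<open>riemann G l k i j\<close> is the coefficient of \<open>\<partial>\<^sub>l\<close> in \<open>R(\<partial>\<^sub>i, \<partial>\<^sub>j)\<partial>\<^sub>k\<close>.\<close>
definition riemann :: "(real^2 \<Rightarrow> real^2^2) \<Rightarrow> 2 \<Rightarrow> 2 \<Rightarrow> 2 \<Rightarrow> 2 \<Rightarrow> real^2 \<Rightarrow> real" where
  "riemann G l k i j u =
     partial i (christoffel G l j k) u - partial j (christoffel G l i k) u +
     (\<Sum>m\<in>UNIV. christoffel G l i m u * christoffel G m j k u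
              - christoffel G l j m u * christoffel G m i k u)"

definition flat_metric :: "'p chart set \<Rightarrow> 'p metric \<Rightarrow> bool" where
  "flat_metric A g \<longleftrightarrow>
     (\<forall>c\<in>A. \<forall>u\<in>chart_image c. \<forall>l k i j. riemann (g c) l k i j u = 0)"

text \<open>Affinely parametrized geodesics on an open interval \<open>I\<close> (constant curves included);
  \<open>x'\<close> and \<open>x''\<close> are the first two derivatives of the curve in the chart.\<close>
definition geodesic_on ::
  "'p topology \<Rightarrow> 'p chart set \<Rightarrow> 'p metric \<Rightarrow> real set \<Rightarrow> (real \<Rightarrow> 'p) \<Rightarrow> bool" where
  "geodesic_on X A g I \<gamma> \<longleftrightarrow> continuous_map (top_of_set I) X \<gamma> \<and>
     (\<forall>(U, \<phi>)\<in>A. \<exists>x' x''. \<forall>t\<in>I. \<gamma> t \<in> U \<longrightarrow>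
        ((\<lambda>r. \<phi> (\<gamma> r)) has_vector_derivative x' t) (at t) \<and>
        (x' has_vector_derivative x'' t) (at t) \<and>
        (\<forall>k. x'' t $ k +
           (\<Sum>i\<in>UNIV. \<Sum>j\<in>UNIV. christoffel (g (U, \<phi>)) k i j (\<phi> (\<gamma> t)) * x' t $ i * x' t $ j) = 0))"

text \<open>Geodesic completeness: every geodesic extends to one defined on all of \<open>\<real>\<close>.\<close>
definition complete_metric :: "'p topology \<Rightarrow> 'p chart set \<Rightarrow> 'p metric \<Rightarrow> bool" where
  "complete_metric X A g \<longleftrightarrow>
     (\<forall>I \<gamma>. open I \<and> is_interval I \<and> I \<noteq> {} \<and> geodesic_on X A g I \<gamma> \<longrightarrow>
        (\<exists>\<gamma>'. geodesic_on X A g UNIV \<gamma>' \<and> (\<forall>t\<in>I. \<gamma>' t = \<gamma> t)))"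


section \<open>Indefinite improper affine spheres\<close>

definition det3 :: "real^3 \<Rightarrow> real^3 \<Rightarrow> real^3 \<Rightarrow> real" where
  "det3 a b c = det (vector [a, b, c] :: real^3^3)"

text \<open>The coefficient \<open>h(v, w)\<close> in \<open>D\<^sub>v d\<psi>(w) = d\<psi>(\<nabla>\<^sub>v w) + h(v, w) \<xi>\<close>, where \<open>x\<close> is the expression
  of \<open>\<psi>\<close> in a chart and \<open>v, w\<close> are constant coordinate fields. It is well defined when
  \<open>x\<close> is transversal to \<open>\<xi>\<close> at \<open>u\<close>.\<close>
definition transversal_coeff ::
  "(real^2 \<Rightarrow> real^3) \<Rightarrow> real^3 \<Rightarrow> real^2 \<Rightarrow> real^2 \<Rightarrow> real^2 \<Rightarrow> real" where
  "transversal_coeff x \<xi> u v w =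
     (THE r. frechet_derivative (\<lambda>y. frechet_derivative x (at y) w) (at u) v - r *\<^sub>R \<xi>
               \<in> range (frechet_derivative x (at u)))"

definition affine_metric :: "('p \<Rightarrow> real^3) \<Rightarrow> real^3 \<Rightarrow> 'p metric" where
  "affine_metric \<psi> \<xi> c u =
     (\<chi> i j. transversal_coeff (in_chart c \<psi>) \<xi> u (axis i 1) (axis j 1))"

definition indefinite_improper_affine_sphere ::
  "'p topology \<Rightarrow> 'p chart set \<Rightarrow> ('p \<Rightarrow> real^3) \<Rightarrow> real^3 \<Rightarrow> bool" where
  "indefinite_improper_affine_sphere X A \<psi> \<xi> \<longleftrightarrow>
     smooth_surface X A \<and> smooth_immersion A \<psi> \<and> \<xi> \<noteq> 0 \<and>
     (\<forall>c\<in>A. \<forall>u\<in>chart_image c.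
        let d\<psi> = frechet_derivative (in_chart c \<psi>) (at u); h = form (affine_metric \<psi> \<xi> c u) in
          \<xi> \<notin> range d\<psi> \<and>
          lorentzian_form (affine_metric \<psi> \<xi> c u) \<and>
          (\<forall>v w. sqrt ((h v w)\<^sup>2 - h v v * h w w) = \<bar>det3 (d\<psi> v) (d\<psi> w) \<xi>\<bar>))"


section \<open>Equiaffine transformations and helicoidal surfaces\<close>

definition equiaffine :: "(real^3 \<Rightarrow> real^3) \<Rightarrow> bool" where
  "equiaffine T \<longleftrightarrow> (\<exists>(A :: real^3^3) v0. det A = 1 \<and> T = (\<lambda>v. A *v v + v0))"

definition one_parameter_group :: "(real \<Rightarrow> real^3 \<Rightarrow> real^3) \<Rightarrow> bool" where
  "one_parameter_group T \<longleftrightarrow>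
     (\<forall>s. equiaffine (T s)) \<and> T 0 = id \<and> (\<forall>s r. T (s + r) = T s \<circ> T r) \<and>
     (\<forall>v. continuous_on UNIV (\<lambda>s. T s v))"

definition helicoidal :: "'p topology \<Rightarrow> ('p \<Rightarrow> real^3) \<Rightarrow> bool" where
  "helicoidal X \<psi> \<longleftrightarrow>
     (\<exists>T. one_parameter_group T \<and> (\<exists>s. T s \<noteq> id) \<and>
          (\<forall>s. T s ` (\<psi> ` topspace X) = \<psi> ` topspace X))"

text \<open>The affine normal \<open>\<xi>\<close> of \<open>\<psi>\<close> is unique up to sign, and replacing \<open>\<xi>\<close> by \<open>-\<xi>\<close> replaces
  the affine metric by its negative, which does not affect completeness or flatness.\<close>
definition complete_nonflat_helicoidal_IAS ::
  "'p topology \<Rightarrow> 'p chart set \<Rightarrow> ('p \<Rightarrow> real^3) \<Rightarrow> bool" where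
  "complete_nonflat_helicoidal_IAS X A \<psi> \<longleftrightarrow>
     helicoidal X \<psi> \<and>
     (\<exists>\<xi>. indefinite_improper_affine_sphere X A \<psi> \<xi> \<and>
          complete_metric X A (affine_metric \<psi> \<xi>) \<and> \<not> flat_metric A (affine_metric \<psi> \<xi>))"

definition psi_acm :: "real \<Rightarrow> real \<Rightarrow> real \<Rightarrow> real^2 \<Rightarrow> real^3" where
  "psi_acm a c m p = (let s = p $ 1; t = p $ 2 in vector
     [1/4 * exp (s - t) * (exp (2*t) * (a + 2*c + m) - a + 2*c - m),
      1/(4*c) * exp (- s - t) * (exp (2*t) * (- a + 2*c + m) + a + 2*c - m),
      a * s + (exp (- 2*t) * (- a\<^sup>2 + (- 2*c + m)\<^sup>2) + exp (2*t) * (a\<^sup>2 - (2*c + m)\<^sup>2)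
              + 4 * (a\<^sup>2 + 4*c\<^sup>2 - m\<^sup>2) * t) / (16*c)])"

definition admissible :: "real \<Rightarrow> real \<Rightarrow> real \<Rightarrow> bool" where
  "admissible a c m \<longleftrightarrow> c > 0 \<and> m > 0 \<and> 4*c*m > \<bar>4*c\<^sup>2 + m\<^sup>2 - a\<^sup>2\<bar>"

end

theory Submission
  imports Defs
begin

text \<open>Normalize the affine normal to \<open>(0, 0, 1)\<close>, write the surface as \<open>(Z, \<zeta>)\<close> with \<open>Z\<close> in the plane, and let
  \<open>P\<close> be the conormal map, \<open>d\<zeta> = - [P, dZ]\<close>. The condition on the volume says that \<open>\<alpha> = (Z + P) / 2\<close> and
  \<open>\<beta> = (Z - P) / 2\<close> have rank one, and the affine metric is \<open>- ([d\<alpha>, d\<beta>] + [d\<alpha>, d\<beta>]\<^sup>T)\<close>; hence the null lines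
  are \<open>\<alpha> = const\<close> and \<open>\<beta> = const\<close>. The generator of the group is tangent to the surface and annihilates the
  affine normal; \<open>\<alpha>\<close> and \<open>\<beta>\<close> then run in orbits of two affine vector fields \<open>B x + b1\<close>, \<open>B x + b2\<close> with
  \<open>tr B = 0\<close>. If one of these orbits is a line, the metric is flat. Otherwise completeness of the null
  lines forces \<open>det B < 0\<close>, so that the orbits are branches of hyperbolas with the same asymptotic directions
  but in different quadrants, \<open>\<alpha> = (e\<^sup>u, \<kappa> e\<^sup>-\<^sup>u)\<close> and \<open>\<beta> = (\<mu> e\<^sup>v, e\<^sup>-\<^sup>v)\<close> with \<open>\<kappa> \<mu> < 0\<close>. Completeness of
  the null lines also makes \<open>(u, v)\<close> a global coordinate system, and \<open>\<zeta>\<close> is found by integration. Conversely, the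
  metric of \<open>\<psi>\<^sub>a\<^sub>,\<^sub>c\<^sub>,\<^sub>m\<close> is \<open>K cosh (2 (t - d)) (ds\<^sup>2 - dt\<^sup>2)\<close>, whose geodesic equation reduces to a globally
  Lipschitz system.\<close>

subsection \<open>Calculus of smooth maps\<close>

text \<open>Invariance is given only for the image of the surface as a set, and the group is only
  continuous in its parameter. The group need not act on the abstract surface, since \<psi> may fail
  to be injective. So the group is first shown to be differentiable, and after that only its
  generator is used.

  The metric is the one induced by the map (\<alpha>, \<beta>) from a flat neutral form on R^4. Its
  geodesics are therefore described by the second derivatives of \<alpha> and \<beta> along the
  curve, without Christoffel symbols. On a null line one of \<alpha>, \<beta> is constant, and a
  determinant with a constant vector is the affine parameter.

  In the classification, completeness is used only for null lines. Neither embeddedness nor simple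
  connectedness is assumed, so the bijectivity of (u, v) has to come from continuing local inverses
  along these lines; the difficulty there is that the lines are chosen point by point, with no
  continuity in the starting point.\<close>

lemma C_k_on_cong:
  assumes "open S" "\<And>x. x \<in> S \<Longrightarrow> f x = g x" "C_k_on k S f"
  shows "C_k_on k S g"
proof (cases k)
  case 0
  then show ?thesis using assms by (simp cong: continuous_on_cong)
next
  case (Suc j)
  then obtain f' where "\<forall>x\<in>S. (f has_derivative f' x) (at x)" "\<forall>v. C_k_on j S (\<lambda>x. f' x v)"
    using assms by auto
  moreover have "(g has_derivative f' x) (at x)" if "x \<in> S" for x
    using has_derivative_transform_within_open[OF _ assms(1) that, of f "f' x" UNIV g] calculation(1) that assms(2)
    by simp
  ultimately show ?thesis using Suc by auto
qed

lemma C_k_on_SucD: "C_k_on (Suc k) S f \<Longrightarrow> C_k_on k S f"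
proof (induction k arbitrary: f)
  case 0
  then show ?case
    by (auto intro!: continuous_at_imp_continuous_on dest: has_derivative_continuous)
next
  case (Suc k)
  then obtain f' where "\<forall>x\<in>S. (f has_derivative f' x) (at x)" "\<forall>v. C_k_on (Suc k) S (\<lambda>x. f' x v)"
    using C_k_on.simps(2) by blast
  then show ?case using Suc.IH by auto
qed

lemma C_k_on_subset: "C_k_on k S f \<Longrightarrow> T \<subseteq> S \<Longrightarrow> C_k_on k T f"
proof (induction k arbitrary: f)
  case 0
  then show ?case using continuous_on_subset by auto
next
  case (Suc k)
  then obtain f' where "\<forall>x\<in>S. (f has_derivative f' x) (at x)" "\<forall>v. C_k_on k S (\<lambda>x. f' x v)"
    by auto
  then show ?case
    using Suc.IH Suc.prems(2) unfolding C_k_on.simps by (intro exI[of _ f']) blast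
qed

lemma C_k_on_const: "C_k_on k S (\<lambda>x. c)"
proof (induction k arbitrary: c)
  case (Suc k)
  have "\<forall>x\<in>S. ((\<lambda>x. c) has_derivative (\<lambda>v. 0)) (at x)" by simp
  then show ?case using Suc unfolding C_k_on.simps by (intro exI[of _ "\<lambda>x v. 0"]) auto
qed simp

lemma C_k_on_add: "C_k_on k S f \<Longrightarrow> C_k_on k S g \<Longrightarrow> C_k_on k S (\<lambda>x. f x + g x)"
proof (induction k arbitrary: f g)
  case 0
  then show ?case by (simp add: continuous_on_add)
next
  case (Suc k)
  obtain f' where f': "\<forall>x\<in>S. (f has_derivative f' x) (at x)" "\<forall>v. C_k_on k S (\<lambda>x. f' x v)"
    using Suc.prems by auto
  obtain g' where g': "\<forall>x\<in>S. (g has_derivative g' x) (at x)" "\<forall>v. C_k_on k S (\<lambda>x. g' x v)"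
    using Suc.prems by auto
  show ?case
    using f' g' Suc.IH unfolding C_k_on.simps
    by (intro exI[of _ "\<lambda>x v. f' x v + g' x v"]) (auto intro!: has_derivative_add)
qed

lemma C_k_on_sum: "finite I \<Longrightarrow> (\<And>i. i \<in> I \<Longrightarrow> C_k_on k S (f i)) \<Longrightarrow> C_k_on k S (\<lambda>x. \<Sum>i\<in>I. f i x)"
proof (induction I rule: finite_induct)
  case empty
  then show ?case by (simp add: C_k_on_const)
next
  case (insert i I)
  then show ?case by (simp add: C_k_on_add)
qed

lemma C_k_on_bounded_bilinear:
  assumes "bounded_bilinear B"
  shows "C_k_on k S f \<Longrightarrow> C_k_on k S g \<Longrightarrow> C_k_on k S (\<lambda>x. B (f x) (g x))"
proof (induction k arbitrary: f g)
  case 0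
  then show ?case using bounded_bilinear.continuous_on[OF assms] by auto
next
  case (Suc k)
  obtain f' where f': "\<forall>x\<in>S. (f has_derivative f' x) (at x)" "\<forall>v. C_k_on k S (\<lambda>x. f' x v)"
    using Suc.prems by auto
  obtain g' where g': "\<forall>x\<in>S. (g has_derivative g' x) (at x)" "\<forall>v. C_k_on k S (\<lambda>x. g' x v)"
    using Suc.prems by auto
  have "C_k_on k S f" "C_k_on k S g"
    using Suc.prems C_k_on_SucD by auto
  then show ?case
    using f' g' Suc.IH unfolding C_k_on.simps
    by (intro exI[of _ "\<lambda>x v. B (f x) (g' x v) + B (f' x v) (g x)"])
      (auto intro!: C_k_on_add bounded_bilinear.FDERIV[OF assms])
qed

lemma C_k_on_bounded_linear:
  assumes "bounded_linear L"
  shows "C_k_on k S f \<Longrightarrow> C_k_on k S (\<lambda>x. L (f x))"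
proof (induction k arbitrary: f)
  case 0
  then show ?case using bounded_linear.continuous_on[OF assms] by auto
next
  case (Suc k)
  obtain f' where f': "\<forall>x\<in>S. (f has_derivative f' x) (at x)" "\<forall>v. C_k_on k S (\<lambda>x. f' x v)"
    using Suc.prems by auto
  then show ?case
    using Suc.IH unfolding C_k_on.simps
    by (intro exI[of _ "\<lambda>x v. L (f' x v)"]) (auto intro!: bounded_linear.has_derivative[OF assms])
qed

lemma C_k_on_ident: "C_k_on k S (\<lambda>x. x)"
proof (cases k)
  case (Suc j)
  then show ?thesis
    by (auto intro!: exI[of _ "\<lambda>x v. v"] C_k_on_const)
qed auto

lemma C_k_on_compose:
  fixes f :: "'a::euclidean_space \<Rightarrow> 'b::euclidean_space" and g :: "'b \<Rightarrow> 'c::real_normed_vector"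
  shows "C_k_on k S f \<Longrightarrow> C_k_on k T g \<Longrightarrow> f ` S \<subseteq> T \<Longrightarrow> open S \<Longrightarrow> C_k_on k S (\<lambda>x. g (f x))"
proof (induction k arbitrary: f g)
  case 0
  then show ?case using continuous_on_compose2 by auto
next
  case (Suc k)
  obtain f' where f': "\<forall>x\<in>S. (f has_derivative f' x) (at x)" "\<forall>v. C_k_on k S (\<lambda>x. f' x v)"
    using Suc.prems by auto
  obtain g' where g': "\<forall>x\<in>T. (g has_derivative g' x) (at x)" "\<forall>v. C_k_on k T (\<lambda>x. g' x v)"
    using Suc.prems by auto
  have fk: "C_k_on k S f" by (rule C_k_on_SucD[OF Suc.prems(1)])
  have der: "((\<lambda>x. g (f x)) has_derivative (\<lambda>v. g' (f x) (f' x v))) (at x)" if "x \<in> S" for x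
    by (rule has_derivative_compose[of f "f' x" x UNIV g "g' (f x)"]) (use f' g' that Suc.prems(3) in blast)+
  \<comment> \<open>The definition controls the derivative of \<open>g\<close> only in a fixed
    direction, while the direction \<open>f' x v\<close> moves with \<open>x\<close>. Expanding it
    in the basis leaves fixed directions with coefficients to which the induction hypothesis and the
    product rule apply.\<close>
  have "C_k_on k S (\<lambda>x. g' (f x) (f' x v))" for v
  proof (rule C_k_on_cong[OF Suc.prems(4)])
    show "C_k_on k S (\<lambda>x. \<Sum>b\<in>Basis. (f' x v \<bullet> b) *\<^sub>R g' (f x) b)"
      using f'(2) g'(2) Suc.IH[OF fk] Suc.prems
      by (intro C_k_on_sum C_k_on_bounded_bilinear[OF bounded_bilinear_scaleR]
          C_k_on_bounded_linear[OF bounded_linear_inner_left]) auto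
    show "(\<Sum>b\<in>Basis. (f' x v \<bullet> b) *\<^sub>R g' (f x) b) = g' (f x) (f' x v)" if "x \<in> S" for x
    proof -
      have "linear (g' (f x))" using g' that Suc.prems has_derivative_linear by blast
      then have "g' (f x) (\<Sum>b\<in>Basis. (f' x v \<bullet> b) *\<^sub>R b) = (\<Sum>b\<in>Basis. (f' x v \<bullet> b) *\<^sub>R g' (f x) b)"
        by (simp add: linear_sum linear_cmul)
      then show ?thesis by (simp add: euclidean_representation)
    qed
  qed
  then show ?case using der unfolding C_k_on.simps by (intro exI[of _ "\<lambda>x v. g' (f x) (f' x v)"]) auto
qed

lemma smooth_on_cong:
  "open S \<Longrightarrow> (\<And>x. x \<in> S \<Longrightarrow> f x = g x) \<Longrightarrow> smooth_on S f \<Longrightarrow> smooth_on S g"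
  unfolding smooth_on_def using C_k_on_cong[of S f g] by simp

lemma smooth_on_subset: "smooth_on S f \<Longrightarrow> T \<subseteq> S \<Longrightarrow> smooth_on T f"
  unfolding smooth_on_def using C_k_on_subset[of _ S f T] by simp

lemma smooth_on_const: "smooth_on S (\<lambda>x. c)"
  by (simp add: smooth_on_def C_k_on_const)

lemma smooth_on_ident: "smooth_on S (\<lambda>x. x)"
  by (simp add: smooth_on_def C_k_on_ident)

lemma smooth_on_bounded_linear: "bounded_linear L \<Longrightarrow> smooth_on S f \<Longrightarrow> smooth_on S (\<lambda>x. L (f x))"
  unfolding smooth_on_def by (rule allI, rule C_k_on_bounded_linear) simp_all

lemma smooth_on_bounded_bilinear:
  "bounded_bilinear B \<Longrightarrow> smooth_on S f \<Longrightarrow> smooth_on S g \<Longrightarrow> smooth_on S (\<lambda>x. B (f x) (g x))"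
  unfolding smooth_on_def by (rule allI, rule C_k_on_bounded_bilinear) simp_all

lemma smooth_on_add: "smooth_on S f \<Longrightarrow> smooth_on S g \<Longrightarrow> smooth_on S (\<lambda>x. f x + g x)"
  by (simp add: smooth_on_def C_k_on_add)

lemma smooth_on_sum:
  "finite I \<Longrightarrow> (\<And>i. i \<in> I \<Longrightarrow> smooth_on S (f i)) \<Longrightarrow> smooth_on S (\<lambda>x. \<Sum>i\<in>I. f i x)"
  by (simp add: smooth_on_def C_k_on_sum)

lemma smooth_on_minus: "smooth_on S f \<Longrightarrow> smooth_on S (\<lambda>x. - f x)"
  by (rule smooth_on_bounded_linear[OF bounded_linear_minus[OF bounded_linear_ident]])

lemma smooth_on_diff: "smooth_on S f \<Longrightarrow> smooth_on S g \<Longrightarrow> smooth_on S (\<lambda>x. f x - g x)"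
  using smooth_on_add[of S f "\<lambda>x. - g x"] smooth_on_minus[of S g] by simp

lemma smooth_on_scaleR: "smooth_on S f \<Longrightarrow> smooth_on S g \<Longrightarrow> smooth_on S (\<lambda>x. f x *\<^sub>R g x)"
  by (rule smooth_on_bounded_bilinear[OF bounded_bilinear_scaleR])

lemma smooth_on_mult:
  fixes f :: "'a::euclidean_space \<Rightarrow> real"
  shows "smooth_on S f \<Longrightarrow> smooth_on S g \<Longrightarrow> smooth_on S (\<lambda>x. f x * g x)"
  by (rule smooth_on_bounded_bilinear[OF bounded_bilinear_mult])

lemma smooth_on_compose:
  fixes f :: "'a::euclidean_space \<Rightarrow> 'b::euclidean_space"
  assumes "smooth_on T g" "smooth_on S f" "f ` S \<subseteq> T" "open S"
  shows "smooth_on S (\<lambda>x. g (f x))"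
  using assms(1,2) unfolding smooth_on_def by (auto intro: C_k_on_compose[OF _ _ assms(3,4)])

lemma smooth_on_imp_continuous_on: "smooth_on S f \<Longrightarrow> continuous_on S f"
  unfolding smooth_on_def by (drule spec[of _ 0]) simp

lemma smooth_on_has_derivative:
  assumes "smooth_on S f" "x \<in> S"
  shows "(f has_derivative frechet_derivative f (at x)) (at x)"
proof -
  have "C_k_on (Suc 0) S f" using assms(1) unfolding smooth_on_def by blast
  then obtain f' where "(f has_derivative f') (at x)" using assms(2) by auto
  then show ?thesis using frechet_derivative_works differentiableI by blast
qed

lemma smooth_on_frechet_derivative:
  assumes "smooth_on S f" "open S"
  shows "smooth_on S (\<lambda>x. frechet_derivative f (at x) v)"
  unfolding smooth_on_def
proof
  fix k
  have "C_k_on (Suc k) S f" using assms(1) unfolding smooth_on_def by blast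
  then obtain f' where f': "\<forall>x\<in>S. (f has_derivative f' x) (at x)" "\<forall>v. C_k_on k S (\<lambda>x. f' x v)"
    unfolding C_k_on.simps by blast
  show "C_k_on k S (\<lambda>x. frechet_derivative f (at x) v)"
  proof (rule C_k_on_cong[OF assms(2)])
    show "f' x v = frechet_derivative f (at x) v" if "x \<in> S" for x
      using f'(1) that frechet_derivative_at by metis
    show "C_k_on k S (\<lambda>x. f' x v)" using f'(2) by blast
  qed
qed

lemma smooth_on_partial: "smooth_on S f \<Longrightarrow> open S \<Longrightarrow> smooth_on S (partial i f)"
  using smooth_on_frechet_derivative[of S f "axis i 1"] by (simp add: partial_def[abs_def])

lemma smooth_onI:
  assumes "\<And>x. x \<in> S \<Longrightarrow> (f has_derivative f' x) (at x)" "\<And>v. smooth_on S (\<lambda>x. f' x v)"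
  shows "smooth_on S f"
  unfolding smooth_on_def
proof
  fix k
  have "C_k_on (Suc k) S f" using assms unfolding smooth_on_def by auto
  then show "C_k_on k S f" by (rule C_k_on_SucD)
qed

text \<open>The derivative is a product of the function with itself, so each order of smoothness
  gives the next.\<close>

lemma smooth_on_inverse_real: "smooth_on {x::real. x \<noteq> 0} inverse"
  unfolding smooth_on_def
proof
  fix k show "C_k_on k {x::real. x \<noteq> 0} inverse"
  proof (induction k)
    case 0
    then show ?case by (auto intro!: continuous_intros)
  next
    case (Suc k)
    have "C_k_on k {x::real. x \<noteq> 0} (\<lambda>x. - (inverse x * v * inverse x))" for v
      by (intro C_k_on_bounded_linear[OF bounded_linear_minus[OF bounded_linear_ident]]
          C_k_on_bounded_bilinear[OF bounded_bilinear_mult] Suc C_k_on_const)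
    then show ?case
      by (auto intro!: exI[of _ "\<lambda>x v. - (inverse x * v * inverse x)"] has_derivative_inverse')
  qed
qed

lemma smooth_on_exp_real: "smooth_on UNIV (exp::real \<Rightarrow> real)"
  unfolding smooth_on_def
proof
  fix k show "C_k_on k UNIV (exp::real \<Rightarrow> real)"
  proof (induction k)
    case 0
    then show ?case by (auto intro!: continuous_intros)
  next
    case (Suc k)
    have "C_k_on k UNIV (\<lambda>x::real. exp x * v)" for v
      by (intro C_k_on_bounded_bilinear[OF bounded_bilinear_mult] Suc C_k_on_const)
    then show ?case
      using DERIV_exp unfolding has_field_derivative_def
      by (auto intro!: exI[of _ "\<lambda>x v. exp x * v"])
  qed
qed

lemma smooth_on_ln_real: "smooth_on {0::real<..} ln"
proof (rule smooth_onI)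
  show "(ln has_derivative (\<lambda>v. inverse x * v)) (at x)" if "x \<in> {0<..}" for x :: real
    using that DERIV_ln[of x] unfolding has_field_derivative_def by simp
  show "smooth_on {0::real<..} (\<lambda>x. inverse x * v)" for v
    by (intro smooth_on_mult smooth_on_const smooth_on_subset[OF smooth_on_inverse_real]) auto
qed

lemma smooth_on_inverse:
  fixes f :: "'a::euclidean_space \<Rightarrow> real"
  shows "smooth_on S f \<Longrightarrow> open S \<Longrightarrow> (\<And>x. x \<in> S \<Longrightarrow> f x \<noteq> 0) \<Longrightarrow> smooth_on S (\<lambda>x. inverse (f x))"
  by (rule smooth_on_compose[OF smooth_on_inverse_real]) auto

lemma smooth_on_divide:
  fixes f :: "'a::euclidean_space \<Rightarrow> real"
  shows "smooth_on S f \<Longrightarrow> smooth_on S g \<Longrightarrow> open S \<Longrightarrow> (\<And>x. x \<in> S \<Longrightarrow> g x \<noteq> 0) \<Longrightarrow> smooth_on S (\<lambda>x. f x / g x)"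
  unfolding divide_inverse by (intro smooth_on_mult smooth_on_inverse)

lemma smooth_on_exp:
  fixes f :: "'a::euclidean_space \<Rightarrow> real"
  shows "smooth_on S f \<Longrightarrow> open S \<Longrightarrow> smooth_on S (\<lambda>x. exp (f x))"
  by (rule smooth_on_compose[OF smooth_on_exp_real]) auto

lemma smooth_on_ln:
  fixes f :: "'a::euclidean_space \<Rightarrow> real"
  shows "smooth_on S f \<Longrightarrow> open S \<Longrightarrow> (\<And>x. x \<in> S \<Longrightarrow> f x > 0) \<Longrightarrow> smooth_on S (\<lambda>x. ln (f x))"
  by (rule smooth_on_compose[OF smooth_on_ln_real]) auto

lemma smooth_on_vec_nth: "smooth_on S f \<Longrightarrow> smooth_on S (\<lambda>x. f x $ i)"
  by (rule smooth_on_bounded_linear[OF bounded_linear_vec_nth])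

lemma smooth_on_vecI:
  fixes f :: "'a::euclidean_space \<Rightarrow> real^'n"
  assumes "\<And>i. smooth_on S (\<lambda>x. f x $ i)"
  shows "smooth_on S f"
proof -
  have "f = (\<lambda>x. \<Sum>i\<in>UNIV. f x $ i *\<^sub>R axis i 1)"
    by (simp add: fun_eq_iff scalar_mult_eq_scaleR[symmetric] basis_expansion)
  moreover have "smooth_on S (\<lambda>x. \<Sum>i\<in>UNIV. f x $ i *\<^sub>R axis i (1::real))"
    by (intro smooth_on_sum smooth_on_scaleR smooth_on_const assms) auto
  ultimately show ?thesis by simp
qed

lemma smooth_on_matrix_vector_mult: "smooth_on S f \<Longrightarrow> smooth_on S (\<lambda>x. (M::real^'n^'m) *v f x)"
  by (rule smooth_on_bounded_linear[OF matrix_vector_mul_bounded_linear])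

lemmas smooth_on_intros = smooth_on_const smooth_on_ident smooth_on_add smooth_on_diff smooth_on_minus
  smooth_on_scaleR smooth_on_mult smooth_on_exp smooth_on_vec_nth smooth_on_matrix_vector_mult
  smooth_on_partial

section \<open>Symmetry of second derivatives\<close>

text \<open>The mean value theorem is applied twice, once along \<open>v\<close> and once along
  \<open>w\<close>. The left-hand side is symmetric in \<open>v\<close> and \<open>w\<close>, the
  right-hand side is not; this is the source of the symmetry of second derivatives.\<close>

lemma second_difference_mean_value:
  fixes f :: "'a::euclidean_space \<Rightarrow> real"
  assumes "open S" "smooth_on S f" "h > 0"
    "\<And>s t. 0 \<le> s \<Longrightarrow> s \<le> h \<Longrightarrow> 0 \<le> t \<Longrightarrow> t \<le> h \<Longrightarrow> u + s *\<^sub>R v + t *\<^sub>R w \<in> S"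
  obtains s t where "0 < s" "s < h" "0 < t" "t < h"
    "f (u + h *\<^sub>R v + h *\<^sub>R w) - f (u + h *\<^sub>R v) - f (u + h *\<^sub>R w) + f u
      = h * h * frechet_derivative (\<lambda>y. frechet_derivative f (at y) v) (at (u + s *\<^sub>R v + t *\<^sub>R w)) w"
proof -
  define F where "F y = frechet_derivative f (at y) v" for y
  have F: "smooth_on S F" unfolding F_def by (rule smooth_on_frechet_derivative[OF assms(2,1)])
  have lin: "frechet_derivative g (at y) (r *\<^sub>R x) = r * frechet_derivative g (at y) x"
    if "smooth_on S g" "y \<in> S" for g :: "'a \<Rightarrow> real" and x y r
    using linear_cmul[OF has_derivative_linear[OF smooth_on_has_derivative[OF that]]] by simp
  have d1: "((\<lambda>s. f (u + s *\<^sub>R v + t *\<^sub>R w)) has_real_derivative F (u + s *\<^sub>R v + t *\<^sub>R w)) (at s)"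
    if "0 \<le> s" "s \<le> h" "0 \<le> t" "t \<le> h" for s t
  proof -
    have "((\<lambda>s. f (u + s *\<^sub>R v + t *\<^sub>R w)) has_derivative
        (\<lambda>r. frechet_derivative f (at (u + s *\<^sub>R v + t *\<^sub>R w)) (r *\<^sub>R v))) (at s)"
      by (rule has_derivative_compose[where f="\<lambda>s. u + s *\<^sub>R v + t *\<^sub>R w", OF _ smooth_on_has_derivative[OF assms(2) assms(4)[OF that]]])
        (auto intro!: derivative_eq_intros)
    then show ?thesis
      using lin[OF assms(2) assms(4)[OF that]] unfolding has_field_derivative_def F_def
      by (simp add: mult_commute_abs)
  qed
  have d2: "((\<lambda>t. F (u + s *\<^sub>R v + t *\<^sub>R w)) has_real_derivative
      frechet_derivative F (at (u + s *\<^sub>R v + t *\<^sub>R w)) w) (at t)"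
    if "0 \<le> s" "s \<le> h" "0 \<le> t" "t \<le> h" for s t
  proof -
    have "((\<lambda>t. F (u + s *\<^sub>R v + t *\<^sub>R w)) has_derivative
        (\<lambda>r. frechet_derivative F (at (u + s *\<^sub>R v + t *\<^sub>R w)) (r *\<^sub>R w))) (at t)"
      by (rule has_derivative_compose[where f="\<lambda>t. u + s *\<^sub>R v + t *\<^sub>R w", OF _ smooth_on_has_derivative[OF F assms(4)[OF that]]])
        (auto intro!: derivative_eq_intros)
    then show ?thesis
      using lin[OF F assms(4)[OF that]] unfolding has_field_derivative_def
      by (simp add: mult_commute_abs)
  qed
  have "\<exists>s. 0 < s \<and> s < h \<and>
      (f (u + h *\<^sub>R v + h *\<^sub>R w) - f (u + h *\<^sub>R v + 0 *\<^sub>R w)) - (f (u + 0 *\<^sub>R v + h *\<^sub>R w) - f (u + 0 *\<^sub>R v + 0 *\<^sub>R w))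
      = (h - 0) * (F (u + s *\<^sub>R v + h *\<^sub>R w) - F (u + s *\<^sub>R v + 0 *\<^sub>R w))"
    by (rule MVT2[where f="\<lambda>s. f (u + s *\<^sub>R v + h *\<^sub>R w) - f (u + s *\<^sub>R v + 0 *\<^sub>R w)"])
      (use assms(3) d1[of _ h] d1[of _ 0] in \<open>auto intro!: DERIV_diff\<close>)
  then obtain s where s: "0 < s" "s < h"
    "(f (u + h *\<^sub>R v + h *\<^sub>R w) - f (u + h *\<^sub>R v + 0 *\<^sub>R w)) - (f (u + 0 *\<^sub>R v + h *\<^sub>R w) - f (u + 0 *\<^sub>R v + 0 *\<^sub>R w))
      = (h - 0) * (F (u + s *\<^sub>R v + h *\<^sub>R w) - F (u + s *\<^sub>R v + 0 *\<^sub>R w))" by blast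
  have "\<exists>t. 0 < t \<and> t < h \<and> F (u + s *\<^sub>R v + h *\<^sub>R w) - F (u + s *\<^sub>R v + 0 *\<^sub>R w)
      = (h - 0) * frechet_derivative F (at (u + s *\<^sub>R v + t *\<^sub>R w)) w"
    by (rule MVT2[where f="\<lambda>t. F (u + s *\<^sub>R v + t *\<^sub>R w)"]) (use assms(3) s d2 in auto)
  then obtain t where "0 < t" "t < h" "F (u + s *\<^sub>R v + h *\<^sub>R w) - F (u + s *\<^sub>R v + 0 *\<^sub>R w)
      = (h - 0) * frechet_derivative F (at (u + s *\<^sub>R v + t *\<^sub>R w)) w" by blast
  then show ?thesis
    using that[of s t] s unfolding F_def by simp
qed

text \<open>One and the same second difference equals a value of each mixed derivative at some point
  near \<open>u\<close>. Both mixed derivatives are continuous, so they agree at \<open>u\<close> up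
  to any \<open>e\<close>.\<close>

lemma second_derivative_symmetric_real:
  fixes f :: "'a::euclidean_space \<Rightarrow> real"
  assumes "open S" "smooth_on S f" "u \<in> S"
  shows "frechet_derivative (\<lambda>y. frechet_derivative f (at y) v) (at u) w
    = frechet_derivative (\<lambda>y. frechet_derivative f (at y) w) (at u) v"
proof -
  define D where "D v w x = frechet_derivative (\<lambda>y. frechet_derivative f (at y) v) (at x) w" for v w x
  have cont: "isCont (D v w) u" for v w
    using smooth_on_frechet_derivative[OF smooth_on_frechet_derivative[OF assms(2,1)] assms(1), THEN smooth_on_imp_continuous_on]
      assms(1,3) unfolding D_def by (simp add: continuous_on_eq_continuous_at)
  have "\<bar>D v w u - D w v u\<bar> \<le> e" if "e > 0" for e
  proof -
    have "\<forall>\<^sub>F x in nhds u. dist (D v w x) (D v w u) < e/2" for v w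
      using cont[of v w] half_gt_zero[OF \<open>e > 0\<close>]
      unfolding isCont_def tendsto_iff eventually_nhds_conv_at by (metis dist_self)
    then have "\<forall>\<^sub>F x in nhds u. dist (D v w x) (D v w u) < e/2 \<and> dist (D w v x) (D w v u) < e/2 \<and> x \<in> S"
      by (intro eventually_conj eventually_nhds_in_open assms)
    then obtain d where d: "d > 0" "\<And>x. dist x u < d \<Longrightarrow>
        dist (D v w x) (D v w u) < e/2 \<and> dist (D w v x) (D w v u) < e/2 \<and> x \<in> S"
      unfolding eventually_nhds_metric by auto
    \<comment> \<open>Small enough that the parallelogram with sides \<open>h *\<^sub>R v\<close>
      and \<open>h *\<^sub>R w\<close> stays in the ball of radius \<open>d\<close>; the summand 1
      keeps the denominator positive when both vectors vanish.\<close>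
    define h where "h = d / (2 * (norm v + norm w + 1))"
    have pos: "norm v + norm w + 1 > 0" using norm_ge_zero[of v] norm_ge_zero[of w] by linarith
    then have h: "h > 0" using d(1) unfolding h_def by simp
    have hb: "h * (norm v + norm w + 1) = d / 2" using pos unfolding h_def by (simp add: field_simps)
    have near: "dist (u + s *\<^sub>R v + t *\<^sub>R w) u < d" if "0 \<le> s" "s \<le> h" "0 \<le> t" "t \<le> h" for s t
    proof -
      have "dist (u + s *\<^sub>R v + t *\<^sub>R w) u = norm (s *\<^sub>R v + t *\<^sub>R w)" by (simp add: dist_norm)
      also have "\<dots> \<le> s * norm v + t * norm w" using that norm_triangle_ineq[of "s *\<^sub>R v" "t *\<^sub>R w"] by simp
      also have "\<dots> \<le> h * norm v + h * norm w" using that by (intro add_mono mult_right_mono) auto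
      also have "\<dots> \<le> h * (norm v + norm w + 1)" using h by (simp add: algebra_simps)
      also have "\<dots> < d" using hb d(1) by simp
      finally show ?thesis .
    qed
    have near': "dist (u + s *\<^sub>R w + t *\<^sub>R v) u < d" if "0 \<le> s" "s \<le> h" "0 \<le> t" "t \<le> h" for s t
      using near[OF that(3,4,1,2)] by (simp add: add_ac)
    obtain s t where st: "0 < s" "s < h" "0 < t" "t < h"
      "f (u + h *\<^sub>R v + h *\<^sub>R w) - f (u + h *\<^sub>R v) - f (u + h *\<^sub>R w) + f u = h * h * D v w (u + s *\<^sub>R v + t *\<^sub>R w)"
      unfolding D_def
      by (rule second_difference_mean_value[OF assms(1,2) h, of u v w]) (use d(2)[OF near] in blast)+
    obtain s' t' where st': "0 < s'" "s' < h" "0 < t'" "t' < h"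
      "f (u + h *\<^sub>R w + h *\<^sub>R v) - f (u + h *\<^sub>R w) - f (u + h *\<^sub>R v) + f u = h * h * D w v (u + s' *\<^sub>R w + t' *\<^sub>R v)"
      unfolding D_def
      by (rule second_difference_mean_value[OF assms(1,2) h, of u w v]) (use d(2)[OF near'] in blast)+
    have "f (u + h *\<^sub>R w + h *\<^sub>R v) = f (u + h *\<^sub>R v + h *\<^sub>R w)" by (simp add: add_ac)
    then have "h * h * D v w (u + s *\<^sub>R v + t *\<^sub>R w) = h * h * D w v (u + s' *\<^sub>R w + t' *\<^sub>R v)"
      using st(5) st'(5) by linarith
    then have "D v w (u + s *\<^sub>R v + t *\<^sub>R w) = D w v (u + s' *\<^sub>R w + t' *\<^sub>R v)"
      using h by simp
    moreover have "dist (D v w (u + s *\<^sub>R v + t *\<^sub>R w)) (D v w u) < e/2" using d(2)[OF near] st by auto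
    moreover have "dist (D w v (u + s' *\<^sub>R w + t' *\<^sub>R v)) (D w v u) < e/2" using d(2)[OF near'] st' by auto
    ultimately show ?thesis unfolding dist_real_def by linarith
  qed
  then have "\<bar>D v w u - D w v u\<bar> \<le> 0" using field_le_epsilon[of "\<bar>D v w u - D w v u\<bar>" 0] by simp
  then show ?thesis unfolding D_def by simp
qed

lemma second_derivative_symmetric:
  fixes f :: "'a::euclidean_space \<Rightarrow> 'b::euclidean_space"
  assumes "open S" "smooth_on S f" "u \<in> S"
  shows "frechet_derivative (\<lambda>y. frechet_derivative f (at y) v) (at u) w
    = frechet_derivative (\<lambda>y. frechet_derivative f (at y) w) (at u) v"
proof (rule euclidean_eqI)
  fix b :: 'b assume "b \<in> Basis"
  have *: "frechet_derivative (\<lambda>y. g y \<bullet> b) (at x) = (\<lambda>v. frechet_derivative g (at x) v \<bullet> b)"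
    if "smooth_on S g" "x \<in> S" for g :: "'a \<Rightarrow> 'b" and x
    using has_derivative_inner_left[OF smooth_on_has_derivative[OF that], of b]
    by (rule frechet_derivative_at[symmetric])
  have sm: "smooth_on S (\<lambda>y. f y \<bullet> b)"
    by (rule smooth_on_bounded_linear[OF bounded_linear_inner_left assms(2)])
  have **: "frechet_derivative (\<lambda>y. frechet_derivative (\<lambda>y. f y \<bullet> b) (at y) v) (at u) w
      = frechet_derivative (\<lambda>y. frechet_derivative f (at y) v) (at u) w \<bullet> b" for v w
  proof -
    have "((\<lambda>y. frechet_derivative f (at y) v \<bullet> b) has_derivative
        (\<lambda>w. frechet_derivative (\<lambda>y. frechet_derivative f (at y) v) (at u) w \<bullet> b)) (at u)"
      using has_derivative_inner_left[OF smooth_on_has_derivative[OF smooth_on_frechet_derivative[OF assms(2,1)] assms(3)]] .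
    then have "((\<lambda>y. frechet_derivative (\<lambda>y. f y \<bullet> b) (at y) v) has_derivative
        (\<lambda>w. frechet_derivative (\<lambda>y. frechet_derivative f (at y) v) (at u) w \<bullet> b)) (at u)"
      by (rule has_derivative_transform_within_open[OF _ assms(1,3)]) (simp add: *[OF assms(2)])
    then show ?thesis by (rule frechet_derivative_at[symmetric, THEN fun_cong])
  qed
  show "frechet_derivative (\<lambda>y. frechet_derivative f (at y) v) (at u) w \<bullet> b
    = frechet_derivative (\<lambda>y. frechet_derivative f (at y) w) (at u) v \<bullet> b"
    using second_derivative_symmetric_real[OF assms(1) sm assms(3), of v w] by (simp add: **)
qed

lemma partial_commute:
  fixes f :: "real^2 \<Rightarrow> 'b::euclidean_space"
  assumes "open S" "smooth_on S f" "u \<in> S"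
  shows "partial i (partial j f) u = partial j (partial i f) u"
  using second_derivative_symmetric[OF assms] unfolding partial_def[abs_def] .

subsection \<open>Ordinary differential equations\<close>

text \<open>The bound on the derivative makes \<open>exp (- 2 * L * t)\<close> times the squared
  norm nonincreasing, and it starts at zero.\<close>

lemma gronwall_zero_forward:
  fixes f :: "real \<Rightarrow> 'a::real_inner"
  assumes "a \<le> b" "f a = 0"
    "\<And>t. a \<le> t \<Longrightarrow> t \<le> b \<Longrightarrow> (f has_vector_derivative f' t) (at t)"
    "\<And>t. a \<le> t \<Longrightarrow> t \<le> b \<Longrightarrow> norm (f' t) \<le> L * norm (f t)"
  shows "f b = 0"
proof -
  define \<phi> where "\<phi> t = exp (- 2 * L * t) * (f t \<bullet> f t)" for t
  have der: "(\<phi> has_real_derivative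
      (exp (- 2 * L * t) * (2 * (f t \<bullet> f' t)) - 2 * L * exp (- 2 * L * t) * (f t \<bullet> f t))) (at t)"
    if "a \<le> t" "t \<le> b" for t
  proof -
    have "((\<lambda>t. f t \<bullet> f t) has_real_derivative (f t \<bullet> f' t + f' t \<bullet> f t)) (at t)"
      using bounded_bilinear.has_vector_derivative[OF bounded_bilinear_inner assms(3)[OF that] assms(3)[OF that]]
      by (simp add: has_real_derivative_iff_has_vector_derivative)
    then show ?thesis
      unfolding \<phi>_def by (auto intro!: derivative_eq_intros simp: inner_commute)
  qed
  have neg: "exp (- 2 * L * t) * (2 * (f t \<bullet> f' t)) - 2 * L * exp (- 2 * L * t) * (f t \<bullet> f t) \<le> 0"
    if "a \<le> t" "t \<le> b" for t
  proof -
    have "f t \<bullet> f' t \<le> norm (f t) * norm (f' t)" by (rule norm_cauchy_schwarz)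
    also have "\<dots> \<le> norm (f t) * (L * norm (f t))" using assms(4)[OF that] by (intro mult_left_mono) auto
    finally have "f t \<bullet> f' t \<le> L * (f t \<bullet> f t)"
      by (simp add: power2_norm_eq_inner[symmetric] power2_eq_square algebra_simps)
    then have "exp (- 2 * L * t) * (2 * (f t \<bullet> f' t)) \<le> exp (- 2 * L * t) * (2 * (L * (f t \<bullet> f t)))"
      by (intro mult_left_mono) auto
    then show ?thesis by (simp add: algebra_simps)
  qed
  have "\<phi> b \<le> \<phi> a"
    by (rule DERIV_nonpos_imp_nonincreasing[OF assms(1)]) (use der neg in blast)
  then have "exp (- 2 * L * b) * (f b \<bullet> f b) \<le> 0" using assms(2) by (simp add: \<phi>_def)
  then have "f b \<bullet> f b \<le> 0" by (simp add: mult_le_0_iff)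
  then show ?thesis using inner_ge_zero[of "f b"] by (simp add: order_antisym)
qed

text \<open>On the compact segment from \<open>t0\<close> to \<open>t\<close> the rate
  \<open>L\<close> is bounded by a constant; for earlier times the forward statement is applied
  after reversing the parameter.\<close>

lemma gronwall_zero:
  fixes f :: "real \<Rightarrow> 'a::real_inner"
  assumes "is_interval S" "t0 \<in> S" "f t0 = 0" "t \<in> S"
    "\<And>t. t \<in> S \<Longrightarrow> (f has_vector_derivative f' t) (at t)"
    "\<And>t. t \<in> S \<Longrightarrow> norm (f' t) \<le> L t * norm (f t)"
    "continuous_on S L"
  shows "f t = 0"
proof -
  have seg: "closed_segment t0 t \<subseteq> S"
    using assms(1,2,4) by (simp add: closed_segment_subset is_interval_convex)
  have "compact (L ` closed_segment t0 t)"
    using assms(7) seg by (intro compact_continuous_image) (auto intro: continuous_on_subset)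
  then obtain M where M: "\<And>r. r \<in> closed_segment t0 t \<Longrightarrow> L r \<le> M"
    using compact_imp_bounded bounded_has_Sup(1)[of "L ` closed_segment t0 t"] by (metis empty_iff image_eqI)
  have bd: "norm (f' r) \<le> M * norm (f r)" if "r \<in> closed_segment t0 t" for r
    using assms(6)[of r] M[OF that] seg that mult_right_mono[of "L r" M "norm (f r)"] by fastforce
  show ?thesis
  proof (cases "t0 \<le> t")
    case True
    then show ?thesis
      using bd seg assms(5)
      by (intro gronwall_zero_forward[of t0 t f f' M, OF True assms(3)]) (auto simp: closed_segment_eq_real_ivl)
  next
    case False
    define g where "g r = f (- r)" for r
    have "g (- t) = 0"
    proof (rule gronwall_zero_forward[where f' = "\<lambda>r. - f' (- r)" and L = M])
      show "- t0 \<le> - t" "g (- t0) = 0" using False assms(3) by (auto simp: g_def)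
      fix r assume r: "- t0 \<le> r" "r \<le> - t"
      then have *: "- r \<in> closed_segment t0 t" using False by (auto simp: closed_segment_eq_real_ivl)
      then have "(f has_vector_derivative f' (- r)) (at (- r))" using assms(5) seg by auto
      then show "(g has_vector_derivative - f' (- r)) (at r)"
      proof -
        have "(uminus has_vector_derivative - 1) (at r)" by (auto intro!: derivative_eq_intros)
        from vector_diff_chain_at[OF this, of f "f' (- r)"] show ?thesis
          using \<open>(f has_vector_derivative f' (- r)) (at (- r))\<close> by (simp add: o_def g_def[abs_def])
      qed
      show "norm (- f' (- r)) \<le> M * norm (g r)" using bd[OF *] by (simp add: g_def)
    qed
    then show ?thesis by (simp add: g_def)
  qed
qed

section \<open>Global solutions of Lipschitz equations\<close>

lemma integral_norm_exp_bound:
  fixes g :: "real \<Rightarrow> 'a::euclidean_space"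
  assumes "0 \<le> t" "continuous_on {0..t} g" "\<And>r. r \<in> {0..t} \<Longrightarrow> norm (g r) \<le> K * exp (c * r)" "c > 0" "K \<ge> 0"
  shows "norm (integral {0..t} g) \<le> K * exp (c * t) / c"
proof -
  have "((\<lambda>r. K * exp (c * r)) has_integral (K * exp (c * t) / c - K * exp (c * 0) / c)) {0..t}"
    using assms(1,4)
    by (intro fundamental_theorem_of_calculus)
      (auto intro!: derivative_eq_intros simp: has_real_derivative_iff_has_vector_derivative[symmetric])
  note I = this
  have "norm (integral {0..t} g) \<le> integral {0..t} (\<lambda>r. K * exp (c * r))"
    using assms(2,3) I
    by (intro integral_norm_bound_integral integrable_continuous_real) (auto simp: integrable_on_def intro!: continuous_intros)
  also have "\<dots> = K * exp (c * t) / c - K * exp (c * 0) / c"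
    by (rule integral_unique[OF I])
  finally have "norm (integral {0..t} g) \<le> K * exp (c * t) / c - K * exp (c * 0) / c" .
  moreover have "0 \<le> K * exp (c * 0) / c" using assms(4,5) by simp
  ultimately show ?thesis by linarith
qed

text \<open>Banach's fixed point theorem for the weight \<open>exp (- c t)\<close>, which makes the Picard operator
  a contraction on the whole half line.\<close>
lemma lipschitz_ode_forward:
  fixes F :: "'a::euclidean_space \<Rightarrow> 'a"
  assumes "L-lipschitz_on UNIV F"
  obtains x where "x 0 = x0" "\<And>t. t \<ge> 0 \<Longrightarrow> (x has_vector_derivative F (x t)) (at t within {0..})"
proof -
  have L0: "L \<ge> 0" using assms lipschitz_on_nonneg by blast
  have lip: "norm (F x - F y) \<le> L * norm (x - y)" for x y
    using lipschitz_onD[OF assms, of x y] by (simp add: dist_norm)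
  have contF: "continuous_on S F" for S
    using lipschitz_on_continuous_on[OF assms] continuous_on_subset by blast
  \<comment> \<open>The contraction constant of the weighted Picard operator is
    \<open>L / c\<close>, which this choice makes at most 1/2.\<close>
  define c where "c = 2 * (L + 1)"
  have c: "c > 0" using L0 by (simp add: c_def)
  \<comment> \<open>The unknown is the rescaled function
    \<open>b t = exp (- c * t) *\<^sub>R x t\<close>, so that the weighted norm of \<open>x\<close>
    becomes the supremum norm of \<open>b\<close>. \<open>G b\<close> is the right-hand side of the
    equation along \<open>x\<close>.\<close>
  define G where "G b r = F (exp (c * r) *\<^sub>R b r)" for b :: "real \<Rightarrow> 'a" and r
  \<comment> \<open>Bounded continuous functions are taken on the whole line; \<open>max 0 t\<close>
    continues the operator by its value at 0 to negative times.\<close>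
  define \<Phi> where "\<Phi> b t = exp (- c * max 0 t) *\<^sub>R (x0 + integral {0..max 0 t} (G b))" for b :: "real \<Rightarrow> 'a" and t
  have contG: "continuous_on S (G b)" if "continuous_on UNIV b" for b S
    unfolding G_def
    by (intro continuous_on_compose2[OF contF[of UNIV]] continuous_intros continuous_on_subset[OF that]) auto
  have contI: "continuous_on {0..} (\<lambda>t. integral {0..t} (G b))" if "continuous_on UNIV b" for b
    unfolding continuous_on_eq_continuous_within
  proof
    fix t :: real assume t: "t \<in> {0..}"
    have "continuous_on {0..t+1} (\<lambda>t. integral {0..t} (G b))"
      by (rule indefinite_integral_continuous_1[OF integrable_continuous_real[OF contG[OF that]]])
    then have "continuous (at t within {0..t+1}) (\<lambda>t. integral {0..t} (G b))"
      using t by (auto simp: continuous_on_eq_continuous_within)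
    moreover have "at t within {0..t+1} = at t within {0..}"
      by (rule at_within_nhd[of _ "{..<t+1}"]) auto
    ultimately show "continuous (at t within {0..}) (\<lambda>t. integral {0..t} (G b))" by simp
  qed
  have cont\<Phi>: "continuous_on UNIV (\<Phi> b)" if "continuous_on UNIV b" for b
    unfolding \<Phi>_def
    by (intro continuous_intros continuous_on_compose2[OF contI[OF that], of _ "\<lambda>t. max 0 t"]) auto
  have bound: "exp (- c * s) * norm (integral {0..s} g) \<le> K / c"
    if "0 \<le> s" "continuous_on {0..s} g" "\<And>r. r \<in> {0..s} \<Longrightarrow> norm (g r) \<le> K * exp (c * r)" "K \<ge> 0" for s K and g :: "real \<Rightarrow> 'a"
  proof -
    have "exp (- c * s) * norm (integral {0..s} g) \<le> exp (- c * s) * (K * exp (c * s) / c)"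
      using integral_norm_exp_bound[OF that(1-3) c that(4)] by (intro mult_left_mono) auto
    also have "\<dots> = K / c * (exp (- c * s) * exp (c * s))" by simp
    also have "\<dots> = K / c" by (simp add: exp_add[symmetric] del: mult_minus_left)
    finally show ?thesis .
  qed
  have bcon: "\<Phi> (apply_bcontfun b) \<in> bcontfun" for b
  proof -
    have contb: "continuous_on UNIV (apply_bcontfun b)" by (rule continuous_on_apply_bcontfun) 
    define K where "K = norm (F 0) + L * norm b"
    have K: "K \<ge> 0" using L0 by (simp add: K_def)
    have "norm (G b r) \<le> K * exp (c * r)" if "r \<ge> 0" for r
    proof -
      have "norm (G b r) \<le> norm (F 0) + norm (G b r - F 0)" by (metis add.commute diff_add_cancel norm_triangle_ineq)
      also have "\<dots> \<le> norm (F 0) + L * (exp (c * r) * norm (b r))" using lip[of "exp (c * r) *\<^sub>R b r" 0] by (simp add: G_def)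
      also have "\<dots> \<le> norm (F 0) * exp (c * r) + L * (exp (c * r) * norm b)"
        using that c L0 norm_bounded[of b r]
        by (intro add_mono mult_left_mono) (auto simp: mult_le_cancel_left1)
      finally show ?thesis by (simp add: K_def algebra_simps)
    qed
    then have B: "exp (- c * max 0 t) * norm (integral {0..max 0 t} (G b)) \<le> K / c" for t
      using contG[OF contb] K by (intro bound) auto
    have "norm (\<Phi> b t) \<le> norm x0 + K / c" for t
    proof -
      have "norm (\<Phi> b t) = exp (- c * max 0 t) * norm (x0 + integral {0..max 0 t} (G b))" by (simp add: \<Phi>_def)
      also have "\<dots> \<le> exp (- c * max 0 t) * (norm x0 + norm (integral {0..max 0 t} (G b)))"
        by (intro mult_left_mono norm_triangle_ineq) auto
      also have "\<dots> \<le> 1 * norm x0 + K / c"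
        using B[of t] c by (simp only: distrib_left) (intro add_mono mult_right_mono, auto)
      finally show ?thesis by simp
    qed
    then show ?thesis using cont\<Phi>[OF contb] by (intro bcontfun_normI) auto
  qed
  define TT where "TT b = Bcontfun (\<Phi> (apply_bcontfun b))" for b
  have TT: "apply_bcontfun (TT b) = \<Phi> (apply_bcontfun b)" for b
    unfolding TT_def by (rule Bcontfun_inverse[OF bcon])
  have "dist (TT b) (TT b') \<le> 1/2 * dist b b'" for b b'
  proof (rule dist_bound)
    fix t :: real
    have contb: "continuous_on UNIV (apply_bcontfun b)" "continuous_on UNIV (apply_bcontfun b')"
      by (rule continuous_on_apply_bcontfun)+
    define s where "s = max 0 t"
    have int: "G (apply_bcontfun b) integrable_on {0..s}" "G (apply_bcontfun b') integrable_on {0..s}"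
      by (intro integrable_continuous_real contG contb)+
    have "norm (G (apply_bcontfun b) r - G (apply_bcontfun b') r) \<le> L * dist b b' * exp (c * r)" for r
    proof -
      have "norm (G (apply_bcontfun b) r - G (apply_bcontfun b') r) \<le> L * norm (exp (c * r) *\<^sub>R b r - exp (c * r) *\<^sub>R b' r)"
        unfolding G_def by (rule lip)
      also have "\<dots> = L * (exp (c * r) * dist (b r) (b' r))"
        by (simp add: scaleR_diff_right[symmetric] dist_norm)
      also have "\<dots> \<le> L * (exp (c * r) * dist b b')"
        using L0 by (intro mult_left_mono dist_bounded) auto
      finally show ?thesis by (simp add: algebra_simps)
    qed
    then have B: "exp (- c * s) * norm (integral {0..s} (\<lambda>r. G (apply_bcontfun b) r - G (apply_bcontfun b') r)) \<le> L * dist b b' / c"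
      using L0 by (intro bound continuous_intros contG contb) (auto simp: s_def)
    have "dist (TT b t) (TT b' t) = exp (- c * s) * norm (integral {0..s} (\<lambda>r. G (apply_bcontfun b) r - G (apply_bcontfun b') r))"
      by (simp add: TT \<Phi>_def s_def[symmetric] dist_norm scaleR_diff_right[symmetric] integral_diff[OF int])
    also note B
    also have "L * dist b b' / c \<le> 1/2 * dist b b'"
      using L0 by (simp add: c_def field_simps mult_right_mono)
    finally show "dist (TT b t) (TT b' t) \<le> 1/2 * dist b b'" .
  qed
  then have "\<exists>!b. TT b = b" by (intro banach_fix_type[of "1/2"]) auto
  then obtain b where "TT b = b" by blast
  then have fixpt: "apply_bcontfun b t = \<Phi> b t" for t using TT by metis
  have contb: "continuous_on UNIV (apply_bcontfun b)" by (rule continuous_on_apply_bcontfun)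
  define x where "x t = exp (c * t) *\<^sub>R b t" for t
  have x: "x t = x0 + integral {0..t} (G b)" if "t \<ge> 0" for t
    using that fixpt[of t] by (simp add: x_def \<Phi>_def exp_add[symmetric])
  have Gx: "G b r = F (x r)" for r by (simp add: G_def x_def)
  show ?thesis
  proof (rule that[of x])
    show "x 0 = x0" using x[of 0] by simp
    fix t :: real assume t: "t \<ge> 0"
    have "((\<lambda>t. integral {0..t} (G b)) has_vector_derivative G b t) (at t within {0..t+1})"
      using integral_has_vector_derivative[OF contG[OF contb], of t 0 "t+1"] t by simp
    moreover have "at t within {0..t+1} = at t within {0..}"
      by (rule at_within_nhd[of _ "{..<t+1}"]) auto
    ultimately have "((\<lambda>t. x0 + integral {0..t} (G b)) has_vector_derivative G b t) (at t within {0..})"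
      by (auto intro!: derivative_eq_intros)
    then show "(x has_vector_derivative F (x t)) (at t within {0..})"
      unfolding Gx by (rule has_vector_derivative_transform[rotated 2]) (use t x in \<open>auto simp: Gx[abs_def]\<close>)
  qed
qed

text \<open>A forward solution for \<open>F\<close> and a reversed forward solution for
  \<open>- F\<close> are glued at time 0, where both one-sided derivatives are the value of
  \<open>F\<close> at \<open>x0\<close>. Since the equation is autonomous, a shift moves the initial
  time to \<open>t0\<close>.\<close>

lemma lipschitz_ode_global:
  fixes F :: "'a::euclidean_space \<Rightarrow> 'a"
  assumes "L-lipschitz_on UNIV F"
  obtains x where "x t0 = x0" "\<And>t. (x has_vector_derivative F (x t)) (at t)"
proof -
  obtain y where y: "y 0 = x0" "\<And>t. t \<ge> 0 \<Longrightarrow> (y has_vector_derivative F (y t)) (at t within {0..})"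
    using lipschitz_ode_forward[OF assms] by metis
  have "L-lipschitz_on UNIV (\<lambda>x. - F x)" using assms by (simp add: lipschitz_on_def dist_norm norm_minus_commute)
  then obtain z where z: "z 0 = x0" "\<And>t. t \<ge> 0 \<Longrightarrow> (z has_vector_derivative - F (z t)) (at t within {0..})"
    using lipschitz_ode_forward by metis
  define w where "w t = (if t \<ge> 0 then y t else z (- t))" for t
  have wl: "w t = z (- t)" if "t \<le> 0" for t using that y(1) z(1) by (cases "t = 0") (auto simp: w_def)
  have r: "(w has_vector_derivative F (w t)) (at t within {0..})" if "t \<ge> 0" for t
    using has_vector_derivative_transform[OF _ _ y(2)[OF that], of w] that by (auto simp: w_def)
  have l: "(w has_vector_derivative F (w t)) (at t within {..0})" if "t \<le> 0" for t
  proof -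
    have "(z \<circ> uminus has_vector_derivative (-1) *\<^sub>R - F (z (- t))) (at t within {..0})"
      using z(2)[of "- t"] that
      by (intro vector_diff_chain_within) (auto intro!: derivative_eq_intros)
    then have "((\<lambda>t. z (- t)) has_vector_derivative F (w t)) (at t within {..0})"
      using wl[OF that] by (simp add: o_def)
    then show ?thesis
      by (rule has_vector_derivative_transform[rotated 2]) (use that wl in auto)
  qed
  have w: "(w has_vector_derivative F (w t)) (at t)" for t
  proof -
    consider "t > 0" | "t < 0" | "t = 0" by linarith
    then show ?thesis
    proof cases
      case 1
      then show ?thesis using r[of t] at_within_interior[of t "{0..}"] by (simp add: interior_real_atLeast)
    next
      case 2
      then show ?thesis using l[of t] at_within_interior[of t "{..0}"] by (simp add: interior_real_atMost)
    next
      case 3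
      have "(w has_vector_derivative F (w t)) (at t within {0..} \<union> {..0})"
        using r[of t] l[of t] 3
        unfolding has_vector_derivative_def has_derivative_within Lim_within_Un by blast
      moreover have "{0..} \<union> {..0} = (UNIV :: real set)" by auto
      ultimately show ?thesis by simp
    qed
  qed
  show ?thesis
  proof (rule that[of "\<lambda>t. w (t - t0)"])
    show "w (t0 - t0) = x0" using y(1) by (simp add: w_def)
    show "((\<lambda>t. w (t - t0)) has_vector_derivative F (w (t - t0))) (at t)" for t
    proof -
      have "((\<lambda>t. t - t0) has_vector_derivative 1) (at t)"
        by (auto intro!: derivative_eq_intros)
      from vector_diff_chain_at[OF this w] show ?thesis by (simp add: o_def)
    qed
  qed
qed

subsection \<open>One-parameter groups of equiaffine transformations\<close>

text \<open>Reduces every statement about an affine map to its values at the origin and at the unit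
  vectors, here to finitely many orbits of the group.\<close>

lemma affine_expansion:
  fixes f :: "real^'n \<Rightarrow> 'b::real_vector"
  assumes "\<And>v. f v = L v + b" "linear L"
  shows "f v = f 0 + (\<Sum>i\<in>UNIV. v $ i *\<^sub>R (f (axis i 1) - f 0))"
proof -
  have "L v = L (\<Sum>i\<in>UNIV. v $ i *\<^sub>R axis i 1)"
    using basis_expansion[of v] by (simp add: scalar_mult_eq_scaleR)
  also have "\<dots> = (\<Sum>i\<in>UNIV. v $ i *\<^sub>R L (axis i 1))"
    using assms(2) by (simp add: linear_sum linear_cmul)
  finally show ?thesis using assms by (simp add: linear_0)
qed

locale equiaffine_group =
  fixes T :: "real \<Rightarrow> real^3 \<Rightarrow> real^3"
  assumes group: "one_parameter_group T"
begin

lemma T_0 [simp]: "T 0 v = v"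
  using group by (simp add: one_parameter_group_def)

lemma T_add: "T (s + r) v = T s (T r v)"
  using group by (simp add: one_parameter_group_def)

lemma T_continuous: "continuous_on S (\<lambda>s. T s v)"
  using group continuous_on_subset unfolding one_parameter_group_def by blast

lemma T_affine: obtains M b where "det (M::real^3^3) = 1" "\<And>v. T s v = M *v v + b"
  using group unfolding one_parameter_group_def equiaffine_def by metis

lemma T_expansion: "T s v = T s 0 + (\<Sum>i\<in>UNIV. v $ i *\<^sub>R (T s (axis i 1) - T s 0))"
proof -
  obtain M b where "\<And>v. T s v = M *v v + b" using T_affine[of s] by metis
  then show ?thesis by (rule affine_expansion) (rule matrix_vector_mul_linear)
qed

lemma T_affine_combination: "T s (w + (\<Sum>i\<in>I. c i *\<^sub>R (x i - w))) = T s w + (\<Sum>i\<in>I. c i *\<^sub>R (T s (x i) - T s w))"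
proof -
  obtain M b where M: "\<And>v. T s v = M *v v + b" using T_affine[of s] by metis
  have "M *v (\<Sum>i\<in>I. c i *\<^sub>R (x i - w)) = (\<Sum>i\<in>I. c i *\<^sub>R (M *v x i - M *v w))"
    by (simp add: linear_sum[OF matrix_vector_mul_linear] linear_cmul[OF matrix_vector_mul_linear]
        matrix_vector_mult_diff_distrib)
  then show ?thesis by (simp add: M matrix_vector_right_distrib)
qed

text \<open>Averaging over a short time turns a merely continuous orbit into a differentiable one,
  as in the construction of Garding vectors for a continuous representation.\<close>

definition orbit_mean :: "real \<Rightarrow> real^3 \<Rightarrow> real^3" where
  "orbit_mean \<delta> v = (1 / \<delta>) *\<^sub>R integral {0..\<delta>} (\<lambda>r. T r v)"

lemma orbit_mean_tendsto: "((\<lambda>\<delta>. orbit_mean \<delta> v) \<longlongrightarrow> v) (at_right 0)"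
proof -
  have "((\<lambda>\<delta>. integral {0..\<delta>} (\<lambda>r. T r v)) has_vector_derivative T 0 v) (at 0 within {0..1})"
    by (rule integral_has_vector_derivative[OF T_continuous]) simp
  moreover have "at 0 within {0..1} = at_right (0::real)"
    by (simp add: at_within_Icc_at_right)
  ultimately have "((\<lambda>\<delta>. (1 / norm (\<delta> - 0)) *\<^sub>R (integral {0..\<delta>} (\<lambda>r. T r v) -
      (integral {0..0} (\<lambda>r. T r v) + (\<delta> - 0) *\<^sub>R T 0 v))) \<longlongrightarrow> 0) (at_right 0)"
    unfolding has_vector_derivative_def has_derivative_within by metis
  then have "((\<lambda>\<delta>. (1 / norm (\<delta> - 0)) *\<^sub>R (integral {0..\<delta>} (\<lambda>r. T r v) -
      (integral {0..0} (\<lambda>r. T r v) + (\<delta> - 0) *\<^sub>R T 0 v)) + v) \<longlongrightarrow> 0 + v) (at_right 0)"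
    by (rule tendsto_add[OF _ tendsto_const])
  moreover have "\<forall>\<^sub>F \<delta> in at_right 0. (1 / norm (\<delta> - 0)) *\<^sub>R (integral {0..\<delta>} (\<lambda>r. T r v) -
      (integral {0..0} (\<lambda>r. T r v) + (\<delta> - 0) *\<^sub>R T 0 v)) + v = orbit_mean \<delta> v"
    using eventually_at_right_less[of 0]
    by eventually_elim (simp add: orbit_mean_def scaleR_diff_right)
  ultimately have "((\<lambda>\<delta>. orbit_mean \<delta> v) \<longlongrightarrow> 0 + v) (at_right 0)"
    by (rule Lim_transform_eventually)
  then show ?thesis by simp
qed

text \<open>An affine map commutes with averages, so \<open>T s\<close> carries the mean over the
  interval from 0 to \<delta> to the mean over that interval shifted by \<open>s\<close>. Only the
  endpoints move, and the fundamental theorem of calculus gives the derivative.\<close>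

lemma orbit_mean_differentiable:
  assumes "\<delta> > 0"
  shows "((\<lambda>s. T s (orbit_mean \<delta> v)) has_vector_derivative (1 / \<delta>) *\<^sub>R (T \<delta> v - v)) (at 0)"
proof -
  \<comment> \<open>The lower limit lies to the left of 0, which makes \<open>H\<close>
    differentiable at 0 from both sides.\<close>
  define H where "H t = integral {- \<delta>..t} (\<lambda>r. T r v)" for t
  have int: "(\<lambda>r. T r v) integrable_on {a..b}" for a b
    by (rule integrable_continuous_real[OF T_continuous])
  have H: "(H has_vector_derivative T t v) (at t)" if "- \<delta> < t" for t
  proof -
    have "(H has_vector_derivative T t v) (at t within {- \<delta>..t+1})"
      unfolding H_def by (rule integral_has_vector_derivative[OF T_continuous]) (use that in auto)
    then show ?thesis using at_within_interior[of t "{- \<delta>..t+1}"] that by simp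
  qed
  have eq: "T s (orbit_mean \<delta> v) = (1 / \<delta>) *\<^sub>R (H (s + \<delta>) - H s)" if "s \<in> {- \<delta><..}" for s
  proof -
    obtain M b where M: "\<And>v. T s v = M *v v + b" using T_affine[of s] by metis
    have "integral {0..\<delta>} (\<lambda>r. T (r + s) v) = integral {s..s+\<delta>} (\<lambda>r. T r v)"
      using integral_shift_Icc_real[of 0 \<delta> "\<lambda>r. T r v" s] by (simp add: o_def add.commute)
    moreover have "integral {0..\<delta>} (\<lambda>r. T (r + s) v) = integral {0..\<delta>} (\<lambda>r. M *v T r v + b)"
      by (intro integral_cong) (metis M T_add add.commute)
    moreover have "\<dots> = M *v integral {0..\<delta>} (\<lambda>r. T r v) + \<delta> *\<^sub>R b"
    proof -
      have "integral {0..\<delta>} (\<lambda>r. M *v T r v) = M *v integral {0..\<delta>} (\<lambda>r. T r v)"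
        using integral_linear[OF int matrix_vector_mul_bounded_linear] by (simp add: o_def)
      moreover have "(\<lambda>r. M *v T r v) integrable_on {0..\<delta>}"
        by (intro integrable_continuous_real bounded_linear.continuous_on[OF matrix_vector_mul_bounded_linear T_continuous])
      ultimately show ?thesis
        using assms integral_add[of "\<lambda>r. M *v T r v" "{0..\<delta>}" "\<lambda>r. b"] by (simp add: integrable_const_ivl)
    qed
    moreover have "H (s + \<delta>) - H s = integral {s..s+\<delta>} (\<lambda>r. T r v)"
      using Henstock_Kurzweil_Integration.integral_combine[where f = "\<lambda>r. T r v" and a = "- \<delta>" and c = s and b = "s + \<delta>"] that assms int by (simp add: H_def algebra_simps)
    ultimately have "(1 / \<delta>) *\<^sub>R (H (s + \<delta>) - H s) = (1 / \<delta>) *\<^sub>R (M *v integral {0..\<delta>} (\<lambda>r. T r v) + \<delta> *\<^sub>R b)"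
      by simp
    also have "\<dots> = T s (orbit_mean \<delta> v)"
      using assms by (simp add: M orbit_mean_def scaleR_add_right linear_cmul[OF matrix_vector_mul_linear])
    finally show ?thesis by simp
  qed
  have "((\<lambda>s. (1 / \<delta>) *\<^sub>R (H (s + \<delta>) - H s)) has_vector_derivative (1 / \<delta>) *\<^sub>R (T \<delta> v - T 0 v)) (at 0)"
  proof -
    have 1: "((\<lambda>s. s + \<delta>) has_vector_derivative 1) (at 0)" by (auto intro!: derivative_eq_intros)
    have "(H has_vector_derivative T \<delta> v) (at (0 + \<delta>))" using H[of \<delta>] assms by simp
    from vector_diff_chain_at[OF 1 this] have "((\<lambda>s. H (s + \<delta>)) has_vector_derivative T \<delta> v) (at 0)"
      by (simp add: o_def)
    moreover have "(H has_vector_derivative T 0 v) (at 0)" using H[of 0] assms by simp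
    ultimately have "((\<lambda>s. H (s + \<delta>) - H s) has_vector_derivative T \<delta> v - T 0 v) (at 0)"
      by (rule has_vector_derivative_diff)
    then show ?thesis
      using bounded_linear.has_vector_derivative[OF bounded_linear_scaleR_right] by blast
  qed
  then have "((\<lambda>s. T s (orbit_mean \<delta> v)) has_vector_derivative (1 / \<delta>) *\<^sub>R (T \<delta> v - T 0 v)) (at 0)"
    by (rule has_vector_derivative_transform_within_open[of _ _ _ "{- \<delta><..}"]) (use assms eq in auto)
  then show ?thesis by simp
qed

text \<open>For small \<open>\<delta>\<close> the means of the orbits of \<open>0\<close> and of the unit vectors are affinely
  independent, and the group is differentiable along them.\<close>
lemma T_differentiable: "\<exists>z. ((\<lambda>s. T s v) has_vector_derivative z) (at 0)"
proof -
  \<comment> \<open>The edge vectors of the simplex spanned by the means. They tend to the unit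
    vectors as \<delta> tends to 0, so the determinant is eventually positive.\<close>
  define W where "W \<delta> = (\<chi> i j. (orbit_mean \<delta> (axis j 1) - orbit_mean \<delta> 0) $ i :: real^3^3)" for \<delta>
  have ent: "((\<lambda>\<delta>. W \<delta> $ i $ j) \<longlongrightarrow> (\<chi> i j. axis j (1::real) $ i :: real^3^3) $ i $ j) (at_right 0)" for i j
  proof -
    have "((\<lambda>\<delta>. (orbit_mean \<delta> (axis j 1) - orbit_mean \<delta> 0) $ i) \<longlongrightarrow> (axis j 1 - 0) $ i) (at_right 0)"
      by (intro tendsto_intros orbit_mean_tendsto)
    then show ?thesis by (simp add: W_def)
  qed
  have "((\<lambda>\<delta>. det (W \<delta>)) \<longlongrightarrow> det (\<chi> i j. axis j (1::real) $ i :: real^3^3)) (at_right 0)"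
    unfolding det_3 by (intro tendsto_add tendsto_diff tendsto_mult ent)
  moreover have "det (\<chi> i j. axis j (1::real) $ i :: real^3^3) = 1"
    by (simp add: det_3 axis_def)
  ultimately have "((\<lambda>\<delta>. det (W \<delta>)) \<longlongrightarrow> 1) (at_right 0)" by simp
  then have "\<forall>\<^sub>F \<delta> in at_right 0. det (W \<delta>) \<in> {0<..}"
    by (rule topological_tendstoD) auto
  then have "\<forall>\<^sub>F \<delta> in at_right 0. det (W \<delta>) \<in> {0<..} \<and> \<delta> > (0::real)"
    using eventually_at_right_less[of 0] by (rule eventually_conj)
  then obtain \<delta> where \<delta>: "\<delta> > 0" "det (W \<delta>) \<noteq> 0"
    using eventually_happens'[OF trivial_limit_at_right_real] by force
  then have "invertible (W \<delta>)" by (simp add: invertible_det_nz)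
  then obtain W' where "W \<delta> ** W' = mat 1" by (auto simp: invertible_def)
  then have Wc: "W \<delta> *v (W' *v x) = x" for x by (simp add: matrix_vector_mul_assoc)
  define w where "w = orbit_mean \<delta> 0"
  define c where "c = W' *v (v - w)"
  have "v - w = (\<Sum>j\<in>UNIV. c $ j *\<^sub>R (orbit_mean \<delta> (axis j 1) - w))"
  proof -
    have "v - w = W \<delta> *v c" by (simp add: c_def Wc)
    then show ?thesis
      by (simp add: vec_eq_iff W_def matrix_vector_mult_def w_def mult.commute)
  qed
  then have v: "v = w + (\<Sum>j\<in>UNIV. c $ j *\<^sub>R (orbit_mean \<delta> (axis j 1) - w))" by (simp add: algebra_simps)
  have "(\<lambda>s. T s v) = (\<lambda>s. T s w + (\<Sum>j\<in>UNIV. c $ j *\<^sub>R (T s (orbit_mean \<delta> (axis j 1)) - T s w)))"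
    by (subst v, subst T_affine_combination) simp
  moreover have "((\<lambda>s. T s w + (\<Sum>j\<in>UNIV. c $ j *\<^sub>R (T s (orbit_mean \<delta> (axis j 1)) - T s w))) has_vector_derivative
      (1 / \<delta>) *\<^sub>R (T \<delta> 0 - 0) + (\<Sum>j\<in>UNIV. c $ j *\<^sub>R ((1 / \<delta>) *\<^sub>R (T \<delta> (axis j 1) - axis j 1) - (1 / \<delta>) *\<^sub>R (T \<delta> 0 - 0)))) (at 0)"
    unfolding w_def
    by (intro has_vector_derivative_add has_vector_derivative_sum
        bounded_linear.has_vector_derivative[OF bounded_linear_scaleR_right] has_vector_derivative_diff
        orbit_mean_differentiable[OF \<delta>(1)])
  ultimately show ?thesis by metis
qed

definition generator :: "real^3 \<Rightarrow> real^3" where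
  "generator v = vector_derivative (\<lambda>s. T s v) (at 0)"

lemma generator: "((\<lambda>s. T s v) has_vector_derivative generator v) (at 0)"
  unfolding generator_def using T_differentiable[of v] vector_derivative_works differentiableI_vector by blast

definition generator_matrix :: "real^3^3" where
  "generator_matrix = (\<chi> i j. (generator (axis j 1) - generator 0) $ i)"

lemma generator_affine: "generator v = generator_matrix *v v + generator 0"
proof -
  have "((\<lambda>s. T s 0 + (\<Sum>i\<in>UNIV. v $ i *\<^sub>R (T s (axis i 1) - T s 0))) has_vector_derivative
     generator 0 + (\<Sum>i\<in>UNIV. v $ i *\<^sub>R (generator (axis i 1) - generator 0))) (at 0)"
    by (intro has_vector_derivative_add has_vector_derivative_sum generator
        bounded_linear.has_vector_derivative[OF bounded_linear_scaleR_right] has_vector_derivative_diff)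
  then have "((\<lambda>s. T s v) has_vector_derivative
     generator 0 + (\<Sum>i\<in>UNIV. v $ i *\<^sub>R (generator (axis i 1) - generator 0))) (at 0)"
    using T_expansion[of _ v] by simp
  then have "generator v = generator 0 + (\<Sum>i\<in>UNIV. v $ i *\<^sub>R (generator (axis i 1) - generator 0))"
    using generator vector_derivative_unique_at by blast
  then show ?thesis
    by (simp add: vec_eq_iff generator_matrix_def matrix_vector_mult_def algebra_simps)
qed

lemma generator_flow: "((\<lambda>s. T s v) has_vector_derivative generator (T s v)) (at s)"
proof -
  have 1: "((\<lambda>r. r - s) has_vector_derivative 1) (at s)" by (auto intro!: derivative_eq_intros)
  have "((\<lambda>r. T r (T s v)) has_vector_derivative generator (T s v)) (at (s - s))" using generator by simp
  from vector_diff_chain_at[OF 1 this] show ?thesis by (simp add: o_def T_add[symmetric])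
qed

lemma generator_zero_imp_trivial:
  assumes "\<And>v. generator v = 0"
  shows "T s = id"
proof
  fix v
  have "((\<lambda>s. T s v) has_derivative (\<lambda>h. 0)) (at r within UNIV)" for r
    using generator_flow[of v r] assms by (simp add: has_vector_derivative_def)
  then have "T s v = T 0 v"
    using has_derivative_zero_unique[of UNIV "\<lambda>s. T s v" 0 s] by auto
  then show "T s v = id v" by simp
qed

text \<open>The derivative at the identity of the determinant of the linear part, which is
  constantly 1.\<close>

lemma generator_trace: "generator_matrix $ 1 $ 1 + generator_matrix $ 2 $ 2 + generator_matrix $ 3 $ 3 = 0"
proof -
  define a where "a i j s = (T s (axis j 1) - T s 0) $ i" for i j :: 3 and s
  have da: "((\<lambda>s. a i j s) has_real_derivative generator_matrix $ i $ j) (at 0)" for i j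
    using bounded_linear.has_vector_derivative[OF bounded_linear_vec_nth
        has_vector_derivative_diff[OF generator generator], of "axis j 1" 0 i]
    unfolding has_real_derivative_iff_has_vector_derivative a_def by (simp add: generator_matrix_def)
  have a0: "a i j 0 = (if i = j then 1 else 0)" for i j by (simp add: a_def axis_def)
  define d where "d s = a 1 1 s * a 2 2 s * a 3 3 s + a 1 2 s * a 2 3 s * a 3 1 s + a 1 3 s * a 2 1 s * a 3 2 s
    - a 1 1 s * a 2 3 s * a 3 2 s - a 1 2 s * a 2 1 s * a 3 3 s - a 1 3 s * a 2 2 s * a 3 1 s" for s
  have "d s = 1" for s
  proof -
    obtain M b where M: "det (M::real^3^3) = 1" "\<And>v. T s v = M *v v + b" using T_affine[of s] by metis
    have "a i j s = M $ i $ j" for i j by (simp add: a_def M(2) matrix_vector_mult_basis column_def)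
    then show ?thesis using M(1) by (simp add: d_def det_3)
  qed
  then have "d = (\<lambda>s. 1)" by auto
  then have "(d has_real_derivative 0) (at 0)" by simp
  moreover have "(d has_real_derivative generator_matrix $ 1 $ 1 + generator_matrix $ 2 $ 2 + generator_matrix $ 3 $ 3) (at 0)"
    unfolding d_def by (auto intro!: derivative_eq_intros da simp: a0)
  ultimately show ?thesis using DERIV_unique by blast
qed

lemma T_jointly_continuous: "continuous_on UNIV (\<lambda>p. T (snd p) (fst p))"
proof -
  have c: "continuous_on UNIV (\<lambda>p :: (real^3) \<times> real. T (snd p) x)" for x
    by (rule continuous_on_compose2[OF T_continuous[of UNIV x] continuous_on_snd[OF continuous_on_id]]) simp
  have "continuous_on UNIV (\<lambda>p :: (real^3) \<times> real. T (snd p) 0 + (\<Sum>i\<in>UNIV. fst p $ i *\<^sub>R (T (snd p) (axis i 1) - T (snd p) 0)))"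
    by (intro continuous_on_add continuous_on_sum continuous_on_scaleR continuous_on_diff c
        continuous_on_component continuous_on_fst continuous_on_id)
  then show ?thesis by (subst T_expansion[abs_def])
qed

text \<open>At time zero the linear part is the identity, so a displacement \<open>w\<close> of the
  point enters unchanged. This is the input for the open mapping argument that forces the generator
  to be tangent to the surface.\<close>

lemma T_joint_derivative:
  "((\<lambda>p. T (snd p) (fst p)) has_derivative (\<lambda>(w, h). w + h *\<^sub>R generator v)) (at (v, 0))"
proof -
  have d: "((\<lambda>p. T (snd p) x) has_derivative (\<lambda>q. snd q *\<^sub>R generator x)) (at (v, 0))" for x and v :: "real^3"
  proof -
    have "((\<lambda>s. T s x) has_derivative (\<lambda>h. h *\<^sub>R generator x)) (at (snd (v, 0)))"
      using generator[of x] by (simp add: has_vector_derivative_def)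
    from has_derivative_compose[OF has_derivative_snd[OF has_derivative_ident] this] show ?thesis by simp
  qed
  have f: "((\<lambda>p. fst p $ i) has_derivative (\<lambda>q. fst q $ i)) (at (v, 0::real))" for i and v :: "real^3"
    by (intro bounded_linear.has_derivative[OF bounded_linear_vec_nth] has_derivative_fst has_derivative_ident)
  have t: "((\<lambda>p. fst p $ i *\<^sub>R (T (snd p) (axis i 1) - T (snd p) 0)) has_derivative
     (\<lambda>q. v $ i *\<^sub>R (snd q *\<^sub>R generator (axis i 1) - snd q *\<^sub>R generator 0) + fst q $ i *\<^sub>R (axis i 1 - 0))) (at (v, 0))" for i
    using has_derivative_scaleR[OF f[of i v] has_derivative_diff[OF d[of "axis i 1" v] d[of 0 v]]] by simp
  have "((\<lambda>p. T (snd p) 0 + (\<Sum>i\<in>UNIV. fst p $ i *\<^sub>R (T (snd p) (axis i 1) - T (snd p) 0))) has_derivative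
     (\<lambda>q. snd q *\<^sub>R generator 0 + (\<Sum>i\<in>UNIV. v $ i *\<^sub>R (snd q *\<^sub>R generator (axis i 1) - snd q *\<^sub>R generator 0)
        + fst q $ i *\<^sub>R (axis i 1 - 0)))) (at (v, 0))"
    by (intro has_derivative_add has_derivative_sum d t)
  moreover have "(\<lambda>q. snd q *\<^sub>R generator 0 + (\<Sum>i\<in>UNIV. v $ i *\<^sub>R (snd q *\<^sub>R generator (axis i 1) - snd q *\<^sub>R generator 0)
        + fst q $ i *\<^sub>R (axis i 1 - 0))) = (\<lambda>(w, h). w + h *\<^sub>R generator v)"
  proof (clarsimp simp: fun_eq_iff)
    fix w :: "real^3" and h :: real
    have "generator v = generator 0 + (\<Sum>i\<in>UNIV. v $ i *\<^sub>R (generator (axis i 1) - generator 0))"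
      by (subst generator_affine) (simp add: vec_eq_iff generator_matrix_def matrix_vector_mult_def algebra_simps)
    moreover have "(\<Sum>i\<in>UNIV. w $ i *\<^sub>R axis i 1) = w" using basis_expansion[of w] by (simp add: scalar_mult_eq_scaleR)
    ultimately show "h *\<^sub>R generator 0 + (\<Sum>i\<in>UNIV. v $ i *\<^sub>R (h *\<^sub>R generator (axis i 1) - h *\<^sub>R generator 0) + w $ i *\<^sub>R axis i 1) = w + h *\<^sub>R generator v"
      by (simp add: sum.distrib scaleR_add_right scaleR_sum_right scaleR_diff_right mult.commute)
  qed
  ultimately show ?thesis by (subst T_expansion[abs_def]) (simp only:)
qed

end

subsection \<open>The determinant of two plane vectors\<close>

definition det2 :: "real^2 \<Rightarrow> real^2 \<Rightarrow> real" where
  "det2 x y = x $ 1 * y $ 2 - x $ 2 * y $ 1"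

lemma det2_simps [simp]:
  "det2 (x + y) z = det2 x z + det2 y z" "det2 x (y + z) = det2 x y + det2 x z"
  "det2 (x - y) z = det2 x z - det2 y z" "det2 x (y - z) = det2 x y - det2 x z"
  "det2 (- x) y = - det2 x y" "det2 x (- y) = - det2 x y"
  "det2 (r *\<^sub>R x) y = r * det2 x y" "det2 x (r *\<^sub>R y) = r * det2 x y"
  "det2 0 y = 0" "det2 x 0 = 0" "det2 x x = 0"
  by (simp_all add: det2_def algebra_simps)

lemma det2_commute: "det2 x y = - det2 y x"
  by (simp add: det2_def)

lemma bounded_bilinear_det2: "bounded_bilinear det2"
proof (rule bilinear_conv_bounded_bilinear[THEN iffD1])
  show "bilinear det2"
    unfolding bilinear_def by (auto intro!: linearI)
qed

lemma smooth_on_det2: "smooth_on S f \<Longrightarrow> smooth_on S g \<Longrightarrow> smooth_on S (\<lambda>x. det2 (f x) (g x))"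
  by (rule smooth_on_bounded_bilinear[OF bounded_bilinear_det2])

lemma det2_expand: "det2 x y *\<^sub>R z = det2 z y *\<^sub>R x + det2 x z *\<^sub>R y"
  by (simp add: vec_eq_iff forall_2 det2_def algebra_simps)

lemma det2_eq_0_iff_parallel: "y \<noteq> 0 \<Longrightarrow> det2 x y = 0 \<longleftrightarrow> (\<exists>r. x = r *\<^sub>R y)"
proof
  assume y: "y \<noteq> 0" and "det2 x y = 0"
  then have *: "x $ 1 * y $ 2 = x $ 2 * y $ 1" by (simp add: det2_def)
  consider "y $ 1 \<noteq> 0" | "y $ 1 = 0" "y $ 2 \<noteq> 0"
    using y by (auto simp: vec_eq_iff forall_2)
  then show "\<exists>r. x = r *\<^sub>R y"
  proof cases
    case 1
    then show ?thesis using *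
      by (intro exI[of _ "x $ 1 / y $ 1"]) (simp add: vec_eq_iff forall_2 field_simps)
  next
    case 2
    then show ?thesis using *
      by (intro exI[of _ "x $ 2 / y $ 2"]) (simp add: vec_eq_iff forall_2 field_simps)
  qed
qed auto

lemma det2_eq_0_both: "det2 x y \<noteq> 0 \<Longrightarrow> det2 z x = 0 \<Longrightarrow> det2 z y = 0 \<Longrightarrow> z = 0"
  using det2_expand[of x y z] by (simp add: det2_commute[of x z])

lemma linear_real2:
  fixes L :: "real^2 \<Rightarrow> 'b::real_vector"
  assumes "linear L"
  shows "L w = w $ 1 *\<^sub>R L (axis 1 1) + w $ 2 *\<^sub>R L (axis 2 1)"
proof -
  have "w = w $ 1 *\<^sub>R axis 1 1 + w $ 2 *\<^sub>R axis 2 1"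
    by (simp add: vec_eq_iff forall_2 axis_def)
  then have "L w = L (w $ 1 *\<^sub>R axis 1 1 + w $ 2 *\<^sub>R axis 2 1)" by simp
  then show ?thesis using assms by (simp add: linear_add linear_cmul)
qed

lemma smooth_on_frechet_eq_partial:
  assumes "smooth_on S f" "u \<in> S"
  shows "frechet_derivative f (at u) w = w $ 1 *\<^sub>R partial 1 f u + w $ 2 *\<^sub>R partial 2 f u"
  using linear_real2[OF has_derivative_linear[OF smooth_on_has_derivative[OF assms]], of w]
  by (simp add: partial_def)

lemma smooth_on_has_derivative_partial:
  assumes "smooth_on S f" "u \<in> S"
  shows "(f has_derivative (\<lambda>w. w $ 1 *\<^sub>R partial 1 f u + w $ 2 *\<^sub>R partial 2 f u)) (at u)"
  using smooth_on_has_derivative[OF assms] smooth_on_frechet_eq_partial[OF assms]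
  by (metis (no_types, lifting) ext)

lemma partial_eqI: "(f has_derivative f') (at u) \<Longrightarrow> partial i f u = f' (axis i 1)"
  unfolding partial_def using frechet_derivative_at by metis

text \<open>Locally equal functions have the same set of derivatives, so the choice operator inside
  \<open>frechet_derivative\<close> picks the same one, even where that set is empty.\<close>

lemma partial_cong:
  assumes "open S" "u \<in> S" "\<And>x. x \<in> S \<Longrightarrow> f x = g x"
  shows "partial i f u = partial i g u"
  unfolding partial_def frechet_derivative_def
proof -
  have "(f has_derivative f') (at u) \<longleftrightarrow> (g has_derivative f') (at u)" for f'
    using has_derivative_transform_within_open[OF _ assms(1,2), of f f' UNIV g]
      has_derivative_transform_within_open[OF _ assms(1,2), of g f' UNIV f] assms(3) by auto
  then show "(SOME f'. (f has_derivative f') (at u)) (axis i 1) = (SOME f'. (g has_derivative f') (at u)) (axis i 1)"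
    by simp
qed

lemma partial_bilinear:
  assumes "bounded_bilinear B" "smooth_on S f" "smooth_on S g" "u \<in> S"
  shows "partial i (\<lambda>x. B (f x) (g x)) u = B (f u) (partial i g u) + B (partial i f u) (g u)"
  using partial_eqI[OF bounded_bilinear.FDERIV[OF assms(1) smooth_on_has_derivative[OF assms(2,4)] smooth_on_has_derivative[OF assms(3,4)]]]
  by (simp add: partial_def)

lemmas partial_det2 = partial_bilinear[OF bounded_bilinear_det2]
lemmas partial_mult = partial_bilinear[OF bounded_bilinear_mult]
lemmas partial_scaleR = partial_bilinear[OF bounded_bilinear_scaleR]

lemma partial_linear:
  assumes "bounded_linear L" "smooth_on S f" "u \<in> S"
  shows "partial i (\<lambda>x. L (f x)) u = L (partial i f u)"
  using partial_eqI[OF bounded_linear.has_derivative[OF assms(1) smooth_on_has_derivative[OF assms(2,3)]]]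
  by (simp add: partial_def)

lemma partial_add:
  assumes "smooth_on S f" "smooth_on S g" "u \<in> S"
  shows "partial i (\<lambda>x. f x + g x) u = partial i f u + partial i g u"
  using partial_eqI[OF has_derivative_add[OF smooth_on_has_derivative[OF assms(1,3)] smooth_on_has_derivative[OF assms(2,3)]]]
  by (simp add: partial_def)

lemma partial_diff:
  assumes "smooth_on S f" "smooth_on S g" "u \<in> S"
  shows "partial i (\<lambda>x. f x - g x) u = partial i f u - partial i g u"
  using partial_eqI[OF has_derivative_diff[OF smooth_on_has_derivative[OF assms(1,3)] smooth_on_has_derivative[OF assms(2,3)]]]
  by (simp add: partial_def)

lemma partial_const: "partial i (\<lambda>x. c) u = 0"
  by (simp add: partial_def)

lemma partial_matrix_vector_mult:
  "smooth_on S f \<Longrightarrow> u \<in> S \<Longrightarrow> partial i (\<lambda>x. (M::real^'n^'m) *v f x) u = M *v partial i f u"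
  by (rule partial_linear[OF matrix_vector_mul_bounded_linear])

lemma partial_vec_nth: "smooth_on S f \<Longrightarrow> u \<in> S \<Longrightarrow> partial i (\<lambda>x. f x $ j) u = partial i f u $ j"
  by (rule partial_linear[OF bounded_linear_vec_nth])

section \<open>Smoothness of local inverses\<close>

text \<open>Bootstrapping: the derivative of \<open>g\<close> is a smooth function of
  \<open>g\<close> itself, so each order of differentiability gives the next.\<close>

lemma smooth_on_autonomous:
  fixes g :: "'a::euclidean_space \<Rightarrow> 'b::euclidean_space"
  assumes "open V" "g ` V \<subseteq> S" "\<And>v. smooth_on S (\<Psi> v)"
    "\<And>y. y \<in> V \<Longrightarrow> (g has_derivative (\<lambda>v. \<Psi> v (g y))) (at y)"
  shows "smooth_on V g"
  unfolding smooth_on_def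
proof
  fix k show "C_k_on k V g"
  proof (induction k)
    case 0
    then show ?case using assms(4)
      by (auto intro!: continuous_at_imp_continuous_on dest: has_derivative_continuous)
  next
    case (Suc k)
    have "C_k_on k V (\<lambda>y. \<Psi> v (g y))" for v
      by (rule C_k_on_compose[OF Suc _ assms(2,1)]) (use assms(3) in \<open>auto simp: smooth_on_def\<close>)
    then show ?case using assms(4) unfolding C_k_on.simps
      by (intro exI[of _ "\<lambda>y v. \<Psi> v (g y)"]) blast
  qed
qed

text \<open>The inverse function theorem yields only differentiability of the inverse. Its
  derivative is the inverse Jacobian evaluated at the inverse function, and Cramer's rule shows that
  this is a smooth expression, so bootstrapping applies.\<close>

lemma smooth_local_inverse:
  fixes f :: "real^2 \<Rightarrow> real^2"
  assumes "open S" "smooth_on S f" "u \<in> S" "det2 (partial 1 f u) (partial 2 f u) \<noteq> 0"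
  obtains W V g where "open W" "W \<subseteq> S" "u \<in> W" "open V" "f u \<in> V" "homeomorphism W V f g" "smooth_on V g"
proof -
  define J where "J x = det2 (partial 1 f x) (partial 2 f x)" for x
  define S' where "S' = {x \<in> S. J x \<noteq> 0}"
  have smJ: "smooth_on S J"
    unfolding J_def by (intro smooth_on_det2 smooth_on_partial assms)
  then have "open S'" unfolding S'_def
    using continuous_open_preimage[OF smooth_on_imp_continuous_on[OF smJ] assms(1), of "- {0}"]
    by (simp add: vimage_def Int_def open_Compl)
  have "u \<in> S'" using assms(3,4) by (simp add: S'_def J_def)
  have sm': "smooth_on S' f" by (rule smooth_on_subset[OF assms(2)]) (auto simp: S'_def)
  \<comment> \<open>Cramer's rule: the solution \<open>w\<close> of the linear equation that the
    derivative of \<open>f\<close> at \<open>x\<close> sends \<open>w\<close> to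
    \<open>v\<close>.\<close>
  define \<Psi> :: "real^2 \<Rightarrow> real^2 \<Rightarrow> real^2" where "\<Psi> v x = (det2 v (partial 2 f x) / J x) *\<^sub>R axis 1 (1::real) + (det2 (partial 1 f x) v / J x) *\<^sub>R axis 2 (1::real)" for v x :: "real^2"
  have sm\<Psi>: "smooth_on S' (\<Psi> v)" for v
    unfolding \<Psi>_def
    by (intro smooth_on_add smooth_on_scaleR smooth_on_const smooth_on_divide smooth_on_det2 smooth_on_partial
        sm' \<open>open S'\<close> smooth_on_subset[OF smJ]) (auto simp: S'_def)
  define f' where "f' x = Blinfun (frechet_derivative f (at x))" for x
  have f': "blinfun_apply (f' x) = frechet_derivative f (at x)" if "x \<in> S'" for x
    unfolding f'_def using smooth_on_has_derivative[OF sm' that] has_derivative_bounded_linear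
    by (intro bounded_linear_Blinfun_apply) auto
  have f'w: "blinfun_apply (f' x) w = w $ 1 *\<^sub>R partial 1 f x + w $ 2 *\<^sub>R partial 2 f x" if "x \<in> S'" for x w
    using f'[OF that] smooth_on_frechet_eq_partial[OF sm' that] by simp
  have \<Psi>lin: "bounded_linear (\<lambda>v. \<Psi> v x)" for x
    unfolding \<Psi>_def by (intro linear_conv_bounded_linear[THEN iffD1] linearI)
      (auto simp: algebra_simps add_divide_distrib)
  have left: "\<Psi> (blinfun_apply (f' x) w) x = w" if "x \<in> S'" for x w
    using that unfolding f'w[OF that] \<Psi>_def S'_def J_def
    by (simp add: vec_eq_iff forall_2 axis_def)
  have right: "blinfun_apply (f' x) (\<Psi> w x) = w" if "x \<in> S'" for x w
  proof -
    have "J x \<noteq> 0" using that by (simp add: S'_def)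
    then have "(1 / J x) *\<^sub>R (J x *\<^sub>R w) = w" by simp
    then show ?thesis
      unfolding f'w[OF that] \<Psi>_def using det2_expand[of "partial 1 f x" "partial 2 f x" w]
      by (simp add: J_def axis_def scaleR_add_right)
  qed
  obtain W V g g' where g: "open W" "W \<subseteq> S'" "u \<in> W" "open V" "f u \<in> V" "homeomorphism W V f g"
    "\<And>y. y \<in> V \<Longrightarrow> (g has_derivative (g' y)) (at y)"
    "\<And>y. y \<in> V \<Longrightarrow> g' y = inv (blinfun_apply (f' (g y)))"
  proof (rule inverse_function_theorem[OF \<open>open S'\<close>, of f f' u "Blinfun (\<lambda>v. \<Psi> v u)"])
    show "(f has_derivative blinfun_apply (f' x)) (at x)" if "x \<in> S'" for x
      using smooth_on_has_derivative[OF sm' that] f'[OF that] by simp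
    show "continuous_on S' f'"
    proof (rule continuous_on_blinfun_componentwise)
      fix i :: "real^2" assume "i \<in> Basis"
      show "continuous_on S' (\<lambda>x. blinfun_apply (f' x) i)"
        using smooth_on_imp_continuous_on[OF smooth_on_frechet_derivative[OF sm' \<open>open S'\<close>, of i]] f'
        by (simp cong: continuous_on_cong)
    qed
    show "Blinfun (\<lambda>v. \<Psi> v u) o\<^sub>L f' u = id_blinfun"
      by (rule blinfun_eqI) (simp add: bounded_linear_Blinfun_apply[OF \<Psi>lin] left[OF \<open>u \<in> S'\<close>])
  qed (use \<open>u \<in> S'\<close> in auto)
  have gS: "g y \<in> S'" if "y \<in> V" for y
    using g(2,6) that unfolding homeomorphism_def by blast
  have g': "g' y = (\<lambda>v. \<Psi> v (g y))" if "y \<in> V" for y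
    unfolding g(8)[OF that]
    by (rule inv_unique_comp) (auto simp: fun_eq_iff left[OF gS[OF that]] right[OF gS[OF that]])
  have "smooth_on V g"
    by (rule smooth_on_autonomous[OF g(4) _ sm\<Psi>]) (use gS g(7) g' in auto)
  moreover have "W \<subseteq> S" using g(2) by (auto simp: S'_def)
  ultimately show ?thesis using that g by blast
qed

subsection \<open>Smooth functions on surfaces\<close>

definition smooth_fun :: "'p chart set \<Rightarrow> ('p \<Rightarrow> 'b::real_normed_vector) \<Rightarrow> bool" where
  "smooth_fun A f \<longleftrightarrow> (\<forall>c\<in>A. smooth_on (chart_image c) (in_chart c f))"

lemma in_chart_fun: "in_chart c (\<lambda>p. g (f p)) = (\<lambda>u. g (in_chart c f u))"
  by (simp add: in_chart_def o_def)

locale surface =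
  fixes X :: "'p topology" and A :: "'p chart set"
  assumes surface: "smooth_surface X A"
begin

abbreviation chart_inv :: "'p chart \<Rightarrow> real^2 \<Rightarrow> 'p" where
  "chart_inv c \<equiv> inv_into (fst c) (snd c)"

lemma Hausdorff: "Hausdorff_space X" and connected: "connected_space X"
  and second_countable: "second_countable X" and nonempty: "topspace X \<noteq> {}"
  using surface by (auto simp: smooth_surface_def)

lemma chart_homeomorphic:
  assumes "c \<in> A"
  shows "openin X (fst c)" "open (chart_image c)"
    "homeomorphic_map (subtopology X (fst c)) (top_of_set (chart_image c)) (snd c)"
proof -
  have "\<forall>(U, \<phi>)\<in>A. openin X U \<and> open (\<phi> ` U) \<and>
        homeomorphic_map (subtopology X U) (top_of_set (\<phi> ` U)) \<phi>"
    using surface unfolding smooth_surface_def by blast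
  then show "openin X (fst c)" "open (chart_image c)"
    "homeomorphic_map (subtopology X (fst c)) (top_of_set (chart_image c)) (snd c)"
    using assms unfolding chart_image_def by (metis (no_types, lifting) case_prod_unfold)+
qed

lemma chart_subset: "c \<in> A \<Longrightarrow> fst c \<subseteq> topspace X"
  using chart_homeomorphic(1) openin_subset by blast

lemma chart_inj: "c \<in> A \<Longrightarrow> inj_on (snd c) (fst c)"
  using chart_homeomorphic(3)[of c] chart_subset[of c] homeomorphic_imp_injective_map
  by (force simp: topspace_subtopology inf.absorb2)

lemma chart_cover: "p \<in> topspace X \<Longrightarrow> \<exists>c\<in>A. p \<in> fst c"
proof -
  assume "p \<in> topspace X"
  then have "p \<in> (\<Union>(U, \<phi>)\<in>A. U)" using surface unfolding smooth_surface_def by metis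
  then obtain c where "c \<in> A" "p \<in> (case c of (U, \<phi>) \<Rightarrow> U)" by blast
  then show ?thesis by (intro bexI[of _ c]) (auto split: prod.splits)
qed

lemma chart_inv_left: "c \<in> A \<Longrightarrow> p \<in> fst c \<Longrightarrow> chart_inv c (snd c p) = p"
  using chart_inj by (rule inv_into_f_f)

lemma chart_inv_right: "u \<in> chart_image c \<Longrightarrow> snd c (chart_inv c u) = u"
  unfolding chart_image_def by (rule f_inv_into_f)

lemma chart_inv_in: "u \<in> chart_image c \<Longrightarrow> chart_inv c u \<in> fst c"
  unfolding chart_image_def by (rule inv_into_into)

lemma chart_imageI: "p \<in> fst c \<Longrightarrow> snd c p \<in> chart_image c"
  by (simp add: chart_image_def)

lemma in_chart_apply: "c \<in> A \<Longrightarrow> p \<in> fst c \<Longrightarrow> in_chart c f (snd c p) = f p"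
  by (simp add: in_chart_def chart_inv_left)

lemma continuous_map_chart:
  "c \<in> A \<Longrightarrow> continuous_map (subtopology X (fst c)) euclidean (snd c)"
  using homeomorphic_imp_continuous_map[OF chart_homeomorphic(3)[of c]]
  by (simp add: continuous_map_in_subtopology)

lemma continuous_map_chart_inv:
  assumes c: "c \<in> A"
  shows "continuous_map (top_of_set (chart_image c)) X (chart_inv c)"
proof -
  obtain g where g: "homeomorphic_maps (subtopology X (fst c)) (top_of_set (chart_image c)) (snd c) g"
    using chart_homeomorphic(3)[OF c] homeomorphic_map_maps by blast
  have "continuous_map (top_of_set (chart_image c)) X g"
    using g unfolding homeomorphic_maps_def continuous_map_in_subtopology by blast
  moreover have "g u = chart_inv c u" if "u \<in> topspace (top_of_set (chart_image c))" for u
  proof -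
    have u: "u \<in> chart_image c" using that by simp
    have "g (snd c (chart_inv c u)) = chart_inv c u"
      using g chart_inv_in[OF u] chart_subset[OF c] unfolding homeomorphic_maps_def by auto
    then show ?thesis using chart_inv_right[OF u] by simp
  qed
  ultimately show ?thesis by (rule continuous_map_eq)
qed

lemma openin_chart_inv_image:
  assumes "c \<in> A" "W \<subseteq> chart_image c" "open W"
  shows "openin X (chart_inv c ` W)"
proof -
  have eq: "chart_inv c ` W = {p \<in> topspace (subtopology X (fst c)). snd c p \<in> W}"
  proof (intro equalityI subsetI)
    fix p assume "p \<in> chart_inv c ` W"
    then obtain u where u: "u \<in> W" "p = chart_inv c u" by blast
    then have "u \<in> chart_image c" using assms(2) by blast
    then show "p \<in> {p \<in> topspace (subtopology X (fst c)). snd c p \<in> W}"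
      using u chart_inv_in[of u c] chart_inv_right[of u c] chart_subset[OF assms(1)] by auto
  next
    fix p assume "p \<in> {p \<in> topspace (subtopology X (fst c)). snd c p \<in> W}"
    then have "p \<in> fst c" "snd c p \<in> W" by auto
    then show "p \<in> chart_inv c ` W"
      using chart_inv_left[OF assms(1), of p] by (intro image_eqI[of _ _ "snd c p"]) auto
  qed
  have "openin (subtopology X (fst c)) (chart_inv c ` W)"
    unfolding eq by (rule openin_continuous_map_preimage[OF continuous_map_chart[OF assms(1)]]) (simp add: assms(3))
  then show ?thesis using chart_homeomorphic(1)[OF assms(1)] openin_trans_full by blast
qed

lemma open_chart_image:
  assumes "c \<in> A" "openin X V"
  shows "open (snd c ` (fst c \<inter> V))"
proof -
  have eq: "snd c ` (fst c \<inter> V) = {u \<in> topspace (top_of_set (chart_image c)). chart_inv c u \<in> V}"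
  proof (intro equalityI subsetI)
    fix u assume "u \<in> snd c ` (fst c \<inter> V)"
    then obtain p where p: "p \<in> fst c" "p \<in> V" "u = snd c p" by blast
    then show "u \<in> {u \<in> topspace (top_of_set (chart_image c)). chart_inv c u \<in> V}"
      using chart_inv_left[OF assms(1) p(1)] chart_imageI[OF p(1)] by simp
  next
    fix u assume "u \<in> {u \<in> topspace (top_of_set (chart_image c)). chart_inv c u \<in> V}"
    then have "u \<in> chart_image c" "chart_inv c u \<in> V" by auto
    then show "u \<in> snd c ` (fst c \<inter> V)"
      using chart_inv_in[of u c] chart_inv_right[of u c] by (intro image_eqI[of _ _ "chart_inv c u"]) auto
  qed
  have "openin (top_of_set (chart_image c)) (snd c ` (fst c \<inter> V))"
    unfolding eq by (rule openin_continuous_map_preimage[OF continuous_map_chart_inv[OF assms(1)] assms(2)])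
  then show ?thesis using chart_homeomorphic(2)[OF assms(1)] openin_open_eq by blast
qed

lemma smooth_transition:
  assumes "c \<in> A" "c' \<in> A"
  shows "smooth_on (snd c ` (fst c \<inter> fst c')) (in_chart c (snd c'))"
proof -
  have "\<forall>(U, \<phi>)\<in>A. \<forall>(V, \<theta>)\<in>A. smooth_on (\<phi> ` (U \<inter> V)) (in_chart (U, \<phi>) \<theta>)"
    using surface unfolding smooth_surface_def by blast
  then show ?thesis using assms by (cases c, cases c') auto
qed

lemma continuous_map_in_charts:
  fixes f :: "'p \<Rightarrow> 'b::topological_space"
  assumes "\<And>c. c \<in> A \<Longrightarrow> continuous_on (chart_image c) (in_chart c f)"
  shows "continuous_map X euclidean f"
proof (rule continuous_map_openin_preimage_eq[THEN iffD2], intro conjI allI impI)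
  show "f \<in> topspace X \<rightarrow> topspace euclidean" by simp
  fix U :: "'b set" assume "openin euclidean U"
  then have U: "open U" by simp
  define S where "S c = {u \<in> chart_image c. in_chart c f u \<in> U}" for c
  have "open (S c)" if "c \<in> A" for c
    using continuous_open_preimage[OF assms[OF that] chart_homeomorphic(2)[OF that] U]
    unfolding S_def by (simp add: vimage_def Int_def)
  then have "openin X (\<Union>c\<in>A. chart_inv c ` S c)"
    by (intro openin_Union ballI) (auto intro!: openin_chart_inv_image simp: S_def)
  moreover have "(\<Union>c\<in>A. chart_inv c ` S c) = {p \<in> topspace X. f p \<in> U}"
  proof (intro equalityI subsetI)
    fix p assume "p \<in> (\<Union>c\<in>A. chart_inv c ` S c)"
    then obtain c u where "c \<in> A" "u \<in> S c" "p = chart_inv c u" by auto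
    then show "p \<in> {p \<in> topspace X. f p \<in> U}"
      using chart_inv_in[of u c] chart_subset[of c] by (auto simp: S_def in_chart_def)
  next
    fix p assume "p \<in> {p \<in> topspace X. f p \<in> U}"
    then obtain c where c: "c \<in> A" "p \<in> fst c" "f p \<in> U" using chart_cover[of p] by blast
    then have "snd c p \<in> S c" by (simp add: S_def chart_imageI in_chart_apply)
    then show "p \<in> (\<Union>c\<in>A. chart_inv c ` S c)"
      using chart_inv_left[OF c(1,2)] c(1) by (intro UN_I[OF c(1)]) (metis image_eqI)
  qed
  ultimately show "openin X (topspace X \<inter> f -` U)" by (simp add: Int_def vimage_def)
qed

lemma smooth_fun_continuous: "smooth_fun A f \<Longrightarrow> continuous_map X euclidean f"
  by (rule continuous_map_in_charts) (auto simp: smooth_fun_def intro: smooth_on_imp_continuous_on)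

lemma locally_constant_imp_constant:
  assumes "\<And>p. p \<in> topspace X \<Longrightarrow> \<exists>W. openin X W \<and> p \<in> W \<and> (\<forall>q\<in>W. f q = f p)" "p \<in> topspace X" "q \<in> topspace X"
  shows "f q = f p"
proof -
  define S where "S = {q \<in> topspace X. f q = f p}"
  have op: "openin X {q \<in> topspace X. P (f q)}" for P
  proof (subst openin_subopen, intro ballI)
    fix q assume q: "q \<in> {q \<in> topspace X. P (f q)}"
    then have "q \<in> topspace X" by simp
    from assms(1)[OF this] obtain W where W: "openin X W" "q \<in> W" "\<forall>r\<in>W. f r = f q" by (elim exE conjE)
    have "W \<subseteq> {q \<in> topspace X. P (f q)}"
    proof
      fix r assume r: "r \<in> W"
      have "f r = f q" by (rule bspec[OF W(3) r])
      then show "r \<in> {q \<in> topspace X. P (f q)}" using q r openin_subset[OF W(1)] by auto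
    qed
    then show "\<exists>T. openin X T \<and> q \<in> T \<and> T \<subseteq> {q \<in> topspace X. P (f q)}"
      using W(1,2) by (intro exI[of _ W] conjI)
  qed
  have "openin X S" unfolding S_def by (rule op)
  moreover have "topspace X - S = {q \<in> topspace X. f q \<noteq> f p}" by (auto simp: S_def)
  then have "openin X (topspace X - S)" using op[of "\<lambda>y. y \<noteq> f p"] by simp
  moreover have "S \<subseteq> topspace X" by (auto simp: S_def)
  ultimately have "S = {} \<or> S = topspace X"
    using connected unfolding connected_space_clopen_in closedin_def by blast
  then show ?thesis using assms(2,3) unfolding S_def by blast
qed

text \<open>This replaces integration: the conserved quantities, and later the third coordinate of
  the surface, are obtained by guessing an expression and showing that its partial derivatives
  vanish.\<close>

lemma constant_if_partial_zero:
  fixes f :: "'p \<Rightarrow> 'b::real_normed_vector"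
  assumes "smooth_fun A f"
    "\<And>c u i. c \<in> A \<Longrightarrow> u \<in> chart_image c \<Longrightarrow> partial i (in_chart c f) u = 0"
    "p \<in> topspace X" "q \<in> topspace X"
  shows "f q = f p"
proof (rule locally_constant_imp_constant[OF _ assms(3,4)])
  fix p assume "p \<in> topspace X"
  then obtain c where c: "c \<in> A" "p \<in> fst c" using chart_cover by blast
  obtain e where e: "e > 0" "ball (snd c p) e \<subseteq> chart_image c"
    using chart_homeomorphic(2)[OF c(1)] chart_imageI[OF c(2)] open_contains_ball by blast
  have sm: "smooth_on (chart_image c) (in_chart c f)" using assms(1) c(1) by (simp add: smooth_fun_def)
  have "in_chart c f u = in_chart c f (snd c p)" if u: "u \<in> ball (snd c p) e" for u
  proof (rule has_derivative_zero_unique[OF convex_ball _ u])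
    fix x assume "x \<in> ball (snd c p) e"
    then have x: "x \<in> chart_image c" using e by blast
    have "frechet_derivative (in_chart c f) (at x) = (\<lambda>h. 0)"
      using smooth_on_frechet_eq_partial[OF sm x] assms(2)[OF c(1) x] by (simp add: fun_eq_iff)
    then show "(in_chart c f has_derivative (\<lambda>h. 0)) (at x within ball (snd c p) e)"
      using smooth_on_has_derivative[OF sm x] has_derivative_at_withinI by metis
  qed (use e in auto)
  then show "\<exists>W. openin X W \<and> p \<in> W \<and> (\<forall>q\<in>W. f q = f p)"
    using openin_chart_inv_image[OF c(1) e(2)] e(1) chart_inv_left[OF c]
    by (intro exI[of _ "chart_inv c ` ball (snd c p) e"])
      (auto simp: in_chart_def image_iff intro!: bexI[of _ "snd c p"])
qed

lemma local_inverse: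
  fixes F :: "'p \<Rightarrow> real^2"
  assumes "smooth_fun A F" "c \<in> A" "p \<in> fst c"
    "det2 (partial 1 (in_chart c F) (snd c p)) (partial 2 (in_chart c F) (snd c p)) \<noteq> 0"
  obtains V \<sigma> where "open V" "F p \<in> V" "\<sigma> (F p) = p" "\<And>w. w \<in> V \<Longrightarrow> \<sigma> w \<in> fst c \<and> F (\<sigma> w) = w"
    "smooth_on V (\<lambda>w. snd c (\<sigma> w))" "openin X (\<sigma> ` V)" "continuous_map (top_of_set V) X \<sigma>"
proof -
  have sm: "smooth_on (chart_image c) (in_chart c F)" using assms(1,2) by (simp add: smooth_fun_def)
  obtain W V g where g: "open W" "W \<subseteq> chart_image c" "snd c p \<in> W" "open V" "in_chart c F (snd c p) \<in> V"
    "homeomorphism W V (in_chart c F) g" "smooth_on V g"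
    by (rule smooth_local_inverse[OF chart_homeomorphic(2)[OF assms(2)] sm chart_imageI[OF assms(3)] assms(4)])
  have gW: "g w \<in> W" "in_chart c F (g w) = w" if "w \<in> V" for w
    using g(6) that unfolding homeomorphism_def by auto
  have gV: "g ` V = W" using g(6) unfolding homeomorphism_def by auto
  define \<sigma> where "\<sigma> w = chart_inv c (g w)" for w
  show ?thesis
  proof (rule that[of V \<sigma>])
    show "open V" by (rule g(4))
    show "F p \<in> V" using g(5) in_chart_apply[OF assms(2,3), of F] by simp
    have "g (F p) = snd c p"
      using g(3,6) in_chart_apply[OF assms(2,3), of F] unfolding homeomorphism_def by metis
    then show "\<sigma> (F p) = p" by (simp add: \<sigma>_def chart_inv_left[OF assms(2,3)])
    show "\<sigma> w \<in> fst c \<and> F (\<sigma> w) = w" if "w \<in> V" for w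
      using gW[OF that] g(2) chart_inv_in[of "g w" c] by (auto simp: \<sigma>_def in_chart_def)
    have "g w = snd c (\<sigma> w)" if "w \<in> V" for w
      using gW[OF that] g(2) chart_inv_right[of "g w" c] by (auto simp: \<sigma>_def)
    then show "smooth_on V (\<lambda>w. snd c (\<sigma> w))"
      by (rule smooth_on_cong[OF g(4) _ g(7)])
    have "\<sigma> ` V = chart_inv c ` W" unfolding gV[symmetric] by (simp add: \<sigma>_def image_image)
    then show "openin X (\<sigma> ` V)" using openin_chart_inv_image[OF assms(2) g(2,1)] by simp
    have "continuous_map (top_of_set V) (top_of_set (chart_image c)) g"
      using smooth_on_imp_continuous_on[OF g(7)] gW(1) g(2) by (auto simp: continuous_map_in_subtopology)
    then have "continuous_map (top_of_set V) X (chart_inv c \<circ> g)"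
      by (rule continuous_map_compose[OF _ continuous_map_chart_inv[OF assms(2)]])
    then show "continuous_map (top_of_set V) X \<sigma>"
      by (simp add: \<sigma>_def[abs_def] o_def)
  qed
qed

end

subsection \<open>Metrics of the form \<open>- (d\<alpha> \<and> d\<beta> + d\<beta> \<and> d\<alpha>)\<close>\<close>

text \<open>Lowering the upper index removes \<open>matrix_inv\<close>, so that later identities are
  polynomial in the metric and its derivatives.\<close>

lemma christoffel_lowered:
  assumes "det (G u) \<noteq> 0"
  shows "G u $ l $ 1 * christoffel G 1 i j u + G u $ l $ 2 * christoffel G 2 i j u
    = (partial i (\<lambda>x. G x $ j $ l) u + partial j (\<lambda>x. G x $ i $ l) u - partial l (\<lambda>x. G x $ i $ j) u) / 2"
proof -
  define L where "L l = partial i (\<lambda>x. G x $ j $ l) u + partial j (\<lambda>x. G x $ i $ l) u - partial l (\<lambda>x. G x $ i $ j) u" for l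
  define N where "N = matrix_inv (G u)"
  have "\<exists>N. G u ** N = mat 1 \<and> N ** G u = mat 1"
    using assms invertible_det_nz[of "G u"] by (simp add: invertible_def)
  from someI_ex[OF this] have "G u ** N = mat 1"
    by (simp add: N_def matrix_inv_def)
  then have "(G u ** N) $ l $ m = (if l = m then 1 else 0)" for m by (simp add: mat_def)
  then have m: "G u $ l $ 1 * N $ 1 $ m + G u $ l $ 2 * N $ 2 $ m = (if l = m then 1 else 0)" for m
    by (simp add: matrix_matrix_mult_def sum_2)
  have c: "christoffel G k i j u = (N $ k $ 1 * L 1 + N $ k $ 2 * L 2) / 2" for k
    by (simp add: christoffel_def L_def N_def sum_2)
  have "G u $ l $ 1 * christoffel G 1 i j u + G u $ l $ 2 * christoffel G 2 i j u
    = ((G u $ l $ 1 * N $ 1 $ 1 + G u $ l $ 2 * N $ 2 $ 1) * L 1 + (G u $ l $ 1 * N $ 1 $ 2 + G u $ l $ 2 * N $ 2 $ 2) * L 2) / 2"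
    unfolding c by (simp add: field_simps)
  also have "\<dots> = L l / 2" unfolding m using exhaust_2[of l] by auto
  finally show ?thesis by (simp add: L_def)
qed

text \<open>The second derivative of \<open>f\<close> along a curve through \<open>u\<close> with
  coordinate velocity \<open>v\<close> and coordinate second derivative \<open>w\<close>.\<close>

definition acceleration :: "(real^2 \<Rightarrow> 'b::real_normed_vector) \<Rightarrow> real^2 \<Rightarrow> real^2 \<Rightarrow> real^2 \<Rightarrow> 'b" where
  "acceleration f u v w = w $ 1 *\<^sub>R partial 1 f u + w $ 2 *\<^sub>R partial 2 f u
     + (\<Sum>i\<in>UNIV. \<Sum>j\<in>UNIV. (v $ i * v $ j) *\<^sub>R partial i (partial j f) u)"

lemma curve_derivative:
  assumes "smooth_on S f" "(x has_vector_derivative x') (at t)" "x t \<in> S"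
  shows "((\<lambda>r. f (x r)) has_vector_derivative (x' $ 1 *\<^sub>R partial 1 f (x t) + x' $ 2 *\<^sub>R partial 2 f (x t))) (at t)"
  using has_derivative_compose[OF assms(2)[unfolded has_vector_derivative_def] smooth_on_has_derivative_partial[OF assms(1,3)]]
  by (simp add: has_vector_derivative_def scaleR_add_right)

lemma curve_acceleration:
  assumes "open S" "smooth_on S f" "(x has_vector_derivative x' t) (at t)" "x t \<in> S" "(x' has_vector_derivative x'') (at t)"
  shows "((\<lambda>r. x' r $ 1 *\<^sub>R partial 1 f (x r) + x' r $ 2 *\<^sub>R partial 2 f (x r))
    has_vector_derivative acceleration f (x t) (x' t) x'') (at t)"
proof -
  have c: "((\<lambda>r. x' r $ i) has_vector_derivative x'' $ i) (at t)" for i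
    by (rule bounded_linear.has_vector_derivative[OF bounded_linear_vec_nth assms(5)])
  have p: "((\<lambda>r. partial i f (x r)) has_vector_derivative
      (x' t $ 1 *\<^sub>R partial 1 (partial i f) (x t) + x' t $ 2 *\<^sub>R partial 2 (partial i f) (x t))) (at t)" for i
    by (rule curve_derivative[OF smooth_on_partial[OF assms(2,1)] assms(3,4)])
  have "((\<lambda>r. x' r $ i *\<^sub>R partial i f (x r)) has_vector_derivative
      (x' t $ i *\<^sub>R (x' t $ 1 *\<^sub>R partial 1 (partial i f) (x t) + x' t $ 2 *\<^sub>R partial 2 (partial i f) (x t))
        + x'' $ i *\<^sub>R partial i f (x t))) (at t)" for i
    by (rule bounded_bilinear.has_vector_derivative[OF bounded_bilinear_scaleR c p])
  from has_vector_derivative_add[OF this[of 1] this[of 2]] show ?thesis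
    by (rule has_vector_derivative_eq_rhs) (simp add: acceleration_def sum_2 algebra_simps)
qed

text \<open>The symmetric form that sends two pairs (x, y) and (x', y') to
  \<open>- (det2 x y' + det2 x' y)\<close> is a flat neutral metric on R^4, and
  \<open>metric\<close> says that \<open>G\<close> is induced from it by the map
  \<open>(a, b)\<close>. Its diagonal value on a tangent vector is \<open>- 2 * det2 da db\<close>,
  so the kernels of the rank-one differentials of \<open>a\<close> and \<open>b\<close> are null
  directions.\<close>

locale chart_pair =
  fixes S :: "(real^2) set" and a b :: "real^2 \<Rightarrow> real^2" and G :: "real^2 \<Rightarrow> real^2^2"
  assumes open_S: "open S" and smooth_a: "smooth_on S a" and smooth_b: "smooth_on S b"
    and rank_a: "\<And>u. u \<in> S \<Longrightarrow> det2 (partial 1 a u) (partial 2 a u) = 0"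
    and rank_b: "\<And>u. u \<in> S \<Longrightarrow> det2 (partial 1 b u) (partial 2 b u) = 0"
    and regular: "\<And>u. u \<in> S \<Longrightarrow> det2 (partial 1 a u) (partial 2 b u) - det2 (partial 2 a u) (partial 1 b u) \<noteq> 0"
    and metric: "\<And>u i j. u \<in> S \<Longrightarrow> G u $ i $ j = - (det2 (partial i a u) (partial j b u) + det2 (partial j a u) (partial i b u))"
begin

text \<open>By a Pluecker relation the failure of this formula is a multiple of the product of the
  Jacobians of \<open>a\<close> and \<open>b\<close>, which vanish. So \<open>regular\<close>
  already makes the metric nondegenerate and indefinite.\<close>

lemma det_metric:
  assumes "u \<in> S"
  shows "det (G u) = - (det2 (partial 1 a u) (partial 2 b u) - det2 (partial 2 a u) (partial 1 b u))\<^sup>2"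
proof -
  have pl: "det2 (partial 1 a u) (partial 1 b u) * det2 (partial 2 a u) (partial 2 b u)
      - det2 (partial 1 a u) (partial 2 b u) * det2 (partial 2 a u) (partial 1 b u)
      = det2 (partial 1 a u) (partial 2 a u) * det2 (partial 1 b u) (partial 2 b u)"
    unfolding det2_def by algebra
  have "det (G u) = 4 * (det2 (partial 1 a u) (partial 1 b u) * det2 (partial 2 a u) (partial 2 b u))
      - (det2 (partial 1 a u) (partial 2 b u) + det2 (partial 2 a u) (partial 1 b u))\<^sup>2"
    unfolding det_2 metric[OF assms] by (simp add: power2_eq_square algebra_simps)
  then show ?thesis using pl rank_a[OF assms] by (simp add: power2_eq_square algebra_simps)
qed

lemma det_metric_nonzero: "u \<in> S \<Longrightarrow> det (G u) \<noteq> 0"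
  using det_metric regular by simp

lemma partial_metric:
  assumes "u \<in> S"
  shows "partial l (\<lambda>x. G x $ i $ j) u =
    - (det2 (partial i a u) (partial l (partial j b) u) + det2 (partial l (partial i a) u) (partial j b u)
     + (det2 (partial j a u) (partial l (partial i b) u) + det2 (partial l (partial j a) u) (partial i b u)))"
proof -
  note sm = smooth_on_partial[OF smooth_a open_S] smooth_on_partial[OF smooth_b open_S]
  have "partial l (\<lambda>x. G x $ i $ j) u = partial l (\<lambda>x. - (det2 (partial i a x) (partial j b x) + det2 (partial j a x) (partial i b x))) u"
    by (rule partial_cong[OF open_S assms metric])
  also have "\<dots> = - (partial l (\<lambda>x. det2 (partial i a x) (partial j b x) + det2 (partial j a x) (partial i b x)) u)"
    by (rule partial_linear[OF bounded_linear_minus[OF bounded_linear_ident] _ assms])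
      (intro smooth_on_add smooth_on_det2 sm)
  also have "\<dots> = - (partial l (\<lambda>x. det2 (partial i a x) (partial j b x)) u + partial l (\<lambda>x. det2 (partial j a x) (partial i b x)) u)"
    by (simp add: partial_add[OF smooth_on_det2[OF sm] smooth_on_det2[OF sm] assms])
  finally show ?thesis by (simp add: partial_det2[OF sm assms])
qed

text \<open>The usual computation for an induced metric: in the alternating sum of derivatives of
  \<open>G\<close> the second derivatives involving the index \<open>l\<close> cancel in pairs,
  which leaves the ambient product of the second derivative of \<open>(a, b)\<close> with its
  \<open>l\<close>-th tangent vector.\<close>

lemma christoffel_pair:
  assumes "u \<in> S"
  shows "G u $ l $ 1 * christoffel G 1 i j u + G u $ l $ 2 * christoffel G 2 i j u
    = - (det2 (partial i (partial j a) u) (partial l b u) + det2 (partial l a u) (partial i (partial j b) u))"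
proof -
  have c: "partial i (partial j a) u = partial j (partial i a) u" "partial i (partial j b) u = partial j (partial i b) u" for i j
    using partial_commute[OF open_S smooth_a assms] partial_commute[OF open_S smooth_b assms] by blast+
  show ?thesis
    unfolding christoffel_lowered[of G u, OF det_metric_nonzero[OF assms]] partial_metric[OF assms]
    by (simp add: c[of l i] c[of l j] c[of j i])
qed

text \<open>A curve in a submanifold of a flat space is a geodesic iff its ambient acceleration is
  normal to the submanifold; the right-hand side says this for the map
  \<open>(a, b)\<close>.\<close>

lemma geodesic_equation_iff:
  assumes "u \<in> S"
  shows "(\<forall>k. w $ k + (\<Sum>i\<in>UNIV. \<Sum>j\<in>UNIV. christoffel G k i j u * v $ i * v $ j) = 0) \<longleftrightarrow>
    (\<forall>l. det2 (acceleration a u v w) (partial l b u) + det2 (partial l a u) (acceleration b u v w) = 0)"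
proof -
  define z where "z k = w $ k + (\<Sum>i\<in>UNIV. \<Sum>j\<in>UNIV. christoffel G k i j u * v $ i * v $ j)" for k :: 2
  have hz: "G u $ l $ 1 * z 1 + G u $ l $ 2 * z 2 = G u $ l $ 1 * w $ 1 + G u $ l $ 2 * w $ 2
     + (\<Sum>i\<in>UNIV. \<Sum>j\<in>UNIV. (G u $ l $ 1 * christoffel G 1 i j u + G u $ l $ 2 * christoffel G 2 i j u) * v $ i * v $ j)" for l
    by (simp add: z_def sum_2 algebra_simps)
  have key: "G u $ l $ 1 * z 1 + G u $ l $ 2 * z 2 =
      - (det2 (acceleration a u v w) (partial l b u) + det2 (partial l a u) (acceleration b u v w))" for l
    unfolding hz christoffel_pair[OF assms] by (simp add: metric[OF assms] acceleration_def sum_2 algebra_simps)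
  have "(\<forall>k. z k = 0) \<longleftrightarrow> (\<forall>l. G u $ l $ 1 * z 1 + G u $ l $ 2 * z 2 = 0)"
  proof
    assume *: "\<forall>l. G u $ l $ 1 * z 1 + G u $ l $ 2 * z 2 = 0"
    have "det (G u) * z 1 = (G u $ 1 $ 1 * z 1 + G u $ 1 $ 2 * z 2) * G u $ 2 $ 2 - (G u $ 2 $ 1 * z 1 + G u $ 2 $ 2 * z 2) * G u $ 1 $ 2"
      "det (G u) * z 2 = (G u $ 2 $ 1 * z 1 + G u $ 2 $ 2 * z 2) * G u $ 1 $ 1 - (G u $ 1 $ 1 * z 1 + G u $ 1 $ 2 * z 2) * G u $ 2 $ 1"
      by (simp_all add: det_2 algebra_simps)
    moreover have "G u $ 1 $ 1 * z 1 + G u $ 1 $ 2 * z 2 = 0" "G u $ 2 $ 1 * z 1 + G u $ 2 $ 2 * z 2 = 0"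
      using * by blast+
    ultimately have "det (G u) * z 1 = 0" "det (G u) * z 2 = 0" by (simp_all only: mult_zero_left diff_self)
    then have "z 1 = 0 \<and> z 2 = 0" using det_metric_nonzero[OF assms] by simp
    then show "\<forall>k. z k = 0" by (metis exhaust_2)
  qed simp
  then show ?thesis unfolding key by (simp only: z_def neg_equal_0_iff_equal)
qed

end

locale null_pair = surface X A for X :: "'p topology" and A +
  fixes \<alpha> \<beta> :: "'p \<Rightarrow> real^2" and g :: "'p metric"
  assumes smooth_\<alpha>: "smooth_fun A \<alpha>" and smooth_\<beta>: "smooth_fun A \<beta>"
    and pair: "\<And>c. c \<in> A \<Longrightarrow> chart_pair (chart_image c) (in_chart c \<alpha>) (in_chart c \<beta>) (g c)"
begin

text \<open>The curve \<open>\<gamma>\<close> is a geodesic iff this holds for \<open>p = \<gamma> t\<close> and the second derivatives of \<open>\<alpha> \<circ> \<gamma>\<close> and \<open>\<beta> \<circ> \<gamma>\<close>.\<close>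
definition null_geodesic_eq :: "'p \<Rightarrow> real^2 \<Rightarrow> real^2 \<Rightarrow> bool" where
  "null_geodesic_eq p a'' b'' \<longleftrightarrow> (\<forall>c\<in>A. p \<in> fst c \<longrightarrow>
     (\<forall>l. det2 a'' (partial l (in_chart c \<beta>) (snd c p)) + det2 (partial l (in_chart c \<alpha>) (snd c p)) b'' = 0))"

lemma chart_times_open:
  assumes "open I" "continuous_map (top_of_set I) X \<gamma>" "c \<in> A"
  shows "open {t \<in> I. \<gamma> t \<in> fst c}"
proof -
  have "openin (top_of_set I) {t \<in> topspace (top_of_set I). \<gamma> t \<in> fst c}"
    by (rule openin_continuous_map_preimage[OF assms(2) chart_homeomorphic(1)[OF assms(3)]])
  then have "openin (top_of_set I) {t \<in> I. \<gamma> t \<in> fst c}" by simp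
  then show ?thesis by (rule openin_open_trans[OF _ assms(1)])
qed

lemma function_along_curve:
  assumes I: "open I" "continuous_map (top_of_set I) X \<gamma>" "c \<in> A" and f: "smooth_fun A f"
    and curve: "\<forall>t\<in>I. \<gamma> t \<in> fst c \<longrightarrow>
      ((\<lambda>r. snd c (\<gamma> r)) has_vector_derivative x' t) (at t) \<and> (x' has_vector_derivative x'' t) (at t)"
    and t: "t \<in> I" "\<gamma> t \<in> fst c"
  defines "f' \<equiv> \<lambda>t. vector_derivative (\<lambda>r. f (\<gamma> r)) (at t)"
  shows "((\<lambda>r. f (\<gamma> r)) has_vector_derivative f' t) (at t)"
    "f' t = x' t $ 1 *\<^sub>R partial 1 (in_chart c f) (snd c (\<gamma> t)) + x' t $ 2 *\<^sub>R partial 2 (in_chart c f) (snd c (\<gamma> t))"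
    "(f' has_vector_derivative acceleration (in_chart c f) (snd c (\<gamma> t)) (x' t) (x'' t)) (at t)"
proof -
  have x: "((\<lambda>r. snd c (\<gamma> r)) has_vector_derivative x' t) (at t)" "(x' has_vector_derivative x'' t) (at t)"
    if "t \<in> I" "\<gamma> t \<in> fst c" for t
    using bspec[OF curve that(1)] that(2) by blast+
  define J where "J = {t \<in> I. \<gamma> t \<in> fst c}"
  have J: "open J" unfolding J_def by (rule chart_times_open[OF I])
  have sm: "smooth_on (chart_image c) (in_chart c f)" using f I(3) by (simp add: smooth_fun_def)
  define h where "h t = x' t $ 1 *\<^sub>R partial 1 (in_chart c f) (snd c (\<gamma> t)) + x' t $ 2 *\<^sub>R partial 2 (in_chart c f) (snd c (\<gamma> t))" for t
  have d: "((\<lambda>r. f (\<gamma> r)) has_vector_derivative h t) (at t)" if "t \<in> J" for t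
  proof -
    have t: "t \<in> I" "\<gamma> t \<in> fst c" using that by (auto simp: J_def)
    have "((\<lambda>r. in_chart c f (snd c (\<gamma> r))) has_vector_derivative h t) (at t)"
      unfolding h_def by (rule curve_derivative[OF sm x(1)[OF t] chart_imageI[OF t(2)]])
    then show ?thesis
      by (rule has_vector_derivative_transform_within_open[OF _ J that]) (simp add: J_def in_chart_apply[OF I(3)])
  qed
  have f'h: "f' t = h t" if "t \<in> J" for t
    unfolding f'_def by (rule vector_derivative_at[OF d[OF that]])
  have tJ: "t \<in> J" using t by (simp add: J_def)
  show "((\<lambda>r. f (\<gamma> r)) has_vector_derivative f' t) (at t)" using d[OF tJ] f'h[OF tJ] by simp
  show "f' t = x' t $ 1 *\<^sub>R partial 1 (in_chart c f) (snd c (\<gamma> t)) + x' t $ 2 *\<^sub>R partial 2 (in_chart c f) (snd c (\<gamma> t))"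
    using f'h[OF tJ] by (simp add: h_def)
  have "(h has_vector_derivative acceleration (in_chart c f) (snd c (\<gamma> t)) (x' t) (x'' t)) (at t)"
    unfolding h_def
    by (rule curve_acceleration[OF chart_homeomorphic(2)[OF I(3)] sm x(1)[OF t] chart_imageI[OF t(2)] x(2)[OF t]])
  then show "(f' has_vector_derivative acceleration (in_chart c f) (snd c (\<gamma> t)) (x' t) (x'' t)) (at t)"
    by (rule has_vector_derivative_transform_within_open[OF _ J tJ]) (simp add: f'h)
qed

text \<open>The last conclusion records that the velocities of \<alpha> and \<beta> are the images
  of one tangent vector \<open>w\<close>; it is what later makes them multiples of \<open>E1\<close>
  and \<open>E2\<close>.\<close>

lemma geodesic_imp_null_geodesic_eq:
  assumes "geodesic_on X A g I \<gamma>" "open I"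
  obtains a' a'' b' b'' where
    "\<And>t. t \<in> I \<Longrightarrow> ((\<lambda>r. \<alpha> (\<gamma> r)) has_vector_derivative a' t) (at t)"
    "\<And>t. t \<in> I \<Longrightarrow> (a' has_vector_derivative a'' t) (at t)"
    "\<And>t. t \<in> I \<Longrightarrow> ((\<lambda>r. \<beta> (\<gamma> r)) has_vector_derivative b' t) (at t)"
    "\<And>t. t \<in> I \<Longrightarrow> (b' has_vector_derivative b'' t) (at t)"
    "\<And>t. t \<in> I \<Longrightarrow> null_geodesic_eq (\<gamma> t) (a'' t) (b'' t)"
    "\<And>t. t \<in> I \<Longrightarrow> \<exists>c\<in>A. \<exists>w :: real^2. \<gamma> t \<in> fst c \<and>
       a' t = w $ 1 *\<^sub>R partial 1 (in_chart c \<alpha>) (snd c (\<gamma> t)) + w $ 2 *\<^sub>R partial 2 (in_chart c \<alpha>) (snd c (\<gamma> t)) \<and>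
       b' t = w $ 1 *\<^sub>R partial 1 (in_chart c \<beta>) (snd c (\<gamma> t)) + w $ 2 *\<^sub>R partial 2 (in_chart c \<beta>) (snd c (\<gamma> t))"
proof -
  \<comment> \<open>The definition of a geodesic supplies separate derivatives in every chart.
    Taking derivatives of \<alpha> and \<beta> along the curve gives functions that do not depend on
    the chart.\<close>
  define a' where "a' t = vector_derivative (\<lambda>r. \<alpha> (\<gamma> r)) (at t)" for t
  define b' where "b' t = vector_derivative (\<lambda>r. \<beta> (\<gamma> r)) (at t)" for t
  define a'' where "a'' t = vector_derivative a' (at t)" for t
  define b'' where "b'' t = vector_derivative b' (at t)" for t
  have cont: "continuous_map (top_of_set I) X \<gamma>" using assms(1) by (simp add: geodesic_on_def)
  have gX: "\<gamma> t \<in> topspace X" if "t \<in> I" for t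
    using continuous_map_funspace[OF cont] that by auto
  have chart: "((\<lambda>r. \<alpha> (\<gamma> r)) has_vector_derivative a' t) (at t) \<and> (a' has_vector_derivative a'' t) (at t) \<and>
      ((\<lambda>r. \<beta> (\<gamma> r)) has_vector_derivative b' t) (at t) \<and> (b' has_vector_derivative b'' t) (at t) \<and>
      (\<forall>l. det2 (a'' t) (partial l (in_chart c \<beta>) (snd c (\<gamma> t))) + det2 (partial l (in_chart c \<alpha>) (snd c (\<gamma> t))) (b'' t) = 0) \<and>
      (\<exists>w :: real^2. a' t = w $ 1 *\<^sub>R partial 1 (in_chart c \<alpha>) (snd c (\<gamma> t)) + w $ 2 *\<^sub>R partial 2 (in_chart c \<alpha>) (snd c (\<gamma> t)) \<and>
       b' t = w $ 1 *\<^sub>R partial 1 (in_chart c \<beta>) (snd c (\<gamma> t)) + w $ 2 *\<^sub>R partial 2 (in_chart c \<beta>) (snd c (\<gamma> t)))"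
    if t: "t \<in> I" "\<gamma> t \<in> fst c" and c: "c \<in> A" for t c
  proof -
    have "\<forall>(U, \<phi>)\<in>A. \<exists>x' x''. \<forall>t\<in>I. \<gamma> t \<in> U \<longrightarrow>
        ((\<lambda>r. \<phi> (\<gamma> r)) has_vector_derivative x' t) (at t) \<and>
        (x' has_vector_derivative x'' t) (at t) \<and>
        (\<forall>k. x'' t $ k +
           (\<Sum>i\<in>UNIV. \<Sum>j\<in>UNIV. christoffel (g (U, \<phi>)) k i j (\<phi> (\<gamma> t)) * x' t $ i * x' t $ j) = 0)"
      using assms(1) unfolding geodesic_on_def by (rule conjunct2)
    from bspec[OF this c] obtain x' x'' where xx: "\<forall>t\<in>I. \<gamma> t \<in> fst c \<longrightarrow>
        ((\<lambda>r. snd c (\<gamma> r)) has_vector_derivative x' t) (at t) \<and>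
        (x' has_vector_derivative x'' t) (at t) \<and>
        (\<forall>k. x'' t $ k +
           (\<Sum>i\<in>UNIV. \<Sum>j\<in>UNIV. christoffel (g c) k i j (snd c (\<gamma> t)) * x' t $ i * x' t $ j) = 0)"
      by (cases c) auto
    have x: "((\<lambda>r. snd c (\<gamma> r)) has_vector_derivative x' t) (at t)" "(x' has_vector_derivative x'' t) (at t)"
      "\<forall>k. x'' t $ k + (\<Sum>i\<in>UNIV. \<Sum>j\<in>UNIV. christoffel (g c) k i j (snd c (\<gamma> t)) * x' t $ i * x' t $ j) = 0"
      if "t \<in> I" "\<gamma> t \<in> fst c" for t
      using bspec[OF xx that(1)] that(2) by blast+
    have curve: "\<forall>t\<in>I. \<gamma> t \<in> fst c \<longrightarrow>
      ((\<lambda>r. snd c (\<gamma> r)) has_vector_derivative x' t) (at t) \<and> (x' has_vector_derivative x'' t) (at t)"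
      using x(1,2) by blast
    note A = function_along_curve[OF assms(2) cont c smooth_\<alpha> curve t, folded a'_def]
    note B = function_along_curve[OF assms(2) cont c smooth_\<beta> curve t, folded b'_def]
    have a'': "a'' t = acceleration (in_chart c \<alpha>) (snd c (\<gamma> t)) (x' t) (x'' t)"
      unfolding a''_def by (rule vector_derivative_at[OF A(3)])
    have b'': "b'' t = acceleration (in_chart c \<beta>) (snd c (\<gamma> t)) (x' t) (x'' t)"
      unfolding b''_def by (rule vector_derivative_at[OF B(3)])
    have "\<forall>l. det2 (acceleration (in_chart c \<alpha>) (snd c (\<gamma> t)) (x' t) (x'' t)) (partial l (in_chart c \<beta>) (snd c (\<gamma> t)))
        + det2 (partial l (in_chart c \<alpha>) (snd c (\<gamma> t))) (acceleration (in_chart c \<beta>) (snd c (\<gamma> t)) (x' t) (x'' t)) = 0"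
      using chart_pair.geodesic_equation_iff[OF pair[OF c] chart_imageI[OF t(2)], of "x'' t" "x' t"] x(3)[OF t]
      by (rule iffD1)
    then show ?thesis
      unfolding a'' b'' by (intro conjI exI[of _ "x' t"] A B)
  qed
  show ?thesis
  proof (rule that[of a' a'' b' b''])
    fix t assume t: "t \<in> I"
    obtain c where c: "c \<in> A" "\<gamma> t \<in> fst c" using chart_cover[OF gX[OF t]] by blast
    note * = chart[OF t c(2,1)]
    show "((\<lambda>r. \<alpha> (\<gamma> r)) has_vector_derivative a' t) (at t)" "(a' has_vector_derivative a'' t) (at t)"
      "((\<lambda>r. \<beta> (\<gamma> r)) has_vector_derivative b' t) (at t)" "(b' has_vector_derivative b'' t) (at t)"
      using * by blast+
    show "null_geodesic_eq (\<gamma> t) (a'' t) (b'' t)"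
      unfolding null_geodesic_eq_def using chart[OF t] by blast
    show "\<exists>c\<in>A. \<exists>w :: real^2. \<gamma> t \<in> fst c \<and>
       a' t = w $ 1 *\<^sub>R partial 1 (in_chart c \<alpha>) (snd c (\<gamma> t)) + w $ 2 *\<^sub>R partial 2 (in_chart c \<alpha>) (snd c (\<gamma> t)) \<and>
       b' t = w $ 1 *\<^sub>R partial 1 (in_chart c \<beta>) (snd c (\<gamma> t)) + w $ 2 *\<^sub>R partial 2 (in_chart c \<beta>) (snd c (\<gamma> t))"
      using * c by blast
  qed
qed

lemma smooth_on_real_vector_derivative:
  fixes x :: "real \<Rightarrow> 'b::euclidean_space"
  assumes "open J" "smooth_on J x"
  obtains x' where "smooth_on J x'" "\<And>t. t \<in> J \<Longrightarrow> (x has_vector_derivative x' t) (at t)"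
proof (rule that[of "\<lambda>t. frechet_derivative x (at t) 1"])
  show "smooth_on J (\<lambda>t. frechet_derivative x (at t) 1)"
    by (rule smooth_on_frechet_derivative[OF assms(2,1)])
  show "(x has_vector_derivative frechet_derivative x (at t) 1) (at t)" if "t \<in> J" for t
  proof -
    have d: "(x has_derivative frechet_derivative x (at t)) (at t)" by (rule smooth_on_has_derivative[OF assms(2) that])
    have "frechet_derivative x (at t) h = h *\<^sub>R frechet_derivative x (at t) 1" for h
      using linear_cmul[OF has_derivative_linear[OF d], of h 1] by simp
    then show ?thesis using d unfolding has_vector_derivative_def by (metis (no_types, lifting) ext)
  qed
qed

text \<open>Smoothness in charts supplies the coordinate derivatives that \<open>geodesic_on\<close>
  asks for; the equation itself is checked on \<alpha> and \<beta> alone.\<close>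

lemma geodesicI:
  assumes I: "open I" "continuous_map (top_of_set I) X \<gamma>"
    and sm: "\<And>c. c \<in> A \<Longrightarrow> smooth_on {t \<in> I. \<gamma> t \<in> fst c} (\<lambda>t. snd c (\<gamma> t))"
    and a: "\<And>t. t \<in> I \<Longrightarrow> ((\<lambda>r. \<alpha> (\<gamma> r)) has_vector_derivative a' t) (at t)"
      "\<And>t. t \<in> I \<Longrightarrow> (a' has_vector_derivative a'' t) (at t)"
    and b: "\<And>t. t \<in> I \<Longrightarrow> ((\<lambda>r. \<beta> (\<gamma> r)) has_vector_derivative b' t) (at t)"
      "\<And>t. t \<in> I \<Longrightarrow> (b' has_vector_derivative b'' t) (at t)"
    and eq: "\<And>t. t \<in> I \<Longrightarrow> null_geodesic_eq (\<gamma> t) (a'' t) (b'' t)"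
  shows "geodesic_on X A g I \<gamma>"
proof -
  have "\<exists>x' x''. \<forall>t\<in>I. \<gamma> t \<in> fst c \<longrightarrow>
        ((\<lambda>r. snd c (\<gamma> r)) has_vector_derivative x' t) (at t) \<and>
        (x' has_vector_derivative x'' t) (at t) \<and>
        (\<forall>k. x'' t $ k +
           (\<Sum>i\<in>UNIV. \<Sum>j\<in>UNIV. christoffel (g c) k i j (snd c (\<gamma> t)) * x' t $ i * x' t $ j) = 0)"
    if c: "c \<in> A" for c
  proof -
    define J where "J = {t \<in> I. \<gamma> t \<in> fst c}"
    have J: "open J" unfolding J_def by (rule chart_times_open[OF I c])
    have smJ: "smooth_on J (\<lambda>t. snd c (\<gamma> t))" unfolding J_def by (rule sm[OF c])
    obtain x' where x': "smooth_on J x'" "\<And>t. t \<in> J \<Longrightarrow> ((\<lambda>t. snd c (\<gamma> t)) has_vector_derivative x' t) (at t)"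
      by (rule smooth_on_real_vector_derivative[OF J smJ]) blast
    obtain x'' where x'': "smooth_on J x''" "\<And>t. t \<in> J \<Longrightarrow> (x' has_vector_derivative x'' t) (at t)"
      by (rule smooth_on_real_vector_derivative[OF J x'(1)]) blast
    have x: "((\<lambda>r. snd c (\<gamma> r)) has_vector_derivative x' t) (at t)" "(x' has_vector_derivative x'' t) (at t)"
      if "t \<in> I" "\<gamma> t \<in> fst c" for t
      using x'(2) x''(2) that by (auto simp: J_def)
    have curve: "\<forall>t\<in>I. \<gamma> t \<in> fst c \<longrightarrow>
      ((\<lambda>r. snd c (\<gamma> r)) has_vector_derivative x' t) (at t) \<and> (x' has_vector_derivative x'' t) (at t)"
      using x by blast
    have "\<forall>k. x'' t $ k + (\<Sum>i\<in>UNIV. \<Sum>j\<in>UNIV. christoffel (g c) k i j (snd c (\<gamma> t)) * x' t $ i * x' t $ j) = 0"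
      if t: "t \<in> I" "\<gamma> t \<in> fst c" for t
    proof -
      have tJ: "t \<in> J" using t by (simp add: J_def)
      have JI: "J \<subseteq> I" by (auto simp: J_def)
      have "(a' has_vector_derivative acceleration (in_chart c \<alpha>) (snd c (\<gamma> t)) (x' t) (x'' t)) (at t)"
        by (rule has_vector_derivative_transform_within_open[OF function_along_curve(3)[OF I c smooth_\<alpha> curve t] J tJ])
          (use a(1) JI in \<open>auto intro!: vector_derivative_at\<close>)
      then have a'': "acceleration (in_chart c \<alpha>) (snd c (\<gamma> t)) (x' t) (x'' t) = a'' t"
        using vector_derivative_unique_at[OF _ a(2)[OF t(1)]] by blast
      have "(b' has_vector_derivative acceleration (in_chart c \<beta>) (snd c (\<gamma> t)) (x' t) (x'' t)) (at t)"
        by (rule has_vector_derivative_transform_within_open[OF function_along_curve(3)[OF I c smooth_\<beta> curve t] J tJ])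
          (use b(1) JI in \<open>auto intro!: vector_derivative_at\<close>)
      then have b'': "acceleration (in_chart c \<beta>) (snd c (\<gamma> t)) (x' t) (x'' t) = b'' t"
        using vector_derivative_unique_at[OF _ b(2)[OF t(1)]] by blast
      show ?thesis
        unfolding chart_pair.geodesic_equation_iff[OF pair[OF c] chart_imageI[OF t(2)]] a'' b''
        using eq[OF t(1)] c t(2) by (simp add: null_geodesic_eq_def)
    qed
    note geq = this
    show ?thesis
      by (intro exI[of _ x'] exI[of _ x''] ballI impI conjI) (rule x geq; assumption)+
  qed
  then show ?thesis
    unfolding geodesic_on_def using I(2) by (auto split: prod.splits)
qed

end

subsection \<open>Flatness\<close>

lemma partial_sum_products_eq:
  fixes p q r s t :: "real^2 \<Rightarrow> real"
  assumes "open S" "u \<in> S" "smooth_on S p" "smooth_on S q" "smooth_on S r" "smooth_on S s"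
    "\<And>x. x \<in> S \<Longrightarrow> p x * q x + r x * s x = t x"
  shows "p u * partial i q u + partial i p u * q u + (r u * partial i s u + partial i r u * s u) = partial i t u"
proof -
  have "partial i t u = partial i (\<lambda>x. p x * q x + r x * s x) u"
    by (rule partial_cong[OF assms(1,2)]) (simp add: assms(7))
  also have "\<dots> = partial i (\<lambda>x. p x * q x) u + partial i (\<lambda>x. r x * s x) u"
    by (rule partial_add[OF smooth_on_mult[OF assms(3,4)] smooth_on_mult[OF assms(5,6)] assms(2)])
  finally show ?thesis
    by (simp add: partial_mult[OF assms(3,4,2)] partial_mult[OF assms(5,6,2)])
qed

context chart_pair
begin

text \<open>Obtained by solving the lowered equations with Cramer's rule. It makes the curvature
  continuous, so that its vanishing passes to limit points.\<close>

lemma smooth_on_christoffel: "smooth_on S (christoffel G k i j)"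
proof -
  define L where "L l x = - (det2 (partial i (partial j a) x) (partial l b x) + det2 (partial l a x) (partial i (partial j b) x))" for l x
  define H where "H i j x = - (det2 (partial i a x) (partial j b x) + det2 (partial j a x) (partial i b x))" for i j x
  define D where "D x = det2 (partial 1 a x) (partial 2 b x) - det2 (partial 2 a x) (partial 1 b x)" for x
  \<comment> \<open>The two numerators of Cramer's rule for the lowered symbols \<open>L\<close>;
    the denominator \<open>- (D x * D x)\<close> is the determinant of the metric.\<close>
  define N where "N x = (if k = 1 then L 1 x * H 2 2 x - L 2 x * H 1 2 x else L 2 x * H 1 1 x - L 1 x * H 2 1 x)" for x
  have sm: "smooth_on S (L l)" "smooth_on S (H i' j')" "smooth_on S D" for l i' j'
    unfolding L_def H_def D_def
    by (intro smooth_on_minus smooth_on_add smooth_on_diff smooth_on_det2 smooth_on_partial smooth_a smooth_b open_S)+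
  have Dnz: "D x \<noteq> 0" if "x \<in> S" for x using regular[OF that] by (simp add: D_def)
  have sm1: "smooth_on S (\<lambda>x. N x / - (D x * D x))"
    unfolding N_def using Dnz
    by (cases "k = 1") (auto intro!: smooth_on_divide smooth_on_minus smooth_on_diff smooth_on_mult sm open_S)
  have eq1: "N x / - (D x * D x) = christoffel G k i j x" if x: "x \<in> S" for x
  proof -
    have e: "H l 1 x * christoffel G 1 i j x + H l 2 x * christoffel G 2 i j x = L l x" for l
      using christoffel_pair[OF x, of l i j] unfolding metric[OF x] by (simp only: L_def H_def)
    have "H 1 1 x * H 2 2 x - H 1 2 x * H 2 1 x = - (D x * D x)"
      using det_metric[OF x] unfolding det_2 metric[OF x] by (simp only: H_def D_def power2_eq_square)
    then have "- (D x * D x) * christoffel G k i j x = (H 1 1 x * H 2 2 x - H 1 2 x * H 2 1 x) * christoffel G k i j x"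
      by simp
    also have "\<dots> = N x"
      using exhaust_2[of k] unfolding N_def e[symmetric] by (auto simp: algebra_simps)
    finally have e2: "- (D x * D x) * christoffel G k i j x = N x" .
    show ?thesis unfolding e2[symmetric] using Dnz[OF x] by simp
  qed
  show ?thesis by (rule smooth_on_cong[OF open_S eq1 sm1])
qed

lemma continuous_on_riemann: "continuous_on S (riemann G l k i j)"
proof -
  have "smooth_on S (\<lambda>u. partial i (christoffel G l j k) u - partial j (christoffel G l i k) u +
     (\<Sum>m\<in>UNIV. christoffel G l i m u * christoffel G m j k u
              - christoffel G l j m u * christoffel G m i k u))"
    by (intro smooth_on_add smooth_on_diff smooth_on_sum smooth_on_mult smooth_on_partial smooth_on_christoffel open_S finite)
  from smooth_on_imp_continuous_on[OF this] show ?thesis unfolding riemann_def[abs_def] .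
qed

text \<open>If \<open>\<alpha>\<close> moves in a line, the metric is \<open>- 2 da db\<close> for two functions \<open>a, b\<close> that serve as
  affine coordinates of the Levi-Civita connection.\<close>
lemma riemann_zero_if_parallel:
  assumes "m \<noteq> 0" "\<And>x i. x \<in> S \<Longrightarrow> det2 m (partial i a x) = 0" "u \<in> S"
  shows "riemann G l k i j u = 0"
proof -
  define f where "f x = (a x \<bullet> m) / (m \<bullet> m)" for x
  define h where "h x = det2 m (b x)" for x
  have mm: "m \<bullet> m \<noteq> 0" using assms(1) by simp
  have smf: "smooth_on S f"
    unfolding f_def divide_inverse
    by (intro smooth_on_mult smooth_on_const smooth_on_bounded_linear[OF bounded_linear_inner_left] smooth_a)
  have smh: "smooth_on S h" unfolding h_def by (intro smooth_on_det2 smooth_on_const smooth_b)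
  have pf: "partial i f x = (partial i a x \<bullet> m) / (m \<bullet> m)" if "x \<in> S" for x i
  proof -
    have "bounded_linear (\<lambda>y. (y \<bullet> m) / (m \<bullet> m))"
      unfolding divide_inverse by (intro bounded_linear_mult_const bounded_linear_inner_left)
    from partial_linear[OF this smooth_a that] show ?thesis unfolding f_def[abs_def] .
  qed
  have am: "partial i a x = partial i f x *\<^sub>R m" if "x \<in> S" for x i
  proof -
    have "det2 (partial i a x) m = 0" using assms(2)[OF that] det2_commute[of "partial i a x" m] by simp
    then obtain r where "partial i a x = r *\<^sub>R m" using det2_eq_0_iff_parallel[OF assms(1)] by blast
    then show ?thesis using mm by (simp add: pf[OF that])
  qed
  have ph: "partial i h x = det2 m (partial i b x)" if "x \<in> S" for x i
    unfolding h_def using partial_linear[OF bounded_bilinear.bounded_linear_right[OF bounded_bilinear_det2] smooth_b that] .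
  define W where "W x = partial 1 f x * partial 2 h x - partial 2 f x * partial 1 h x" for x
  have W: "W x \<noteq> 0" if "x \<in> S" for x
    using regular[OF that] by (simp add: W_def am[OF that] ph[OF that])
  have a2: "det2 (partial i (partial j a) x) (partial l b x) = partial i (partial j f) x * partial l h x"
    if "x \<in> S" for x i j l
  proof -
    have "partial i (partial j a) x = partial i (\<lambda>x. partial j f x *\<^sub>R m) x"
      by (rule partial_cong[OF open_S that am])
    also have "\<dots> = partial i (partial j f) x *\<^sub>R m"
      by (rule partial_linear[OF bounded_linear_scaleR_left smooth_on_partial[OF smf open_S] that])
    finally show ?thesis by (simp add: ph[OF that])
  qed
  have b2: "det2 (partial l a x) (partial i (partial j b) x) = partial l f x * partial i (partial j h) x"
    if "x \<in> S" for x i j l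
  proof -
    have "partial i (partial j h) x = partial i (\<lambda>x. det2 m (partial j b x)) x"
      by (rule partial_cong[OF open_S that ph])
    also have "\<dots> = det2 m (partial i (partial j b) x)"
      by (rule partial_linear[OF bounded_bilinear.bounded_linear_right[OF bounded_bilinear_det2] smooth_on_partial[OF smooth_b open_S] that])
    finally show ?thesis by (simp add: am[OF that])
  qed
  let ?\<Gamma> = "christoffel G"
  \<comment> \<open>The covariant Hessians of \<open>f\<close> and \<open>h\<close> vanish. With
    \<open>P\<close> and \<open>Q\<close> as the two defects, the lowered formula reads
    \<open>partial l f x * Q + partial l h x * P = 0\<close> for both indices \<open>l\<close>, and
    the differentials of \<open>f\<close> and \<open>h\<close> are independent.\<close>
  have both: "partial 1 f x * ?\<Gamma> 1 i j x + partial 2 f x * ?\<Gamma> 2 i j x = partial i (partial j f) x \<and>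
    partial 1 h x * ?\<Gamma> 1 i j x + partial 2 h x * ?\<Gamma> 2 i j x = partial i (partial j h) x" if x: "x \<in> S" for x i j
  proof -
    define P where "P = partial 1 f x * ?\<Gamma> 1 i j x + partial 2 f x * ?\<Gamma> 2 i j x - partial i (partial j f) x"
    define Q where "Q = partial 1 h x * ?\<Gamma> 1 i j x + partial 2 h x * ?\<Gamma> 2 i j x - partial i (partial j h) x"
    have q: "partial l f x * Q + partial l h x * P = 0" for l
      using christoffel_pair[OF x, of l i j] unfolding metric[OF x] a2[OF x] b2[OF x]
      by (simp add: P_def Q_def am[OF x] ph[OF x] algebra_simps)
    have w: "W x * Q = (partial 1 f x * Q + partial 1 h x * P) * partial 2 h x - (partial 2 f x * Q + partial 2 h x * P) * partial 1 h x"
      "W x * P = (partial 2 f x * Q + partial 2 h x * P) * partial 1 f x - (partial 1 f x * Q + partial 1 h x * P) * partial 2 f x"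
      by (simp_all add: W_def algebra_simps)
    have "W x * Q = 0" "W x * P = 0" unfolding w q by simp_all
    then have "P = 0 \<and> Q = 0" using W[OF x] by simp
    then show ?thesis by (simp add: P_def Q_def)
  qed
  \<comment> \<open>The Ricci identity: if the covariant Hessian of \<open>F\<close> vanishes,
    commuting third derivatives shows that the differential of \<open>F\<close> annihilates the
    curvature. Two functions with independent differentials then leave no curvature.\<close>
  have key: "partial 1 F u * riemann G 1 k i j u + partial 2 F u * riemann G 2 k i j u = 0"
    if smF: "smooth_on S F"
      and F: "\<And>x i j. x \<in> S \<Longrightarrow> partial 1 F x * ?\<Gamma> 1 i j x + partial 2 F x * ?\<Gamma> 2 i j x = partial i (partial j F) x"
    for F :: "real^2 \<Rightarrow> real"
  proof -
    have d: "partial 1 F u * partial i (?\<Gamma> 1 j k) u + partial i (partial 1 F) u * ?\<Gamma> 1 j k u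
      + (partial 2 F u * partial i (?\<Gamma> 2 j k) u + partial i (partial 2 F) u * ?\<Gamma> 2 j k u) = partial i (partial j (partial k F)) u" for i j
      by (rule partial_sum_products_eq[OF open_S assms(3)])
        (intro smooth_on_partial smF open_S smooth_on_christoffel F; assumption?)+
    have c: "partial i (partial j (partial k F)) u = partial j (partial i (partial k F)) u"
      by (rule partial_commute[OF open_S smooth_on_partial[OF smF open_S] assms(3)])
    have e: "partial 1 F u * riemann G 1 k i j u + partial 2 F u * riemann G 2 k i j u =
      (partial 1 F u * partial i (?\<Gamma> 1 j k) u + partial 2 F u * partial i (?\<Gamma> 2 j k) u)
      - (partial 1 F u * partial j (?\<Gamma> 1 i k) u + partial 2 F u * partial j (?\<Gamma> 2 i k) u)
      + ((partial 1 F u * ?\<Gamma> 1 i 1 u + partial 2 F u * ?\<Gamma> 2 i 1 u) * ?\<Gamma> 1 j k u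
       + (partial 1 F u * ?\<Gamma> 1 i 2 u + partial 2 F u * ?\<Gamma> 2 i 2 u) * ?\<Gamma> 2 j k u)
      - ((partial 1 F u * ?\<Gamma> 1 j 1 u + partial 2 F u * ?\<Gamma> 2 j 1 u) * ?\<Gamma> 1 i k u
       + (partial 1 F u * ?\<Gamma> 1 j 2 u + partial 2 F u * ?\<Gamma> 2 j 2 u) * ?\<Gamma> 2 i k u)"
      by (simp add: riemann_def sum_2 algebra_simps)
    show ?thesis
      unfolding e F[OF assms(3)] using d[of i j] d[of j i] c by (simp add: algebra_simps)
  qed
  have r: "partial 1 f u * riemann G 1 k i j u + partial 2 f u * riemann G 2 k i j u = 0"
    "partial 1 h u * riemann G 1 k i j u + partial 2 h u * riemann G 2 k i j u = 0"
    by (rule key[OF smf], use both in blast, rule key[OF smh], use both in blast)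
  have "W u * riemann G 1 k i j u = (partial 1 f u * riemann G 1 k i j u + partial 2 f u * riemann G 2 k i j u) * partial 2 h u
      - (partial 1 h u * riemann G 1 k i j u + partial 2 h u * riemann G 2 k i j u) * partial 2 f u"
    "W u * riemann G 2 k i j u = (partial 1 h u * riemann G 1 k i j u + partial 2 h u * riemann G 2 k i j u) * partial 1 f u
      - (partial 1 f u * riemann G 1 k i j u + partial 2 f u * riemann G 2 k i j u) * partial 1 h u"
    by (simp_all add: W_def algebra_simps)
  then have "riemann G 1 k i j u = 0" "riemann G 2 k i j u = 0"
    unfolding r using W[OF assms(3)] by auto
  then show ?thesis using exhaust_2[of l] by auto
qed

lemma subset: "open S' \<Longrightarrow> S' \<subseteq> S \<Longrightarrow> chart_pair S' a b G"
  using smooth_on_subset[OF smooth_a] smooth_on_subset[OF smooth_b] rank_a rank_b regular metric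
  by (intro chart_pair.intro) auto

end

section \<open>Affine vector fields with trace zero\<close>

text \<open>The theorem of Cayley and Hamilton for trace zero.\<close>

lemma traceless_square:
  fixes B :: "real^2^2"
  assumes "B $ 1 $ 1 + B $ 2 $ 2 = 0"
  shows "B *v (B *v x) = - det B *\<^sub>R x"
proof -
  have "B $ 2 $ 2 = - B $ 1 $ 1" using assms by simp
  then show ?thesis
    by (simp add: vec_eq_iff forall_2 matrix_vector_mult_def sum_2 det_2 algebra_simps)
qed

text \<open>Trace zero says that the linear flow of \<open>B\<close> preserves the area form
  \<open>det2\<close>; this is the infinitesimal version.\<close>

lemma traceless_skew:
  fixes B :: "real^2^2"
  assumes "B $ 1 $ 1 + B $ 2 $ 2 = 0"
  shows "det2 (B *v x) y = - det2 x (B *v y)"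
proof -
  have "B $ 2 $ 2 = - B $ 1 $ 1" using assms by simp
  then show ?thesis
    by (simp add: det2_def matrix_vector_mult_def sum_2 algebra_simps)
qed

text \<open>The planar part of the surface and its conormal are moved with the same linear part
  \<open>B\<close>, hence so are their half sum \<alpha> and half difference \<beta>; only the
  translation parts differ.\<close>

locale helical_pair = null_pair X A \<alpha> \<beta> g
  for X :: "'p topology" and A and \<alpha> \<beta> :: "'p \<Rightarrow> real^2" and g :: "'p metric" +
  fixes B :: "real^2^2" and b1 b2 :: "real^2"
  assumes traceless: "B $ 1 $ 1 + B $ 2 $ 2 = 0"
    and tangent_\<alpha>: "\<And>c u i. c \<in> A \<Longrightarrow> u \<in> chart_image c \<Longrightarrow>
      det2 (B *v in_chart c \<alpha> u + b1) (partial i (in_chart c \<alpha>) u) = 0"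
    and tangent_\<beta>: "\<And>c u i. c \<in> A \<Longrightarrow> u \<in> chart_image c \<Longrightarrow>
      det2 (B *v in_chart c \<beta> u + b2) (partial i (in_chart c \<beta>) u) = 0"
begin

definition E1 :: "'p \<Rightarrow> real^2" where "E1 p = B *v \<alpha> p + b1"
definition E2 :: "'p \<Rightarrow> real^2" where "E2 p = B *v \<beta> p + b2"

lemma in_chart_E1: "in_chart c E1 u = B *v in_chart c \<alpha> u + b1"
  and in_chart_E2: "in_chart c E2 u = B *v in_chart c \<beta> u + b2"
  by (simp_all add: in_chart_def E1_def E2_def)

lemma chart_smooth:
  assumes "c \<in> A"
  shows "smooth_on (chart_image c) (in_chart c \<alpha>)" "smooth_on (chart_image c) (in_chart c \<beta>)"
    "open (chart_image c)"
  using assms smooth_\<alpha> smooth_\<beta> chart_homeomorphic(2) by (auto simp: smooth_fun_def)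

lemma smooth_fun_E1: "smooth_fun A E1"
  unfolding smooth_fun_def
proof
  fix c assume "c \<in> A"
  have "smooth_on (chart_image c) (\<lambda>u. B *v in_chart c \<alpha> u + b1)"
    by (intro smooth_on_add smooth_on_const smooth_on_matrix_vector_mult chart_smooth[OF \<open>c \<in> A\<close>])
  then show "smooth_on (chart_image c) (in_chart c E1)" by (simp add: in_chart_E1[abs_def])
qed

lemma partial_E1:
  assumes "c \<in> A" "u \<in> chart_image c"
  shows "partial i (in_chart c E1) u = B *v partial i (in_chart c \<alpha>) u"
proof -
  note sm = smooth_on_matrix_vector_mult[OF chart_smooth(1)[OF assms(1)], of B]
  have "partial i (\<lambda>u. B *v in_chart c \<alpha> u + b1) u = partial i (\<lambda>u. B *v in_chart c \<alpha> u) u + partial i (\<lambda>u. b1) u"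
    by (rule partial_add[OF sm smooth_on_const assms(2)])
  then show ?thesis
    by (simp add: in_chart_E1[abs_def] partial_const partial_matrix_vector_mult[OF chart_smooth(1)[OF assms(1)] assms(2)])
qed

text \<open>On an orbit of the affine field this is the determinant of velocity and acceleration. It
  is constant along the orbit, and it vanishes iff the orbit is straight or a point.\<close>

definition curv1 :: "'p \<Rightarrow> real" where "curv1 p = det2 (E1 p) (B *v E1 p)"
definition curv2 :: "'p \<Rightarrow> real" where "curv2 p = det2 (E2 p) (B *v E2 p)"

text \<open>Differentials of \<alpha> are parallel to \<open>E1\<close>, and along \<open>E1\<close>
  the derivative is \<open>det2 (B E1) (B E1) + det2 E1 (B (B E1))\<close>, where \<open>B\<close>
  squared is a multiple of the identity.\<close>

lemma curv1_constant:
  assumes "p \<in> topspace X" "q \<in> topspace X"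
  shows "curv1 q = curv1 p"
proof (rule constant_if_partial_zero[OF _ _ assms])
  have e: "in_chart c curv1 = (\<lambda>u. det2 (in_chart c E1 u) (B *v in_chart c E1 u))" for c
    by (simp add: in_chart_def curv1_def fun_eq_iff)
  have sm: "smooth_on (chart_image c) (in_chart c E1)" "smooth_on (chart_image c) (\<lambda>u. B *v in_chart c E1 u)" if "c \<in> A" for c
    using smooth_fun_E1 that by (auto simp: smooth_fun_def intro: smooth_on_matrix_vector_mult)
  show "smooth_fun A curv1"
    unfolding smooth_fun_def e using sm by (auto intro!: smooth_on_det2)
  fix c u i assume c: "c \<in> A" and u: "u \<in> chart_image c"
  have "det2 (in_chart c E1 u) (partial i (in_chart c \<alpha>) u) = 0"
    using tangent_\<alpha>[OF c u] by (simp add: in_chart_E1)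
  then show "partial i (in_chart c curv1) u = 0"
    unfolding e partial_det2[OF sm[OF c] u] partial_matrix_vector_mult[OF sm(1)[OF c] u] partial_E1[OF c u]
    using traceless_square[OF traceless] traceless_skew[OF traceless, of "partial i (in_chart c \<alpha>) u" "B *v in_chart c E1 u"]
      det2_commute[of "partial i (in_chart c \<alpha>) u" "in_chart c E1 u"] by simp
qed

text \<open>Near a point with \<open>E1\<close> nonzero the direction of \<open>E1\<close> is
  constant, so \<alpha> moves in a line. If \<open>E1\<close> vanishes on an open set, then
  \<open>B\<close> is nonzero and annihilates the differential of \<alpha>, which again confines
  \<alpha> to a line. Every other point is a limit of points of the first kind, and the curvature is
  continuous.\<close>

lemma flat_if_curv1_zero:
  assumes zero: "\<And>p. p \<in> topspace X \<Longrightarrow> curv1 p = 0" and nontrivial: "B \<noteq> 0 \<or> b1 \<noteq> 0"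
  shows "flat_metric A g"
  unfolding flat_metric_def
proof (intro ballI allI)
  fix c u l k i j assume c: "c \<in> A" and u: "u \<in> chart_image c"
  interpret cp: chart_pair "chart_image c" "in_chart c \<alpha>" "in_chart c \<beta>" "g c" by (rule pair[OF c])
  let ?S = "chart_image c"
  let ?R = "riemann (g c) l k i j"
  define e where "e = in_chart c E1"
  have sme: "smooth_on ?S e" using smooth_fun_E1 c by (simp add: smooth_fun_def e_def)
  have conte: "continuous_on ?S e" by (rule smooth_on_imp_continuous_on[OF sme])
  have k0: "det2 (e x) (B *v e x) = 0" if "x \<in> ?S" for x
    using zero[of "chart_inv c x"] chart_inv_in[OF that] chart_subset[OF c]
    by (auto simp: curv1_def e_def in_chart_def)
  have tan: "det2 (e x) (partial i (in_chart c \<alpha>) x) = 0" if "x \<in> ?S" for x i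
    using tangent_\<alpha>[OF c that] by (simp add: e_def in_chart_E1)
  have at_nonzero: "?R x = 0" if x: "x \<in> ?S" "e x \<noteq> 0" for x
  proof -
    have "open {y \<in> ?S. e y \<noteq> 0}"
      using continuous_open_preimage[OF conte cp.open_S, of "- {0}"] by (simp add: vimage_def Int_def open_Compl)
    then obtain d where d: "d > 0" "ball x d \<subseteq> {y \<in> ?S. e y \<noteq> 0}"
      using x open_contains_ball by blast
    \<comment> \<open>The differential of \<open>E1\<close> is \<open>B\<close> applied to a
      multiple of \<open>E1\<close>, and \<open>B E1\<close> is parallel to \<open>E1\<close>
      because \<open>curv1\<close> vanishes. So along the segment from \<open>x\<close> to
      \<open>y\<close> the determinant solves a linear homogeneous equation and starts at
      zero.\<close>
    have fixed: "det2 (e x) (e y) = 0" if y: "y \<in> ball x d" for y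
    proof -
      define z where "z t = x + t *\<^sub>R (y - x)" for t :: real
      define I where "I = {t. z t \<in> ball x d}"
      have contz: "continuous_on UNIV z" unfolding z_def by (intro continuous_intros)
      have zI: "z t \<in> ?S" "e (z t) \<noteq> 0" if "t \<in> I" for t using d(2) that by (auto simp: I_def)
      have "convex I"
        unfolding convex_alt
      proof (intro ballI allI impI)
        fix s t r :: real assume st: "s \<in> I" "t \<in> I" "0 \<le> r \<and> r \<le> 1"
        have "z ((1 - r) *\<^sub>R s + r *\<^sub>R t) = (1 - r) *\<^sub>R z s + r *\<^sub>R z t"
          by (simp add: z_def algebra_simps)
        then show "(1 - r) *\<^sub>R s + r *\<^sub>R t \<in> I"
          using st convex_ball[of x d] unfolding I_def convex_alt by simp
      qed
      then have int: "is_interval I" by (simp add: is_interval_convex_1)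
      define w where "w = y - x"
      have dz: "(z has_vector_derivative w) (at t)" for t
        unfolding z_def w_def by (auto intro!: derivative_eq_intros)
      \<comment> \<open>The coefficient of that equation. The proportionality factors are written as
        quotients of inner products so that their continuity is evident.\<close>
      define \<kappa> where "\<kappa> t = (w $ 1 * ((partial 1 (in_chart c \<alpha>) (z t) \<bullet> e (z t)) / (e (z t) \<bullet> e (z t)))
          + w $ 2 * ((partial 2 (in_chart c \<alpha>) (z t) \<bullet> e (z t)) / (e (z t) \<bullet> e (z t))))
          * (((B *v e (z t)) \<bullet> e (z t)) / (e (z t) \<bullet> e (z t)))" for t
      have par: "v = ((v \<bullet> n) / (n \<bullet> n)) *\<^sub>R n" if n0: "n \<noteq> 0" and nv: "det2 n v = 0" for v n :: "real^2"
      proof -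
        have "det2 v n = 0" using nv det2_commute[of v n] by simp
        then obtain r where "v = r *\<^sub>R n" using det2_eq_0_iff_parallel[OF n0] by blast
        then show ?thesis using n0 by simp
      qed
      have der: "((\<lambda>t. det2 (e x) (e (z t))) has_vector_derivative \<kappa> t * det2 (e x) (e (z t))) (at t)" if t: "t \<in> I" for t
      proof -
        have "((\<lambda>t. e (z t)) has_vector_derivative (w $ 1 *\<^sub>R partial 1 e (z t) + w $ 2 *\<^sub>R partial 2 e (z t))) (at t)"
          by (rule curve_derivative[OF sme dz zI(1)[OF t]])
        then have "((\<lambda>t. det2 (e x) (e (z t))) has_vector_derivative
            det2 (e x) (w $ 1 *\<^sub>R partial 1 e (z t) + w $ 2 *\<^sub>R partial 2 e (z t))) (at t)"
          by (rule bounded_linear.has_vector_derivative[OF bounded_bilinear.bounded_linear_right[OF bounded_bilinear_det2]])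
        moreover have "det2 (e x) (partial i e (z t)) = ((partial i (in_chart c \<alpha>) (z t) \<bullet> e (z t)) / (e (z t) \<bullet> e (z t)))
            * (((B *v e (z t)) \<bullet> e (z t)) / (e (z t) \<bullet> e (z t))) * det2 (e x) (e (z t))" for i
        proof -
          define r where "r = (partial i (in_chart c \<alpha>) (z t) \<bullet> e (z t)) / (e (z t) \<bullet> e (z t))"
          define s where "s = ((B *v e (z t)) \<bullet> e (z t)) / (e (z t) \<bullet> e (z t))"
          have "partial i e (z t) = B *v partial i (in_chart c \<alpha>) (z t)"
            unfolding e_def by (rule partial_E1[OF c zI(1)[OF t]])
          also have "\<dots> = B *v (r *\<^sub>R e (z t))"
            using par[OF zI(2)[OF t] tan[OF zI(1)[OF t]], of i] by (simp add: r_def)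
          also have "\<dots> = r *\<^sub>R (B *v e (z t))" by (rule linear_cmul[OF matrix_vector_mul_linear])
          also have "\<dots> = r *\<^sub>R (s *\<^sub>R e (z t))"
            using par[OF zI(2)[OF t] k0[OF zI(1)[OF t]]] by (simp add: s_def)
          finally show ?thesis by (simp add: r_def s_def)
        qed
        ultimately show ?thesis by (simp add: \<kappa>_def algebra_simps)
      qed
      have cz: "continuous_on I (\<lambda>t. f (z t))" if "continuous_on ?S f" for f :: "real^2 \<Rightarrow> real^2"
        by (rule continuous_on_compose2[OF that continuous_on_subset[OF contz]]) (use zI in auto)
      have "continuous_on I \<kappa>"
        unfolding \<kappa>_def using zI
        by (intro continuous_on_mult continuous_on_add continuous_on_divide continuous_on_inner continuous_on_const
            cz conte bounded_linear.continuous_on[OF matrix_vector_mul_bounded_linear]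
            smooth_on_imp_continuous_on[OF smooth_on_partial[OF cp.smooth_a cp.open_S]]) auto
      then have "continuous_on I (\<lambda>t. \<bar>\<kappa> t\<bar>)" by (rule continuous_on_rabs)
      then have contL: "continuous_on I (\<lambda>t. \<bar>\<kappa> t\<bar>)" .
      have "det2 (e x) (e (z 1)) = 0"
      proof (rule gronwall_zero[of I 0 "\<lambda>t. det2 (e x) (e (z t))" 1 "\<lambda>t. \<kappa> t * det2 (e x) (e (z t))" "\<lambda>t. \<bar>\<kappa> t\<bar>"])
        show "0 \<in> I" "1 \<in> I" using y d(1) by (simp_all add: I_def z_def)
        show "det2 (e x) (e (z 0)) = 0" by (simp add: z_def)
        show "norm (\<kappa> t * det2 (e x) (e (z t))) \<le> \<bar>\<kappa> t\<bar> * norm (det2 (e x) (e (z t)))" for t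
          by (simp add: abs_mult)
      qed (rule int der contL; assumption?)+
      then show ?thesis by (simp add: z_def)
    qed
    have "det2 (e x) (partial i (in_chart c \<alpha>) y) = 0" if y: "y \<in> ball x d" for y i
    proof -
      have yS: "y \<in> ?S" "e y \<noteq> 0" using y d(2) by auto
      have "det2 (e y) (e x) = 0" using fixed[OF y] det2_commute[of "e y" "e x"] by simp
      then obtain r where r: "e y = r *\<^sub>R e x" using det2_eq_0_iff_parallel[OF x(2)] by blast
      then show ?thesis using tan[OF yS(1), of i] yS(2) by auto
    qed
    moreover have "chart_pair (ball x d) (in_chart c \<alpha>) (in_chart c \<beta>) (g c)"
      by (rule cp.subset) (use d(2) in auto)
    ultimately show ?thesis
      using chart_pair.riemann_zero_if_parallel[of "ball x d" "in_chart c \<alpha>" "in_chart c \<beta>" "g c" "e x" x] x(2) d(1) by simp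
  qed
  show "?R u = 0"
  proof (cases "\<exists>d>0. \<forall>y\<in>ball u d. y \<in> ?S \<longrightarrow> e y = 0")
    case True
    then obtain d where d: "d > 0" "\<forall>y\<in>ball u d. y \<in> ?S \<longrightarrow> e y = 0" by blast
    define N where "N = ball u d \<inter> ?S"
    have N: "open N" "N \<subseteq> ?S" "u \<in> N" unfolding N_def using cp.open_S d(1) u by auto
    have kerB: "B *v partial i (in_chart c \<alpha>) y = 0" if "y \<in> N" for y i
    proof -
      have "partial i e y = partial i (\<lambda>y. 0) y"
        by (rule partial_cong[OF N(1) that]) (use d(2) in \<open>auto simp: N_def\<close>)
      then show ?thesis using partial_E1[OF c, of y i] that N(2) by (auto simp: e_def partial_const)
    qed
    have "B \<noteq> 0"
    proof
      assume "B = 0"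
      then have "e u = b1" by (simp add: e_def in_chart_E1 matrix_vector_mult_def vec_eq_iff)
      then show False using d u nontrivial \<open>B = 0\<close> by auto
    qed
    then obtain r s where rs: "B $ r $ s \<noteq> 0" by (auto simp: vec_eq_iff)
    \<comment> \<open>The kernel direction of a nonzero row of \<open>B\<close>:
      \<open>det2 m x\<close> is the product of that row with \<open>x\<close>.\<close>
    define m where "m = (vector [B $ r $ 2, - B $ r $ 1] :: real^2)"
    have m0: "m \<noteq> 0" using rs exhaust_2[of s] by (auto simp: m_def vec_eq_iff forall_2)
    have "det2 m (partial i (in_chart c \<alpha>) y) = 0" if "y \<in> N" for y i
    proof -
      have "(B *v partial i (in_chart c \<alpha>) y) $ r = 0" using kerB[OF that] by simp
      then show ?thesis by (simp add: matrix_vector_mult_def sum_2 det2_def m_def)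
    qed
    then show ?thesis
      by (rule chart_pair.riemann_zero_if_parallel[OF cp.subset[OF N(1,2)] m0 _ N(3)])
  next
    case False
    have "?R u = 0" if "\<And>d. d > 0 \<Longrightarrow> \<exists>y\<in>ball u d. y \<in> ?S \<and> ?R y = 0"
    proof (rule ccontr)
      assume ne: "?R u \<noteq> 0"
      have "open {y \<in> ?S. ?R y \<noteq> 0}"
        using continuous_open_preimage[OF cp.continuous_on_riemann cp.open_S, of "- {0}"]
        by (simp add: vimage_def Int_def open_Compl)
      then obtain d where "d > 0" "ball u d \<subseteq> {y \<in> ?S. ?R y \<noteq> 0}"
        using ne u open_contains_ball by blast
      then show False using that[of d] by blast
    qed
    then show ?thesis using False at_nonzero by blast
  qed
qed

end

subsection \<open>Complete null geodesics\<close>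

text \<open>The reflection used to exchange the roles of \<alpha> and \<beta>, so that everything
  about null lines is proved for one family only.\<close>

definition swap :: "real^2^2" where
  "swap = (\<chi> i j. if i = j then 0 else 1)"

lemma swap_mult: "(swap *v x) $ 1 = x $ 2" "(swap *v x) $ 2 = x $ 1"
  by (simp_all add: swap_def matrix_vector_mult_def sum_2)

lemma swap_swap: "swap *v (swap *v x) = x"
  by (simp add: vec_eq_iff forall_2 swap_mult)

lemma det2_swap: "det2 (swap *v x) (swap *v y) = - det2 x y"
  by (simp add: det2_def swap_mult)

lemma in_chart_matrix: "in_chart c (\<lambda>p. M *v f p) = (\<lambda>u. M *v in_chart c f u)"
  by (simp add: in_chart_def o_def)

lemma smooth_fun_matrix: "smooth_fun A f \<Longrightarrow> smooth_fun A (\<lambda>p. (M::real^'n^'m) *v f p)"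
  unfolding smooth_fun_def in_chart_matrix by (simp add: smooth_on_matrix_vector_mult)

context helical_pair
begin

text \<open>A reflection changes the sign of \<open>det2\<close>, and so does exchanging its arguments.\<close>
lemma helical_pair_swap:
  "helical_pair X A (\<lambda>p. swap *v \<beta> p) (\<lambda>p. swap *v \<alpha> p) g (swap ** B ** swap) (swap *v b2) (swap *v b1)"
proof (intro helical_pair.intro null_pair.intro null_pair_axioms.intro helical_pair_axioms.intro)
  show "surface X A" by (rule surface_axioms)
  show "smooth_fun A (\<lambda>p. swap *v \<beta> p)" "smooth_fun A (\<lambda>p. swap *v \<alpha> p)"
    by (rule smooth_fun_matrix[OF smooth_\<beta>], rule smooth_fun_matrix[OF smooth_\<alpha>])
  show "(swap ** B ** swap) $ 1 $ 1 + (swap ** B ** swap) $ 2 $ 2 = 0"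
    using traceless by (simp add: swap_def matrix_matrix_mult_def sum_2)
  have e: "(swap ** B ** swap) *v (swap *v x) + swap *v b = swap *v (B *v x + b)" for x b
    by (simp add: matrix_vector_mul_assoc[symmetric] swap_swap matrix_vector_right_distrib)
  fix c assume c: "c \<in> A"
  interpret cp: chart_pair "chart_image c" "in_chart c \<alpha>" "in_chart c \<beta>" "g c" by (rule pair[OF c])
  note p\<alpha> = partial_matrix_vector_mult[OF cp.smooth_a, of _ _ swap]
  note p\<beta> = partial_matrix_vector_mult[OF cp.smooth_b, of _ _ swap]
  show "chart_pair (chart_image c) (in_chart c (\<lambda>p. swap *v \<beta> p)) (in_chart c (\<lambda>p. swap *v \<alpha> p)) (g c)"
    unfolding in_chart_matrix
  proof (rule chart_pair.intro)
    show "open (chart_image c)" by (rule cp.open_S)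
    show "smooth_on (chart_image c) (\<lambda>u. swap *v in_chart c \<beta> u)" "smooth_on (chart_image c) (\<lambda>u. swap *v in_chart c \<alpha> u)"
      by (rule smooth_on_matrix_vector_mult[OF cp.smooth_b], rule smooth_on_matrix_vector_mult[OF cp.smooth_a])
    show "g c u $ i $ j =
       - (det2 (partial i (\<lambda>u. swap *v in_chart c \<beta> u) u) (partial j (\<lambda>u. swap *v in_chart c \<alpha> u) u) +
          det2 (partial j (\<lambda>u. swap *v in_chart c \<beta> u) u) (partial i (\<lambda>u. swap *v in_chart c \<alpha> u) u))"
      if u: "u \<in> chart_image c" for u i j
      unfolding p\<alpha>[OF u] p\<beta>[OF u] det2_swap cp.metric[OF u] by (simp add: det2_def algebra_simps)
    fix u assume u: "u \<in> chart_image c"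
    show "det2 (partial 1 (\<lambda>u. swap *v in_chart c \<beta> u) u) (partial 2 (\<lambda>u. swap *v in_chart c \<beta> u) u) = 0"
      "det2 (partial 1 (\<lambda>u. swap *v in_chart c \<alpha> u) u) (partial 2 (\<lambda>u. swap *v in_chart c \<alpha> u) u) = 0"
      by (simp_all add: p\<alpha>[OF u] p\<beta>[OF u] det2_swap cp.rank_a[OF u] cp.rank_b[OF u])
    show "det2 (partial 1 (\<lambda>u. swap *v in_chart c \<beta> u) u) (partial 2 (\<lambda>u. swap *v in_chart c \<alpha> u) u) -
         det2 (partial 2 (\<lambda>u. swap *v in_chart c \<beta> u) u) (partial 1 (\<lambda>u. swap *v in_chart c \<alpha> u) u) \<noteq> 0"
    proof -
      have "- det2 x w - - det2 y z = - (det2 z y - det2 w x)" for x y z w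
        by (simp add: det2_def algebra_simps)
      then show ?thesis
        using cp.regular[OF u] unfolding p\<alpha>[OF u] p\<beta>[OF u] det2_swap by simp
    qed
  qed
  fix u i assume u: "u \<in> chart_image c"
  show "det2 ((swap ** B ** swap) *v in_chart c (\<lambda>p. swap *v \<beta> p) u + swap *v b2) (partial i (in_chart c (\<lambda>p. swap *v \<beta> p)) u) = 0"
    "det2 ((swap ** B ** swap) *v in_chart c (\<lambda>p. swap *v \<alpha> p) u + swap *v b1) (partial i (in_chart c (\<lambda>p. swap *v \<alpha> p)) u) = 0"
    unfolding in_chart_matrix e p\<alpha>[OF u] p\<beta>[OF u] det2_swap
    using tangent_\<alpha>[OF c u] tangent_\<beta>[OF c u] by simp_all
qed

lemma swap_E: "(swap ** B ** swap) *v (swap *v \<beta> p) + swap *v b2 = swap *v E2 p"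
  "(swap ** B ** swap) *v (swap *v \<alpha> p) + swap *v b1 = swap *v E1 p"
  "(swap ** B ** swap) *v (swap *v x) = swap *v (B *v x)"
  unfolding E1_def E2_def
  by (simp_all add: matrix_vector_mul_assoc[symmetric] swap_swap matrix_vector_right_distrib)

end

locale curved_pair = helical_pair X A \<alpha> \<beta> g B b1 b2
  for X :: "'p topology" and A and \<alpha> \<beta> :: "'p \<Rightarrow> real^2" and g :: "'p metric"
    and B :: "real^2^2" and b1 b2 :: "real^2" +
  assumes curv1_nonzero: "\<And>p. p \<in> topspace X \<Longrightarrow> curv1 p \<noteq> 0"
    and curv2_nonzero: "\<And>p. p \<in> topspace X \<Longrightarrow> curv2 p \<noteq> 0"
begin

lemma curved_pair_swap:
  "curved_pair X A (\<lambda>p. swap *v \<beta> p) (\<lambda>p. swap *v \<alpha> p) g (swap ** B ** swap) (swap *v b2) (swap *v b1)"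
proof -
  interpret s: helical_pair X A "\<lambda>p. swap *v \<beta> p" "\<lambda>p. swap *v \<alpha> p" g "swap ** B ** swap" "swap *v b2" "swap *v b1"
    by (rule helical_pair_swap)
  show ?thesis
  proof unfold_locales
    fix p assume p: "p \<in> topspace X"
    have e: "s.E1 p = swap *v E2 p" "s.E2 p = swap *v E1 p"
      unfolding s.E1_def s.E2_def by (rule swap_E)+
    have "s.curv1 p = - curv2 p" "s.curv2 p = - curv1 p"
      unfolding s.curv1_def s.curv2_def curv1_def curv2_def e swap_E(3) det2_swap by simp_all
    then show "s.curv1 p \<noteq> 0" "s.curv2 p \<noteq> 0" using curv1_nonzero[OF p] curv2_nonzero[OF p] by auto
  qed
qed

lemma E1_nonzero: "p \<in> topspace X \<Longrightarrow> E1 p \<noteq> 0"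
  using curv1_nonzero[of p] unfolding curv1_def by force

lemma E2_nonzero: "p \<in> topspace X \<Longrightarrow> E2 p \<noteq> 0"
  using curv2_nonzero[of p] unfolding curv2_def by force

text \<open>In the nowhere vanishing frame \<open>E1\<close>, \<open>E2\<close> the differentials of
  \<alpha> and \<beta> are scalar one-forms \<open>r\<close> and \<open>s\<close>. The regularity
  condition factors accordingly, which gives both the independence of these forms and the
  independence of \<open>E1\<close> and \<open>E2\<close>.\<close>

lemma chart_frame:
  assumes c: "c \<in> A" and p: "p \<in> fst c"
  obtains r s where "\<And>i. partial i (in_chart c \<alpha>) (snd c p) = r i *\<^sub>R E1 p"
    "\<And>i. partial i (in_chart c \<beta>) (snd c p) = s i *\<^sub>R E2 p"
    "r 1 * s 2 - r 2 * s 1 \<noteq> 0" "det2 (E1 p) (E2 p) \<noteq> 0"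
proof -
  have pX: "p \<in> topspace X" using chart_subset[OF c] p by blast
  note u = chart_imageI[OF p]
  have "det2 (partial i (in_chart c \<alpha>) (snd c p)) (E1 p) = 0" for i
    using tangent_\<alpha>[OF c u, of i] det2_commute[of "partial i (in_chart c \<alpha>) (snd c p)" "E1 p"]
    by (simp add: in_chart_apply[OF c p] E1_def)
  then have "\<forall>i. \<exists>r. partial i (in_chart c \<alpha>) (snd c p) = r *\<^sub>R E1 p"
    using det2_eq_0_iff_parallel[OF E1_nonzero[OF pX]] by simp
  then obtain r where r: "\<And>i. partial i (in_chart c \<alpha>) (snd c p) = r i *\<^sub>R E1 p" by metis
  have "det2 (partial i (in_chart c \<beta>) (snd c p)) (E2 p) = 0" for i
    using tangent_\<beta>[OF c u, of i] det2_commute[of "partial i (in_chart c \<beta>) (snd c p)" "E2 p"]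
    by (simp add: in_chart_apply[OF c p] E2_def)
  then have "\<forall>i. \<exists>r. partial i (in_chart c \<beta>) (snd c p) = r *\<^sub>R E2 p"
    using det2_eq_0_iff_parallel[OF E2_nonzero[OF pX]] by simp
  then obtain s where s: "\<And>i. partial i (in_chart c \<beta>) (snd c p) = s i *\<^sub>R E2 p" by metis
  have "(r 1 * s 2 - r 2 * s 1) * det2 (E1 p) (E2 p) \<noteq> 0"
    using chart_pair.regular[OF pair[OF c] u] by (simp add: r s algebra_simps)
  then show ?thesis using that[OF r s] by simp
qed

lemma null_geodesic_eq_iff:
  assumes p: "p \<in> topspace X"
  shows "null_geodesic_eq p a b \<longleftrightarrow> det2 a (E2 p) = 0 \<and> det2 (E1 p) b = 0"
proof
  assume *: "null_geodesic_eq p a b"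
  obtain c where c: "c \<in> A" "p \<in> fst c" using chart_cover[OF p] by blast
  obtain r s where rs: "\<And>i. partial i (in_chart c \<alpha>) (snd c p) = r i *\<^sub>R E1 p"
    "\<And>i. partial i (in_chart c \<beta>) (snd c p) = s i *\<^sub>R E2 p"
    "r 1 * s 2 - r 2 * s 1 \<noteq> 0" "det2 (E1 p) (E2 p) \<noteq> 0" by (rule chart_frame[OF c]) blast
  define x where "x = det2 a (E2 p)"
  define y where "y = det2 (E1 p) b"
  have e: "s l * x + r l * y = 0" for l
  proof -
    have "det2 a (partial l (in_chart c \<beta>) (snd c p)) + det2 (partial l (in_chart c \<alpha>) (snd c p)) b = 0"
      using * c unfolding null_geodesic_eq_def by blast
    then show ?thesis by (simp add: rs(1,2) x_def y_def)
  qed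
  have f: "(r 1 * s 2 - r 2 * s 1) * x = (s 2 * x + r 2 * y) * r 1 - (s 1 * x + r 1 * y) * r 2"
    "(r 1 * s 2 - r 2 * s 1) * y = (s 1 * x + r 1 * y) * s 2 - (s 2 * x + r 2 * y) * s 1"
    by (simp_all add: algebra_simps)
  have "(r 1 * s 2 - r 2 * s 1) * x = 0" "(r 1 * s 2 - r 2 * s 1) * y = 0" unfolding f e by simp_all
  then show "det2 a (E2 p) = 0 \<and> det2 (E1 p) b = 0" using rs(3) by (simp add: x_def y_def)
next
  assume *: "det2 a (E2 p) = 0 \<and> det2 (E1 p) b = 0"
  show "null_geodesic_eq p a b"
    unfolding null_geodesic_eq_def
  proof (intro ballI impI allI)
    fix c l assume c: "c \<in> A" "p \<in> fst c"
    obtain r s where rs: "\<And>i. partial i (in_chart c \<alpha>) (snd c p) = r i *\<^sub>R E1 p"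
      "\<And>i. partial i (in_chart c \<beta>) (snd c p) = s i *\<^sub>R E2 p" by (rule chart_frame[OF c]) blast
    show "det2 a (partial l (in_chart c \<beta>) (snd c p)) + det2 (partial l (in_chart c \<alpha>) (snd c p)) b = 0"
      using * by (simp add: rs)
  qed
qed

text \<open>A coordinate line of a chart adapted to \<open>p\<close>: with \<open>n = E2 p\<close>
  and \<open>m = E1 p\<close>, the functions \<open>det2 \<alpha> n\<close> and
  \<open>det2 \<beta> m\<close> are local coordinates, and the line moves the first at unit speed
  and fixes the second. Then \<beta> is constant, so \<open>E2\<close> stays equal to
  \<open>n\<close>, and the second derivative of \<alpha> is parallel to \<open>E2\<close>.\<close>

lemma local_null_geodesic:
  assumes p: "p \<in> topspace X"
  obtains d \<gamma> where "d > 0" "geodesic_on X A g {- d<..<d} \<gamma>" "\<gamma> 0 = p"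
    "\<And>t. t \<in> {- d<..<d} \<Longrightarrow> \<beta> (\<gamma> t) = \<beta> p"
    "\<And>t. t \<in> {- d<..<d} \<Longrightarrow> det2 (\<alpha> (\<gamma> t)) (E2 p) = det2 (\<alpha> p) (E2 p) + t"
proof -
  obtain c where c: "c \<in> A" "p \<in> fst c" using chart_cover[OF p] by blast
  define n where "n = E2 p"
  define m where "m = E1 p"
  have sm\<alpha>: "smooth_on (chart_image c') (in_chart c' \<alpha>)" and sm\<beta>: "smooth_on (chart_image c') (in_chart c' \<beta>)"
    if "c' \<in> A" for c'
    using that chart_smooth by auto
  define L1 :: "real^2 \<Rightarrow> real^2" where "L1 x = det2 x n *\<^sub>R axis 1 (1::real)" for x :: "real^2"
  define L2 :: "real^2 \<Rightarrow> real^2" where "L2 x = det2 x m *\<^sub>R axis 2 (1::real)" for x :: "real^2"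
  have L: "bounded_linear L1" "bounded_linear L2"
    unfolding L1_def L2_def
    by (intro bounded_linear_compose[OF bounded_linear_scaleR_left]
        bounded_bilinear.bounded_linear_left[OF bounded_bilinear_det2])+
  define \<Phi> :: "'p \<Rightarrow> real^2" where "\<Phi> q = L1 (\<alpha> q) + L2 (\<beta> q)" for q
  have \<Phi>c: "in_chart c' \<Phi> = (\<lambda>u. L1 (in_chart c' \<alpha> u) + L2 (in_chart c' \<beta> u))" for c'
    by (simp add: in_chart_def \<Phi>_def fun_eq_iff)
  have sm\<Phi>: "smooth_fun A \<Phi>"
    unfolding smooth_fun_def \<Phi>c
    by (intro ballI smooth_on_add smooth_on_bounded_linear[OF L(1)] smooth_on_bounded_linear[OF L(2)] sm\<alpha> sm\<beta>)
  have p\<Phi>: "partial i (in_chart c \<Phi>) (snd c p) = L1 (partial i (in_chart c \<alpha>) (snd c p)) + L2 (partial i (in_chart c \<beta>) (snd c p))" for i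
    unfolding \<Phi>c
    by (simp add: partial_add[OF smooth_on_bounded_linear[OF L(1) sm\<alpha>[OF c(1)]] smooth_on_bounded_linear[OF L(2) sm\<beta>[OF c(1)]] chart_imageI[OF c(2)]]
        partial_linear[OF L(1) sm\<alpha>[OF c(1)] chart_imageI[OF c(2)]] partial_linear[OF L(2) sm\<beta>[OF c(1)] chart_imageI[OF c(2)]])
  obtain r s where rs: "\<And>i. partial i (in_chart c \<alpha>) (snd c p) = r i *\<^sub>R E1 p"
    "\<And>i. partial i (in_chart c \<beta>) (snd c p) = s i *\<^sub>R E2 p"
    "r 1 * s 2 - r 2 * s 1 \<noteq> 0" "det2 (E1 p) (E2 p) \<noteq> 0" by (rule chart_frame[OF c]) blast
  have D: "det2 m n \<noteq> 0" using rs(4) by (simp add: m_def n_def)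
  have ax: "det2 (axis 1 1) (axis 2 1) = 1" "det2 (axis 2 1) (axis 1 1) = - 1"
    by (simp_all add: det2_def axis_def)
  have "det2 (partial 1 (in_chart c \<Phi>) (snd c p)) (partial 2 (in_chart c \<Phi>) (snd c p))
      = (r 1 * s 2 - r 2 * s 1) * (det2 m n * det2 n m)"
    unfolding p\<Phi> rs L1_def L2_def m_def[symmetric] n_def[symmetric]
    by (simp add: ax algebra_simps)
  then have "det2 (partial 1 (in_chart c \<Phi>) (snd c p)) (partial 2 (in_chart c \<Phi>) (snd c p)) \<noteq> 0"
    using rs(3) D det2_commute[of n m] by simp
  from local_inverse[OF sm\<Phi> c this] obtain V \<sigma> where V: "open V" "\<Phi> p \<in> V" "\<sigma> (\<Phi> p) = p"
    "\<And>w. w \<in> V \<Longrightarrow> \<sigma> w \<in> fst c \<and> \<Phi> (\<sigma> w) = w" "smooth_on V (\<lambda>w. snd c (\<sigma> w))"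
    "continuous_map (top_of_set V) X \<sigma>" by metis
  obtain e where e: "e > 0" "ball (\<Phi> p) e \<subseteq> V" using V(1,2) open_contains_ball by blast
  define z where "z t = \<Phi> p + t *\<^sub>R axis 1 1" for t :: real
  have zV: "z t \<in> V" if "t \<in> {- e<..<e}" for t
  proof -
    have "dist (\<Phi> p) (z t) < e" using that by (simp add: z_def dist_norm abs_less_iff)
    then show ?thesis using e(2) by auto
  qed
  define \<gamma> where "\<gamma> t = \<sigma> (z t)" for t
  have \<gamma>c: "\<gamma> t \<in> fst c" "\<Phi> (\<gamma> t) = z t" if "t \<in> {- e<..<e}" for t
    using V(4)[OF zV[OF that]] by (auto simp: \<gamma>_def)
  have smz: "smooth_on {- e<..<e} z" unfolding z_def by (intro smooth_on_add smooth_on_const smooth_on_scaleR smooth_on_ident)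
  have smx: "smooth_on {- e<..<e} (\<lambda>t. snd c (\<gamma> t))"
    unfolding \<gamma>_def by (rule smooth_on_compose[OF V(5) smz]) (use zV in auto)
  have xc: "(\<lambda>t. snd c (\<gamma> t)) ` {- e<..<e} \<subseteq> chart_image c" using \<gamma>c(1) by (auto simp: chart_image_def)
  have smf: "smooth_on {- e<..<e} (\<lambda>t. f (\<gamma> t))" if "smooth_fun A f" for f :: "'p \<Rightarrow> real^2"
  proof (rule smooth_on_cong)
    show "smooth_on {- e<..<e} (\<lambda>t. in_chart c f (snd c (\<gamma> t)))"
      by (rule smooth_on_compose[OF _ smx xc]) (use that c(1) in \<open>auto simp: smooth_fun_def\<close>)
    show "in_chart c f (snd c (\<gamma> t)) = f (\<gamma> t)" if "t \<in> {- e<..<e}" for t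
      by (rule in_chart_apply[OF c(1) \<gamma>c(1)[OF that]])
  qed auto
  \<comment> \<open>The determinant of \<open>E2\<close> along the curve with \<open>m\<close>. It
    is nonzero near time 0, and there the velocity of \<beta>, a multiple of \<open>E2\<close> with
    zero determinant against \<open>m\<close>, must vanish.\<close>
  define h where "h t = det2 (B *v \<beta> (\<gamma> t) + b2) m" for t
  have "smooth_on {- e<..<e} h"
    unfolding h_def by (intro smooth_on_det2 smooth_on_add smooth_on_const smooth_on_matrix_vector_mult smf smooth_\<beta>)
  then have "open {t \<in> {- e<..<e}. h t \<noteq> 0}"
    using continuous_open_preimage[OF smooth_on_imp_continuous_on, of "{- e<..<e}" h "- {0}"]
    by (simp add: vimage_def Int_def open_Compl)
  moreover have "z 0 = \<Phi> p" by (simp add: z_def)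
  then have \<gamma>0: "\<gamma> 0 = p" by (simp add: \<gamma>_def V(3))
  have "h 0 = det2 n m" by (simp add: h_def \<gamma>0 n_def E2_def)
  then have "0 \<in> {t \<in> {- e<..<e}. h t \<noteq> 0}" using D e(1) det2_commute[of n m] by simp
  ultimately obtain d where d: "d > 0" "ball 0 d \<subseteq> {t \<in> {- e<..<e}. h t \<noteq> 0}"
    using open_contains_ball by blast
  define I where "I = {- d<..<d}"
  have Ib: "I = ball 0 d" by (auto simp: I_def dist_real_def)
  then have Ie: "I \<subseteq> {- e<..<e}" and hI: "\<And>t. t \<in> I \<Longrightarrow> h t \<noteq> 0" using d(2) by blast+
  have I: "open I" "0 \<in> I" "convex I" using d(1) by (auto simp: I_def)
  have zcont: "continuous_map (top_of_set I) (top_of_set V) z"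
    using zV Ie smooth_on_imp_continuous_on[OF smooth_on_subset[OF smz Ie]]
    by (auto simp: continuous_map_in_subtopology)
  then have cont: "continuous_map (top_of_set I) X \<gamma>"
    using continuous_map_compose[OF zcont V(6)] by (simp add: \<gamma>_def[abs_def] o_def)
  obtain a' where a': "smooth_on I a'" "\<And>t. t \<in> I \<Longrightarrow> ((\<lambda>t. \<alpha> (\<gamma> t)) has_vector_derivative a' t) (at t)"
    by (rule smooth_on_real_vector_derivative[OF I(1) smooth_on_subset[OF smf[OF smooth_\<alpha>] Ie]]) blast
  obtain a'' where a'': "smooth_on I a''" "\<And>t. t \<in> I \<Longrightarrow> (a' has_vector_derivative a'' t) (at t)"
    by (rule smooth_on_real_vector_derivative[OF I(1) a'(1)]) blast
  obtain b' where b': "smooth_on I b'" "\<And>t. t \<in> I \<Longrightarrow> ((\<lambda>t. \<beta> (\<gamma> t)) has_vector_derivative b' t) (at t)"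
    by (rule smooth_on_real_vector_derivative[OF I(1) smooth_on_subset[OF smf[OF smooth_\<beta>] Ie]]) blast
  obtain x' where x': "smooth_on I x'" "\<And>t. t \<in> I \<Longrightarrow> ((\<lambda>t. snd c (\<gamma> t)) has_vector_derivative x' t) (at t)"
    by (rule smooth_on_real_vector_derivative[OF I(1) smooth_on_subset[OF smx Ie]]) blast
  have an: "det2 (\<alpha> (\<gamma> t)) n = det2 (\<alpha> p) n + t" and bm: "det2 (\<beta> (\<gamma> t)) m = det2 (\<beta> p) m" if "t \<in> I" for t
  proof -
    have eq: "\<Phi> (\<gamma> t) = \<Phi> p + t *\<^sub>R axis 1 1" using \<gamma>c(2) that Ie by (auto simp: z_def)
    show "det2 (\<alpha> (\<gamma> t)) n = det2 (\<alpha> p) n + t"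
      using arg_cong[OF eq, of "\<lambda>v. v $ 1"] by (simp add: \<Phi>_def L1_def L2_def axis_def)
    show "det2 (\<beta> (\<gamma> t)) m = det2 (\<beta> p) m"
      using arg_cong[OF eq, of "\<lambda>v. v $ 2"] by (simp add: \<Phi>_def L1_def L2_def axis_def)
  qed
  have dl: "((\<lambda>t. det2 (f t) v) has_vector_derivative det2 f' v) (at t)"
    if "(f has_vector_derivative f') (at t)" for f f' t v
    by (rule bounded_linear.has_vector_derivative[OF bounded_bilinear.bounded_linear_left[OF bounded_bilinear_det2] that])
  have b0: "b' t = 0" if t: "t \<in> I" for t
  proof -
    have \<gamma>t: "\<gamma> t \<in> fst c" using \<gamma>c(1) t Ie by blast
    have "((\<lambda>t. in_chart c \<beta> (snd c (\<gamma> t))) has_vector_derivative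
        (x' t $ 1 *\<^sub>R partial 1 (in_chart c \<beta>) (snd c (\<gamma> t)) + x' t $ 2 *\<^sub>R partial 2 (in_chart c \<beta>) (snd c (\<gamma> t)))) (at t)"
      by (rule curve_derivative[OF sm\<beta>[OF c(1)] x'(2)[OF t] chart_imageI[OF \<gamma>t]])
    then have "((\<lambda>t. \<beta> (\<gamma> t)) has_vector_derivative
        (x' t $ 1 *\<^sub>R partial 1 (in_chart c \<beta>) (snd c (\<gamma> t)) + x' t $ 2 *\<^sub>R partial 2 (in_chart c \<beta>) (snd c (\<gamma> t)))) (at t)"
      by (rule has_vector_derivative_transform_within_open[OF _ I(1) t])
        (use \<gamma>c(1) Ie in_chart_apply[OF c(1)] in blast)
    then have "b' t = x' t $ 1 *\<^sub>R partial 1 (in_chart c \<beta>) (snd c (\<gamma> t)) + x' t $ 2 *\<^sub>R partial 2 (in_chart c \<beta>) (snd c (\<gamma> t))"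
      using vector_derivative_unique_at[OF b'(2)[OF t]] by blast
    moreover obtain r s where "\<And>i. partial i (in_chart c \<alpha>) (snd c (\<gamma> t)) = r i *\<^sub>R E1 (\<gamma> t)"
      "\<And>i. partial i (in_chart c \<beta>) (snd c (\<gamma> t)) = s i *\<^sub>R E2 (\<gamma> t)" by (rule chart_frame[OF c(1) \<gamma>t]) blast
    ultimately have b'E: "b' t = (x' t $ 1 * s 1 + x' t $ 2 * s 2) *\<^sub>R E2 (\<gamma> t)" by (simp add: scaleR_add_left)
    have "((\<lambda>t. det2 (\<beta> p) m) has_vector_derivative det2 (b' t) m) (at t)"
      by (rule has_vector_derivative_transform_within_open[OF dl[OF b'(2)[OF t]] I(1) t]) (rule bm)
    then have "det2 (b' t) m = 0"
      using vector_derivative_unique_at[OF _ has_vector_derivative_const] by blast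
    then have "(x' t $ 1 * s 1 + x' t $ 2 * s 2) * h t = 0" by (simp add: b'E h_def E2_def)
    then show ?thesis using hI[OF t] b'E by simp
  qed
  have const: "\<beta> (\<gamma> t) = \<beta> p" if t: "t \<in> I" for t
  proof -
    have "((\<lambda>t. \<beta> (\<gamma> t)) has_derivative (\<lambda>h. 0)) (at s within I)" if "s \<in> I" for s
      using b'(2)[OF that] b0[OF that] by (simp add: has_vector_derivative_def has_derivative_at_withinI)
    from has_derivative_zero_unique[OF I(3) this t I(2)] show ?thesis by (simp add: \<gamma>0)
  qed
  have En: "E2 (\<gamma> t) = n" if "t \<in> I" for t using const[OF that] by (simp add: E2_def n_def)
  have a'n: "det2 (a' t) n = 1" if t: "t \<in> I" for t
  proof -
    have "((\<lambda>t. det2 (\<alpha> p) n + t) has_vector_derivative det2 (a' t) n) (at t)"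
      by (rule has_vector_derivative_transform_within_open[OF dl[OF a'(2)[OF t]] I(1) t]) (rule an)
    moreover have "((\<lambda>t. det2 (\<alpha> p) n + t) has_vector_derivative 1) (at t)" by (auto intro!: derivative_eq_intros)
    ultimately show ?thesis by (rule vector_derivative_unique_at)
  qed
  have a''n: "det2 (a'' t) n = 0" if t: "t \<in> I" for t
  proof -
    have "((\<lambda>t. 1) has_vector_derivative det2 (a'' t) n) (at t)"
      by (rule has_vector_derivative_transform_within_open[OF dl[OF a''(2)[OF t]] I(1) t]) (rule a'n)
    then show ?thesis by (rule vector_derivative_unique_at[OF _ has_vector_derivative_const])
  qed
  have db0: "(b' has_vector_derivative 0) (at t)" if t: "t \<in> I" for t
    by (rule has_vector_derivative_transform_within_open[OF has_vector_derivative_const I(1) t]) (simp add: b0)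
  have \<gamma>X: "\<gamma> t \<in> topspace X" if "t \<in> I" for t
    using \<gamma>c(1) that Ie chart_subset[OF c(1)] by blast
  have "geodesic_on X A g I \<gamma>"
  proof (rule geodesicI[OF I(1) cont _ a'(2) a''(2) b'(2) db0])
    show "null_geodesic_eq (\<gamma> t) (a'' t) 0" if t: "t \<in> I" for t
      unfolding null_geodesic_eq_iff[OF \<gamma>X[OF t]] using a''n[OF t] En[OF t] by simp
    fix c' assume c': "c' \<in> A"
    let ?J = "{t \<in> I. \<gamma> t \<in> fst c'}"
    have J: "open ?J" by (rule chart_times_open[OF I(1) cont c'])
    have Je: "?J \<subseteq> {- e<..<e}" using Ie by blast
    have "smooth_on ?J (\<lambda>t. in_chart c (snd c') (snd c (\<gamma> t)))"
      by (rule smooth_on_compose[OF smooth_transition[OF c(1) c'] smooth_on_subset[OF smx Je] _ J])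
        (use \<gamma>c(1) Ie in blast)
    then show "smooth_on ?J (\<lambda>t. snd c' (\<gamma> t))"
      by (rule smooth_on_cong[OF J, rotated]) (use \<gamma>c(1) Ie in_chart_apply[OF c(1)] in blast)
  qed
  then show ?thesis
    using that[of d \<gamma>] d(1) \<gamma>0 const an unfolding I_def n_def by blast
qed

text \<open>The extension supplied by completeness is a geodesic, but nothing says at first that it
  stays null. The velocity of \<beta> along it is governed by a linear homogeneous equation and
  vanishes at time 0, hence always. After that \<open>E2\<close> is constant and the geodesic
  equation makes \<open>det2 \<alpha> E2\<close> affine in \<open>t\<close>.\<close>

lemma null_line:
  assumes complete: "complete_metric X A g" and p: "p \<in> topspace X"
  obtains \<gamma> a' where "continuous_map euclideanreal X \<gamma>" "\<gamma> 0 = p" "\<And>t. \<beta> (\<gamma> t) = \<beta> p"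
    "\<And>t. det2 (\<alpha> (\<gamma> t)) (E2 p) = det2 (\<alpha> p) (E2 p) + t"
    "\<And>t. ((\<lambda>t. \<alpha> (\<gamma> t)) has_vector_derivative a' t) (at t)" "\<And>t. det2 (a' t) (E1 (\<gamma> t)) = 0"
proof -
  obtain d \<gamma>0 where \<gamma>0: "d > 0" "geodesic_on X A g {- d<..<d} \<gamma>0" "\<gamma>0 0 = p"
    "\<And>t. t \<in> {- d<..<d} \<Longrightarrow> \<beta> (\<gamma>0 t) = \<beta> p"
    "\<And>t. t \<in> {- d<..<d} \<Longrightarrow> det2 (\<alpha> (\<gamma>0 t)) (E2 p) = det2 (\<alpha> p) (E2 p) + t"
    by (rule local_null_geodesic[OF p]) blast
  have "open {- d<..<d} \<and> is_interval {- d<..<d} \<and> {- d<..<d} \<noteq> {} \<and> geodesic_on X A g {- d<..<d} \<gamma>0"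
    using \<gamma>0(1,2) by (auto intro: is_interval_oo)
  then obtain \<gamma> where \<gamma>: "geodesic_on X A g UNIV \<gamma>" "\<And>t. t \<in> {- d<..<d} \<Longrightarrow> \<gamma> t = \<gamma>0 t"
    using complete unfolding complete_metric_def by meson
  obtain a' a'' b' b'' where der:
    "\<And>t. ((\<lambda>r. \<alpha> (\<gamma> r)) has_vector_derivative a' t) (at t)" "\<And>t. (a' has_vector_derivative a'' t) (at t)"
    "\<And>t. ((\<lambda>r. \<beta> (\<gamma> r)) has_vector_derivative b' t) (at t)" "\<And>t. (b' has_vector_derivative b'' t) (at t)"
    and eq: "\<And>t. null_geodesic_eq (\<gamma> t) (a'' t) (b'' t)"
    and vel: "\<And>t. \<exists>c\<in>A. \<exists>w :: real^2. \<gamma> t \<in> fst c \<and>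
       a' t = w $ 1 *\<^sub>R partial 1 (in_chart c \<alpha>) (snd c (\<gamma> t)) + w $ 2 *\<^sub>R partial 2 (in_chart c \<alpha>) (snd c (\<gamma> t)) \<and>
       b' t = w $ 1 *\<^sub>R partial 1 (in_chart c \<beta>) (snd c (\<gamma> t)) + w $ 2 *\<^sub>R partial 2 (in_chart c \<beta>) (snd c (\<gamma> t))"
    by (rule geodesic_imp_null_geodesic_eq[OF \<gamma>(1) open_UNIV]) (simp, metis UNIV_I)
  have cont: "continuous_map euclideanreal X \<gamma>" using \<gamma>(1) by (simp add: geodesic_on_def)
  then have \<gamma>X: "\<gamma> t \<in> topspace X" for t by (simp add: continuous_map_def Pi_iff)
  have geo: "det2 (a'' t) (E2 (\<gamma> t)) = 0" "det2 (E1 (\<gamma> t)) (b'' t) = 0" for t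
    using eq[of t] null_geodesic_eq_iff[OF \<gamma>X] by auto
  have par: "det2 (a' t) (E1 (\<gamma> t)) = 0" "det2 (b' t) (E2 (\<gamma> t)) = 0" and D: "det2 (E1 (\<gamma> t)) (E2 (\<gamma> t)) \<noteq> 0" for t
  proof -
    obtain c and w :: "real^2" where c: "c \<in> A" "\<gamma> t \<in> fst c"
       "a' t = w $ 1 *\<^sub>R partial 1 (in_chart c \<alpha>) (snd c (\<gamma> t)) + w $ 2 *\<^sub>R partial 2 (in_chart c \<alpha>) (snd c (\<gamma> t))"
       "b' t = w $ 1 *\<^sub>R partial 1 (in_chart c \<beta>) (snd c (\<gamma> t)) + w $ 2 *\<^sub>R partial 2 (in_chart c \<beta>) (snd c (\<gamma> t))"
      using vel[of t] by blast
    obtain r s where rs: "\<And>i. partial i (in_chart c \<alpha>) (snd c (\<gamma> t)) = r i *\<^sub>R E1 (\<gamma> t)"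
      "\<And>i. partial i (in_chart c \<beta>) (snd c (\<gamma> t)) = s i *\<^sub>R E2 (\<gamma> t)" "det2 (E1 (\<gamma> t)) (E2 (\<gamma> t)) \<noteq> 0"
      by (rule chart_frame[OF c(1,2)]) blast
    show "det2 (a' t) (E1 (\<gamma> t)) = 0" "det2 (b' t) (E2 (\<gamma> t)) = 0" "det2 (E1 (\<gamma> t)) (E2 (\<gamma> t)) \<noteq> 0"
      using rs by (simp_all add: c(3,4))
  qed
  have dE: "((\<lambda>t. E1 (\<gamma> t)) has_vector_derivative B *v a' t) (at t)" "((\<lambda>t. E2 (\<gamma> t)) has_vector_derivative B *v b' t) (at t)" for t
    unfolding E1_def E2_def has_vector_derivative_add_const
    by (rule bounded_linear.has_vector_derivative[OF matrix_vector_mul_bounded_linear der(1)],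
        rule bounded_linear.has_vector_derivative[OF matrix_vector_mul_bounded_linear der(3)])
  define f where "f t = det2 (E1 (\<gamma> t)) (b' t)" for t
  \<comment> \<open>The velocities are multiples of \<open>E1\<close> and \<open>E2\<close> with
    factors that are only chosen pointwise; the rate is expressed by determinants instead, which
    makes it continuous.\<close>
  define \<kappa> where "\<kappa> t = det2 (a' t) (E2 (\<gamma> t)) * det2 (B *v E1 (\<gamma> t)) (E2 (\<gamma> t)) / (det2 (E1 (\<gamma> t)) (E2 (\<gamma> t)))\<^sup>2" for t
  have df: "(f has_vector_derivative \<kappa> t * f t) (at t)" for t
  proof -
    have "(f has_vector_derivative det2 (E1 (\<gamma> t)) (b'' t) + det2 (B *v a' t) (b' t)) (at t)"
      unfolding f_def by (rule bounded_bilinear.has_vector_derivative[OF bounded_bilinear_det2 dE(1) der(4)])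
    moreover obtain P where P: "a' t = P *\<^sub>R E1 (\<gamma> t)"
      using par(1)[of t] det2_eq_0_iff_parallel[OF E1_nonzero[OF \<gamma>X]] by blast
    moreover obtain Q where Q: "b' t = Q *\<^sub>R E2 (\<gamma> t)"
      using par(2)[of t] det2_eq_0_iff_parallel[OF E2_nonzero[OF \<gamma>X]] by blast
    moreover have "\<kappa> t * f t = det2 (B *v a' t) (b' t)"
      using D[of t] by (simp add: \<kappa>_def f_def P Q linear_cmul[OF matrix_vector_mul_linear] power2_eq_square)
    ultimately show ?thesis using geo(2)[of t] by simp
  qed
  have contE: "continuous_on UNIV (\<lambda>t. E1 (\<gamma> t))" "continuous_on UNIV (\<lambda>t. E2 (\<gamma> t))" "continuous_on UNIV a'"
    by (intro continuous_at_imp_continuous_on ballI has_vector_derivative_continuous[OF dE(1)]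
        has_vector_derivative_continuous[OF dE(2)] has_vector_derivative_continuous[OF der(2)])+
  note cdet = bounded_bilinear.continuous_on[OF bounded_bilinear_det2]
  have "continuous_on UNIV \<kappa>"
    unfolding \<kappa>_def using D
    by (intro continuous_on_divide continuous_on_mult continuous_on_power cdet contE
        bounded_linear.continuous_on[OF matrix_vector_mul_bounded_linear]) auto
  then have cont\<kappa>: "continuous_on UNIV (\<lambda>t. \<bar>\<kappa> t\<bar>)" by (rule continuous_on_rabs)
  have I0: "open {- d<..<d}" "0 \<in> {- d<..<d}" using \<gamma>0(1) by auto
  have b'0: "b' 0 = 0"
  proof -
    have "((\<lambda>t. \<beta> p) has_vector_derivative b' 0) (at 0)"
      by (rule has_vector_derivative_transform_within_open[OF der(3) I0]) (simp add: \<gamma>(2) \<gamma>0(4))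
    then show ?thesis by (rule vector_derivative_unique_at[OF _ has_vector_derivative_const])
  qed
  have "f t = 0" for t
  proof (rule gronwall_zero[of UNIV 0 f t "\<lambda>t. \<kappa> t * f t" "\<lambda>t. \<bar>\<kappa> t\<bar>"])
    show "f 0 = 0" by (simp add: f_def b'0)
    show "norm (\<kappa> t * f t) \<le> \<bar>\<kappa> t\<bar> * norm (f t)" for t by (simp add: abs_mult)
  qed (simp_all add: df cont\<kappa>)
  then have b'z: "b' t = 0" for t
    using det2_eq_0_both[OF D[of t], of "b' t"] par(2)[of t] det2_commute[of "b' t" "E1 (\<gamma> t)"] by (simp add: f_def)
  have \<beta>c: "\<beta> (\<gamma> t) = \<beta> p" for t
  proof -
    have "((\<lambda>t. \<beta> (\<gamma> t)) has_derivative (\<lambda>h. 0)) (at s within UNIV)" for s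
      using der(3)[of s] b'z[of s] by (simp add: has_vector_derivative_def)
    from has_derivative_zero_unique[OF convex_UNIV this, of t 0] show ?thesis
      using \<gamma>(2)[of 0] \<gamma>0(1,3) by simp
  qed
  then have En: "E2 (\<gamma> t) = E2 p" for t by (simp add: E2_def)
  have dl: "((\<lambda>t. det2 (f t) v) has_vector_derivative det2 f' v) (at t)"
    if "(f has_vector_derivative f') (at t)" for f f' t v
    by (rule bounded_linear.has_vector_derivative[OF bounded_bilinear.bounded_linear_left[OF bounded_bilinear_det2] that])
  have a'c: "det2 (a' t) (E2 p) = 1" for t
  proof -
    have "((\<lambda>t. det2 (a' t) (E2 p)) has_derivative (\<lambda>h. 0)) (at s within UNIV)" for s
      using dl[OF der(2)[of s], of "E2 p"] geo(1)[of s] En[of s] by (simp add: has_vector_derivative_def)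
    from has_derivative_zero_unique[OF convex_UNIV this, of t 0]
    have "det2 (a' t) (E2 p) = det2 (a' 0) (E2 p)" by simp
    moreover have "((\<lambda>t. det2 (\<alpha> p) (E2 p) + t) has_vector_derivative det2 (a' 0) (E2 p)) (at 0)"
      by (rule has_vector_derivative_transform_within_open[OF dl[OF der(1)] I0]) (simp add: \<gamma>(2) \<gamma>0(5))
    moreover have "((\<lambda>t. det2 (\<alpha> p) (E2 p) + t) has_vector_derivative 1) (at 0)" by (auto intro!: derivative_eq_intros)
    ultimately show ?thesis using vector_derivative_unique_at by metis
  qed
  have an: "det2 (\<alpha> (\<gamma> t)) (E2 p) = det2 (\<alpha> p) (E2 p) + t" for t
  proof -
    have "((\<lambda>t. det2 (\<alpha> (\<gamma> t)) (E2 p) - t) has_derivative (\<lambda>h. 0)) (at s within UNIV)" for s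
    proof -
      have "((\<lambda>t. det2 (\<alpha> (\<gamma> t)) (E2 p) - t) has_vector_derivative 1 - 1) (at s)"
        using dl[OF der(1)[of s], of "E2 p"] a'c[of s] by (intro has_vector_derivative_diff) (auto intro!: derivative_eq_intros)
      then show ?thesis by (simp add: has_vector_derivative_def)
    qed
    from has_derivative_zero_unique[OF convex_UNIV this, of t 0] show ?thesis
      using \<gamma>(2)[of 0] \<gamma>0(1,3) by simp
  qed
  show ?thesis
    by (rule that[OF cont _ \<beta>c an der(1) par(1)]) (use \<gamma>(2)[of 0] \<gamma>0(1,3) in simp)
qed

text \<open>Along a null line put \<open>x = [E\<^sub>1, n]\<close> and \<open>y = [B E\<^sub>1, n]\<close> with \<open>n = E\<^sub>2\<close> constant; then
  \<open>y\<^sup>2 + det B x\<^sup>2\<close> is constant, \<open>y' = - det B\<close> and \<open>(x\<^sup>2)' = 2 y\<close>, while \<open>x\<close> never vanishes.\<close>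
lemma complete_imp_hyperbolic:
  assumes complete: "complete_metric X A g" and p: "p \<in> topspace X"
  shows "det B < 0" "curv1 p * curv2 p < 0"
proof -
  obtain \<gamma> a' where \<gamma>: "continuous_map euclideanreal X \<gamma>" "\<gamma> 0 = p" "\<And>t. \<beta> (\<gamma> t) = \<beta> p"
    "\<And>t. det2 (\<alpha> (\<gamma> t)) (E2 p) = det2 (\<alpha> p) (E2 p) + t"
    "\<And>t. ((\<lambda>t. \<alpha> (\<gamma> t)) has_vector_derivative a' t) (at t)" "\<And>t. det2 (a' t) (E1 (\<gamma> t)) = 0"
    by (rule null_line[OF assms]) blast
  have \<gamma>X: "\<gamma> t \<in> topspace X" for t using \<gamma>(1) by (simp add: continuous_map_def Pi_iff)
  define n where "n = E2 p"
  define \<delta> where "\<delta> = det B"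
  define x where "x t = det2 (E1 (\<gamma> t)) n" for t
  define y where "y t = det2 (B *v E1 (\<gamma> t)) n" for t
  have k2: "curv2 p = det2 n (B *v n)" by (simp add: curv2_def n_def)
  have BB: "B *v (B *v v) = - \<delta> *\<^sub>R v" for v unfolding \<delta>_def by (rule traceless_square[OF traceless])
  \<comment> \<open>A Gram determinant: the quadratic form \<open>det2 x (B x)\<close> has
    determinant \<open>det B\<close>, its polar form on \<open>E1\<close> and \<open>n\<close> is
    \<open>y\<close> up to sign, and \<open>x\<close> is the area spanned by the two
    vectors.\<close>
  have conic: "curv1 p * curv2 p = (y t)\<^sup>2 + \<delta> * (x t)\<^sup>2" for t
  proof -
    define e where "e = E1 (\<gamma> t)"
    have c1: "curv1 p = det2 e (B *v e)" using curv1_constant[OF p \<gamma>X[of t]] by (simp add: e_def curv1_def)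
    have tr: "B $ 2 $ 2 = - B $ 1 $ 1" using traceless by simp
    show ?thesis
      unfolding c1 k2 x_def y_def e_def[symmetric] \<delta>_def
      by (simp add: det2_def matrix_vector_mult_def sum_2 det_2 tr power2_eq_square algebra_simps)
  qed
  have y: "y t = y 0 - \<delta> * t" for t
  proof -
    have yt: "y t = - \<delta> * det2 (\<alpha> (\<gamma> t)) n + det2 (B *v b1) n" for t
      by (simp add: y_def E1_def matrix_vector_right_distrib BB)
    show ?thesis using yt[of t] yt[of 0] \<gamma>(4)[of t] \<gamma>(2) by (simp add: n_def algebra_simps)
  qed
  have a'n: "det2 (a' t) n = 1" for t
  proof -
    have "((\<lambda>t. det2 (\<alpha> (\<gamma> t)) n) has_vector_derivative det2 (a' t) n) (at t)"
      by (rule bounded_linear.has_vector_derivative[OF bounded_bilinear.bounded_linear_left[OF bounded_bilinear_det2] \<gamma>(5)])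
    then have "((\<lambda>t. det2 (\<alpha> p) n + t) has_vector_derivative det2 (a' t) n) (at t)"
      using \<gamma>(4) by (simp add: n_def)
    moreover have "((\<lambda>t. det2 (\<alpha> p) n + t) has_vector_derivative 1) (at t)" by (auto intro!: derivative_eq_intros)
    ultimately show ?thesis by (rule vector_derivative_unique_at)
  qed
  have Px: "\<exists>P. a' t = P *\<^sub>R E1 (\<gamma> t) \<and> P * x t = 1" for t
  proof -
    obtain P where "a' t = P *\<^sub>R E1 (\<gamma> t)"
      using \<gamma>(6)[of t] det2_eq_0_iff_parallel[OF E1_nonzero[OF \<gamma>X]] by blast
    then show ?thesis using a'n[of t] by (auto simp: x_def)
  qed
  then have x0: "x t \<noteq> 0" for t by (metis mult_zero_right zero_neq_one)
  have dx: "((\<lambda>t. (x t)\<^sup>2) has_real_derivative 2 * y t) (at t)" for t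
  proof -
    obtain P where P: "a' t = P *\<^sub>R E1 (\<gamma> t)" "P * x t = 1" using Px by blast
    have "((\<lambda>t. B *v \<alpha> (\<gamma> t) + b1) has_vector_derivative B *v a' t) (at t)"
      unfolding has_vector_derivative_add_const
      by (rule bounded_linear.has_vector_derivative[OF matrix_vector_mul_bounded_linear \<gamma>(5)])
    then have "((\<lambda>t. det2 (B *v \<alpha> (\<gamma> t) + b1) n) has_vector_derivative det2 (B *v a' t) n) (at t)"
      by (rule bounded_linear.has_vector_derivative[OF bounded_bilinear.bounded_linear_left[OF bounded_bilinear_det2]])
    then have "(x has_real_derivative P * y t) (at t)"
      by (simp add: has_real_derivative_iff_has_vector_derivative x_def[abs_def] y_def E1_def P(1)
          linear_cmul[OF matrix_vector_mul_linear])
    then have "((\<lambda>t. (x t)\<^sup>2) has_real_derivative 2 * (P * x t) * y t) (at t)"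
      by (auto intro!: derivative_eq_intros)
    then show ?thesis by (simp add: P(2))
  qed
  have nz: "curv1 p * curv2 p \<noteq> 0" using curv1_nonzero[OF p] curv2_nonzero[OF p] by simp
  have "\<not> \<delta> > 0"
  proof
    assume \<delta>: "\<delta> > 0"
    \<comment> \<open>For positive \<delta> the affine function \<open>y\<close> is unbounded; at
      this time its square exceeds the constant that bounds it in \<open>conic\<close>.\<close>
    define t where "t = (y 0 - \<bar>curv1 p * curv2 p\<bar> - 1) / \<delta>"
    have "y t = \<bar>curv1 p * curv2 p\<bar> + 1" using \<delta> y[of t] by (simp add: t_def)
    moreover have "(k + 1)\<^sup>2 > k" if "k \<ge> 0" for k :: real
      using mult_nonneg_nonneg[OF that that] that unfolding power2_eq_square distrib_left distrib_right by linarith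
    ultimately have "(y t)\<^sup>2 > \<bar>curv1 p * curv2 p\<bar>" by simp
    moreover have "\<delta> * (x t)\<^sup>2 \<ge> 0" using \<delta> by simp
    ultimately show False using conic[of t] abs_ge_self[of "curv1 p * curv2 p"] by linarith
  qed
  moreover have "\<delta> \<noteq> 0"
  proof
    assume \<delta>: "\<delta> = 0"
    have yc: "y t = y 0" for t using y[of t] \<delta> by simp
    have "y 0 \<noteq> 0" using conic[of 0] nz \<delta> by auto
    define h where "h t = (x t)\<^sup>2 - 2 * y 0 * t" for t
    have "(h has_real_derivative 0) (at t)" for t
    proof -
      have "(h has_real_derivative 2 * y t - 2 * y 0) (at t)"
        unfolding h_def by (rule DERIV_diff[OF dx]) (auto intro!: derivative_eq_intros)
      then show ?thesis by (simp add: yc[of t])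
    qed
    \<comment> \<open>For \<delta> = 0 the square of \<open>x\<close> is affine with slope
      \<open>2 * y 0\<close>, and this is the parameter at which it would have to vanish.\<close>
    then have "h (- (x 0)\<^sup>2 / (2 * y 0)) = h 0" using DERIV_isconst_all by blast
    then have "(x (- (x 0)\<^sup>2 / (2 * y 0)))\<^sup>2 = 0" using \<open>y 0 \<noteq> 0\<close> by (simp add: h_def)
    then show False using x0 by simp
  qed
  ultimately have neg: "\<delta> < 0" by linarith
  then show "det B < 0" by (simp add: \<delta>_def)
  \<comment> \<open>At the zero of \<open>y\<close> the conic identity reduces to \<delta> times a
    nonzero square, which fixes the sign of the product of the curvatures.\<close>
  have "y (y 0 / \<delta>) = 0" using neg y[of "y 0 / \<delta>"] by simp
  then have "curv1 p * curv2 p = \<delta> * (x (y 0 / \<delta>))\<^sup>2" using conic[of "y 0 / \<delta>"] by simp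
  then show "curv1 p * curv2 p < 0" using neg x0[of "y 0 / \<delta>"] by (simp add: mult_less_0_iff)
qed

end

subsection \<open>The affine metric and the conormal map\<close>

lemma det3_expand:
  "det3 a b c = a $ 1 * (b $ 2 * c $ 3 - b $ 3 * c $ 2) - a $ 2 * (b $ 1 * c $ 3 - b $ 3 * c $ 1)
    + a $ 3 * (b $ 1 * c $ 2 - b $ 2 * c $ 1)"
  by (simp add: det3_def det_3 vector_3 algebra_simps)

lemma det3_cramer:
  "det3 x y z *\<^sub>R q = det3 q y z *\<^sub>R x + det3 x q z *\<^sub>R y + det3 x y q *\<^sub>R z"
  by (simp add: vec_eq_iff forall_3 det3_expand algebra_simps)

lemma range_frechet_derivative_iff:
  assumes "smooth_on S x" "u \<in> S"
  shows "v \<in> range (frechet_derivative x (at u)) \<longleftrightarrow> (\<exists>p q. v = p *\<^sub>R partial 1 x u + q *\<^sub>R partial 2 x u)"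
proof
  assume "v \<in> range (frechet_derivative x (at u))"
  then obtain w where "v = frechet_derivative x (at u) w" by blast
  then show "\<exists>p q. v = p *\<^sub>R partial 1 x u + q *\<^sub>R partial 2 x u"
    using smooth_on_frechet_eq_partial[OF assms] by metis
next
  assume "\<exists>p q. v = p *\<^sub>R partial 1 x u + q *\<^sub>R partial 2 x u"
  then obtain p q where "v = p *\<^sub>R partial 1 x u + q *\<^sub>R partial 2 x u" by blast
  then have "v = frechet_derivative x (at u) (vector [p, q])"
    unfolding smooth_on_frechet_eq_partial[OF assms] by simp
  then show "v \<in> range (frechet_derivative x (at u))" by blast
qed

lemma transversal_if_det3:
  assumes "smooth_on S x" "u \<in> S" "det3 (partial 1 x u) (partial 2 x u) \<xi> \<noteq> 0"
  shows "\<xi> \<notin> range (frechet_derivative x (at u))" "inj (frechet_derivative x (at u))"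
proof -
  show "\<xi> \<notin> range (frechet_derivative x (at u))"
  proof
    assume "\<xi> \<in> range (frechet_derivative x (at u))"
    then obtain p q where "\<xi> = p *\<^sub>R partial 1 x u + q *\<^sub>R partial 2 x u"
      using range_frechet_derivative_iff[OF assms(1,2)] by blast
    then have "det3 (partial 1 x u) (partial 2 x u) \<xi> = 0" by (simp add: det3_expand algebra_simps)
    then show False using assms(3) by simp
  qed
  have lin: "linear (frechet_derivative x (at u))"
    by (rule has_derivative_linear[OF smooth_on_has_derivative[OF assms(1,2)]])
  show "inj (frechet_derivative x (at u))"
  proof (rule linear_inj_iff_eq_0[OF lin, THEN iffD2], intro allI impI)
    fix w assume "frechet_derivative x (at u) w = 0"
    then have w: "w $ 1 *\<^sub>R partial 1 x u + w $ 2 *\<^sub>R partial 2 x u = 0"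
      unfolding smooth_on_frechet_eq_partial[OF assms(1,2)] .
    have "w $ 1 * det3 (partial 1 x u) (partial 2 x u) \<xi> = det3 (w $ 1 *\<^sub>R partial 1 x u + w $ 2 *\<^sub>R partial 2 x u) (partial 2 x u) \<xi>"
      "w $ 2 * det3 (partial 1 x u) (partial 2 x u) \<xi> = det3 (partial 1 x u) (w $ 1 *\<^sub>R partial 1 x u + w $ 2 *\<^sub>R partial 2 x u) \<xi>"
      by (simp_all add: det3_expand algebra_simps)
    then have "w $ 1 = 0" "w $ 2 = 0" unfolding w using assms(3) by (simp_all add: det3_expand)
    then show "w = 0" by (simp add: vec_eq_iff forall_2)
  qed
qed

text \<open>Cramer's rule for the \<xi>-component of the second derivative in the frame formed by
  the two tangent vectors and \<xi>.\<close>

lemma transversal_coeff_eq: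
  assumes "smooth_on S x" "u \<in> S" "det3 (partial 1 x u) (partial 2 x u) \<xi> \<noteq> 0"
  shows "transversal_coeff x \<xi> u (axis i 1) (axis j 1)
    = det3 (partial 1 x u) (partial 2 x u) (partial i (partial j x) u) / det3 (partial 1 x u) (partial 2 x u) \<xi>"
proof -
  define q where "q = partial i (partial j x) u"
  define D where "D = det3 (partial 1 x u) (partial 2 x u) \<xi>"
  have e: "transversal_coeff x \<xi> u (axis i 1) (axis j 1) = (THE r. q - r *\<^sub>R \<xi> \<in> range (frechet_derivative x (at u)))"
    unfolding transversal_coeff_def q_def partial_def[abs_def] ..
  have "(THE r. q - r *\<^sub>R \<xi> \<in> range (frechet_derivative x (at u))) = det3 (partial 1 x u) (partial 2 x u) q / D"
  proof (rule the_equality)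
    have "q = (1 / D) *\<^sub>R (D *\<^sub>R q)" using assms(3) by (simp add: D_def)
    also have "\<dots> = (1 / D) *\<^sub>R (det3 q (partial 2 x u) \<xi> *\<^sub>R partial 1 x u + det3 (partial 1 x u) q \<xi> *\<^sub>R partial 2 x u
        + det3 (partial 1 x u) (partial 2 x u) q *\<^sub>R \<xi>)"
      unfolding D_def det3_cramer[of "partial 1 x u" "partial 2 x u" \<xi> q] ..
    finally have "q - (det3 (partial 1 x u) (partial 2 x u) q / D) *\<^sub>R \<xi> =
        (det3 q (partial 2 x u) \<xi> / D) *\<^sub>R partial 1 x u + (det3 (partial 1 x u) q \<xi> / D) *\<^sub>R partial 2 x u"
      by (simp add: scaleR_add_right diff_eq_eq)
    then show "q - (det3 (partial 1 x u) (partial 2 x u) q / D) *\<^sub>R \<xi> \<in> range (frechet_derivative x (at u))"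
      unfolding range_frechet_derivative_iff[OF assms(1,2)] by blast
    fix r assume "q - r *\<^sub>R \<xi> \<in> range (frechet_derivative x (at u))"
    then obtain a b where "q - r *\<^sub>R \<xi> = a *\<^sub>R partial 1 x u + b *\<^sub>R partial 2 x u"
      unfolding range_frechet_derivative_iff[OF assms(1,2)] by blast
    then have "q = a *\<^sub>R partial 1 x u + b *\<^sub>R partial 2 x u + r *\<^sub>R \<xi>" by (simp add: algebra_simps)
    then have "det3 (partial 1 x u) (partial 2 x u) q = r * D"
      by (simp add: D_def det3_expand algebra_simps)
    then show "r = det3 (partial 1 x u) (partial 2 x u) q / D" using assms(3) by (simp add: D_def)
  qed
  then show ?thesis by (simp add: e q_def D_def)
qed

text \<open>Differentiating the conormal equation once more splits the third coordinate of the
  second derivative of \<open>x\<close> into \<open>- det2 P (partial i (partial j Z))\<close>,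
  which completes the planar part to a tangent vector, and
  \<open>- det2 (partial i P) (partial j Z)\<close>, which is the coefficient of the normal.\<close>

lemma affine_metric_conormal:
  fixes x :: "real^2 \<Rightarrow> real^3" and Z P :: "real^2 \<Rightarrow> real^2"
  assumes S: "open S" "u \<in> S" and sm: "smooth_on S x" "smooth_on S Z" "smooth_on S P"
    and Z: "\<And>v. v \<in> S \<Longrightarrow> x v $ 1 = Z v $ 1" "\<And>v. v \<in> S \<Longrightarrow> x v $ 2 = Z v $ 2"
    and P: "\<And>v i. v \<in> S \<Longrightarrow> partial i x v $ 3 = - det2 (P v) (partial i Z v)"
    and J: "det2 (partial 1 Z u) (partial 2 Z u) \<noteq> 0"
  shows "det3 (partial 1 x u) (partial 2 x u) (axis 3 1) = det2 (partial 1 Z u) (partial 2 Z u)"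
    "transversal_coeff x (axis 3 1) u (axis i 1) (axis j 1) = - det2 (partial i P u) (partial j Z u)"
proof -
  have p1: "partial i x v $ 1 = partial i Z v $ 1" "partial i x v $ 2 = partial i Z v $ 2" if v: "v \<in> S" for v i
  proof -
    have "partial i (\<lambda>v. x v $ 1) v = partial i (\<lambda>v. Z v $ 1) v" "partial i (\<lambda>v. x v $ 2) v = partial i (\<lambda>v. Z v $ 2) v"
      by (rule partial_cong[OF S(1) v Z(1)], assumption, rule partial_cong[OF S(1) v Z(2)], assumption)
    then show "partial i x v $ 1 = partial i Z v $ 1" "partial i x v $ 2 = partial i Z v $ 2"
      by (simp_all add: partial_vec_nth[OF sm(1) v] partial_vec_nth[OF sm(2) v])
  qed
  show D: "det3 (partial 1 x u) (partial 2 x u) (axis 3 1) = det2 (partial 1 Z u) (partial 2 Z u)"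
    by (simp add: det3_expand det2_def p1[OF S(2)] axis_def)
  note smx = smooth_on_partial[OF sm(1) S(1)] and smZ = smooth_on_partial[OF sm(2) S(1)]
  have q12: "partial i (partial j x) u $ 1 = partial i (partial j Z) u $ 1" "partial i (partial j x) u $ 2 = partial i (partial j Z) u $ 2"
  proof -
    have "partial i (\<lambda>v. partial j x v $ 1) u = partial i (\<lambda>v. partial j Z v $ 1) u"
      "partial i (\<lambda>v. partial j x v $ 2) u = partial i (\<lambda>v. partial j Z v $ 2) u"
      by (rule partial_cong[OF S p1(1)], assumption, rule partial_cong[OF S p1(2)], assumption)
    then show "partial i (partial j x) u $ 1 = partial i (partial j Z) u $ 1" "partial i (partial j x) u $ 2 = partial i (partial j Z) u $ 2"
      by (simp_all add: partial_vec_nth[OF smx S(2)] partial_vec_nth[OF smZ S(2)])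
  qed
  have q3: "partial i (partial j x) u $ 3 = - (det2 (P u) (partial i (partial j Z) u) + det2 (partial i P u) (partial j Z u))"
  proof -
    have "partial i (partial j x) u $ 3 = partial i (\<lambda>v. partial j x v $ 3) u"
      by (simp add: partial_vec_nth[OF smx S(2)])
    also have "\<dots> = partial i (\<lambda>v. - det2 (P v) (partial j Z v)) u"
      by (rule partial_cong[OF S P])
    also have "\<dots> = - partial i (\<lambda>v. det2 (P v) (partial j Z v)) u"
      by (rule partial_linear[OF bounded_linear_minus[OF bounded_linear_ident] smooth_on_det2[OF sm(3) smZ] S(2)])
    finally show ?thesis by (simp add: partial_det2[OF sm(3) smZ S(2)])
  qed
  have "det3 (partial 1 x u) (partial 2 x u) (partial i (partial j x) u)
      = - det2 (partial i P u) (partial j Z u) * det2 (partial 1 Z u) (partial 2 Z u)"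
    unfolding det3_expand p1[OF S(2)] q12 q3 P[OF S(2)] by (simp add: det2_def algebra_simps)
  then show "transversal_coeff x (axis 3 1) u (axis i 1) (axis j 1) = - det2 (partial i P u) (partial j Z u)"
    using J transversal_coeff_eq[OF sm(1) S(2), of "axis 3 1" i j] unfolding D by simp
qed

subsection \<open>The infinitesimal symmetry preserves the affine normal\<close>

lemma det2_plucker: "det2 x z * det2 y w - det2 y z * det2 x w = det2 x y * det2 z w"
  by (simp add: det2_def algebra_simps)

text \<open>The generator of the group is \<open>(z, \<zeta>) \<mapsto> (B z + \<zeta> e + b, l \<bullet> z + k \<zeta> + b3)\<close>, and \<open>tangent\<close> says that
  it is tangent to the surface.\<close>
locale helical_chart =
  fixes S :: "(real^2) set" and Z P :: "real^2 \<Rightarrow> real^2" and \<zeta> :: "real^2 \<Rightarrow> real"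
    and B :: "real^2^2" and e b l :: "real^2" and k b3 :: real
  assumes open_S: "open S" and smooth_Z: "smooth_on S Z" and smooth_P: "smooth_on S P" and smooth_\<zeta>: "smooth_on S \<zeta>"
    and immersed: "\<And>u. u \<in> S \<Longrightarrow> det2 (partial 1 Z u) (partial 2 Z u) \<noteq> 0"
    and conormal: "\<And>u i. u \<in> S \<Longrightarrow> partial i \<zeta> u = - det2 (P u) (partial i Z u)"
    and symmetric: "\<And>u. u \<in> S \<Longrightarrow> det2 (partial 1 P u) (partial 2 Z u) = det2 (partial 2 P u) (partial 1 Z u)"
    and volume: "\<And>u. u \<in> S \<Longrightarrow> det2 (partial 1 P u) (partial 2 P u) = - det2 (partial 1 Z u) (partial 2 Z u)"
    and tangent: "\<And>u. u \<in> S \<Longrightarrow> l \<bullet> Z u + k * \<zeta> u + b3 = - det2 (P u) (B *v Z u + \<zeta> u *\<^sub>R e + b)"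
    and trace: "B $ 1 $ 1 + B $ 2 $ 2 + k = 0"
begin

definition m :: "real^2 \<Rightarrow> real^2" where "m u = B *v Z u + \<zeta> u *\<^sub>R e + b"

text \<open>The infinitesimal contragredient action on the covector with planar part
  \<open>det2 P\<close> and third entry 1. Renormalizing the third entry to 1 produces the term
  quadratic in \<open>P\<close>; rewriting the transpose of \<open>B\<close> through
  \<open>det2\<close>, with \<open>tr B = - k\<close>, accounts for one of the two \<open>k\<close>;
  the last vector represents \<open>l\<close> through \<open>det2\<close>.\<close>

definition R :: "real^2 \<Rightarrow> real^2" where
  "R u = B *v P u + (2 * k + det2 (P u) e) *\<^sub>R P u + vector [- l $ 2, l $ 1]"

text \<open>The coordinates, by Cramer's rule, of the planar part of the generator in the basis of
  partial derivatives of \<open>Z\<close>; together they form the vector field induced on the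
  surface.\<close>

definition V :: "2 \<Rightarrow> real^2 \<Rightarrow> real" where
  "V i u = (if i = 1 then det2 (m u) (partial 2 Z u) else det2 (partial 1 Z u) (m u)) / det2 (partial 1 Z u) (partial 2 Z u)"

lemma smooth_m: "smooth_on S m"
  unfolding m_def
  by (intro smooth_on_add smooth_on_matrix_vector_mult smooth_on_scaleR smooth_on_const smooth_Z smooth_\<zeta>)

lemma smooth_R: "smooth_on S R"
  unfolding R_def
  by (intro smooth_on_add smooth_on_matrix_vector_mult smooth_on_scaleR smooth_on_det2 smooth_on_const smooth_P)

lemma partial_m: "u \<in> S \<Longrightarrow> partial i m u = B *v partial i Z u + partial i \<zeta> u *\<^sub>R e"
  unfolding m_def[abs_def]
  by (simp add: partial_add[OF smooth_on_add[OF smooth_on_matrix_vector_mult[OF smooth_Z] smooth_on_scaleR[OF smooth_\<zeta> smooth_on_const]] smooth_on_const]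
      partial_add[OF smooth_on_matrix_vector_mult[OF smooth_Z] smooth_on_scaleR[OF smooth_\<zeta> smooth_on_const]]
      partial_matrix_vector_mult[OF smooth_Z] partial_scaleR[OF smooth_\<zeta> smooth_on_const] partial_const)

lemma partial_R:
  assumes u: "u \<in> S"
  shows "partial i R u = B *v partial i P u + (2 * k + det2 (P u) e) *\<^sub>R partial i P u + det2 (partial i P u) e *\<^sub>R P u"
proof -
  note c = smooth_on_const[of S]
  note s1 = smooth_on_add[OF c smooth_on_det2[OF smooth_P c]]
  note s2 = smooth_on_scaleR[OF s1 smooth_P]
  note s3 = smooth_on_matrix_vector_mult[OF smooth_P]
  show ?thesis
    unfolding R_def[abs_def]
    by (simp add: partial_add[OF smooth_on_add[OF s3 s2] c u] partial_add[OF s3 s2 u] partial_const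
        partial_matrix_vector_mult[OF smooth_P u] partial_scaleR[OF s1 smooth_P u]
        partial_add[OF c smooth_on_det2[OF smooth_P c] u] partial_det2[OF smooth_P c u])
qed

lemma m_eq: "u \<in> S \<Longrightarrow> m u = V 1 u *\<^sub>R partial 1 Z u + V 2 u *\<^sub>R partial 2 Z u"
proof -
  assume u: "u \<in> S"
  define J where "J = det2 (partial 1 Z u) (partial 2 Z u)"
  have J: "J \<noteq> 0" using immersed[OF u] by (simp add: J_def)
  have "m u = (1 / J) *\<^sub>R (J *\<^sub>R m u)" using J by simp
  also have "J *\<^sub>R m u = det2 (m u) (partial 2 Z u) *\<^sub>R partial 1 Z u + det2 (partial 1 Z u) (m u) *\<^sub>R partial 2 Z u"
    unfolding J_def by (rule det2_expand)
  finally have f: "m u = (1 / J) *\<^sub>R (det2 (m u) (partial 2 Z u) *\<^sub>R partial 1 Z u + det2 (partial 1 Z u) (m u) *\<^sub>R partial 2 Z u)" .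
  show ?thesis by (rule trans[OF f]) (simp add: V_def J_def scaleR_add_right)
qed

text \<open>Differentiate the tangency identity. The symmetry of the metric turns
  \<open>det2 (partial i P) m\<close> into the product of the derivative of \<open>P\<close> along
  \<open>V\<close> with \<open>partial i Z\<close>, and the remaining terms are those of
  \<open>R\<close>. So the conormal changes along \<open>V\<close> as the group prescribes.\<close>

lemma R_eq: "u \<in> S \<Longrightarrow> R u = V 1 u *\<^sub>R partial 1 P u + V 2 u *\<^sub>R partial 2 P u"
proof -
  assume u: "u \<in> S"
  define Q where "Q = V 1 u *\<^sub>R partial 1 P u + V 2 u *\<^sub>R partial 2 P u"
  have sym: "det2 (partial i P u) (partial j Z u) = det2 (partial j P u) (partial i Z u)" for i j
    using symmetric[OF u] exhaust_2[of i] exhaust_2[of j] by auto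
  have key: "det2 (Q - R u) (partial i Z u) = 0" for i
  proof -
    have "partial i (\<lambda>u. l \<bullet> Z u + k * \<zeta> u + b3) u = partial i (\<lambda>u. - det2 (P u) (m u)) u"
      by (rule partial_cong[OF open_S u]) (simp add: tangent m_def)
    moreover have "partial i (\<lambda>u. - det2 (P u) (m u)) u = - partial i (\<lambda>u. det2 (P u) (m u)) u"
      by (rule partial_linear[OF bounded_linear_minus[OF bounded_linear_ident] smooth_on_det2[OF smooth_P smooth_m] u])
    moreover have "partial i (\<lambda>u. det2 (P u) (m u)) u = det2 (P u) (partial i m u) + det2 (partial i P u) (m u)"
      by (rule partial_det2[OF smooth_P smooth_m u])
    moreover have "partial i (\<lambda>u. l \<bullet> Z u + k * \<zeta> u + b3) u = l \<bullet> partial i Z u + k * partial i \<zeta> u"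
    proof -
      note s1 = smooth_on_bounded_linear[OF bounded_linear_inner_right smooth_Z]
      note s2 = smooth_on_mult[OF smooth_on_const smooth_\<zeta>]
      show ?thesis
        by (simp add: partial_add[OF smooth_on_add[OF s1 s2] smooth_on_const u] partial_add[OF s1 s2 u] partial_const
            partial_linear[OF bounded_linear_inner_right smooth_Z u] partial_mult[OF smooth_on_const smooth_\<zeta> u])
    qed
    ultimately have 1: "l \<bullet> partial i Z u + k * partial i \<zeta> u = - (det2 (P u) (partial i m u) + det2 (partial i P u) (m u))"
      by simp
    have 2: "det2 (partial i P u) (m u) = det2 Q (partial i Z u)"
      unfolding Q_def m_eq[OF u] by (simp add: sym[of i])
    have tr: "B $ 2 $ 2 = - B $ 1 $ 1 - k" using trace by simp
    show ?thesis
      using 1 unfolding 2 partial_m[OF u] conormal[OF u] R_def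
      by (simp add: det2_def matrix_vector_mult_def sum_2 inner_vec_def tr algebra_simps)
  qed
  have "Q - R u = 0"
    by (rule det2_eq_0_both[OF immersed[OF u]]) (rule key)+
  then show ?thesis by (simp add: Q_def)
qed

text \<open>\<open>R\<close> is the variation of the conormal under the group. Equality of the mixed partial derivatives in
  \<open>[R, P\<^sub>j] + [m, Z\<^sub>j] = 0\<close> gives the claim.\<close>
lemma det2_e: "u \<in> S \<Longrightarrow> det2 (P u) e = - k"
proof -
  assume u: "u \<in> S"
  define F where "F j u = det2 (R u) (partial j P u) + det2 (m u) (partial j Z u)" for j u
  note smP = smooth_on_partial[OF smooth_P open_S] and smZ = smooth_on_partial[OF smooth_Z open_S]
  \<comment> \<open>\<open>R\<close> and \<open>m\<close> have the same coefficients
    \<open>V\<close> in the derivatives of \<open>P\<close> and of \<open>Z\<close>, while the two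
    area forms are opposite by \<open>volume\<close>.\<close>
  have F0: "F j v = 0" if v: "v \<in> S" for j v
    unfolding F_def m_eq[OF v] R_eq[OF v]
    using exhaust_2[of j] volume[OF v] det2_commute[of "partial 2 P v" "partial 1 P v"] det2_commute[of "partial 2 Z v" "partial 1 Z v"]
    by auto
  have dF: "partial i (F j) u = det2 (R u) (partial i (partial j P) u) + det2 (partial i R u) (partial j P u)
      + (det2 (m u) (partial i (partial j Z) u) + det2 (partial i m u) (partial j Z u))" for i j
    unfolding F_def[abs_def]
    by (simp add: partial_add[OF smooth_on_det2[OF smooth_R smP] smooth_on_det2[OF smooth_m smZ] u]
        partial_det2[OF smooth_R smP u] partial_det2[OF smooth_m smZ u])
  have dF0: "partial i (F j) u = 0" for i j
  proof -
    have "partial i (F j) u = partial i (\<lambda>v. 0) u" by (rule partial_cong[OF open_S u F0])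
    then show ?thesis by (simp add: partial_const)
  qed
  have cZ: "partial 2 (partial 1 Z) u = partial 1 (partial 2 Z) u" "partial 2 (partial 1 P) u = partial 1 (partial 2 P) u"
    using partial_commute[OF open_S smooth_Z u] partial_commute[OF open_S smooth_P u] by blast+
  have tr: "B $ 2 $ 2 = - B $ 1 $ 1 - k" using trace by simp
  have "0 = partial 1 (F 2) u - partial 2 (F 1) u" using dF0 by simp
  \<comment> \<open>The second partial derivatives cancel by symmetry. What remains of the
    derivative of \<open>R\<close> is a multiple of the area of \<open>P\<close>, what remains of
    the derivative of \<open>m\<close> a multiple of the area of \<open>Z\<close>; since these areas
    are opposite, the two contributions add instead of cancelling.\<close>
  also have "\<dots> = (3 * k + 3 * det2 (P u) e) * det2 (partial 1 P u) (partial 2 P u)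
      - (k + det2 (P u) e) * det2 (partial 1 Z u) (partial 2 Z u)"
    unfolding dF cZ partial_R[OF u] partial_m[OF u] conormal[OF u]
    by (simp add: det2_def matrix_vector_mult_def sum_2 tr algebra_simps)
  also have "\<dots> = - 4 * (k + det2 (P u) e) * det2 (partial 1 Z u) (partial 2 Z u)"
    unfolding volume[OF u] by (simp add: algebra_simps)
  finally show ?thesis using immersed[OF u] by simp
qed

text \<open>If \<open>e\<close> were nonzero, the constancy of \<open>det2 P e\<close> would confine
  \<open>P\<close> to a line, but \<open>volume\<close> makes \<open>P\<close> an immersion.\<close>

lemma e_zero: "S \<noteq> {} \<Longrightarrow> e = 0 \<and> k = 0"
proof -
  assume "S \<noteq> {}"
  then obtain u where u: "u \<in> S" by blast
  have "det2 (partial i P u) e = 0" for i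
  proof -
    have "partial i (\<lambda>u. det2 (P u) e) u = partial i (\<lambda>u. - k) u"
      by (rule partial_cong[OF open_S u det2_e])
    then show ?thesis using partial_det2[OF smooth_P smooth_on_const u, of i e] by (simp add: partial_const)
  qed
  then have "det2 e (partial i P u) = 0" for i using det2_commute[of e "partial i P u"] by simp
  moreover have "det2 (partial 1 P u) (partial 2 P u) \<noteq> 0" using volume[OF u] immersed[OF u] by simp
  ultimately have "e = 0" using det2_eq_0_both by blast
  then show ?thesis using det2_e[OF u] by simp
qed

text \<open>Now both fields are affine with the same linear part and the same coefficients
  \<open>V\<close>, so sums and differences of the two equations are the tangency conditions for
  \<alpha> and \<beta>.\<close>

lemma tangent_half_sum:
  assumes "u \<in> S" "e = 0" "k = 0"
  defines "l' \<equiv> vector [- l $ 2, l $ 1]"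
  shows "B *v Z u + b = V 1 u *\<^sub>R partial 1 Z u + V 2 u *\<^sub>R partial 2 Z u"
    "B *v P u + l' = V 1 u *\<^sub>R partial 1 P u + V 2 u *\<^sub>R partial 2 P u"
proof -
  have "m u = B *v Z u + b" unfolding m_def using assms(2) by simp
  from trans[OF sym[OF this] m_eq[OF assms(1)]]
  show "B *v Z u + b = V 1 u *\<^sub>R partial 1 Z u + V 2 u *\<^sub>R partial 2 Z u" .
  have "R u = B *v P u + l'" unfolding R_def l'_def using assms(2,3) by simp
  from trans[OF sym[OF this] R_eq[OF assms(1)]]
  show "B *v P u + l' = V 1 u *\<^sub>R partial 1 P u + V 2 u *\<^sub>R partial 2 P u" .
qed

end

subsection \<open>Improper affine spheres as pairs of null curves\<close>

lemma det3_mult: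
  fixes L :: "real^3^3"
  shows "det3 (L *v x) (L *v y) (L *v z) = det L * det3 x y z"
proof -
  have "(vector [L *v x, L *v y, L *v z] :: real^3^3) = vector [x, y, z] ** transpose L"
    by (simp add: vec_eq_iff forall_3 vector_3 matrix_matrix_mult_def matrix_vector_mult_def transpose_def sum_3 algebra_simps)
  then show ?thesis by (simp add: det3_def det_mul)
qed

lemma normalize_vector:
  fixes \<xi> :: "real^3"
  assumes "\<xi> \<noteq> 0"
  obtains L M :: "real^3^3" where "det L = 1" "L *v \<xi> = axis 3 1" "L ** M = mat 1" "M ** L = mat 1"
proof -
  have "\<exists>x y. det3 x y \<xi> = 1"
  proof -
    consider "\<xi> $ 3 \<noteq> 0" | "\<xi> $ 1 \<noteq> 0" | "\<xi> $ 2 \<noteq> 0" using assms by (auto simp: vec_eq_iff forall_3)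
    then show ?thesis
    proof cases
      case 1
      then have "det3 (axis 1 (1 / \<xi> $ 3)) (axis 2 1) \<xi> = 1" by (simp add: det3_expand axis_def)
      then show ?thesis by blast
    next
      case 2
      then have "det3 (axis 2 1) (axis 3 (1 / \<xi> $ 1)) \<xi> = 1" by (simp add: det3_expand axis_def)
      then show ?thesis by blast
    next
      case 3
      then have "det3 (axis 3 1) (axis 1 (1 / \<xi> $ 2)) \<xi> = 1" by (simp add: det3_expand axis_def)
      then show ?thesis by blast
    qed
  qed
  then obtain x y where xy: "det3 x y \<xi> = 1" by blast
  define M where "M = transpose (vector [x, y, \<xi>] :: real^3^3)"
  have detM: "det M = 1" using xy by (simp add: M_def det3_def)
  have Me: "M *v axis 3 1 = \<xi>"
    by (simp add: M_def vec_eq_iff forall_3 matrix_vector_mult_def transpose_def sum_3 vector_3 axis_def)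
  obtain L where L: "M ** L = mat 1" "L ** M = mat 1"
    using invertible_det_nz[of M] detM by (auto simp: invertible_def)
  have "det M * det L = 1" using arg_cong[OF L(1), of det] by (simp add: det_mul)
  then have "det L = 1" using detM by simp
  moreover have "L *v \<xi> = axis 3 1"
    unfolding Me[symmetric] by (simp add: matrix_vector_mul_assoc L(2))
  ultimately show ?thesis using that L by blast
qed

context surface
begin

text \<open>The chain rule in the form that transports an equation between differentials from one
  chart to another; the coefficients \<open>w\<close> are the same for every function.\<close>

lemma partial_change_chart:
  fixes f :: "'p \<Rightarrow> 'b::real_normed_vector"
  assumes "smooth_fun A f" "c \<in> A" "c' \<in> A" "p \<in> fst c" "p \<in> fst c'"
  defines "w \<equiv> \<lambda>i. partial i (in_chart c (snd c')) (snd c p)"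
  shows "partial i (in_chart c f) (snd c p) =
    w i $ 1 *\<^sub>R partial 1 (in_chart c' f) (snd c' p) + w i $ 2 *\<^sub>R partial 2 (in_chart c' f) (snd c' p)"
proof -
  define O' where "O' = snd c ` (fst c \<inter> fst c')"
  have O': "open O'" "snd c p \<in> O'"
    unfolding O'_def using open_chart_image[OF assms(2) chart_homeomorphic(1)[OF assms(3)]] assms(4,5) by auto
  define \<tau> where "\<tau> = in_chart c (snd c')"
  have sm\<tau>: "smooth_on O' \<tau>" unfolding O'_def \<tau>_def by (rule smooth_transition[OF assms(2,3)])
  have \<tau>p: "\<tau> (snd c p) = snd c' p" unfolding \<tau>_def by (rule in_chart_apply[OF assms(2,4)])
  have smf: "smooth_on (chart_image c') (in_chart c' f)" using assms(1,3) by (simp add: smooth_fun_def)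
  have eq: "in_chart c' f (\<tau> v) = in_chart c f v" if "v \<in> O'" for v
  proof -
    obtain q where q: "q \<in> fst c" "q \<in> fst c'" "v = snd c q" using \<open>v \<in> O'\<close> by (auto simp: O'_def)
    show ?thesis unfolding q(3) \<tau>_def in_chart_apply[OF assms(2) q(1)] in_chart_apply[OF assms(3) q(2)] ..
  qed
  have "((\<lambda>v. in_chart c' f (\<tau> v)) has_derivative
      (\<lambda>h. frechet_derivative \<tau> (at (snd c p)) h $ 1 *\<^sub>R partial 1 (in_chart c' f) (snd c' p)
         + frechet_derivative \<tau> (at (snd c p)) h $ 2 *\<^sub>R partial 2 (in_chart c' f) (snd c' p))) (at (snd c p))"
    using has_derivative_compose[OF smooth_on_has_derivative[OF sm\<tau> O'(2)],
        of "in_chart c' f" "\<lambda>w. w $ 1 *\<^sub>R partial 1 (in_chart c' f) (snd c' p) + w $ 2 *\<^sub>R partial 2 (in_chart c' f) (snd c' p)"]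
      smooth_on_has_derivative_partial[OF smf chart_imageI[OF assms(5)]]
    by (simp add: \<tau>p)
  then have "(in_chart c f has_derivative
      (\<lambda>h. frechet_derivative \<tau> (at (snd c p)) h $ 1 *\<^sub>R partial 1 (in_chart c' f) (snd c' p)
         + frechet_derivative \<tau> (at (snd c p)) h $ 2 *\<^sub>R partial 2 (in_chart c' f) (snd c' p))) (at (snd c p))"
    by (rule has_derivative_transform_within_open[OF _ O' eq])
  from partial_eqI[OF this, of i] show ?thesis by (simp add: w_def \<tau>_def partial_def)
qed

end

locale affine_sphere = surface X A for X :: "'p topology" and A +
  fixes y :: "'p \<Rightarrow> real^3"
  assumes smooth_y: "smooth_fun A y"
    and transversal: "\<And>c u. c \<in> A \<Longrightarrow> u \<in> chart_image c \<Longrightarrow>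
      det3 (partial 1 (in_chart c y) u) (partial 2 (in_chart c y) u) (axis 3 1) \<noteq> 0"
    and metric_symmetric: "\<And>c u. c \<in> A \<Longrightarrow> u \<in> chart_image c \<Longrightarrow>
      affine_metric y (axis 3 1) c u $ 1 $ 2 = affine_metric y (axis 3 1) c u $ 2 $ 1"
    and metric_volume: "\<And>c u. c \<in> A \<Longrightarrow> u \<in> chart_image c \<Longrightarrow>
      (affine_metric y (axis 3 1) c u $ 1 $ 2)\<^sup>2 - affine_metric y (axis 3 1) c u $ 1 $ 1 * affine_metric y (axis 3 1) c u $ 2 $ 2
        = (det3 (partial 1 (in_chart c y) u) (partial 2 (in_chart c y) u) (axis 3 1))\<^sup>2"
begin

definition Z :: "'p \<Rightarrow> real^2" where "Z p = (\<chi> i. if i = 1 then y p $ 1 else y p $ 2)"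
definition \<zeta> :: "'p \<Rightarrow> real" where "\<zeta> p = y p $ 3"

lemma Z_nth: "Z p $ 1 = y p $ 1" "Z p $ 2 = y p $ 2"
  by (simp_all add: Z_def)

lemma chart_y: "c \<in> A \<Longrightarrow> smooth_on (chart_image c) (in_chart c y)"
  using smooth_y by (simp add: smooth_fun_def)

lemma in_chart_Z: "in_chart c Z u $ 1 = in_chart c y u $ 1" "in_chart c Z u $ 2 = in_chart c y u $ 2"
  and in_chart_\<zeta>: "in_chart c \<zeta> u = in_chart c y u $ 3"
  by (simp_all add: in_chart_def Z_nth \<zeta>_def)

lemma chart_Z: "c \<in> A \<Longrightarrow> smooth_on (chart_image c) (in_chart c Z)"
proof (rule smooth_on_vecI)
  fix i :: 2 assume c: "c \<in> A"
  show "smooth_on (chart_image c) (\<lambda>u. in_chart c Z u $ i)"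
    using exhaust_2[of i] smooth_on_vec_nth[OF chart_y[OF c], of 1] smooth_on_vec_nth[OF chart_y[OF c], of 2]
    by (auto simp: in_chart_Z)
qed

lemma chart_\<zeta>: "c \<in> A \<Longrightarrow> smooth_on (chart_image c) (in_chart c \<zeta>)"
  using smooth_on_vec_nth[OF chart_y, of c 3] by (simp add: in_chart_\<zeta>[abs_def])

lemma smooth_Z: "smooth_fun A Z" and smooth_\<zeta>: "smooth_fun A \<zeta>"
  using chart_Z chart_\<zeta> by (auto simp: smooth_fun_def)

lemma partial_Z:
  assumes "c \<in> A" "u \<in> chart_image c"
  shows "partial i (in_chart c Z) u $ 1 = partial i (in_chart c y) u $ 1"
    "partial i (in_chart c Z) u $ 2 = partial i (in_chart c y) u $ 2"
    "partial i (in_chart c \<zeta>) u = partial i (in_chart c y) u $ 3"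
proof -
  have "partial i (\<lambda>u. in_chart c Z u $ 1) u = partial i (\<lambda>u. in_chart c y u $ 1) u"
    "partial i (\<lambda>u. in_chart c Z u $ 2) u = partial i (\<lambda>u. in_chart c y u $ 2) u"
    "partial i (in_chart c \<zeta>) u = partial i (\<lambda>u. in_chart c y u $ 3) u"
    by (simp_all only: in_chart_Z in_chart_\<zeta>[abs_def])
  then show "partial i (in_chart c Z) u $ 1 = partial i (in_chart c y) u $ 1"
    "partial i (in_chart c Z) u $ 2 = partial i (in_chart c y) u $ 2"
    "partial i (in_chart c \<zeta>) u = partial i (in_chart c y) u $ 3"
    by (simp_all add: partial_vec_nth[OF chart_Z[OF assms(1)] assms(2)] partial_vec_nth[OF chart_y[OF assms(1)] assms(2)])
qed

definition J :: "'p chart \<Rightarrow> real^2 \<Rightarrow> real" where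
  "J c u = det2 (partial 1 (in_chart c Z) u) (partial 2 (in_chart c Z) u)"

lemma J_det3: "c \<in> A \<Longrightarrow> u \<in> chart_image c \<Longrightarrow>
    det3 (partial 1 (in_chart c y) u) (partial 2 (in_chart c y) u) (axis 3 1) = J c u"
  by (simp add: J_def det3_expand det2_def partial_Z axis_def)

lemma J_nonzero: "c \<in> A \<Longrightarrow> u \<in> chart_image c \<Longrightarrow> J c u \<noteq> 0"
  using transversal J_det3 by metis

definition chart_conormal :: "'p chart \<Rightarrow> real^2 \<Rightarrow> real^2" where
  "chart_conormal c u = (1 / J c u) *\<^sub>R (partial 1 (in_chart c \<zeta>) u *\<^sub>R partial 2 (in_chart c Z) u
     - partial 2 (in_chart c \<zeta>) u *\<^sub>R partial 1 (in_chart c Z) u)"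

lemma chart_conormal_eq:
  assumes "c \<in> A" "u \<in> chart_image c"
  shows "partial i (in_chart c \<zeta>) u = - det2 (chart_conormal c u) (partial i (in_chart c Z) u)"
proof -
  define z w p q where "z = partial 1 (in_chart c Z) u" and "w = partial 2 (in_chart c Z) u"
    and "p = partial 1 (in_chart c \<zeta>) u" and "q = partial 2 (in_chart c \<zeta>) u"
  have n: "chart_conormal c u = (1 / det2 z w) *\<^sub>R (p *\<^sub>R w - q *\<^sub>R z)"
    by (simp add: chart_conormal_def J_def z_def w_def p_def q_def)
  have nz: "det2 z w \<noteq> 0" using J_nonzero[OF assms] by (simp add: J_def z_def w_def)
  have "p = - det2 (chart_conormal c u) z" "q = - det2 (chart_conormal c u) w"
    unfolding n using nz det2_commute[of w z] by simp_all
  then show ?thesis using exhaust_2[of i] by (auto simp: z_def w_def p_def q_def)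
qed

lemma chart_conormal_unique:
  assumes "c \<in> A" "u \<in> chart_image c"
    "\<And>i. partial i (in_chart c \<zeta>) u = - det2 q (partial i (in_chart c Z) u)"
  shows "q = chart_conormal c u"
proof -
  have "det2 (q - chart_conormal c u) (partial i (in_chart c Z) u) = 0" for i
    using assms(3)[of i] chart_conormal_eq[OF assms(1,2), of i] by simp
  then have "q - chart_conormal c u = 0"
    using det2_eq_0_both J_nonzero[OF assms(1,2)] unfolding J_def by blast
  then show ?thesis by simp
qed

lemma smooth_chart_conormal: "c \<in> A \<Longrightarrow> smooth_on (chart_image c) (chart_conormal c)"
proof -
  assume c: "c \<in> A"
  note o = chart_homeomorphic(2)[OF c]
  note s = smooth_on_partial[OF chart_Z[OF c] o] smooth_on_partial[OF chart_\<zeta>[OF c] o]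
  have "smooth_on (chart_image c) (J c)" unfolding J_def by (intro smooth_on_det2 s)
  then show ?thesis
    unfolding chart_conormal_def
    using J_nonzero[OF c] by (intro smooth_on_scaleR smooth_on_divide smooth_on_const smooth_on_diff s o) auto
qed

definition P :: "'p \<Rightarrow> real^2" where
  "P p = (let c = SOME c. c \<in> A \<and> p \<in> fst c in chart_conormal c (snd c p))"

text \<open>The conormal equation determines its solution at a point, because the derivatives of
  \<open>Z\<close> are independent, and it is preserved under a change of chart. Hence the chart
  picked by \<open>SOME\<close> is immaterial.\<close>

lemma P_chart: "c \<in> A \<Longrightarrow> p \<in> fst c \<Longrightarrow> P p = chart_conormal c (snd c p)"
proof -
  assume c: "c \<in> A" "p \<in> fst c"
  define c' where "c' = (SOME c. c \<in> A \<and> p \<in> fst c)"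
  have c': "c' \<in> A" "p \<in> fst c'" unfolding c'_def using someI[of "\<lambda>c. c \<in> A \<and> p \<in> fst c" c] c by auto
  have "chart_conormal c' (snd c' p) = chart_conormal c (snd c p)"
  proof (rule chart_conormal_unique[OF c(1) chart_imageI[OF c(2)]])
    fix i
    show "partial i (in_chart c \<zeta>) (snd c p) = - det2 (chart_conormal c' (snd c' p)) (partial i (in_chart c Z) (snd c p))"
      unfolding partial_change_chart[OF smooth_\<zeta> c(1) c'(1) c(2) c'(2)] partial_change_chart[OF smooth_Z c(1) c'(1) c(2) c'(2)]
        chart_conormal_eq[OF c'(1) chart_imageI[OF c'(2)]]
      by simp
  qed
  then show ?thesis by (simp add: P_def c'_def[symmetric] Let_def)
qed

lemma in_chart_P: "c \<in> A \<Longrightarrow> u \<in> chart_image c \<Longrightarrow> in_chart c P u = chart_conormal c u"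
  using P_chart[of c "chart_inv c u"] chart_inv_in[of u c] chart_inv_right[of u c] by (simp add: in_chart_def)

lemma chart_P: "c \<in> A \<Longrightarrow> smooth_on (chart_image c) (in_chart c P)"
  by (rule smooth_on_cong[OF chart_homeomorphic(2) in_chart_P[symmetric] smooth_chart_conormal])

lemma conormal_eq:
  "c \<in> A \<Longrightarrow> u \<in> chart_image c \<Longrightarrow> partial i (in_chart c \<zeta>) u = - det2 (in_chart c P u) (partial i (in_chart c Z) u)"
  using chart_conormal_eq in_chart_P by simp

lemma metric_eq:
  assumes c: "c \<in> A" and u: "u \<in> chart_image c"
  shows "affine_metric y (axis 3 1) c u $ i $ j = - det2 (partial i (in_chart c P) u) (partial j (in_chart c Z) u)"
proof -
  have "partial i (in_chart c y) v $ 3 = - det2 (in_chart c P v) (partial i (in_chart c Z) v)" if "v \<in> chart_image c" for v i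
    using conormal_eq[OF c that, of i] by (simp add: partial_Z(3)[OF c that])
  then show ?thesis
    using affine_metric_conormal(2)[OF chart_homeomorphic(2)[OF c] u chart_y[OF c] chart_Z[OF c] chart_P[OF c]
        in_chart_Z(1)[symmetric] in_chart_Z(2)[symmetric], of i j]
      J_nonzero[OF c u] by (simp add: affine_metric_def J_def)
qed

lemma symmetric: "c \<in> A \<Longrightarrow> u \<in> chart_image c \<Longrightarrow>
    det2 (partial 1 (in_chart c P) u) (partial 2 (in_chart c Z) u) = det2 (partial 2 (in_chart c P) u) (partial 1 (in_chart c Z) u)"
  using metric_symmetric[of c u] by (simp add: metric_eq)

text \<open>By the Pluecker relation the product of the areas of \<open>P\<close> and
  \<open>Z\<close> is the determinant of the metric, and the volume condition makes this minus the
  square of the area of \<open>Z\<close>. The Lorentzian signature is what fixes the sign.\<close>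

lemma volume:
  assumes c: "c \<in> A" and u: "u \<in> chart_image c"
  shows "det2 (partial 1 (in_chart c P) u) (partial 2 (in_chart c P) u) = - J c u"
proof -
  define p q z w where "p = partial 1 (in_chart c P) u" and "q = partial 2 (in_chart c P) u"
    and "z = partial 1 (in_chart c Z) u" and "w = partial 2 (in_chart c Z) u"
  have s: "det2 p w = det2 q z" using symmetric[OF c u] by (simp add: p_def q_def z_def w_def)
  have v: "(det2 p w)\<^sup>2 - det2 p z * det2 q w = (det2 z w)\<^sup>2"
    using metric_volume[OF c u] unfolding metric_eq[OF c u] J_det3[OF c u] by (simp add: J_def p_def q_def z_def w_def)
  have "det2 p q * det2 z w = det2 p z * det2 q w - det2 q z * det2 p w" by (simp add: det2_plucker)
  also have "\<dots> = - (det2 z w)\<^sup>2" using v s by (simp add: power2_eq_square)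
  finally have "(det2 p q + det2 z w) * det2 z w = 0" by (simp add: power2_eq_square algebra_simps)
  moreover have "det2 z w \<noteq> 0" using J_nonzero[OF c u] by (simp add: J_def z_def w_def)
  ultimately have "det2 p q = - det2 z w" by (simp add: add_eq_0_iff2)
  then show ?thesis by (simp add: J_def p_def q_def z_def w_def)
qed

definition \<alpha> :: "'p \<Rightarrow> real^2" where "\<alpha> p = (1/2) *\<^sub>R (Z p + P p)"
definition \<beta> :: "'p \<Rightarrow> real^2" where "\<beta> p = (1/2) *\<^sub>R (Z p - P p)"

lemma in_chart_\<alpha>: "in_chart c \<alpha> = (\<lambda>u. (1/2) *\<^sub>R (in_chart c Z u + in_chart c P u))"
  and in_chart_\<beta>: "in_chart c \<beta> = (\<lambda>u. (1/2) *\<^sub>R (in_chart c Z u - in_chart c P u))"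
  by (simp_all add: in_chart_def \<alpha>_def \<beta>_def fun_eq_iff)

lemma partial_\<alpha>\<beta>:
  assumes c: "c \<in> A" and u: "u \<in> chart_image c"
  shows "partial i (in_chart c \<alpha>) u = (1/2) *\<^sub>R (partial i (in_chart c Z) u + partial i (in_chart c P) u)"
    "partial i (in_chart c \<beta>) u = (1/2) *\<^sub>R (partial i (in_chart c Z) u - partial i (in_chart c P) u)"
  unfolding in_chart_\<alpha> in_chart_\<beta>
  by (simp_all only: partial_linear[OF bounded_linear_scaleR_right smooth_on_add[OF chart_Z[OF c] chart_P[OF c]] u]
      partial_linear[OF bounded_linear_scaleR_right smooth_on_diff[OF chart_Z[OF c] chart_P[OF c]] u]
      partial_add[OF chart_Z[OF c] chart_P[OF c] u] partial_diff[OF chart_Z[OF c] chart_P[OF c] u])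

text \<open>In the Jacobian of \<alpha> or \<beta> the pure terms cancel by \<open>volume\<close>
  and the mixed terms by the symmetry of the metric; that is why the half sum and the half
  difference have rank one.\<close>

lemma null_pair: "null_pair X A \<alpha> \<beta> (affine_metric y (axis 3 1))"
proof (intro null_pair.intro null_pair_axioms.intro)
  show "surface X A" by (rule surface_axioms)
  have sm: "smooth_on (chart_image c) (in_chart c \<alpha>)" "smooth_on (chart_image c) (in_chart c \<beta>)" if "c \<in> A" for c
    unfolding in_chart_\<alpha> in_chart_\<beta>
    by (intro smooth_on_scaleR smooth_on_const smooth_on_add smooth_on_diff chart_Z chart_P that)+
  show "smooth_fun A \<alpha>" "smooth_fun A \<beta>" using sm by (auto simp: smooth_fun_def)
  show "chart_pair (chart_image c) (in_chart c \<alpha>) (in_chart c \<beta>) (affine_metric y (axis 3 1) c)" if c: "c \<in> A" for c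
  proof (rule chart_pair.intro)
    show "open (chart_image c)" by (rule chart_homeomorphic(2)[OF c])
    show "smooth_on (chart_image c) (in_chart c \<alpha>)" "smooth_on (chart_image c) (in_chart c \<beta>)" by (rule sm[OF c])+
    show "affine_metric y (axis 3 1) c u $ i $ j =
       - (det2 (partial i (in_chart c \<alpha>) u) (partial j (in_chart c \<beta>) u) + det2 (partial j (in_chart c \<alpha>) u) (partial i (in_chart c \<beta>) u))"
      if u: "u \<in> chart_image c" for u i j
    proof -
      have "det2 (partial i (in_chart c P) u) (partial j (in_chart c Z) u) = det2 (partial j (in_chart c P) u) (partial i (in_chart c Z) u)"
        using symmetric[OF c u] exhaust_2[of i] exhaust_2[of j] by auto
      then show ?thesis
        unfolding metric_eq[OF c u] partial_\<alpha>\<beta>[OF c u] by (simp add: det2_def algebra_simps)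
    qed
    fix u assume u: "u \<in> chart_image c"
    note sv = symmetric[OF c u] volume[OF c u, unfolded J_def]
    show "det2 (partial 1 (in_chart c \<alpha>) u) (partial 2 (in_chart c \<alpha>) u) = 0"
      "det2 (partial 1 (in_chart c \<beta>) u) (partial 2 (in_chart c \<beta>) u) = 0"
      unfolding partial_\<alpha>\<beta>[OF c u] using sv by (simp_all add: det2_def algebra_simps)
    have "det2 (partial 1 (in_chart c \<alpha>) u) (partial 2 (in_chart c \<beta>) u) - det2 (partial 2 (in_chart c \<alpha>) u) (partial 1 (in_chart c \<beta>) u)
        = (det2 (partial 1 (in_chart c Z) u) (partial 2 (in_chart c Z) u) - det2 (partial 1 (in_chart c P) u) (partial 2 (in_chart c P) u)) / 2"
      unfolding partial_\<alpha>\<beta>[OF c u] by (simp add: det2_def field_simps)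
    also have "\<dots> = J c u" using volume[OF c u] by (simp add: J_def)
    finally show "det2 (partial 1 (in_chart c \<alpha>) u) (partial 2 (in_chart c \<beta>) u) - det2 (partial 2 (in_chart c \<alpha>) u) (partial 1 (in_chart c \<beta>) u) \<noteq> 0"
      using J_nonzero[OF c u] by simp
  qed
qed

end

subsection \<open>Geodesics of \<open>cosh (2 (t - d)) (ds\<^sup>2 - dt\<^sup>2)\<close>\<close>

lemma inverse_sqrt_deriv:
  "((\<lambda>y::real. 1 / sqrt (1 + y\<^sup>2)) has_real_derivative - y / (sqrt (1 + y\<^sup>2) * (1 + y\<^sup>2))) (at y)"
proof -
  have "1 + y\<^sup>2 > 0" by (simp add: add_pos_nonneg)
  then show ?thesis by (auto intro!: derivative_eq_intros simp: field_simps power2_eq_square)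
qed

lemma div_sqrt_deriv:
  "((\<lambda>y::real. y / sqrt (1 + y\<^sup>2)) has_real_derivative 1 / (sqrt (1 + y\<^sup>2) * (1 + y\<^sup>2))) (at y)"
proof -
  have pos: "1 + y\<^sup>2 > 0" by (simp add: add_pos_nonneg)
  have "((\<lambda>y::real. y * (1 / sqrt (1 + y\<^sup>2))) has_real_derivative
     1 * (1 / sqrt (1 + y\<^sup>2)) + - y / (sqrt (1 + y\<^sup>2) * (1 + y\<^sup>2)) * y) (at y)"
    by (rule DERIV_mult[OF DERIV_ident inverse_sqrt_deriv])
  moreover have "1 * (1 / sqrt (1 + y\<^sup>2)) + - y / (sqrt (1 + y\<^sup>2) * (1 + y\<^sup>2)) * y = 1 / (sqrt (1 + y\<^sup>2) * (1 + y\<^sup>2))"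
  proof -
    define r where "r = sqrt (1 + y\<^sup>2)"
    define q where "q = 1 + y\<^sup>2"
    have "r > 0" "q > 0" using pos by (simp_all add: r_def q_def)
    then have "1 * (1 / r) + - y / (r * q) * y = (q - y * y) / (r * q)" by (simp add: field_simps)
    also have "q - y * y = 1" by (simp add: q_def power2_eq_square)
    finally show ?thesis by (simp only: r_def q_def)
  qed
  ultimately show ?thesis by simp
qed

lemma real_lipschitz_from_derivative:
  fixes f :: "real \<Rightarrow> real"
  assumes "\<And>y. (f has_real_derivative f' y) (at y)" "\<And>y. \<bar>f' y\<bar> \<le> 1"
  shows "\<bar>f y - f z\<bar> \<le> \<bar>y - z\<bar>"
proof -
  have "norm (f y - f z) \<le> 1 * norm (y - z)"
    by (rule field_differentiable_bound[of UNIV f f']) (use assms in auto)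
  then show ?thesis by simp
qed

lemma sqrt_lipschitz:
  "\<bar>y / sqrt (1 + y\<^sup>2) - z / sqrt (1 + z\<^sup>2)\<bar> \<le> \<bar>y - z\<bar>"
  "\<bar>1 / sqrt (1 + y\<^sup>2) - 1 / sqrt (1 + z\<^sup>2)\<bar> \<le> \<bar>y - z\<bar>" for y z :: real
proof -
  have ge: "sqrt (1 + y\<^sup>2) * (1 + y\<^sup>2) \<ge> 1" for y :: real
    using mult_mono[of 1 "sqrt (1 + y\<^sup>2)" 1 "1 + y\<^sup>2"] by simp
  have le: "\<bar>y\<bar> \<le> sqrt (1 + y\<^sup>2) * (1 + y\<^sup>2)" for y :: real
  proof -
    have "\<bar>y\<bar> \<le> sqrt (1 + y\<^sup>2)" by (rule real_le_rsqrt) simp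
    also have "sqrt (1 + y\<^sup>2) * 1 \<le> sqrt (1 + y\<^sup>2) * (1 + y\<^sup>2)" by (intro mult_left_mono) auto
    then have "sqrt (1 + y\<^sup>2) \<le> sqrt (1 + y\<^sup>2) * (1 + y\<^sup>2)" by simp
    finally show ?thesis .
  qed
  have q1: "\<bar>x / P\<bar> \<le> 1" if "\<bar>x\<bar> \<le> 1" "P \<ge> 1" for x P :: real
    using that by (simp add: abs_divide divide_le_eq_1)
  have q2: "\<bar>x / P\<bar> \<le> 1" if "\<bar>x\<bar> \<le> P" "P \<ge> 1" for x P :: real
    using that by (simp add: abs_divide divide_le_eq_1)
  show "\<bar>y / sqrt (1 + y\<^sup>2) - z / sqrt (1 + z\<^sup>2)\<bar> \<le> \<bar>y - z\<bar>"
    by (rule real_lipschitz_from_derivative[OF div_sqrt_deriv]) (rule q1[OF _ ge], simp)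
  have "\<bar>- y / (sqrt (1 + y\<^sup>2) * (1 + y\<^sup>2))\<bar> \<le> 1" for y :: real
    by (rule q2[OF _ ge]) (use le in simp)
  then show "\<bar>1 / sqrt (1 + y\<^sup>2) - 1 / sqrt (1 + z\<^sup>2)\<bar> \<le> \<bar>y - z\<bar>"
    by (rule real_lipschitz_from_derivative[OF inverse_sqrt_deriv])
qed

lemma tanh_arsinh_real: "tanh (arsinh y) = y / sqrt (1 + y\<^sup>2)" for y :: real
  by (simp add: tanh_def cosh_arsinh_real add.commute)

text \<open>With the constants \<open>\<kappa> = cosh s'\<close> and \<open>e = cosh (s'\<^sup>2 - \<tau>'\<^sup>2)\<close> of motion, \<open>Y = sinh (2 (\<tau> - d))\<close>
  satisfies \<open>Y'' = - 2 e Y / sqrt (1 + Y\<^sup>2)\<close> and \<open>s' = \<kappa> / sqrt (1 + Y\<^sup>2)\<close>, a globally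
  Lipschitz system.\<close>
lemma cosh_geodesic_extension:
  fixes s s1 s2 \<tau> \<tau>1 \<tau>2 :: "real \<Rightarrow> real" and d :: real
  assumes I: "open I" "is_interval I" "I \<noteq> {}"
    and s: "\<And>t. t \<in> I \<Longrightarrow> (s has_real_derivative s1 t) (at t)"
      "\<And>t. t \<in> I \<Longrightarrow> (s1 has_real_derivative s2 t) (at t)"
    and \<tau>: "\<And>t. t \<in> I \<Longrightarrow> (\<tau> has_real_derivative \<tau>1 t) (at t)"
      "\<And>t. t \<in> I \<Longrightarrow> (\<tau>1 has_real_derivative \<tau>2 t) (at t)"
    and eq: "\<And>t. t \<in> I \<Longrightarrow> s2 t = - 2 * tanh (2 * (\<tau> t - d)) * s1 t * \<tau>1 t"
      "\<And>t. t \<in> I \<Longrightarrow> \<tau>2 t = - tanh (2 * (\<tau> t - d)) * ((s1 t)\<^sup>2 + (\<tau>1 t)\<^sup>2)"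
  obtains S S1 S2 \<T> \<T>1 \<T>2 where
    "\<And>t. (S has_real_derivative S1 t) (at t)" "\<And>t. (S1 has_real_derivative S2 t) (at t)"
    "\<And>t. (\<T> has_real_derivative \<T>1 t) (at t)" "\<And>t. (\<T>1 has_real_derivative \<T>2 t) (at t)"
    "\<And>t. S2 t = - 2 * tanh (2 * (\<T> t - d)) * S1 t * \<T>1 t"
    "\<And>t. \<T>2 t = - tanh (2 * (\<T> t - d)) * ((S1 t)\<^sup>2 + (\<T>1 t)\<^sup>2)"
    "\<And>t. t \<in> I \<Longrightarrow> S t = s t \<and> \<T> t = \<tau> t"
proof -
  obtain t1 where t1: "t1 \<in> I" using I(3) by blast
  have conv: "convex I" using I(2) is_interval_convex by blast
  define C where "C t = cosh (2 * (\<tau> t - d))" for t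
  define Y where "Y t = sinh (2 * (\<tau> t - d))" for t
  have Cpos: "C t > 0" for t by (simp add: C_def)
  have CY: "sqrt (1 + (Y t)\<^sup>2) = C t" for t
  proof -
    have "1 + (Y t)\<^sup>2 = (C t)\<^sup>2"
      unfolding C_def Y_def using cosh_square_eq[of "2 * (\<tau> t - d)"] by linarith
    then show ?thesis using Cpos[of t] by simp
  qed
  have tanhYC: "tanh (2 * (\<tau> t - d)) = Y t / C t" for t by (simp add: tanh_def C_def Y_def)
  have dC: "(C has_real_derivative 2 * Y t * \<tau>1 t) (at t)" and dY: "(Y has_real_derivative 2 * C t * \<tau>1 t) (at t)"
    if "t \<in> I" for t
    unfolding C_def[abs_def] Y_def[abs_def]
    by (auto intro!: derivative_eq_intros \<tau>(1)[OF that] simp: C_def Y_def)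
  define \<kappa> where "\<kappa> = C t1 * s1 t1"
  define e where "e = C t1 * ((s1 t1)\<^sup>2 - (\<tau>1 t1)\<^sup>2)"
  have s2C: "C t * s2 t = - 2 * Y t * s1 t * \<tau>1 t" and \<tau>2C: "C t * \<tau>2 t = - Y t * ((s1 t)\<^sup>2 + (\<tau>1 t)\<^sup>2)" if "t \<in> I" for t
    unfolding eq(1)[OF that] eq(2)[OF that] tanhYC using Cpos[of t] by simp_all
  have const: "F t = F t1" if "t \<in> I" "\<And>r. r \<in> I \<Longrightarrow> (F has_real_derivative 0) (at r)" for F :: "real \<Rightarrow> real" and t
  proof (rule has_derivative_zero_unique[OF conv _ that(1) t1])
    fix r assume "r \<in> I"
    from that(2)[OF this] have "(F has_derivative (\<lambda>h. 0)) (at r)" by (simp add: has_field_derivative_def lambda_zero)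
    then show "(F has_derivative (\<lambda>h. 0)) (at r within I)" by (rule has_derivative_at_withinI)
  qed
  have \<kappa>: "C t * s1 t = \<kappa>" if "t \<in> I" for t
    unfolding \<kappa>_def
  proof (rule const[OF that])
    fix r assume r: "r \<in> I"
    have "((\<lambda>t. C t * s1 t) has_real_derivative 2 * Y r * \<tau>1 r * s1 r + C r * s2 r) (at r)"
      by (auto intro!: derivative_eq_intros dC[OF r] s(2)[OF r])
    then show "((\<lambda>t. C t * s1 t) has_real_derivative 0) (at r)" by (simp add: s2C[OF r])
  qed
  have e: "C t * ((s1 t)\<^sup>2 - (\<tau>1 t)\<^sup>2) = e" if "t \<in> I" for t
    unfolding e_def
  proof (rule const[OF that])
    fix r assume r: "r \<in> I"
    have "((\<lambda>t. C t * ((s1 t)\<^sup>2 - (\<tau>1 t)\<^sup>2)) has_real_derivative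
       2 * Y r * \<tau>1 r * ((s1 r)\<^sup>2 - (\<tau>1 r)\<^sup>2) + (2 * s1 r * (C r * s2 r) - 2 * \<tau>1 r * (C r * \<tau>2 r))) (at r)"
      by (auto intro!: derivative_eq_intros dC[OF r] s(2)[OF r] \<tau>(2)[OF r] simp: algebra_simps)
    moreover have "2 * Y r * \<tau>1 r * ((s1 r)\<^sup>2 - (\<tau>1 r)\<^sup>2) + (2 * s1 r * (C r * s2 r) - 2 * \<tau>1 r * (C r * \<tau>2 r)) = 0"
      unfolding s2C[OF r] \<tau>2C[OF r] by (simp add: power2_eq_square algebra_simps)
    ultimately show "((\<lambda>t. C t * ((s1 t)\<^sup>2 - (\<tau>1 t)\<^sup>2)) has_real_derivative 0) (at r)" by simp
  qed
  \<comment> \<open>The derivative of \<open>Y\<close>. The constant \<open>e\<close> eliminates the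
    velocities from its derivative, which becomes a bounded function of \<open>Y\<close>
    alone.\<close>
  define W where "W t = 2 * C t * \<tau>1 t" for t
  have dW: "(W has_real_derivative - 2 * e * (Y t / C t)) (at t)" if t: "t \<in> I" for t
  proof -
    have "(W has_real_derivative 4 * Y t * \<tau>1 t * \<tau>1 t + 2 * (C t * \<tau>2 t)) (at t)"
      unfolding W_def by (auto intro!: derivative_eq_intros dC[OF t] \<tau>(2)[OF t] simp: algebra_simps)
    moreover have "4 * Y t * \<tau>1 t * \<tau>1 t + 2 * (C t * \<tau>2 t) = - 2 * Y t * ((s1 t)\<^sup>2 - (\<tau>1 t)\<^sup>2)"
      unfolding \<tau>2C[OF t] by (simp add: power2_eq_square algebra_simps)
    moreover have "(s1 t)\<^sup>2 - (\<tau>1 t)\<^sup>2 = e / C t" using e[OF t] Cpos[of t] by (simp add: field_simps)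
    ultimately show ?thesis by (simp add: mult.commute mult.left_commute)
  qed
  \<comment> \<open>The state consists of \<open>Y\<close>, its derivative and \<open>s\<close>; the
    last component is only integrated, so the right-hand side is Lipschitz on the whole
    space.\<close>
  define F :: "real \<times> real \<times> real \<Rightarrow> real \<times> real \<times> real" where "F = (\<lambda>(y, w, r::real). (w, - 2 * e * (y / sqrt (1 + y\<^sup>2)), \<kappa> * (1 / sqrt (1 + y\<^sup>2))))"
  define L where "L = 1 + 2 * \<bar>e\<bar> + \<bar>\<kappa>\<bar>"
  have lip: "L-lipschitz_on UNIV F"
  proof (rule lipschitz_onI)
    fix x x' :: "real \<times> real \<times> real"
    obtain y w r y' w' r' where x: "x = (y, w, r)" "x' = (y', w', r')" by (metis prod.exhaust)
    have "dist (F x) (F x') \<le> \<bar>w - w'\<bar> + (\<bar>- 2 * e * (y / sqrt (1 + y\<^sup>2)) - - 2 * e * (y' / sqrt (1 + y'\<^sup>2))\<bar>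
        + \<bar>\<kappa> * (1 / sqrt (1 + y\<^sup>2)) - \<kappa> * (1 / sqrt (1 + y'\<^sup>2))\<bar>)"
      unfolding x F_def dist_norm prod.case diff_Pair
      by (intro order_trans[OF norm_Pair_le] add_mono) (auto simp: norm_Pair_le[THEN order_trans])
    also have "\<dots> = \<bar>w - w'\<bar> + (2 * \<bar>e\<bar> * \<bar>y / sqrt (1 + y\<^sup>2) - y' / sqrt (1 + y'\<^sup>2)\<bar> + \<bar>\<kappa>\<bar> * \<bar>1 / sqrt (1 + y\<^sup>2) - 1 / sqrt (1 + y'\<^sup>2)\<bar>)"
    proof -
      have "- 2 * e * (y / sqrt (1 + y\<^sup>2)) - - 2 * e * (y' / sqrt (1 + y'\<^sup>2)) = - 2 * e * (y / sqrt (1 + y\<^sup>2) - y' / sqrt (1 + y'\<^sup>2))"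
        "\<kappa> * (1 / sqrt (1 + y\<^sup>2)) - \<kappa> * (1 / sqrt (1 + y'\<^sup>2)) = \<kappa> * (1 / sqrt (1 + y\<^sup>2) - 1 / sqrt (1 + y'\<^sup>2))"
        by (simp_all only: right_diff_distrib)
      then show ?thesis by (simp only: abs_mult abs_minus_cancel abs_numeral)
    qed
    also have "\<dots> \<le> \<bar>w - w'\<bar> + (2 * \<bar>e\<bar> * \<bar>y - y'\<bar> + \<bar>\<kappa>\<bar> * \<bar>y - y'\<bar>)"
      by (intro add_mono mult_left_mono sqrt_lipschitz order_refl) auto
    also have "\<dots> \<le> dist x x' + (2 * \<bar>e\<bar> * dist x x' + \<bar>\<kappa>\<bar> * dist x x')"
    proof -
      have "\<bar>y - y'\<bar> \<le> dist x x'" using norm_fst_le[of "y - y'" "(w - w', r - r')"] by (simp add: x dist_norm)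
      moreover have "\<bar>w - w'\<bar> \<le> dist x x'"
        using order_trans[OF norm_fst_le[of "w - w'" "r - r'"] norm_snd_le[of "(w - w', r - r')" "y - y'"]]
        by (simp add: x dist_norm)
      ultimately show ?thesis by (intro add_mono mult_left_mono) auto
    qed
    finally show "dist (F x) (F x') \<le> L * dist x x'" by (simp add: L_def algebra_simps)
  qed (simp add: L_def)
  obtain z where z: "z t1 = (Y t1, W t1, s t1)" "\<And>t. (z has_vector_derivative F (z t)) (at t)"
    by (rule lipschitz_ode_global[OF lip]) blast
  have old: "((\<lambda>t. (Y t, W t, s t)) has_vector_derivative F (Y t, W t, s t)) (at t)" if t: "t \<in> I" for t
  proof -
    have "s1 t = \<kappa> * (1 / C t)" using \<kappa>[OF t] Cpos[of t] by (simp add: field_simps)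
    then have "F (Y t, W t, s t) = (2 * C t * \<tau>1 t, - 2 * e * (Y t / C t), s1 t)"
      by (simp only: F_def prod.case CY W_def)
    then show ?thesis
      using dY[OF t] dW[OF t] s(1)[OF t] unfolding has_real_derivative_iff_has_vector_derivative
      by (auto intro!: has_vector_derivative_Pair)
  qed
  \<comment> \<open>Uniqueness: the difference of two solutions satisfies a linear differential
    inequality and vanishes at \<open>t1\<close>.\<close>
  have agree: "(Y t, W t, s t) = z t" if t: "t \<in> I" for t
  proof -
    have "(Y t, W t, s t) - z t = 0"
    proof (rule gronwall_zero[of I t1 "\<lambda>t. (Y t, W t, s t) - z t" t "\<lambda>t. F (Y t, W t, s t) - F (z t)" "\<lambda>_. L"])
      show "norm (F (Y t, W t, s t) - F (z t)) \<le> L * norm ((Y t, W t, s t) - z t)" for t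
        using lipschitz_onD[OF lip, of "(Y t, W t, s t)" "z t"] by (simp add: dist_norm)
      show "((\<lambda>t. (Y t, W t, s t) - z t) has_vector_derivative F (Y t, W t, s t) - F (z t)) (at t)" if "t \<in> I" for t
        by (rule has_vector_derivative_diff[OF old[OF that] z(2)])
      show "(Y t1, W t1, s t1) - z t1 = 0" by (simp add: z(1))
    qed (use I(2) t1 t in auto)
    then show ?thesis by simp
  qed
  define y where "y t = fst (z t)" for t
  define w where "w t = fst (snd (z t))" for t
  define S where "S t = snd (snd (z t))" for t
  define R where "R t = sqrt (1 + (y t)\<^sup>2)" for t
  have Fz: "F (z t) = (w t, - 2 * e * (y t / R t), \<kappa> * (1 / R t))" for t
    by (simp add: F_def y_def w_def R_def split: prod.splits)
  have dz: "(z has_vector_derivative (w t, - 2 * e * (y t / R t), \<kappa> * (1 / R t))) (at t)" for t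
    using z(2)[of t] unfolding Fz .
  have dy: "(y has_real_derivative w t) (at t)" for t
    using bounded_linear.has_vector_derivative[OF bounded_linear_fst dz[of t]]
    by (simp add: has_real_derivative_iff_has_vector_derivative y_def[abs_def])
  have dw: "(w has_real_derivative - 2 * e * (y t / R t)) (at t)" for t
    using bounded_linear.has_vector_derivative[OF bounded_linear_fst bounded_linear.has_vector_derivative[OF bounded_linear_snd dz[of t]]]
    by (simp add: has_real_derivative_iff_has_vector_derivative w_def[abs_def])
  have dS: "(S has_real_derivative \<kappa> / R t) (at t)" for t
    using bounded_linear.has_vector_derivative[OF bounded_linear_snd bounded_linear.has_vector_derivative[OF bounded_linear_snd dz[of t]]]
    by (simp add: has_real_derivative_iff_has_vector_derivative S_def[abs_def])
  have Rpos: "R t > 0" and R2: "R t * R t = 1 + (y t)\<^sup>2" for t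
    by (simp_all add: R_def add_pos_nonneg)
  have dR: "(R has_real_derivative y t * w t / R t) (at t)" for t
  proof -
    have "1 + (y t)\<^sup>2 > 0" by (simp add: add_pos_nonneg)
    then show ?thesis unfolding R_def
      by (auto intro!: derivative_eq_intros dy simp: field_simps power2_eq_square)
  qed
  \<comment> \<open>In the new system \<kappa> and \<open>e\<close> are mere parameters. This
    relation between them holds at \<open>t1\<close> by their definitions and is preserved; it is
    what brings back the squares of the velocities in the second geodesic equation.\<close>
  have energy: "(w t)\<^sup>2 / 4 + e * R t = \<kappa>\<^sup>2" for t
  proof -
    have "((\<lambda>t. (w t)\<^sup>2 / 4 + e * R t) has_real_derivative 2 * w t * (- 2 * e * (y t / R t)) / 4 + e * (y t * w t / R t)) (at t)" for t
      by (auto intro!: derivative_eq_intros dw dR)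
    then have "((\<lambda>t. (w t)\<^sup>2 / 4 + e * R t) has_real_derivative 0) (at t)" for t
      by (simp add: field_simps)
    then have "(w t)\<^sup>2 / 4 + e * R t = (w t1)\<^sup>2 / 4 + e * R t1"
      using DERIV_isconst_all[of "\<lambda>t. (w t)\<^sup>2 / 4 + e * R t"] by blast
    moreover have "w t1 = W t1" "R t1 = C t1" using z(1) CY[of t1] by (simp_all add: w_def R_def y_def)
    ultimately show ?thesis by (simp add: W_def e_def \<kappa>_def power2_eq_square algebra_simps)
  qed
  define \<T> where "\<T> t = d + arsinh (y t) / 2" for t
  have tanhT: "tanh (2 * (\<T> t - d)) = y t / R t" for t by (simp add: \<T>_def tanh_arsinh_real R_def)
  show ?thesis
  proof (rule that[of S "\<lambda>t. \<kappa> / R t" "\<lambda>t. - \<kappa> * (y t * w t / R t) / (R t * R t)" \<T> "\<lambda>t. w t / (2 * R t)"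
        "\<lambda>t. (- 2 * e * (y t / R t) * (2 * R t) - w t * (2 * (y t * w t / R t))) / ((2 * R t) * (2 * R t))"])
    fix t
    show "(S has_real_derivative \<kappa> / R t) (at t)" by (rule dS)
    show "((\<lambda>t. \<kappa> / R t) has_real_derivative - \<kappa> * (y t * w t / R t) / (R t * R t)) (at t)"
      using Rpos[of t] by (auto intro!: derivative_eq_intros dR)
    show "(\<T> has_real_derivative w t / (2 * R t)) (at t)"
    proof -
      have "sqrt ((y t)\<^sup>2 + 1) = R t" by (simp add: R_def add.commute)
      then have "((\<lambda>t. arsinh (y t)) has_real_derivative 1 / R t * w t) (at t)"
        using DERIV_chain2[OF arsinh_real_has_field_derivative[of "y t" UNIV] dy[of t]] by simp
      then have "((\<lambda>t. d + arsinh (y t) / 2) has_real_derivative 0 + 1 / R t * w t / 2) (at t)"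
        by (intro DERIV_add DERIV_const DERIV_cdivide)
      then show ?thesis by (simp add: \<T>_def[abs_def] mult.commute)
    qed
    show "((\<lambda>t. w t / (2 * R t)) has_real_derivative
       (- 2 * e * (y t / R t) * (2 * R t) - w t * (2 * (y t * w t / R t))) / ((2 * R t) * (2 * R t))) (at t)"
      using Rpos[of t] by (intro DERIV_divide dw DERIV_cmult dR) auto
    show "- \<kappa> * (y t * w t / R t) / (R t * R t) = - 2 * tanh (2 * (\<T> t - d)) * (\<kappa> / R t) * (w t / (2 * R t))"
      unfolding tanhT using Rpos[of t] by (simp add: field_simps)
    have vel: "(\<kappa> / R t)\<^sup>2 + (w t / (2 * R t))\<^sup>2 = ((w t)\<^sup>2 / 2 + e * R t) / (R t * R t)"
      using Rpos[of t] energy[of t, symmetric] by (simp add: power_divide power_mult_distrib field_simps power2_eq_square)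
    show "(- 2 * e * (y t / R t) * (2 * R t) - w t * (2 * (y t * w t / R t))) / ((2 * R t) * (2 * R t))
       = - tanh (2 * (\<T> t - d)) * ((\<kappa> / R t)\<^sup>2 + (w t / (2 * R t))\<^sup>2)"
      unfolding tanhT vel using Rpos[of t] by (simp add: field_simps power2_eq_square)
    show "S t = s t \<and> \<T> t = \<tau> t" if "t \<in> I"
      using agree[OF that, symmetric] by (simp add: S_def \<T>_def y_def Y_def arsinh_sinh_real diff_divide_distrib)
  qed
qed

section \<open>Normalization of the affine normal and action of the group\<close>

lemma form_axis: "form G (axis i 1) (axis j 1) = G $ i $ j"
  by (simp add: form_def inner_axis' matrix_vector_mult_basis column_def)

text \<open>The metric is a quotient of two determinants, and \<open>L\<close> has determinant one,
  so moving \<xi> to the third axis leaves the metric unchanged.\<close>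

lemma affine_sphere_of_IAS:
  assumes IAS: "indefinite_improper_affine_sphere X A \<psi> \<xi>" and L: "det L = 1" "L *v \<xi> = axis 3 1"
  shows "affine_sphere X A (\<lambda>p. L *v \<psi> p)"
    "\<And>c u. c \<in> A \<Longrightarrow> u \<in> chart_image c \<Longrightarrow> affine_metric (\<lambda>p. L *v \<psi> p) (axis 3 1) c u = affine_metric \<psi> \<xi> c u"
proof -
  interpret surface X A
    using IAS by (simp add: surface_def indefinite_improper_affine_sphere_def)
  have sm: "smooth_on (chart_image c) (in_chart c \<psi>)" if "c \<in> A" for c
    using IAS that by (simp add: indefinite_improper_affine_sphere_def smooth_immersion_def)
  define y where "y p = L *v \<psi> p" for p
  have yc: "in_chart c y = (\<lambda>u. L *v in_chart c \<psi> u)" for c by (simp add: in_chart_def y_def fun_eq_iff)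
  have smy: "smooth_on (chart_image c) (in_chart c y)" if "c \<in> A" for c
    unfolding yc by (rule smooth_on_matrix_vector_mult[OF sm[OF that]])
  have p1: "partial i (in_chart c y) u = L *v partial i (in_chart c \<psi>) u" if "c \<in> A" "u \<in> chart_image c" for c u i
    unfolding yc by (rule partial_matrix_vector_mult[OF sm[OF that(1)] that(2)])
  have p2: "partial i (partial j (in_chart c y)) u = L *v partial i (partial j (in_chart c \<psi>)) u"
    if c: "c \<in> A" and u: "u \<in> chart_image c" for c u i j
  proof -
    note o = chart_homeomorphic(2)[OF c]
    have "partial i (partial j (in_chart c y)) u = partial i (\<lambda>v. L *v partial j (in_chart c \<psi>) v) u"
      by (rule partial_cong[OF o u p1[OF c]])
    then show ?thesis by (simp add: partial_matrix_vector_mult[OF smooth_on_partial[OF sm[OF c] o] u])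
  qed
  have d\<psi>: "frechet_derivative (in_chart c \<psi>) (at u) w = w $ 1 *\<^sub>R partial 1 (in_chart c \<psi>) u + w $ 2 *\<^sub>R partial 2 (in_chart c \<psi>) u"
    if "c \<in> A" "u \<in> chart_image c" for c u w
    by (rule smooth_on_frechet_eq_partial[OF sm[OF that(1)] that(2)])
  define D where "D c u = det3 (partial 1 (in_chart c \<psi>) u) (partial 2 (in_chart c \<psi>) u) \<xi>" for c u
  have cond: "lorentzian_form (affine_metric \<psi> \<xi> c u)"
    "\<And>v w. sqrt ((form (affine_metric \<psi> \<xi> c u) v w)\<^sup>2 - form (affine_metric \<psi> \<xi> c u) v v * form (affine_metric \<psi> \<xi> c u) w w)
      = \<bar>det3 (frechet_derivative (in_chart c \<psi>) (at u) v) (frechet_derivative (in_chart c \<psi>) (at u) w) \<xi>\<bar>"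
    if "c \<in> A" "u \<in> chart_image c" for c u
    using IAS that unfolding indefinite_improper_affine_sphere_def Let_def by blast+
  \<comment> \<open>On a Lorentz orthonormal pair the square root in the volume condition equals 1,
    whereas a vanishing \<open>D c u\<close> would make the right-hand side 0.\<close>
  have D: "D c u \<noteq> 0" if cu: "c \<in> A" "u \<in> chart_image c" for c u
  proof
    assume D0: "D c u = 0"
    obtain v w where vw: "form (affine_metric \<psi> \<xi> c u) v v = 1" "form (affine_metric \<psi> \<xi> c u) w w = -1" "form (affine_metric \<psi> \<xi> c u) v w = 0"
      using cond(1)[OF cu] unfolding lorentzian_form_def by blast
    have "det3 (frechet_derivative (in_chart c \<psi>) (at u) v) (frechet_derivative (in_chart c \<psi>) (at u) w) \<xi> = (v $ 1 * w $ 2 - v $ 2 * w $ 1) * D c u"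
      unfolding d\<psi>[OF that] D_def by (simp add: det3_expand algebra_simps)
    then show False using cond(2)[OF that, of v w] D0 by (simp add: vw)
  qed
  have Dy: "det3 (partial 1 (in_chart c y) u) (partial 2 (in_chart c y) u) (axis 3 1) = D c u"
    if "c \<in> A" "u \<in> chart_image c" for c u
    unfolding p1[OF that] L(2)[symmetric] det3_mult L(1) D_def by simp
  have metric: "affine_metric y (axis 3 1) c u = affine_metric \<psi> \<xi> c u" if c: "c \<in> A" and u: "u \<in> chart_image c" for c u
  proof -
    have "transversal_coeff (in_chart c y) (axis 3 1) u (axis i 1) (axis j 1) = transversal_coeff (in_chart c \<psi>) \<xi> u (axis i 1) (axis j 1)" for i j
    proof -
      have "transversal_coeff (in_chart c y) (axis 3 1) u (axis i 1) (axis j 1)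
        = det3 (partial 1 (in_chart c y) u) (partial 2 (in_chart c y) u) (partial i (partial j (in_chart c y)) u) / D c u"
        using transversal_coeff_eq[OF smy[OF c] u, of "axis 3 1" i j] D[OF c u] Dy[OF c u] by simp
      also have "\<dots> = det3 (partial 1 (in_chart c \<psi>) u) (partial 2 (in_chart c \<psi>) u) (partial i (partial j (in_chart c \<psi>)) u) / D c u"
        unfolding p1[OF c u] p2[OF c u] det3_mult L(1) by simp
      also have "\<dots> = transversal_coeff (in_chart c \<psi>) \<xi> u (axis i 1) (axis j 1)"
        using transversal_coeff_eq[OF sm[OF c] u, of \<xi> i j] D[OF c u] by (simp add: D_def)
      finally show ?thesis .
    qed
    then show ?thesis by (simp add: affine_metric_def)
  qed
  then show "\<And>c u. c \<in> A \<Longrightarrow> u \<in> chart_image c \<Longrightarrow> affine_metric (\<lambda>p. L *v \<psi> p) (axis 3 1) c u = affine_metric \<psi> \<xi> c u"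
    by (simp add: y_def[abs_def])
  have "affine_sphere X A y"
  proof (intro affine_sphere.intro affine_sphere_axioms.intro)
    show "surface X A" by (rule surface_axioms)
    show "smooth_fun A y" using smy by (simp add: smooth_fun_def)
    fix c u assume cu: "c \<in> A" "u \<in> chart_image c"
    show "det3 (partial 1 (in_chart c y) u) (partial 2 (in_chart c y) u) (axis 3 1) \<noteq> 0" using Dy[OF cu] D[OF cu] by simp
    define G where "G = affine_metric \<psi> \<xi> c u"
    have "transpose G = G" using cond(1)[OF cu] by (simp add: lorentzian_form_def G_def)
    then have "transpose G $ 2 $ 1 = G $ 2 $ 1" by simp
    then show "affine_metric y (axis 3 1) c u $ 1 $ 2 = affine_metric y (axis 3 1) c u $ 2 $ 1"
      unfolding metric[OF cu] G_def[symmetric] by (simp add: transpose_def)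
    have "sqrt ((G $ 1 $ 2)\<^sup>2 - G $ 1 $ 1 * G $ 2 $ 2) = \<bar>D c u\<bar>"
      using cond(2)[OF cu, of "axis 1 1" "axis 2 1"] by (simp add: form_axis G_def D_def partial_def)
    moreover from this have "(G $ 1 $ 2)\<^sup>2 - G $ 1 $ 1 * G $ 2 $ 2 > 0"
      using D[OF cu] real_sqrt_gt_0_iff by (metis zero_less_abs_iff)
    ultimately have "(G $ 1 $ 2)\<^sup>2 - G $ 1 $ 1 * G $ 2 $ 2 = (D c u)\<^sup>2"
      by (metis less_imp_le power2_abs real_sqrt_pow2)
    then show "(affine_metric y (axis 3 1) c u $ 1 $ 2)\<^sup>2 - affine_metric y (axis 3 1) c u $ 1 $ 1 * affine_metric y (axis 3 1) c u $ 2 $ 2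
        = (det3 (partial 1 (in_chart c y) u) (partial 2 (in_chart c y) u) (axis 3 1))\<^sup>2"
      unfolding metric[OF cu] G_def[symmetric] Dy[OF cu] .
  qed
  then show "affine_sphere X A (\<lambda>p. L *v \<psi> p)" by (simp add: y_def[abs_def])
qed

lemma one_parameter_group_conjugate:
  assumes T: "one_parameter_group T" and LM: "L ** M = mat 1" "M ** L = (mat 1 :: real^3^3)"
  shows "one_parameter_group (\<lambda>s v. L *v T s (M *v v))"
  unfolding one_parameter_group_def
proof (intro conjI allI)
  have M_L: "M *v (L *v v) = v" for v using LM(2) by (simp add: matrix_vector_mul_assoc)
  have L_M: "L *v (M *v v) = v" for v using LM(1) by (simp add: matrix_vector_mul_assoc)
  fix s
  obtain N b where N: "det N = 1" "T s = (\<lambda>v. N *v v + b)"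
    using T unfolding one_parameter_group_def equiaffine_def by blast
  have "det L * det M = 1" using arg_cong[OF LM(1), of det] by (simp add: det_mul)
  then have "det (L ** N ** M) = 1" using N(1) by (simp add: det_mul)
  moreover have "(\<lambda>v. L *v T s (M *v v)) = (\<lambda>v. (L ** N ** M) *v v + L *v b)"
    by (simp add: N(2) matrix_vector_right_distrib matrix_vector_mul_assoc matrix_mul_assoc)
  ultimately show "equiaffine (\<lambda>v. L *v T s (M *v v))" unfolding equiaffine_def by blast
  show "(\<lambda>v. L *v T 0 (M *v v)) = id"
    using T by (simp add: one_parameter_group_def fun_eq_iff L_M)
  show "(\<lambda>v. L *v T (s + r) (M *v v)) = (\<lambda>v. L *v T s (M *v v)) \<circ> (\<lambda>v. L *v T r (M *v v))" for r
    using T by (simp add: one_parameter_group_def fun_eq_iff M_L)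
  show "continuous_on UNIV (\<lambda>s. L *v T s (M *v v))" for v
    using T unfolding one_parameter_group_def
    by (intro bounded_linear.continuous_on[OF matrix_vector_mul_bounded_linear]) blast
qed

text \<open>Second countability reduces the atlas to countably many charts, and a differentiable
  image of a plane domain in space is a null set.\<close>

lemma (in surface) negligible_image:
  fixes y :: "'p \<Rightarrow> real^3"
  assumes "smooth_fun A y"
  shows "negligible (y ` topspace X)"
proof -
  have Lin: "Lindelof_space X" by (rule second_countable_imp_Lindelof_space[OF second_countable])
  have "\<exists>\<V>. countable \<V> \<and> \<V> \<subseteq> fst ` A \<and> \<Union>\<V> = topspace X"
  proof (rule Lindelof_spaceD[OF Lin])
    show "openin X U" if "U \<in> fst ` A" for U using that chart_homeomorphic(1) by auto
    show "\<Union> (fst ` A) = topspace X"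
    proof
      show "\<Union> (fst ` A) \<subseteq> topspace X" using chart_subset by blast
      show "topspace X \<subseteq> \<Union> (fst ` A)" using chart_cover by blast
    qed
  qed
  then obtain \<V> where V: "countable \<V>" "\<V> \<subseteq> fst ` A" "\<Union>\<V> = topspace X" by (elim exE conjE)
  have neg: "negligible (y ` U)" if U: "U \<in> \<V>" for U
  proof -
    obtain c where c: "c \<in> A" "U = fst c" using subsetD[OF V(2) U] by (elim imageE)
    have sm: "smooth_on (chart_image c) (in_chart c y)" using assms c(1) by (simp add: smooth_fun_def)
    have "in_chart c y differentiable_on chart_image c"
      unfolding differentiable_on_def
    proof
      fix x assume "x \<in> chart_image c"
      from has_derivative_at_withinI[OF smooth_on_has_derivative[OF sm this]]
      show "in_chart c y differentiable at x within chart_image c" by (rule differentiableI)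
    qed
    then have "negligible (in_chart c y ` chart_image c)"
      by (intro negligible_differentiable_image_lowdim) simp_all
    moreover have "y ` U = in_chart c y ` chart_image c"
    proof -
      have "in_chart c y ` chart_image c = (\<lambda>p. in_chart c y (snd c p)) ` fst c"
        by (simp add: chart_image_def image_image)
      also have "\<dots> = y ` fst c" by (rule image_cong) (simp_all add: in_chart_apply[OF c(1)])
      finally show ?thesis using c(2) by simp
    qed
    ultimately show ?thesis by simp
  qed
  have "negligible (\<Union>((\<lambda>U. y ` U) ` \<V>))"
    by (rule negligible_countable_Union) (use V(1) neg in auto)
  moreover have "y ` topspace X = \<Union>((\<lambda>U. y ` U) ` \<V>)" unfolding V(3)[symmetric] by (rule image_Union)
  ultimately show ?thesis by simp
qed

context affine_sphere
begin

text \<open>If the generator were transversal to the surface somewhere, its flow would sweep out an open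
  set contained in the image of the surface, which is negligible.\<close>
lemma generator_tangent:
  assumes T: "equiaffine_group T" and inv: "\<And>s. T s ` (y ` topspace X) = y ` topspace X"
    and c: "c \<in> A" and u: "u \<in> chart_image c"
  shows "det3 (partial 1 (in_chart c y) u) (partial 2 (in_chart c y) u) (equiaffine_group.generator T (in_chart c y u)) = 0"
proof (rule ccontr)
  interpret equiaffine_group T by (rule T)
  define x where "x = in_chart c y"
  define n where "n = generator (x u)"
  define p q where "p = partial 1 x u" and "q = partial 2 x u"
  define D where "D = det3 p q n"
  assume "det3 (partial 1 (in_chart c y) u) (partial 2 (in_chart c y) u) (generator (in_chart c y u)) \<noteq> 0"
  then have D: "D \<noteq> 0" by (simp add: D_def p_def q_def n_def x_def)
  note o = chart_homeomorphic(2)[OF c]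
  have smx: "smooth_on (chart_image c) x" unfolding x_def by (rule chart_y[OF c])
  define S where "S = chart_image c \<times> (UNIV :: real set)"
  have S: "open S" "(u, 0) \<in> S" unfolding S_def using o u by (auto intro: open_Times)
  define \<Phi> where "\<Phi> w = T (snd w) (x (fst w))" for w :: "(real^2) \<times> real"
  have contx: "continuous_on S (\<lambda>w. (x (fst w), snd w))"
    unfolding S_def
    by (intro continuous_on_Pair continuous_on_snd continuous_on_id
        continuous_on_compose2[OF smooth_on_imp_continuous_on[OF smx] continuous_on_fst[OF continuous_on_id]]) auto
  have cont: "continuous_on S \<Phi>"
    using continuous_on_compose2[OF T_jointly_continuous contx] by (simp add: \<Phi>_def[abs_def])
  have dx: "(x has_derivative (\<lambda>w. w $ 1 *\<^sub>R p + w $ 2 *\<^sub>R q)) (at u)"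
    unfolding p_def q_def by (rule smooth_on_has_derivative_partial[OF smx u])
  have "((\<lambda>w. (x (fst w), snd w)) has_derivative (\<lambda>w. (fst w $ 1 *\<^sub>R p + fst w $ 2 *\<^sub>R q, snd w))) (at (u, 0))"
    by (intro has_derivative_Pair has_derivative_snd has_derivative_ident)
      (use has_derivative_compose[OF has_derivative_fst[OF has_derivative_ident], of x "\<lambda>w. w $ 1 *\<^sub>R p + w $ 2 *\<^sub>R q" "(u, 0)" UNIV] dx in simp)
  from has_derivative_compose[OF this, of "\<lambda>w. T (snd w) (fst w)" "\<lambda>(w, h). w + h *\<^sub>R n"]
  have der: "(\<Phi> has_derivative (\<lambda>w. (fst w $ 1 *\<^sub>R p + fst w $ 2 *\<^sub>R q) + snd w *\<^sub>R n)) (at (u, 0))"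
    using T_joint_derivative[of "x u"] by (simp add: \<Phi>_def[abs_def] n_def)
  \<comment> \<open>The inverse, by Cramer's rule, of the derivative of \<open>\<Phi>\<close> at
    \<open>(u, 0)\<close>, whose columns are the two tangent vectors and the generator. An open
    mapping theorem that asks only for continuity and a derivative at one point then
    applies.\<close>
  define h :: "real^3 \<Rightarrow> (real^2) \<times> real" where
    "h v = ((det3 v q n / D) *\<^sub>R axis 1 1 + (det3 p v n / D) *\<^sub>R axis 2 1, det3 p q v / D)" for v
  have "linear h"
    unfolding h_def by (rule linearI) (simp_all add: det3_expand algebra_simps add_divide_distrib diff_divide_distrib scaleR_add_left scaleR_diff_left)
  then have blh: "bounded_linear h" by (simp add: linear_conv_bounded_linear)
  have "(\<lambda>w. (fst w $ 1 *\<^sub>R p + fst w $ 2 *\<^sub>R q) + snd w *\<^sub>R n) \<circ> h = id"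
  proof
    fix v
    have "((\<lambda>w. (fst w $ 1 *\<^sub>R p + fst w $ 2 *\<^sub>R q) + snd w *\<^sub>R n) \<circ> h) v
      = (1 / D) *\<^sub>R (det3 v q n *\<^sub>R p + det3 p v n *\<^sub>R q + det3 p q v *\<^sub>R n)"
      by (simp add: h_def axis_def scaleR_add_right)
    also have "\<dots> = v" unfolding det3_cramer[symmetric] D_def[symmetric] using D by simp
    finally show "((\<lambda>w. (fst w $ 1 *\<^sub>R p + fst w $ 2 *\<^sub>R q) + snd w *\<^sub>R n) \<circ> h) v = id v" by simp
  qed
  from sussmann_open_mapping[OF S(1) cont S(2) der blh this subset_refl]
  have int: "\<Phi> (u, 0) \<in> interior (\<Phi> ` S)" using S interior_open by blast
  have "\<Phi> ` S \<subseteq> y ` topspace X"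
  proof
    fix z assume "z \<in> \<Phi> ` S"
    then obtain w where w: "w \<in> S" "z = \<Phi> w" by blast
    have "fst w \<in> chart_image c" using w(1) by (auto simp: S_def)
    then have "x (fst w) \<in> y ` topspace X"
      using chart_inv_in[of "fst w" c] chart_subset[OF c] unfolding x_def in_chart_def o_def by blast
    then have "z \<in> T (snd w) ` (y ` topspace X)" unfolding w(2) \<Phi>_def by blast
    then show "z \<in> y ` topspace X" unfolding inv .
  qed
  then have "negligible (interior (\<Phi> ` S))"
    using negligible_subset[OF negligible_image[OF smooth_y]] interior_subset by (metis subset_trans)
  then show False using open_not_negligible[OF open_interior] int by blast
qed

lemma det3_conormal:
  assumes c: "c \<in> A" and u: "u \<in> chart_image c"
  shows "det3 (partial 1 (in_chart c y) u) (partial 2 (in_chart c y) u) v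
    = J c u * (v $ 3 + det2 (in_chart c P u) (\<chi> i. if i = 1 then v $ 1 else v $ 2))"
proof -
  have "partial i (in_chart c y) u $ 3 = - det2 (in_chart c P u) (partial i (in_chart c Z) u)" for i
    using conormal_eq[OF c u, of i] by (simp add: partial_Z(3)[OF c u])
  note y3 = this
  show ?thesis
    by (simp add: det3_expand y3 partial_Z(1,2)[OF c u, symmetric] J_def det2_def algebra_simps)
qed

text \<open>The generator is cut into planar and vertical blocks. \<open>helical_chart\<close> makes
  the blocks \<open>e\<close> and \<open>k\<close> vanish, after which the trace condition falls on
  \<open>B\<close> alone.\<close>

lemma helical_pair_of_group:
  assumes T: "equiaffine_group T" and inv: "\<And>s. T s ` (y ` topspace X) = y ` topspace X"
    and nontrivial: "\<exists>s. T s \<noteq> id"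
  obtains B b1 b2 where "helical_pair X A \<alpha> \<beta> (affine_metric y (axis 3 1)) B b1 b2" "B \<noteq> 0 \<or> b1 \<noteq> 0 \<or> b2 \<noteq> 0"
proof -
  interpret equiaffine_group T by (rule T)
  define N where "N = generator_matrix"
  define n where "n = generator 0"
  define B :: "real^2^2" where "B = (\<chi> i j. N $ (if i = 1 then 1 else 2) $ (if j = 1 then 1 else 2))"
  define e :: "real^2" where "e = (\<chi> i. N $ (if i = 1 then 1 else 2) $ 3)"
  define b :: "real^2" where "b = (\<chi> i. n $ (if i = 1 then 1 else 2))"
  define l :: "real^2" where "l = (\<chi> i. N $ 3 $ (if i = 1 then 1 else 2))"
  define k where "k = N $ 3 $ 3"
  define b3 where "b3 = n $ 3"
  have trace: "B $ 1 $ 1 + B $ 2 $ 2 + k = 0" using generator_trace by (simp add: B_def k_def N_def)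
  have hc: "helical_chart (chart_image c) (in_chart c Z) (in_chart c P) (in_chart c \<zeta>) B e b l k b3" if c: "c \<in> A" for c
  proof (rule helical_chart.intro)
    show "open (chart_image c)" "smooth_on (chart_image c) (in_chart c Z)" "smooth_on (chart_image c) (in_chart c P)"
      "smooth_on (chart_image c) (in_chart c \<zeta>)"
      by (rule chart_homeomorphic(2)[OF c] chart_Z[OF c] chart_P[OF c] chart_\<zeta>[OF c])+
    show "B $ 1 $ 1 + B $ 2 $ 2 + k = 0" by (rule trace)
    show "partial i (in_chart c \<zeta>) u = - det2 (in_chart c P u) (partial i (in_chart c Z) u)" if "u \<in> chart_image c" for u i
      by (rule conormal_eq[OF c that])
    fix u assume u: "u \<in> chart_image c"
    show "det2 (partial 1 (in_chart c Z) u) (partial 2 (in_chart c Z) u) \<noteq> 0" using J_nonzero[OF c u] by (simp add: J_def)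
    show "det2 (partial 1 (in_chart c P) u) (partial 2 (in_chart c Z) u) = det2 (partial 2 (in_chart c P) u) (partial 1 (in_chart c Z) u)"
      by (rule symmetric[OF c u])
    show "det2 (partial 1 (in_chart c P) u) (partial 2 (in_chart c P) u) = - det2 (partial 1 (in_chart c Z) u) (partial 2 (in_chart c Z) u)"
      using volume[OF c u] by (simp add: J_def)
    define v where "v = generator (in_chart c y u)"
    have v: "v = N *v in_chart c y u + n" unfolding v_def N_def n_def by (rule generator_affine)
    have "J c u * (v $ 3 + det2 (in_chart c P u) (\<chi> i. if i = 1 then v $ 1 else v $ 2)) = 0"
      using generator_tangent[OF T inv c u] unfolding det3_conormal[OF c u] v_def[symmetric] .
    then have "v $ 3 = - det2 (in_chart c P u) (\<chi> i. if i = 1 then v $ 1 else v $ 2)"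
      using J_nonzero[OF c u] by (simp add: add_eq_0_iff2)
    moreover have "v $ 3 = l \<bullet> in_chart c Z u + k * in_chart c \<zeta> u + b3"
      by (simp add: v matrix_vector_mult_def sum_3 sum_2 inner_vec_def l_def k_def b3_def in_chart_Z in_chart_\<zeta>)
    moreover have "(\<chi> i. if i = 1 then v $ 1 else v $ 2) = B *v in_chart c Z u + in_chart c \<zeta> u *\<^sub>R e + b"
      by (simp add: vec_eq_iff forall_2 v matrix_vector_mult_def sum_3 sum_2 B_def e_def b_def in_chart_Z in_chart_\<zeta> algebra_simps)
    ultimately show "l \<bullet> in_chart c Z u + k * in_chart c \<zeta> u + b3
        = - det2 (in_chart c P u) (B *v in_chart c Z u + in_chart c \<zeta> u *\<^sub>R e + b)" by simp
  qed
  obtain p0 where "p0 \<in> topspace X" using nonempty by blast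
  then obtain c0 where c0: "c0 \<in> A" "p0 \<in> fst c0" using chart_cover by blast
  have ne: "chart_image c0 \<noteq> {}" using chart_imageI[OF c0(2)] by blast
  have ek: "e = 0" "k = 0" using helical_chart.e_zero[OF hc[OF c0(1)] ne] by auto
  define l' :: "real^2" where "l' = vector [- l $ 2, l $ 1]"
  \<comment> \<open>The translation parts for \<alpha> and \<beta> are the half sum and half
    difference of those for \<open>Z\<close> and \<open>P\<close>; for \<open>P\<close> it is
    \<open>l'\<close>, the covector \<open>l\<close> turned by a right angle.\<close>
  define b1 b2 where "b1 = (1/2) *\<^sub>R (b + l')" and "b2 = (1/2) *\<^sub>R (b - l')"
  interpret np: null_pair X A \<alpha> \<beta> "affine_metric y (axis 3 1)" by (rule null_pair)
  have hp: "helical_pair X A \<alpha> \<beta> (affine_metric y (axis 3 1)) B b1 b2"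
  proof (intro helical_pair.intro helical_pair_axioms.intro)
    show "null_pair X A \<alpha> \<beta> (affine_metric y (axis 3 1))" by (rule null_pair)
    show "B $ 1 $ 1 + B $ 2 $ 2 = 0" using trace ek by simp
    fix c u i assume c: "c \<in> A" and u: "u \<in> chart_image c"
    interpret cp: chart_pair "chart_image c" "in_chart c \<alpha>" "in_chart c \<beta>" "affine_metric y (axis 3 1) c" by (rule np.pair[OF c])
    note th = helical_chart.tangent_half_sum[OF hc[OF c] u ek, folded l'_def]
    define r s where "r = helical_chart.V (in_chart c Z) (in_chart c \<zeta>) B e b 1 u"
      and "s = helical_chart.V (in_chart c Z) (in_chart c \<zeta>) B e b 2 u"
    have "B *v in_chart c \<alpha> u + b1 = (1/2) *\<^sub>R ((B *v in_chart c Z u + b) + (B *v in_chart c P u + l'))"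
      by (simp add: in_chart_\<alpha> b1_def matrix_vector_right_distrib linear_cmul[OF matrix_vector_mul_linear] scaleR_add_right)
    also have "\<dots> = r *\<^sub>R partial 1 (in_chart c \<alpha>) u + s *\<^sub>R partial 2 (in_chart c \<alpha>) u"
      unfolding th partial_\<alpha>\<beta>[OF c u] r_def s_def by (simp add: scaleR_add_right)
    finally show "det2 (B *v in_chart c \<alpha> u + b1) (partial i (in_chart c \<alpha>) u) = 0"
      using exhaust_2[of i] cp.rank_a[OF u] det2_commute[of "partial 2 (in_chart c \<alpha>) u" "partial 1 (in_chart c \<alpha>) u"] by auto
    have "B *v in_chart c \<beta> u + b2 = (1/2) *\<^sub>R ((B *v in_chart c Z u + b) - (B *v in_chart c P u + l'))"
      by (simp add: in_chart_\<beta> b2_def matrix_vector_mult_diff_distrib linear_cmul[OF matrix_vector_mul_linear] scaleR_add_right scaleR_diff_right)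
    also have "\<dots> = r *\<^sub>R partial 1 (in_chart c \<beta>) u + s *\<^sub>R partial 2 (in_chart c \<beta>) u"
      unfolding th partial_\<alpha>\<beta>[OF c u] r_def s_def by (simp add: scaleR_add_right scaleR_diff_right)
    finally show "det2 (B *v in_chart c \<beta> u + b2) (partial i (in_chart c \<beta>) u) = 0"
      using exhaust_2[of i] cp.rank_b[OF u] det2_commute[of "partial 2 (in_chart c \<beta>) u" "partial 1 (in_chart c \<beta>) u"] by auto
  qed
  \<comment> \<open>Otherwise \<open>B\<close>, \<open>b\<close> and \<open>l\<close> vanish
    together with \<open>e\<close> and \<open>k\<close>, tangency at a single point gives
    \<open>b3 = 0\<close>, and the generator would be zero.\<close>
  have "B \<noteq> 0 \<or> b1 \<noteq> 0 \<or> b2 \<noteq> 0"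
  proof (rule ccontr)
    assume "\<not> (B \<noteq> 0 \<or> b1 \<noteq> 0 \<or> b2 \<noteq> 0)"
    then have z: "B = 0" "b1 = 0" "b2 = 0" by auto
    have "b = b1 + b2" "l' = b1 - b2" unfolding b1_def b2_def by (simp_all add: vec_eq_iff field_simps)
    then have bl: "b = 0" "l' = 0" using z by simp_all
    then have "l = 0" by (simp add: l'_def vec_eq_iff forall_2)
    have u0: "snd c0 p0 \<in> chart_image c0" by (rule chart_imageI[OF c0(2)])
    have "b3 = 0"
      using helical_chart.tangent[OF hc[OF c0(1)] u0] z bl ek \<open>l = 0\<close> by simp
    have zz: "B $ i $ j = 0" "e $ i = 0" "l $ i = 0" "b $ i = 0" for i j using z ek bl \<open>l = 0\<close> by simp_all
    have "N $ i $ j = 0" for i j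
      using zz(1)[of 1 1] zz(1)[of 1 2] zz(1)[of 2 1] zz(1)[of 2 2] zz(2)[of 1] zz(2)[of 2] zz(3)[of 1] zz(3)[of 2] ek(2)
        exhaust_3[of i] exhaust_3[of j]
      unfolding B_def e_def l_def k_def by auto
    then have "N = 0" by (simp add: vec_eq_iff)
    moreover have "n $ i = 0" for i
      using zz(4)[of 1] zz(4)[of 2] \<open>b3 = 0\<close> exhaust_3[of i] unfolding b_def b3_def by auto
    then have "n = 0" by (simp add: vec_eq_iff)
    ultimately have "generator v = 0" for v
      using generator_affine[of v] by (simp add: N_def n_def matrix_vector_mult_def vec_eq_iff)
    then show False using nontrivial generator_zero_imp_trivial by blast
  qed
  then show ?thesis using that[OF hp] by blast
qed

end

lemma (in null_pair) null_pair_metric_cong: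
  assumes "\<And>c u. c \<in> A \<Longrightarrow> u \<in> chart_image c \<Longrightarrow> g' c u = g c u"
  shows "null_pair X A \<alpha> \<beta> g'"
proof (intro null_pair.intro null_pair_axioms.intro)
  show "surface X A" "smooth_fun A \<alpha>" "smooth_fun A \<beta>" by (rule surface_axioms smooth_\<alpha> smooth_\<beta>)+
  fix c assume c: "c \<in> A"
  interpret cp: chart_pair "chart_image c" "in_chart c \<alpha>" "in_chart c \<beta>" "g c" by (rule pair[OF c])
  show "chart_pair (chart_image c) (in_chart c \<alpha>) (in_chart c \<beta>) (g' c)"
    by (rule chart_pair.intro)
      (simp_all add: cp.open_S cp.smooth_a cp.smooth_b cp.rank_a cp.rank_b cp.regular[simplified] cp.metric assms[OF c])
qed

text \<open>A curvature that vanishes somewhere vanishes everywhere and makes the metric flat, for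
  \<beta> by reflection. This presupposes a nonzero affine field; \<open>B = 0\<close> is excluded
  because both curvatures would vanish while one of the translations is nonzero.\<close>

lemma (in helical_pair) curved_if_not_flat:
  assumes nontrivial: "B \<noteq> 0 \<or> b1 \<noteq> 0 \<or> b2 \<noteq> 0" and not_flat: "\<not> flat_metric A g"
  shows "curved_pair X A \<alpha> \<beta> g B b1 b2"
proof -
  have c1: "curv1 p \<noteq> 0" if "B \<noteq> 0 \<or> b1 \<noteq> 0" "p \<in> topspace X" for p
  proof
    assume "curv1 p = 0"
    then have "curv1 q = 0" if "q \<in> topspace X" for q using curv1_constant[OF \<open>p \<in> topspace X\<close> that] by simp
    then show False using flat_if_curv1_zero[OF _ that(1)] not_flat by blast
  qed
  interpret s: helical_pair X A "\<lambda>p. swap *v \<beta> p" "\<lambda>p. swap *v \<alpha> p" g "swap ** B ** swap" "swap *v b2" "swap *v b1"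
    by (rule helical_pair_swap)
  have sE: "s.E1 p = swap *v E2 p" for p unfolding s.E1_def by (rule swap_E)
  have sc: "s.curv1 p = - curv2 p" for p
    unfolding s.curv1_def curv2_def sE swap_E(3) det2_swap ..
  have swap0: "x = 0" if "swap *v x = 0" for x using arg_cong[OF that, of "\<lambda>v. swap *v v"] by (simp add: swap_swap)
  have c2: "curv2 p \<noteq> 0" if nt: "B \<noteq> 0 \<or> b2 \<noteq> 0" and p: "p \<in> topspace X" for p
  proof
    assume "curv2 p = 0"
    then have "s.curv1 q = 0" if "q \<in> topspace X" for q using s.curv1_constant[OF p that] sc by simp
    moreover have "swap ** B ** swap \<noteq> 0 \<or> swap *v b2 \<noteq> 0"
    proof (rule ccontr)
      assume "\<not> (swap ** B ** swap \<noteq> 0 \<or> swap *v b2 \<noteq> 0)"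
      then have z: "swap ** B ** swap = 0" "swap *v b2 = 0" by auto
      have "B *v x = 0" for x
        using swap_E(3)[of x] swap0[of "B *v x"] unfolding z by simp
      then have "B = 0" by (simp add: matrix_eq)
      then show False using nt swap0[OF z(2)] by simp
    qed
    ultimately show False using s.flat_if_curv1_zero not_flat by blast
  qed
  have "B \<noteq> 0"
  proof
    assume B: "B = 0"
    obtain p where p: "p \<in> topspace X" using nonempty by blast
    have "curv1 p = 0" "curv2 p = 0" unfolding curv1_def curv2_def unfolding B by simp_all
    then show False using c1[OF _ p] c2[OF _ p] nontrivial B by blast
  qed
  then show ?thesis
    using c1 c2 by (intro curved_pair.intro curved_pair_axioms.intro helical_pair_axioms) blast+
qed

text \<open>Here \<alpha> + \<beta> is the planar part and \<alpha> - \<beta> the conormal. So the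
  pair determines the normalized surface up to a vertical translation, through the differential of
  \<zeta>.\<close>

lemma complete_nonflat_helicoidal_IAS_reduction:
  assumes "complete_nonflat_helicoidal_IAS X A \<psi>"
  obtains L :: "real^3^3" and \<alpha> \<beta> \<zeta> g B b1 b2 where "det L = 1" "curved_pair X A \<alpha> \<beta> g B b1 b2" "complete_metric X A g"
    "smooth_fun A \<zeta>"
    "\<And>c u i. c \<in> A \<Longrightarrow> u \<in> chart_image c \<Longrightarrow> partial i (in_chart c \<zeta>) u =
      - det2 (in_chart c \<alpha> u - in_chart c \<beta> u) (partial i (in_chart c \<alpha>) u + partial i (in_chart c \<beta>) u)"
    "\<And>p. L *v \<psi> p = vector [(\<alpha> p + \<beta> p) $ 1, (\<alpha> p + \<beta> p) $ 2, \<zeta> p]"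
proof -
  obtain T \<xi> where T: "one_parameter_group T" "\<exists>s. T s \<noteq> id" "\<And>s. T s ` (\<psi> ` topspace X) = \<psi> ` topspace X"
    and IAS: "indefinite_improper_affine_sphere X A \<psi> \<xi>"
    and g: "complete_metric X A (affine_metric \<psi> \<xi>)" "\<not> flat_metric A (affine_metric \<psi> \<xi>)"
    using assms unfolding complete_nonflat_helicoidal_IAS_def helicoidal_def by blast
  have "\<xi> \<noteq> 0" using IAS by (simp add: indefinite_improper_affine_sphere_def)
  then obtain L M :: "real^3^3" where L: "det L = 1" "L *v \<xi> = axis 3 1" and LM: "L ** M = mat 1" "M ** L = mat 1"
    by (rule normalize_vector) blast
  define y where "y p = L *v \<psi> p" for p
  interpret affine_sphere X A y unfolding y_def[abs_def] by (rule affine_sphere_of_IAS[OF IAS L])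
  have metric: "affine_metric \<psi> \<xi> c u = affine_metric y (axis 3 1) c u" if "c \<in> A" "u \<in> chart_image c" for c u
    using affine_sphere_of_IAS(2)[OF IAS L that] by (simp add: y_def[abs_def])
  define T' where "T' s v = L *v T s (M *v v)" for s v
  have M_L: "M *v (L *v v) = v" for v using LM(2) by (simp add: matrix_vector_mul_assoc)
  have L_Mv: "L *v (M *v v) = v" for v using LM(1) by (simp add: matrix_vector_mul_assoc)
  have group: "equiaffine_group T'"
    unfolding equiaffine_group_def T'_def[abs_def] by (rule one_parameter_group_conjugate[OF T(1) LM])
  have inv: "T' s ` (y ` topspace X) = y ` topspace X" for s
  proof -
    have "T' s ` (y ` topspace X) = (\<lambda>v. L *v v) ` (T s ` (\<psi> ` topspace X))"
      by (simp add: image_image T'_def y_def M_L)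
    also have "\<dots> = y ` topspace X" unfolding T(3) by (simp add: image_image y_def)
    finally show ?thesis .
  qed
  have nontrivial: "\<exists>s. T' s \<noteq> id"
  proof (rule ccontr)
    assume "\<nexists>s. T' s \<noteq> id"
    then have "T' s (L *v v) = L *v v" for s v by simp
    then have "M *v (L *v T s v) = M *v (L *v v)" for s v by (simp add: T'_def M_L)
    then have "T s = id" for s by (simp add: M_L fun_eq_iff)
    then show False using T(2) by simp
  qed
  obtain B b1 b2 where B: "helical_pair X A \<alpha> \<beta> (affine_metric y (axis 3 1)) B b1 b2" "B \<noteq> 0 \<or> b1 \<noteq> 0 \<or> b2 \<noteq> 0"
    by (rule helical_pair_of_group[OF group inv nontrivial])
  interpret hy: helical_pair X A \<alpha> \<beta> "affine_metric y (axis 3 1)" B b1 b2 by (rule B(1))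
  have "helical_pair X A \<alpha> \<beta> (affine_metric \<psi> \<xi>) B b1 b2"
    by (intro helical_pair.intro helical_pair_axioms.intro hy.null_pair_metric_cong metric hy.traceless
        hy.tangent_\<alpha> hy.tangent_\<beta>)
  then have "curved_pair X A \<alpha> \<beta> (affine_metric \<psi> \<xi>) B b1 b2"
    by (rule helical_pair.curved_if_not_flat[OF _ B(2) g(2)])
  moreover have "partial i (in_chart c \<zeta>) u =
      - det2 (in_chart c \<alpha> u - in_chart c \<beta> u) (partial i (in_chart c \<alpha>) u + partial i (in_chart c \<beta>) u)"
    if "c \<in> A" "u \<in> chart_image c" for c u i
    unfolding conormal_eq[OF that] partial_\<alpha>\<beta>[OF that] unfolding in_chart_\<alpha> in_chart_\<beta>
    by (simp add: det2_def field_simps)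
  moreover have "L *v \<psi> p = vector [(\<alpha> p + \<beta> p) $ 1, (\<alpha> p + \<beta> p) $ 2, \<zeta> p]" for p
    by (simp add: vec_eq_iff forall_3 vector_3 \<alpha>_def \<beta>_def Z_nth \<zeta>_def y_def field_simps)
  ultimately show ?thesis using that[OF L(1) _ g(1) smooth_\<zeta>] by blast
qed

subsection \<open>The model surfaces\<close>

lemma second_countable_euclidean: "second_countable (euclidean :: 'a::second_countable_topology topology)"
proof -
  obtain B :: "'a set set" where B: "countable B" "topological_basis B" using ex_countable_basis by auto
  have "\<exists>V\<in>B. x \<in> V \<and> V \<subseteq> U" if "open U" "x \<in> U" for U and x :: 'a
    using topological_basisE[OF B(2) that] by metis
  then show ?thesis
    unfolding second_countable_def
    by (intro exI[of _ B]) (auto simp: B(1) topological_basis_open[OF B(2)])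
qed

lemma in_chart_plane: "in_chart (UNIV, \<lambda>p::real^2. p) f = f"
  by (simp add: in_chart_def fun_eq_iff inv_into_def)

lemma smooth_surface_plane: "smooth_surface euclidean plane_atlas"
  using connectedin_topspace[of "euclidean :: (real^2) topology"]
  unfolding smooth_surface_def plane_atlas_def
  by (auto simp: second_countable_euclidean in_chart_plane smooth_on_ident homeomorphic_map_id[unfolded id_def] connectedin_iff_connected)

lemma chart_image_plane: "chart_image (UNIV, \<lambda>p. p) = UNIV"
  by (simp add: chart_image_def)

text \<open>A family closed under products and, up to scalars, under differentiation, so that
  computations with the model reduce to linear algebra on exponents.\<close>

definition plane_exp :: "real \<Rightarrow> real \<Rightarrow> real^2 \<Rightarrow> real" where
  "plane_exp k l u = exp (k * u $ 1 + l * u $ 2)"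

lemma plane_exp_derivative: "(plane_exp k l has_derivative (\<lambda>w. (k * w $ 1 + l * w $ 2) * plane_exp k l u)) (at u)"
  unfolding plane_exp_def[abs_def]
  by (auto intro!: derivative_eq_intros bounded_linear.has_derivative[OF bounded_linear_vec_nth] simp: algebra_simps)

lemma smooth_on_plane_exp: "open S \<Longrightarrow> smooth_on S (plane_exp k l)"
  unfolding plane_exp_def[abs_def] by (intro smooth_on_intros)

lemma plane_exp_mult: "plane_exp k l u * plane_exp k' l' u = plane_exp (k + k') (l + l') u"
  by (simp add: plane_exp_def exp_add[symmetric] algebra_simps)

lemma plane_exp_0: "plane_exp 0 0 u = 1"
  by (simp add: plane_exp_def)

lemma plane_exp_product:
  "(a * plane_exp k l u + b * plane_exp k' l' u) * (c * plane_exp p q u + d * plane_exp p' q' u) =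
    a * c * plane_exp (k + p) (l + q) u + a * d * plane_exp (k + p') (l + q') u +
    b * c * plane_exp (k' + p) (l' + q) u + b * d * plane_exp (k' + p') (l' + q') u"
  by (simp add: plane_exp_mult[symmetric] algebra_simps)

text \<open>Here \<alpha> = (A e^(s+t), B e^(-s-t)) and \<beta> = (C e^(s-t), D e^(t-s)), and
  \<open>x\<close> has planar part \<alpha> + \<beta> and conormal \<alpha> - \<beta>. The sign
  conditions make the Jacobian positive everywhere.\<close>

locale model_surface =
  fixes A B C D :: real
  assumes AD: "A * D > 0" and BC: "B * C < 0"
begin

definition Z :: "real^2 \<Rightarrow> real^2" where
  "Z u = (A * plane_exp 1 1 u + C * plane_exp 1 (-1) u) *\<^sub>R axis 1 1
    + (B * plane_exp (-1) (-1) u + D * plane_exp (-1) 1 u) *\<^sub>R axis 2 1"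

definition P :: "real^2 \<Rightarrow> real^2" where
  "P u = (A * plane_exp 1 1 u + - C * plane_exp 1 (-1) u) *\<^sub>R axis 1 1
    + (B * plane_exp (-1) (-1) u + - D * plane_exp (-1) 1 u) *\<^sub>R axis 2 1"

definition x :: "real^2 \<Rightarrow> real^3" where
  "x u = (A * plane_exp 1 1 u + C * plane_exp 1 (-1) u) *\<^sub>R axis 1 1
    + (B * plane_exp (-1) (-1) u + D * plane_exp (-1) 1 u) *\<^sub>R axis 2 1
    + (2 * (A * B - C * D) * u $ 1 + 2 * (A * B + C * D) * u $ 2
       - A * D * plane_exp 0 2 u + B * C * plane_exp 0 (-2) u) *\<^sub>R axis 3 1"

text \<open>The Jacobian is \<open>2 * A * D\<close> times e^(2t) minus \<open>2 * B * C\<close>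
  times e^(-2t), with two positive coefficients; \<open>d\<close> and \<open>K\<close> combine it
  into a single hyperbolic cosine.\<close>

definition d where "d = ln (- (B * C) / (A * D)) / 4"
definition K where "K = 4 * (A * D) * exp (2 * d)"
definition f where "f t = K * cosh (2 * (t - d))"

lemma K_pos: "K > 0" using AD by (simp add: K_def)
lemma f_pos: "f t > 0" using K_pos by (simp add: f_def)

lemma f_eq: "f (u $ 2) = 2 * A * D * plane_exp 0 2 u - 2 * B * C * plane_exp 0 (-2) u"
proof -
  have "exp (4 * d) = - (B * C) / (A * D)"
    using AD BC by (simp add: d_def divide_neg_pos)
  then have "A * D * exp (4 * d) = A * D * (- (B * C) / (A * D))" by (rule arg_cong)
  also have "\<dots> = - (B * C)" using AD by (metis less_irrefl nonzero_mult_div_cancel_left times_divide_eq_right)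
  finally have bc: "- (B * C) = A * D * exp (4 * d)" ..
  have "f (u $ 2) = 2 * (A * D) * (exp (2 * d) * exp (2 * (u $ 2 - d))) + 2 * (A * D) * (exp (2 * d) * exp (- (2 * (u $ 2 - d))))"
    by (simp add: f_def K_def cosh_field_def field_simps)
  also have "exp (2 * d) * exp (2 * (u $ 2 - d)) = plane_exp 0 2 u"
    by (simp add: plane_exp_def exp_add[symmetric] algebra_simps)
  also have "exp (2 * d) * exp (- (2 * (u $ 2 - d))) = exp (4 * d) * plane_exp 0 (-2) u"
    by (simp add: plane_exp_def exp_add[symmetric] algebra_simps)
  also have "2 * (A * D) * (exp (4 * d) * plane_exp 0 (-2) u) = - 2 * B * C * plane_exp 0 (-2) u"
  proof -
    have "2 * (A * D) * (exp (4 * d) * plane_exp 0 (-2) u) = 2 * (A * D * exp (4 * d)) * plane_exp 0 (-2) u" by simp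
    also have "\<dots> = - 2 * B * C * plane_exp 0 (-2) u" unfolding bc[symmetric] by simp
    finally show ?thesis .
  qed
  finally show ?thesis by simp
qed

lemma smooth_model: "smooth_on UNIV Z" "smooth_on UNIV P" "smooth_on UNIV x"
  unfolding Z_def[abs_def] P_def[abs_def] x_def[abs_def]
  by (intro smooth_on_intros smooth_on_plane_exp open_UNIV)+

lemma x_nth:
  "x u $ 1 = A * plane_exp 1 1 u + C * plane_exp 1 (-1) u"
  "x u $ 2 = B * plane_exp (-1) (-1) u + D * plane_exp (-1) 1 u"
  "x u $ 3 = 2 * (A * B - C * D) * u $ 1 + 2 * (A * B + C * D) * u $ 2 - A * D * plane_exp 0 2 u + B * C * plane_exp 0 (-2) u"
  by (simp_all add: x_def axis_def)

lemma axis_2_neq [simp]: "axis 1 (1::real) $ (2::2) = 0" "axis 2 (1::real) $ (1::2) = 0"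
  by (simp_all add: axis_def)

lemma partial_model:
  "partial 1 Z u = (A * plane_exp 1 1 u + C * plane_exp 1 (-1) u) *\<^sub>R axis 1 1
    + (- B * plane_exp (-1) (-1) u + - D * plane_exp (-1) 1 u) *\<^sub>R axis 2 1"
  "partial 2 Z u = (A * plane_exp 1 1 u + - C * plane_exp 1 (-1) u) *\<^sub>R axis 1 1
    + (- B * plane_exp (-1) (-1) u + D * plane_exp (-1) 1 u) *\<^sub>R axis 2 1"
  "partial 1 P u = (A * plane_exp 1 1 u + - C * plane_exp 1 (-1) u) *\<^sub>R axis 1 1
    + (- B * plane_exp (-1) (-1) u + D * plane_exp (-1) 1 u) *\<^sub>R axis 2 1"
  "partial 2 P u = (A * plane_exp 1 1 u + C * plane_exp 1 (-1) u) *\<^sub>R axis 1 1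
    + (- B * plane_exp (-1) (-1) u + - D * plane_exp (-1) 1 u) *\<^sub>R axis 2 1"
  "partial 1 (\<lambda>u. x u $ 3) u = 2 * (A * B - C * D)"
  "partial 2 (\<lambda>u. x u $ 3) u = 2 * (A * B + C * D) - 2 * A * D * plane_exp 0 2 u - 2 * B * C * plane_exp 0 (-2) u"
proof -
  note d = derivative_eq_intros plane_exp_derivative bounded_linear.has_derivative[OF bounded_linear_vec_nth]
  have "(Z has_derivative (\<lambda>w. (A * ((w $ 1 + w $ 2) * plane_exp 1 1 u) + C * ((w $ 1 - w $ 2) * plane_exp 1 (-1) u)) *\<^sub>R axis 1 1
    + (B * ((- w $ 1 - w $ 2) * plane_exp (-1) (-1) u) + D * ((- w $ 1 + w $ 2) * plane_exp (-1) 1 u)) *\<^sub>R axis 2 1)) (at u)"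
    unfolding Z_def[abs_def] by (rule d | simp)+
  from partial_eqI[OF this]
  show "partial 1 Z u = (A * plane_exp 1 1 u + C * plane_exp 1 (-1) u) *\<^sub>R axis 1 1
    + (- B * plane_exp (-1) (-1) u + - D * plane_exp (-1) 1 u) *\<^sub>R axis 2 1"
    "partial 2 Z u = (A * plane_exp 1 1 u + - C * plane_exp 1 (-1) u) *\<^sub>R axis 1 1
    + (- B * plane_exp (-1) (-1) u + D * plane_exp (-1) 1 u) *\<^sub>R axis 2 1" by simp_all
  have "(P has_derivative (\<lambda>w. (A * ((w $ 1 + w $ 2) * plane_exp 1 1 u) + - C * ((w $ 1 - w $ 2) * plane_exp 1 (-1) u)) *\<^sub>R axis 1 1
    + (B * ((- w $ 1 - w $ 2) * plane_exp (-1) (-1) u) + - D * ((- w $ 1 + w $ 2) * plane_exp (-1) 1 u)) *\<^sub>R axis 2 1)) (at u)"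
    unfolding P_def[abs_def] by (rule d | simp)+
  from partial_eqI[OF this]
  show "partial 1 P u = (A * plane_exp 1 1 u + - C * plane_exp 1 (-1) u) *\<^sub>R axis 1 1
    + (- B * plane_exp (-1) (-1) u + D * plane_exp (-1) 1 u) *\<^sub>R axis 2 1"
    "partial 2 P u = (A * plane_exp 1 1 u + C * plane_exp 1 (-1) u) *\<^sub>R axis 1 1
    + (- B * plane_exp (-1) (-1) u + - D * plane_exp (-1) 1 u) *\<^sub>R axis 2 1" by simp_all
  have "((\<lambda>u. x u $ 3) has_derivative (\<lambda>w. 2 * (A * B - C * D) * w $ 1 + 2 * (A * B + C * D) * w $ 2
       - A * D * (2 * w $ 2 * plane_exp 0 2 u) + B * C * (- 2 * w $ 2 * plane_exp 0 (-2) u))) (at u)"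
  proof -
    have "(\<lambda>u. x u $ 3) = (\<lambda>u. 2 * (A * B - C * D) * u $ 1 + 2 * (A * B + C * D) * u $ 2
       - A * D * plane_exp 0 2 u + B * C * plane_exp 0 (-2) u)"
      by (simp add: x_def axis_def)
    then show ?thesis by (simp only:) (rule d | simp)+
  qed
  from partial_eqI[OF this]
  show "partial 1 (\<lambda>u. x u $ 3) u = 2 * (A * B - C * D)"
    "partial 2 (\<lambda>u. x u $ 3) u = 2 * (A * B + C * D) - 2 * A * D * plane_exp 0 2 u - 2 * B * C * plane_exp 0 (-2) u"
    by simp_all
qed

lemma det2_axes: "det2 (p *\<^sub>R axis 1 1 + q *\<^sub>R axis 2 1) (r *\<^sub>R axis 1 1 + s *\<^sub>R axis 2 1) = p * s - q * r"
  by (simp add: det2_def)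

lemma x_conormal: "partial i x u $ 3 = - det2 (P u) (partial i Z u)"
proof -
  have "partial i (\<lambda>u. x u $ 3) u = - det2 (P u) (partial i Z u)"
    using exhaust_2[of i]
    by (elim disjE; simp only: partial_model P_def det2_axes plane_exp_product)
      (simp_all add: plane_exp_0 algebra_simps)
  then show ?thesis using partial_vec_nth[OF smooth_model(3), of u i 3] by simp
qed

lemma jacobian: "det2 (partial 1 Z u) (partial 2 Z u) = f (u $ 2)"
  unfolding f_eq partial_model det2_axes plane_exp_product by (simp add: plane_exp_0)

lemma transversal: "det3 (partial 1 x u) (partial 2 x u) (axis 3 1) = f (u $ 2)"
  and metric_coeff: "transversal_coeff x (axis 3 1) u (axis i 1) (axis j 1) = - det2 (partial i P u) (partial j Z u)"
proof -
  have xZ: "x v $ 1 = Z v $ 1" "x v $ 2 = Z v $ 2" for v by (simp_all add: x_def Z_def axis_def)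
  have ne: "det2 (partial 1 Z u) (partial 2 Z u) \<noteq> 0" using f_pos[of "u $ 2"] unfolding jacobian by simp
  note * = affine_metric_conormal[OF open_UNIV UNIV_I smooth_model(3,1,2) xZ x_conormal ne]
  show "det3 (partial 1 x u) (partial 2 x u) (axis 3 1) = f (u $ 2)" using *(1) unfolding jacobian .
  show "transversal_coeff x (axis 3 1) u (axis i 1) (axis j 1) = - det2 (partial i P u) (partial j Z u)" by (rule *(2))
qed

definition G :: "real^2 \<Rightarrow> real^2^2" where
  "G u = (\<chi> i j. if i = j then (if i = 1 then f (u $ 2) else - f (u $ 2)) else 0)"

text \<open>Since \<alpha> depends on s + t and \<beta> on s - t, each partial derivative of
  \<alpha> - \<beta> is the other partial derivative of \<alpha> + \<beta>. Hence the metric is the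
  Jacobian times ds^2 - dt^2.\<close>

lemma affine_metric_model: "affine_metric x (axis 3 1) (UNIV, \<lambda>p. p) = G"
proof -
  have "partial 1 P u = partial 2 Z u" "partial 2 P u = partial 1 Z u" for u by (simp_all only: partial_model)
  then have "- det2 (partial i P u) (partial j Z u) = G u $ i $ j" for i j u
    using exhaust_2[of i] exhaust_2[of j] jacobian[of u] det2_commute[of "partial 2 Z u" "partial 1 Z u"]
    by (auto simp: G_def)
  then show ?thesis
    by (simp add: affine_metric_def in_chart_plane metric_coeff fun_eq_iff vec_eq_iff)
qed

lemma form_G: "form (G u) v w = f (u $ 2) * (v $ 1 * w $ 1 - v $ 2 * w $ 2)"
  by (simp add: form_def G_def inner_vec_def matrix_vector_mult_def sum_2 algebra_simps)

lemma IAS_model: "indefinite_improper_affine_sphere euclidean plane_atlas x (axis 3 1)"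
proof -
  have tr: "det3 (partial 1 x u) (partial 2 x u) (axis 3 1) \<noteq> 0" for u
    unfolding transversal using f_pos[of "u $ 2"] by simp
  have lor: "lorentzian_form (G u)" for u
  proof -
    define r where "r = 1 / sqrt (f (u $ 2))"
    have r: "f (u $ 2) * (r * r) = 1" using f_pos[of "u $ 2"] by (simp add: r_def)
    have "transpose (G u) = G u" by (simp add: transpose_def G_def vec_eq_iff)
    moreover have "form (G u) (r *\<^sub>R axis 1 1) (r *\<^sub>R axis 1 1) = 1" "form (G u) (r *\<^sub>R axis 2 1) (r *\<^sub>R axis 2 1) = -1"
      "form (G u) (r *\<^sub>R axis 1 1) (r *\<^sub>R axis 2 1) = 0"
      using r by (simp_all add: form_G)
    ultimately show ?thesis unfolding lorentzian_form_def by blast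
  qed
  have vol: "sqrt ((form (G u) v w)\<^sup>2 - form (G u) v v * form (G u) w w)
      = \<bar>det3 (frechet_derivative x (at u) v) (frechet_derivative x (at u) w) (axis 3 1)\<bar>" for u v w
  proof -
    have "det3 (frechet_derivative x (at u) v) (frechet_derivative x (at u) w) (axis 3 1)
        = (v $ 1 * w $ 2 - v $ 2 * w $ 1) * det3 (partial 1 x u) (partial 2 x u) (axis 3 1)"
      unfolding smooth_on_frechet_eq_partial[OF smooth_model(3) UNIV_I] by (simp add: det3_expand algebra_simps)
    moreover have "(form (G u) v w)\<^sup>2 - form (G u) v v * form (G u) w w = ((v $ 1 * w $ 2 - v $ 2 * w $ 1) * f (u $ 2))\<^sup>2"
      unfolding form_G by (simp add: power2_eq_square algebra_simps)
    ultimately show ?thesis unfolding transversal by simp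
  qed
  have "axis 3 1 \<noteq> (0::real^3)" by (simp add: axis_eq_0_iff)
  then show ?thesis
    unfolding indefinite_improper_affine_sphere_def smooth_immersion_def plane_atlas_def Let_def
    using smooth_surface_plane[unfolded plane_atlas_def] lor vol smooth_model(3) transversal_if_det3[OF smooth_model(3) UNIV_I tr]
    by (simp add: in_chart_plane chart_image_plane affine_metric_model)
qed

lemma det_G: "det (G u) \<noteq> 0"
  using f_pos[of "u $ 2"] by (simp add: det_2 G_def)

lemma partial_G:
  "partial l (\<lambda>v. G v $ i $ j) u = (if l = 2 then 2 * tanh (2 * (u $ 2 - d)) * G u $ i $ j else 0)"
proof -
  have f': "((\<lambda>v. f (v $ 2)) has_derivative (\<lambda>w. 2 * tanh (2 * (u $ 2 - d)) * f (u $ 2) * w $ 2)) (at u)"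
  proof -
    have "(f has_real_derivative 2 * tanh (2 * (u $ 2 - d)) * f (u $ 2)) (at (u $ 2))"
      unfolding f_def by (auto intro!: derivative_eq_intros simp: tanh_def)
    from DERIV_compose_FDERIV[OF this bounded_linear.has_derivative[OF bounded_linear_vec_nth has_derivative_ident]]
    show ?thesis by (simp add: mult.commute)
  qed
  have "((\<lambda>v. G v $ i $ j) has_derivative (\<lambda>w. 2 * tanh (2 * (u $ 2 - d)) * G u $ i $ j * w $ 2)) (at u)"
    using f' has_derivative_minus[OF f'] exhaust_2[of i] exhaust_2[of j] by (auto simp: G_def)
  from partial_eqI[OF this] show ?thesis using exhaust_2[of l] by auto
qed

lemma christoffel_G:
  "christoffel G k i j u = (if (k = 1) = (i \<noteq> j) then tanh (2 * (u $ 2 - d)) else 0)"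
proof -
  define T where "T = tanh (2 * (u $ 2 - d))"
  define F where "F = f (u $ 2)"
  have pG: "partial l (\<lambda>v. G v $ i $ j) u = (if l = 2 then 2 * T * G u $ i $ j else 0)" for l i j
    unfolding T_def by (rule partial_G)
  have F: "F \<noteq> 0" using f_pos[of "u $ 2"] by (simp add: F_def)
  have "F * christoffel G 1 i j u = F * (if i \<noteq> j then T else 0)"
    using christoffel_lowered[of G u, OF det_G, of 1 i j] exhaust_2[of i] exhaust_2[of j]
    by (auto simp: pG) (auto simp: G_def F_def)
  moreover have "F * christoffel G 2 i j u = F * (if i = j then T else 0)"
    using christoffel_lowered[of G u, OF det_G, of 2 i j] exhaust_2[of i] exhaust_2[of j]
    by (auto simp: pG) (auto simp: G_def F_def)
  ultimately show ?thesis using F exhaust_2[of k] by (auto simp: T_def)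
qed

lemma not_flat_model: "\<not> flat_metric plane_atlas (affine_metric x (axis 3 1))"
proof
  assume "flat_metric plane_atlas (affine_metric x (axis 3 1))"
  then have flat: "riemann G 1 2 1 2 u = 0" for u
    unfolding flat_metric_def plane_atlas_def by (simp add: chart_image_plane affine_metric_model)
  \<comment> \<open>On the line t = d all Christoffel symbols vanish, and only their derivatives
    contribute to the curvature.\<close>
  define u :: "real^2" where "u = d *\<^sub>R axis 2 1"
  have u2: "u $ 2 = d" by (simp add: u_def)
  have c0: "christoffel G 1 2 2 = (\<lambda>u. 0)" "christoffel G 1 1 2 = (\<lambda>u. tanh (2 * (u $ 2 - d)))" "christoffel G 1 2 1 = (\<lambda>u. tanh (2 * (u $ 2 - d)))"
    by (simp_all add: christoffel_G fun_eq_iff)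
  have "((\<lambda>u. tanh (2 * (u $ 2 - d))) has_derivative (\<lambda>w. 2 * w $ 2)) (at u)"
  proof -
    have "((\<lambda>t. tanh (2 * (t - d))) has_real_derivative 2) (at (u $ 2))"
      by (auto intro!: derivative_eq_intros simp: u2)
    from DERIV_compose_FDERIV[OF this bounded_linear.has_derivative[OF bounded_linear_vec_nth has_derivative_ident]]
    show ?thesis by (simp add: mult.commute)
  qed
  from partial_eqI[OF this, of 2] have "partial 2 (\<lambda>u. tanh (2 * (u $ 2 - d))) u = 2" by simp
  then have "riemann G 1 2 1 2 u = -2"
    unfolding riemann_def c0 by (simp add: sum_2 christoffel_G u2 partial_const)
  then show False using flat[of u] by simp
qed

lemma complete_model: "complete_metric euclidean plane_atlas (affine_metric x (axis 3 1))"
  unfolding complete_metric_def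
proof (intro allI impI, elim conjE)
  have eqs: "(\<forall>k. x'' $ k + (\<Sum>i\<in>UNIV. \<Sum>j\<in>UNIV. christoffel (affine_metric x (axis 3 1) (UNIV, \<lambda>p. p)) k i j u * v $ i * v $ j) = 0)
    \<longleftrightarrow> x'' $ 1 = - 2 * tanh (2 * (u $ 2 - d)) * v $ 1 * v $ 2 \<and> x'' $ 2 = - tanh (2 * (u $ 2 - d)) * ((v $ 1)\<^sup>2 + (v $ 2)\<^sup>2)" for u v x''
    unfolding forall_2 affine_metric_model sum_2
    by (auto simp add: christoffel_G power2_eq_square algebra_simps)
  fix I and \<gamma> :: "real \<Rightarrow> real^2"
  assume I: "open I" "is_interval I" "I \<noteq> {}" and "geodesic_on euclidean plane_atlas (affine_metric x (axis 3 1)) I \<gamma>"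
  then obtain x' x'' where g: "\<forall>t\<in>I. (\<gamma> has_vector_derivative x' t) (at t) \<and> (x' has_vector_derivative x'' t) (at t) \<and>
     x'' t $ 1 = - 2 * tanh (2 * (\<gamma> t $ 2 - d)) * x' t $ 1 * x' t $ 2 \<and> x'' t $ 2 = - tanh (2 * (\<gamma> t $ 2 - d)) * ((x' t $ 1)\<^sup>2 + (x' t $ 2)\<^sup>2)"
    unfolding geodesic_on_def plane_atlas_def by (auto simp: eqs)
  have nth: "((\<lambda>t. y t $ i) has_real_derivative y' $ i) (at t)" if "(y has_vector_derivative y') (at t)" for y :: "real \<Rightarrow> real^2" and y' t i
    using bounded_linear.has_vector_derivative[OF bounded_linear_vec_nth that]
    by (simp add: has_real_derivative_iff_has_vector_derivative)
  obtain S S1 S2 T T1 T2 where ST: "\<And>t. (S has_real_derivative S1 t) (at t)" "\<And>t. (S1 has_real_derivative S2 t) (at t)"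
    "\<And>t. (T has_real_derivative T1 t) (at t)" "\<And>t. (T1 has_real_derivative T2 t) (at t)"
    and eq: "\<And>t. S2 t = - 2 * tanh (2 * (T t - d)) * S1 t * T1 t"
    "\<And>t. T2 t = - tanh (2 * (T t - d)) * ((S1 t)\<^sup>2 + (T1 t)\<^sup>2)"
    and ext: "\<And>t. t \<in> I \<Longrightarrow> S t = \<gamma> t $ 1 \<and> T t = \<gamma> t $ 2"
    by (rule cosh_geodesic_extension[OF I, of "\<lambda>t. \<gamma> t $ 1" "\<lambda>t. x' t $ 1" "\<lambda>t. x'' t $ 1" "\<lambda>t. \<gamma> t $ 2" "\<lambda>t. x' t $ 2" "\<lambda>t. x'' t $ 2" d])
      (use g nth in blast)+
  define cv :: "(real \<Rightarrow> real) \<Rightarrow> (real \<Rightarrow> real) \<Rightarrow> real \<Rightarrow> real^2" where "cv a b t = a t *\<^sub>R axis 1 1 + b t *\<^sub>R axis 2 1" for a b t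
  have cv: "cv a b t $ 1 = a t" "cv a b t $ 2 = b t" for a b t by (simp_all add: cv_def)
  have der: "(cv a b has_vector_derivative cv a' b' t) (at t)"
    if "(a has_real_derivative a' t) (at t)" "(b has_real_derivative b' t) (at t)" for a b a' b' t
    unfolding cv_def by (intro has_vector_derivative_add has_vector_derivative_scaleR[OF that(1) has_vector_derivative_const, simplified]
        has_vector_derivative_scaleR[OF that(2) has_vector_derivative_const, simplified])
  have d1: "(cv S T has_vector_derivative cv S1 T1 t) (at t)" for t by (rule der) (rule ST)+
  have d2: "(cv S1 T1 has_vector_derivative cv S2 T2 t) (at t)" for t by (rule der) (rule ST)+
  have "geodesic_on euclidean plane_atlas (affine_metric x (axis 3 1)) UNIV (cv S T)"
    unfolding geodesic_on_def
  proof
    show "continuous_map (top_of_set UNIV) euclidean (cv S T)"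
      using d1 by (auto intro!: continuous_at_imp_continuous_on has_vector_derivative_continuous)
    have "\<forall>t\<in>UNIV. cv S T t \<in> UNIV \<longrightarrow> ((\<lambda>r. cv S T r) has_vector_derivative cv S1 T1 t) (at t) \<and> (cv S1 T1 has_vector_derivative cv S2 T2 t) (at t) \<and>
        (\<forall>k. cv S2 T2 t $ k + (\<Sum>i\<in>UNIV. \<Sum>j\<in>UNIV. christoffel (affine_metric x (axis 3 1) (UNIV, \<lambda>p. p)) k i j (cv S T t) * cv S1 T1 t $ i * cv S1 T1 t $ j) = 0)"
      unfolding eqs cv using d1 d2 eq by simp
    then show "\<forall>(U, \<phi>)\<in>plane_atlas. \<exists>x' x''. \<forall>t\<in>UNIV. cv S T t \<in> U \<longrightarrow>
        ((\<lambda>r. \<phi> (cv S T r)) has_vector_derivative x' t) (at t) \<and> (x' has_vector_derivative x'' t) (at t) \<and>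
        (\<forall>k. x'' t $ k + (\<Sum>i\<in>UNIV. \<Sum>j\<in>UNIV. christoffel (affine_metric x (axis 3 1) (U, \<phi>)) k i j (\<phi> (cv S T t)) * x' t $ i * x' t $ j) = 0)"
      unfolding plane_atlas_def by blast
  qed
  moreover have "\<forall>t\<in>I. cv S T t = \<gamma> t" using ext by (simp add: vec_eq_iff forall_2 cv)
  ultimately show "\<exists>\<gamma>'. geodesic_on euclidean plane_atlas (affine_metric x (axis 3 1)) UNIV \<gamma>' \<and> (\<forall>t\<in>I. \<gamma>' t = \<gamma> t)" by blast
qed

lemma helicoidal_model: "helicoidal euclidean x"
proof -
  \<comment> \<open>The change of the third coordinate under a unit translation of \<open>s\<close>,
    that is the pitch of the group; for \<open>psi_acm\<close> it is \<open>a\<close>.\<close>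
  define h where "h = 2 * (A * B - C * D)"
  define M :: "real \<Rightarrow> real^3^3" where "M s = (\<chi> i j. if i = j then (if i = 1 then exp s else if i = 2 then exp (- s) else 1) else 0)" for s
  define T where "T s v = M s *v v + (h * s) *\<^sub>R axis 3 1" for s v
  have T_nth: "T s v $ 1 = exp s * v $ 1" "T s v $ 2 = exp (- s) * v $ 2" "T s v $ 3 = v $ 3 + h * s" for s v
    by (simp_all add: T_def M_def matrix_vector_mult_def sum_3 axis_def)
  have "det (M s) = 1" for s
    by (simp add: det_3 M_def exp_add[symmetric])
  then have "equiaffine (T s)" for s unfolding equiaffine_def T_def[abs_def] by blast
  moreover have "T 0 = id" by (simp add: fun_eq_iff vec_eq_iff forall_3 T_nth)
  moreover have "T (s + r) = T s \<circ> T r" for s r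
    by (simp add: fun_eq_iff vec_eq_iff forall_3 T_nth exp_add exp_minus exp_diff divide_inverse algebra_simps)
  moreover have "continuous_on UNIV (\<lambda>s. T s v)" for v
  proof -
    have "(\<lambda>s. T s v) = (\<lambda>s. (exp s * v $ 1) *\<^sub>R axis 1 1 + (exp (- s) * v $ 2) *\<^sub>R axis 2 1 + (v $ 3 + h * s) *\<^sub>R axis 3 1)"
      by (simp add: fun_eq_iff vec_eq_iff forall_3 T_nth axis_def)
    then show ?thesis by (simp only:) (intro continuous_intros)
  qed
  ultimately have grp: "one_parameter_group T" unfolding one_parameter_group_def by blast
  have "T 1 (axis 1 1) $ 1 \<noteq> id (axis 1 1) $ 1" unfolding T_nth by simp
  then have nontriv: "\<exists>s. T s \<noteq> id" by metis
  have shift: "T s (x u) = x (u + s *\<^sub>R axis 1 1)" for s u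
  proof -
    have e: "plane_exp k l (u + s *\<^sub>R axis 1 1) = exp (k * s) * plane_exp k l u" for k l
      by (simp add: plane_exp_def exp_add[symmetric] algebra_simps)
    show ?thesis
      unfolding vec_eq_iff forall_3 T_nth x_nth e by (simp add: h_def algebra_simps)
  qed
  have "T s ` range x = range x" for s
  proof
    show "T s ` range x \<subseteq> range x" by (auto simp: shift)
    have "x u = T s (x (u + (- s) *\<^sub>R axis 1 1))" for u unfolding shift by simp
    then show "range x \<subseteq> T s ` range x" by blast
  qed
  then show ?thesis using grp nontriv unfolding helicoidal_def by auto
qed

lemma complete_nonflat_helicoidal_model: "complete_nonflat_helicoidal_IAS euclidean plane_atlas x"
  unfolding complete_nonflat_helicoidal_IAS_def
  using helicoidal_model IAS_model complete_model not_flat_model by blast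

end

text \<open>With W = 4c^2 + m^2 - a^2 the products are AD = (4cm + W) / (16c) and BC = (W - 4cm) /
  (16c), so the inequality on \<open>a\<close>, \<open>c\<close>, \<open>m\<close> is the pair of
  sign conditions.\<close>

lemma admissible_imp_model_surface:
  assumes "admissible a c m"
  shows "model_surface ((a + 2*c + m) / 4) ((a + 2*c - m) / (4*c)) ((2*c - a - m) / 4) ((2*c - a + m) / (4*c))"
proof
  define W where "W = 4 * c\<^sup>2 + m\<^sup>2 - a\<^sup>2"
  have c: "c > 0" and b: "4 * c * m + W > 0" "W - 4 * c * m < 0"
    using assms by (auto simp: admissible_def W_def[symmetric])
  have "(a + 2*c + m) / 4 * ((2*c - a + m) / (4*c)) = (4 * c * m + W) / (16 * c)"
    "(a + 2*c - m) / (4*c) * ((2*c - a - m) / 4) = (W - 4 * c * m) / (16 * c)"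
    using c unfolding W_def
    by (simp_all add: divide_simps power2_eq_square) (simp_all add: algebra_simps)
  moreover have "(4 * c * m + W) / (16 * c) > 0" "(W - 4 * c * m) / (16 * c) < 0"
    by (rule divide_pos_pos[OF b(1)] divide_neg_pos[OF b(2)], use c in simp)+
  ultimately show "(a + 2*c + m) / 4 * ((2*c - a + m) / (4*c)) > 0" "(a + 2*c - m) / (4*c) * ((2*c - a - m) / 4) < 0"
    by (simp_all only:)
qed

lemma psi_acm_eq_model:
  assumes "admissible a c m"
  shows "psi_acm a c m = model_surface.x ((a + 2*c + m) / 4) ((a + 2*c - m) / (4*c)) ((2*c - a - m) / 4) ((2*c - a + m) / (4*c))"
proof
  fix u
  define A B C D where "A = (a + 2*c + m) / 4" and "B = (a + 2*c - m) / (4*c)" and "C = (2*c - a - m) / 4" and "D = (2*c - a + m) / (4*c)"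
  note defs = A_def B_def C_def D_def
  have c: "c \<noteq> 0" using assms by (simp add: admissible_def)
  interpret model_surface A B C D unfolding defs by (rule admissible_imp_model_surface[OF assms])
  have e: "exp (u $ 1 - u $ 2) = plane_exp 1 (-1) u"
    "exp (- u $ 1 - u $ 2) = plane_exp (-1) (-1) u"
    "exp (2 * u $ 2) = plane_exp 0 2 u" "exp (- 2 * u $ 2) = plane_exp 0 (-2) u"
    by (simp_all add: plane_exp_def exp_add[symmetric])
  have "1/4 * E * (F * (a + 2*c + m) - a + 2*c - m) = A * (E * F) + C * E" for E F
    by (simp add: defs algebra_simps add_divide_distrib diff_divide_distrib)
  then have "psi_acm a c m u $ 1 = A * (exp (u $ 1 - u $ 2) * exp (2 * u $ 2)) + C * exp (u $ 1 - u $ 2)"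
    by (simp only: psi_acm_def Let_def vector_3)
  then have 1: "psi_acm a c m u $ 1 = x u $ 1" unfolding e by (simp add: x_nth plane_exp_mult)
  have "1/(4*c) * E * (F * (- a + 2*c + m) + a + 2*c - m) = B * E + D * (E * F)" for E F
    using c by (simp add: defs divide_simps) (simp add: algebra_simps)
  then have "psi_acm a c m u $ 2 = B * exp (- u $ 1 - u $ 2) + D * (exp (- u $ 1 - u $ 2) * exp (2 * u $ 2))"
    by (simp only: psi_acm_def Let_def vector_3)
  then have 2: "psi_acm a c m u $ 2 = x u $ 2" unfolding e by (simp add: x_nth plane_exp_mult)
  have "a * s + (F * p + E * q + 4 * r * t) / (16 * c) = a * s + 4 * r / (16 * c) * t + q / (16 * c) * E + p / (16 * c) * F" for s t E F p q r
    by (simp add: add_divide_distrib mult.commute)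
  then have "psi_acm a c m u $ 3 = a * u $ 1 + 4 * (a\<^sup>2 + 4*c\<^sup>2 - m\<^sup>2) / (16*c) * u $ 2
      + (a\<^sup>2 - (2*c + m)\<^sup>2) / (16*c) * exp (2 * u $ 2) + (- a\<^sup>2 + (- 2*c + m)\<^sup>2) / (16*c) * exp (- 2 * u $ 2)"
    by (simp only: psi_acm_def Let_def vector_3)
  moreover have "a = 2 * (A * B - C * D)"
    using c by (simp add: defs divide_simps) (simp add: algebra_simps)
  from arg_cong[OF this, of "\<lambda>z. z * u $ 1"] have "a * u $ 1 = 2 * (A * B - C * D) * u $ 1" .
  moreover have "4 * (a\<^sup>2 + 4*c\<^sup>2 - m\<^sup>2) / (16*c) = 2 * (A * B + C * D)"
    using c by (simp add: defs divide_simps) (simp add: algebra_simps power2_eq_square)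
  moreover have "(a\<^sup>2 - (2*c + m)\<^sup>2) / (16*c) = - (A * D)"
    using c by (simp add: defs divide_simps) (simp add: algebra_simps power2_eq_square)
  moreover have "(- a\<^sup>2 + (- 2*c + m)\<^sup>2) / (16*c) = B * C"
    using c by (simp add: defs divide_simps) (simp add: algebra_simps power2_eq_square)
  ultimately have "psi_acm a c m u $ 3 = 2 * (A * B - C * D) * u $ 1 + 2 * (A * B + C * D) * u $ 2
      + - (A * D) * exp (2 * u $ 2) + B * C * exp (- 2 * u $ 2)" by (simp only:)
  then have 3: "psi_acm a c m u $ 3 = x u $ 3" unfolding e by (simp add: x_nth plane_exp_mult)
  show "psi_acm a c m u = model_surface.x ((a + 2*c + m) / 4) ((a + 2*c - m) / (4*c)) ((2*c - a - m) / 4) ((2*c - a + m) / (4*c)) u"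
    unfolding defs[symmetric] using 1 2 3 by (simp add: vec_eq_iff forall_3)
qed

theorem complete_nonflat_helicoidal_psi_acm:
  assumes "admissible a c m"
  shows "complete_nonflat_helicoidal_IAS euclidean plane_atlas (psi_acm a c m)"
  unfolding psi_acm_eq_model[OF assms]
  by (rule model_surface.complete_nonflat_helicoidal_model[OF admissible_imp_model_surface[OF assms]])

subsection \<open>Global coordinates from complete coordinate lines\<close>

text \<open>The set of agreement is closed because \<open>X\<close> is Hausdorff. It is open because
  it is the preimage of \<open>N\<close> under \<open>c\<close>: \<open>d\<close> stays in
  \<open>N\<close>, and inside \<open>N\<close> the two curves cannot differ.\<close>

lemma unique_continuation:
  assumes X: "Hausdorff_space X" "openin X N" and I: "connected (I :: real set)"
    and c: "continuous_map (top_of_set I) X c" and d: "continuous_map (top_of_set I) X d"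
    and N: "\<And>x. x \<in> I \<Longrightarrow> d x \<in> N" "\<And>x. x \<in> I \<Longrightarrow> c x \<in> N \<Longrightarrow> c x = d x"
    and x: "x \<in> I" "y \<in> I" "c x = d x"
  shows "c y = d y"
proof -
  define E where "E = {x \<in> topspace (top_of_set I). c x = d x}"
  have "closedin (top_of_set I) E"
    unfolding E_def by (rule closedin_continuous_maps_eq[OF X(1) c d])
  moreover have "openin (top_of_set I) E"
  proof -
    have "c x = d x \<longleftrightarrow> c x \<in> N" if "x \<in> I" for x
    proof
      show "c x \<in> N" if "c x = d x" unfolding that by (rule N(1)) fact
    qed (rule N(2)[OF that])
    then have "E = {x \<in> topspace (top_of_set I). c x \<in> N}"
      unfolding E_def by (intro Collect_cong conj_cong) simp_all
    then show ?thesis using openin_continuous_map_preimage[OF c X(2)] by simp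
  qed
  ultimately have "E = {} \<or> E = I" using I unfolding connected_clopen by blast
  then show ?thesis using x unfolding E_def by auto
qed

text \<open>\<open>\<sigma> p\<close> is the local inverse of \<open>(u, v)\<close> at \<open>p\<close>; \<open>H p\<close> and \<open>V p\<close> are the coordinate lines through \<open>p\<close>.\<close>
locale line_lifting =
  fixes X :: "'p topology" and u v :: "'p \<Rightarrow> real" and e :: "'p \<Rightarrow> real" and \<sigma> :: "'p \<Rightarrow> real \<times> real \<Rightarrow> 'p"
    and H V :: "'p \<Rightarrow> real \<Rightarrow> 'p"
  assumes Hausdorff: "Hausdorff_space X" and connected: "connected_space X"
    and continuous: "continuous_map X euclideanreal u" "continuous_map X euclideanreal v"
    and e_pos: "\<And>p. p \<in> topspace X \<Longrightarrow> e p > 0"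
    and \<sigma>_base: "\<And>p. p \<in> topspace X \<Longrightarrow> \<sigma> p (u p, v p) = p"
    and \<sigma>_section: "\<And>p w. p \<in> topspace X \<Longrightarrow> w \<in> ball (u p) (e p) \<times> ball (v p) (e p) \<Longrightarrow>
      u (\<sigma> p w) = fst w \<and> v (\<sigma> p w) = snd w"
    and \<sigma>_continuous: "\<And>p. p \<in> topspace X \<Longrightarrow> continuous_map (top_of_set (ball (u p) (e p) \<times> ball (v p) (e p))) X (\<sigma> p)"
    and \<sigma>_open: "\<And>p. p \<in> topspace X \<Longrightarrow> openin X (\<sigma> p ` (ball (u p) (e p) \<times> ball (v p) (e p)))"
    and H: "\<And>p. p \<in> topspace X \<Longrightarrow> continuous_map euclideanreal X (H p) \<and> H p (u p) = p"
      "\<And>p x. p \<in> topspace X \<Longrightarrow> u (H p x) = x \<and> v (H p x) = v p"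
    and V: "\<And>p. p \<in> topspace X \<Longrightarrow> continuous_map euclideanreal X (V p) \<and> V p (v p) = p"
      "\<And>p y. p \<in> topspace X \<Longrightarrow> u (V p y) = u p \<and> v (V p y) = y"
begin

definition "cell p = ball (u p) (e p) \<times> ball (v p) (e p)"
definition "nbhd p = \<sigma> p ` cell p"

lemma cell_self: "p \<in> topspace X \<Longrightarrow> (u p, v p) \<in> cell p"
  using e_pos[of p] by (simp add: cell_def)

lemma nbhd_self: "p \<in> topspace X \<Longrightarrow> p \<in> nbhd p"
  unfolding nbhd_def using cell_self \<sigma>_base by (metis imageI)

lemma nbhd_open: "p \<in> topspace X \<Longrightarrow> openin X (nbhd p)"
  unfolding nbhd_def cell_def by (rule \<sigma>_open)

lemma nbhd_eq:
  assumes "p \<in> topspace X" "q \<in> nbhd p"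
  shows "q = \<sigma> p (u q, v q)"
proof -
  obtain w where w: "w \<in> cell p" "q = \<sigma> p w" using assms(2) by (auto simp: nbhd_def)
  show ?thesis using \<sigma>_section[OF assms(1) w(1)[unfolded cell_def]] w(2) by simp
qed

lemma H_in: "p \<in> topspace X \<Longrightarrow> H p x \<in> topspace X"
  using H(1)[of p] by (auto simp: continuous_map_def)

lemma V_in: "p \<in> topspace X \<Longrightarrow> V p y \<in> topspace X"
  using V(1)[of p] by (auto simp: continuous_map_def)

text \<open>Inside the image of the local inverse a point is determined by its coordinates, and both
  curves have coordinates \<open>(x, y)\<close>; so agreement at one height continues to all heights
  of the cell.\<close>

lemma V_eq_section:
  assumes p: "p \<in> topspace X" and q: "q \<in> topspace X" and x: "u p = x" "(x, y0) \<in> cell q" "(x, y) \<in> cell q"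
    and eq: "V p y0 = \<sigma> q (x, y0)"
  shows "V p y = \<sigma> q (x, y)"
proof (rule unique_continuation[OF Hausdorff nbhd_open[OF q], of "ball (v q) (e q)" "V p" "\<lambda>y. \<sigma> q (x, y)" y0 y])
  show "connected (ball (v q) (e q))" by simp
  show "continuous_map (top_of_set (ball (v q) (e q))) X (V p)"
    using V(1)[OF p] continuous_map_from_subtopology by blast
  have bx: "(x, y) \<in> cell q" if "y \<in> ball (v q) (e q)" for y
    using x(2) that by (simp add: cell_def)
  have "continuous_map (top_of_set (ball (v q) (e q))) X (\<sigma> q \<circ> (\<lambda>y. (x, y)))"
  proof (rule continuous_map_compose[OF _ \<sigma>_continuous[OF q]])
    show "continuous_map (top_of_set (ball (v q) (e q))) (top_of_set (ball (u q) (e q) \<times> ball (v q) (e q))) (\<lambda>y. (x, y))"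
      using bx by (auto simp: continuous_map_in_subtopology cell_def intro!: continuous_intros)
  qed
  then show "continuous_map (top_of_set (ball (v q) (e q))) X (\<lambda>y. \<sigma> q (x, y))" by (simp add: o_def)
  fix y assume y: "y \<in> ball (v q) (e q)"
  show "\<sigma> q (x, y) \<in> nbhd q" using bx[OF y] by (simp add: nbhd_def)
  show "V p y = \<sigma> q (x, y)" if "V p y \<in> nbhd q"
    using nbhd_eq[OF q that] V(2)[OF p, of y] x(1) by simp
qed (use x eq in \<open>auto simp: cell_def\<close>)

definition "G p x y = V (H p x) y"

lemma G_coord: "p \<in> topspace X \<Longrightarrow> G p x y \<in> topspace X \<and> u (G p x y) = x \<and> v (G p x y) = y"
  unfolding G_def using H(2)[of p x] V(2)[OF H_in, of p x y] V_in[OF H_in] by auto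

text \<open>Continuity of the horizontal curve at height \<open>y\<close>. It is the crux: the
  vertical lines are chosen separately for each starting point, and nothing relates neighbouring
  ones in advance.\<close>

definition "good p x y \<longleftrightarrow> (\<forall>U. openin X U \<and> G p x y \<in> U \<longrightarrow> (\<exists>d>0. \<forall>x'\<in>ball x d. G p x' y \<in> U))"

lemma section_near:
  assumes q: "q \<in> topspace X" and w: "(x, y) \<in> cell q" and U: "openin X U" "\<sigma> q (x, y) \<in> U"
  shows "\<exists>d>0. \<forall>x'\<in>ball x d. \<forall>y'\<in>ball y d. (x', y') \<in> cell q \<and> \<sigma> q (x', y') \<in> U"
proof -
  define S where "S = {w \<in> topspace (top_of_set (ball (u q) (e q) \<times> ball (v q) (e q))). \<sigma> q w \<in> U}"
  have "openin (top_of_set (ball (u q) (e q) \<times> ball (v q) (e q))) S"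
    unfolding S_def by (rule openin_continuous_map_preimage[OF \<sigma>_continuous[OF q] U(1)])
  then have "open S" by (rule openin_open_trans) (intro open_Times open_ball)
  moreover have "(x, y) \<in> S" using w U(2) by (simp add: S_def cell_def)
  ultimately obtain a b where ab: "open a" "open b" "x \<in> a" "y \<in> b" "a \<times> b \<subseteq> S"
    by (auto elim: open_prod_elim)
  obtain d1 d2 where d: "d1 > 0" "ball x d1 \<subseteq> a" "d2 > 0" "ball y d2 \<subseteq> b"
    using ab(1-4) openE by metis
  show ?thesis
  proof (intro exI[of _ "min d1 d2"] conjI ballI)
    show "min d1 d2 > 0" using d by simp
    fix x' y' assume "x' \<in> ball x (min d1 d2)" "y' \<in> ball y (min d1 d2)"
    then have "(x', y') \<in> a \<times> b" using d(2,4) by (auto simp: subset_iff)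
    then have "(x', y') \<in> S" using ab(5) by blast
    then show "(x', y') \<in> cell q" "\<sigma> q (x', y') \<in> U" by (auto simp: S_def cell_def)
  qed
qed

text \<open>Continuity at one height \<open>y'\<close> keeps the points \<open>G p x' y'\<close> in
  the range of the local inverse at \<open>G p x y\<close>, where they are determined by their
  coordinates. From there each vertical line follows the local inverse through the whole height of
  the cell.\<close>

lemma good_step:
  assumes p: "p \<in> topspace X" and good: "good p x y'" and y': "y' \<in> ball y (e (G p x y))"
  shows "\<exists>d>0. \<forall>x'\<in>ball x d. \<forall>y''\<in>ball y (e (G p x y)). (x', y'') \<in> cell (G p x y) \<and> G p x' y'' = \<sigma> (G p x y) (x', y'')"
proof -
  define q where "q = G p x y"
  have q: "q \<in> topspace X" "u q = x" "v q = y" using G_coord[OF p] by (auto simp: q_def)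
  note e = e_pos[OF q(1)]
  have bx: "(x, y') \<in> cell q" "(x, y) \<in> cell q" using y' e by (auto simp: cell_def q q_def[symmetric])
  have "V (H p x) y' = \<sigma> q (x, y')"
  proof (rule V_eq_section[OF H_in[OF p] q(1) _ bx(2,1)])
    show "u (H p x) = x" using H(2)[OF p] by simp
    show "V (H p x) y = \<sigma> q (x, y)" using \<sigma>_base[OF q(1)] q by (simp add: q_def G_def)
  qed
  then have "G p x y' \<in> nbhd q" using bx(1) by (simp add: G_def nbhd_def)
  from good[unfolded good_def, rule_format, OF conjI[OF nbhd_open[OF q(1)] this]]
  obtain d where d: "d > 0" "\<forall>x'\<in>ball x d. G p x' y' \<in> nbhd q" by (elim exE conjE)
  have "(x', y'') \<in> cell q \<and> G p x' y'' = \<sigma> q (x', y'')" if x': "x' \<in> ball x (min d (e q))" and y'': "y'' \<in> ball y (e q)" for x' y''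
  proof -
    have b: "(x', y') \<in> cell q" "(x', y'') \<in> cell q" using x' y' y'' by (auto simp: cell_def q q_def[symmetric])
    have "G p x' y' = \<sigma> q (x', y')"
      using nbhd_eq[OF q(1) bspec[OF d(2), of x']] G_coord[OF p, of x' y'] x' by simp
    then show ?thesis
      using V_eq_section[OF H_in[OF p] q(1) _ b, of x'] H(2)[OF p, of x'] b(2) by (simp add: G_def)
  qed
  then show ?thesis using d(1) e unfolding q_def[symmetric] by (intro exI[of _ "min d (e q)"]) simp
qed

lemma good_interval:
  assumes p: "p \<in> topspace X" and "good p x y'" and y': "y' \<in> ball y (e (G p x y))"
    and y'': "y'' \<in> ball y (e (G p x y))"
  shows "good p x y''"
  unfolding good_def
proof (intro allI impI, elim conjE)
  fix U assume U: "openin X U" "G p x y'' \<in> U"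
  define q where "q = G p x y"
  have q: "q \<in> topspace X" using G_coord[OF p] by (auto simp: q_def)
  from good_step[OF assms(1-3), folded q_def] obtain d where "d > 0"
    and "\<forall>x'\<in>ball x d. \<forall>y''\<in>ball y (e q). (x', y'') \<in> cell q \<and> G p x' y'' = \<sigma> q (x', y'')" by (elim exE conjE)
  then have d: "d > 0" "\<And>x'. x' \<in> ball x d \<Longrightarrow> (x', y'') \<in> cell q \<and> G p x' y'' = \<sigma> q (x', y'')"
    using y'' unfolding q_def by simp_all
  have x: "(x, y'') \<in> cell q" "\<sigma> q (x, y'') \<in> U" using d(2)[of x] d(1) U(2) by simp_all
  from section_near[OF q x(1) U(1) x(2)]
  obtain d' where d': "d' > 0" "\<forall>x'\<in>ball x d'. \<forall>y'\<in>ball y'' d'. (x', y') \<in> cell q \<and> \<sigma> q (x', y') \<in> U"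
    by (elim exE conjE)
  show "\<exists>d>0. \<forall>x'\<in>ball x d. G p x' y'' \<in> U"
  proof (intro exI[of _ "min d d'"] conjI ballI)
    show "min d d' > 0" using d(1) d'(1) by simp
    fix x' assume "x' \<in> ball x (min d d')"
    then have "x' \<in> ball x d" "x' \<in> ball x d'" by simp_all
    then show "G p x' y'' \<in> U"
      using d(2)[of x'] bspec[OF bspec[OF d'(2), of x'], of y''] d'(1) by simp
  qed
qed

lemma all_good:
  assumes p: "p \<in> topspace X"
  shows "good p x y"
proof -
  \<comment> \<open>The radius depends on the point \<open>G p x y\<close> alone, so a whole
    interval around \<open>y\<close> is good or none of it is. Thus good and bad heights both form
    open sets, and the line is connected; at height \<open>v p\<close> the curve is
    \<open>H p\<close>, which is continuous.\<close>
  have r: "\<exists>d>0. ball y d \<subseteq> {y. good p x y} \<or> ball y d \<subseteq> - {y. good p x y}" for y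
  proof (intro exI[of _ "e (G p x y)"] conjI)
    show "e (G p x y) > 0" using e_pos G_coord[OF p] by blast
    show "ball y (e (G p x y)) \<subseteq> {y. good p x y} \<or> ball y (e (G p x y)) \<subseteq> - {y. good p x y}"
      using good_interval[OF p, of x _ y] by blast
  qed
  have "open {y. good p x y}" "open (- {y. good p x y})"
    unfolding open_contains_ball using r by (metis ComplD centre_in_ball subsetD)+
  moreover have "T = {} \<or> T = UNIV" if "open T" "open (- T)" for T :: "real set"
    using connected_UNIV[where 'a=real] that unfolding connected_clopen by (simp add: closed_def)
  ultimately have "{y. good p x y} = {} \<or> {y. good p x y} = UNIV" by blast
  moreover have "good p x (v p)"
    unfolding good_def
  proof (intro allI impI, elim conjE)
    have eq: "G p x' (v p) = H p x'" for x'
      using V(1)[OF H_in[OF p], of x'] H(2)[OF p, of x'] by (simp add: G_def)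
    fix U assume U: "openin X U" "G p x (v p) \<in> U"
    have "open {x'. H p x' \<in> U}"
      using openin_continuous_map_preimage[of euclideanreal X "H p" U] H(1)[OF p] U(1) by simp
    then show "\<exists>d>0. \<forall>x'\<in>ball x d. G p x' (v p) \<in> U"
      using U(2) unfolding eq open_contains_ball by blast
  qed
  ultimately show ?thesis by blast
qed

lemma G_eq_section:
  assumes p: "p \<in> topspace X"
  shows "\<exists>d>0. \<forall>x'\<in>ball x d. \<forall>y'\<in>ball y d. (x', y') \<in> cell (G p x y) \<and> G p x' y' = \<sigma> (G p x y) (x', y')"
proof -
  have e: "e (G p x y) > 0" using e_pos G_coord[OF p] by blast
  from good_step[OF p all_good[OF p, of x y], OF e[folded centre_in_ball[of y]]]
  obtain d where "d > 0" "\<forall>x'\<in>ball x d. \<forall>y''\<in>ball y (e (G p x y)). (x', y'') \<in> cell (G p x y) \<and> G p x' y'' = \<sigma> (G p x y) (x', y'')"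
    by (elim exE conjE)
  note d = this
  show ?thesis
  proof (intro exI[of _ "min d (e (G p x y))"] conjI[OF _ ballI[OF ballI]])
    show "min d (e (G p x y)) > 0" using d(1) e by simp
    fix x' y' assume "x' \<in> ball x (min d (e (G p x y)))" "y' \<in> ball y (min d (e (G p x y)))"
    then have "x' \<in> ball x d" "y' \<in> ball y (e (G p x y))" by simp_all
    then show "(x', y') \<in> cell (G p x y) \<and> G p x' y' = \<sigma> (G p x y) (x', y')"
      by (rule bspec[OF bspec[OF d(2)]])
  qed
qed

lemma open_coordinate_box: "openin X {q \<in> topspace X. u q \<in> ball x d \<and> v q \<in> ball y d}"
proof -
  have "openin X ({q \<in> topspace X. u q \<in> ball x d} \<inter> {q \<in> topspace X. v q \<in> ball y d})"
    by (intro openin_Int openin_continuous_map_preimage[OF continuous(1)] openin_continuous_map_preimage[OF continuous(2)]) simp_all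
  moreover have "{q \<in> topspace X. u q \<in> ball x d} \<inter> {q \<in> topspace X. v q \<in> ball y d}
    = {q \<in> topspace X. u q \<in> ball x d \<and> v q \<in> ball y d}" by blast
  ultimately show ?thesis by (simp only:)
qed

text \<open>The points \<open>q\<close> with \<open>G p (u q) (v q) = q\<close> form a closed set because \<open>X\<close> is Hausdorff, and an
  open set because \<open>G p\<close> is locally a section of \<open>(u, v)\<close>.\<close>
lemma G_inverse:
  assumes p: "p \<in> topspace X" and q: "q \<in> topspace X"
  shows "G p (u q) (v q) = q"
proof -
  define M where "M = {q \<in> topspace X. G p (u q) (v q) = q}"
  have "continuous_map X X (\<lambda>q. G p (u q) (v q))"
    unfolding continuous_map_def
  proof (intro conjI allI impI)
    show "(\<lambda>q. G p (u q) (v q)) \<in> topspace X \<rightarrow> topspace X" using G_coord[OF p] by blast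
    fix U assume U: "openin X U"
    show "openin X {q \<in> topspace X. G p (u q) (v q) \<in> U}"
    proof (subst openin_subopen, intro ballI)
      fix q assume q: "q \<in> {q \<in> topspace X. G p (u q) (v q) \<in> U}"
      define r where "r = G p (u q) (v q)"
      have r: "r \<in> topspace X" "u r = u q" "v r = v q" using G_coord[OF p] by (auto simp: r_def)
      from G_eq_section[OF p, of "u q" "v q", folded r_def]
      obtain d where d: "d > 0" "\<forall>x'\<in>ball (u q) d. \<forall>y'\<in>ball (v q) d. (x', y') \<in> cell r \<and> G p x' y' = \<sigma> r (x', y')"
        by (elim exE conjE)
      have "(u q, v q) \<in> cell r" using cell_self[OF r(1)] unfolding r .
      moreover have "\<sigma> r (u q, v q) \<in> U" using q unfolding \<sigma>_base[OF r(1), unfolded r] unfolding r_def by simp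
      ultimately have sec: "(u q, v q) \<in> cell r" "\<sigma> r (u q, v q) \<in> U" by simp_all
      from section_near[OF r(1) sec(1) U sec(2)]
      obtain d' where d': "d' > 0" "\<forall>x'\<in>ball (u q) d'. \<forall>y'\<in>ball (v q) d'. (x', y') \<in> cell r \<and> \<sigma> r (x', y') \<in> U"
        by (elim exE conjE)
      define W where "W = {q' \<in> topspace X. u q' \<in> ball (u q) (min d d') \<and> v q' \<in> ball (v q) (min d d')}"
      have "W \<subseteq> {q \<in> topspace X. G p (u q) (v q) \<in> U}" 
      proof
        fix q' assume "q' \<in> W"
        then have "q' \<in> topspace X" "u q' \<in> ball (u q) d" "v q' \<in> ball (v q) d" "u q' \<in> ball (u q) d'" "v q' \<in> ball (v q) d'"
          by (simp_all add: W_def)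
        then show "q' \<in> {q \<in> topspace X. G p (u q) (v q) \<in> U}"
          using conjunct2[OF bspec[OF bspec[OF d(2)], of "u q'" "v q'"]] conjunct2[OF bspec[OF bspec[OF d'(2)], of "u q'" "v q'"]]
          by (simp only: mem_Collect_eq simp_thms)
      qed
      moreover have "q \<in> W" using q d(1) d'(1) by (simp add: W_def)
      moreover have "openin X W" unfolding W_def by (rule open_coordinate_box)
      ultimately show "\<exists>T. openin X T \<and> q \<in> T \<and> T \<subseteq> {q \<in> topspace X. G p (u q) (v q) \<in> U}"
        by (intro exI[of _ W] conjI)
    qed
  qed
  then have "closedin X M"
    unfolding M_def by (rule closedin_continuous_maps_eq[OF Hausdorff _ continuous_map_id[unfolded id_def]])
  moreover have "openin X M"
  proof (subst openin_subopen, intro ballI)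
    fix q assume "q \<in> M"
    then have q: "q \<in> topspace X" "G p (u q) (v q) = q" by (auto simp: M_def)
    from G_eq_section[OF p, of "u q" "v q", unfolded q(2)]
    obtain d where d: "d > 0" "\<forall>x'\<in>ball (u q) d. \<forall>y'\<in>ball (v q) d. (x', y') \<in> cell q \<and> G p x' y' = \<sigma> q (x', y')"
      by (elim exE conjE)
    define W where "W = {q' \<in> topspace X. u q' \<in> ball (u q) d \<and> v q' \<in> ball (v q) d} \<inter> nbhd q"
    have "openin X W" unfolding W_def by (intro openin_Int open_coordinate_box nbhd_open q)
    moreover have "q \<in> W" using q(1) d(1) nbhd_self by (simp add: W_def)
    moreover have "W \<subseteq> M"
    proof
      fix q' assume q': "q' \<in> W"
      then have a: "q' \<in> topspace X" "u q' \<in> ball (u q) d" "v q' \<in> ball (v q) d" "q' \<in> nbhd q" by (simp_all add: W_def)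
      have "G p (u q') (v q') = \<sigma> q (u q', v q')" by (rule conjunct2[OF bspec[OF bspec[OF d(2) a(2)] a(3)]])
      also have "\<dots> = q'" by (rule nbhd_eq[OF q(1) a(4), symmetric])
      finally show "q' \<in> M" using a(1) by (simp only: M_def mem_Collect_eq simp_thms)
    qed
    ultimately show "\<exists>T. openin X T \<and> q \<in> T \<and> T \<subseteq> M" by (intro exI[of _ W] conjI)
  qed
  ultimately have "M = {} \<or> M = topspace X"
    using connected unfolding connected_space_clopen_in by blast
  moreover have "p \<in> M"
    using p H(1)[OF p] V(1)[OF p] by (simp add: M_def G_def)
  ultimately show ?thesis using q unfolding M_def by auto
qed

lemma bijective:
  assumes "topspace X \<noteq> {}"
  shows "\<exists>q\<in>topspace X. u q = x \<and> v q = y"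
    "p \<in> topspace X \<Longrightarrow> q \<in> topspace X \<Longrightarrow> u p = u q \<Longrightarrow> v p = v q \<Longrightarrow> p = q"
proof -
  obtain p0 where p0: "p0 \<in> topspace X" using assms by blast
  show "\<exists>q\<in>topspace X. u q = x \<and> v q = y" using G_coord[OF p0] by blast
  assume a: "p \<in> topspace X" "q \<in> topspace X" "u p = u q" "v p = v q"
  have "p = G p0 (u p) (v p)" by (rule G_inverse[OF p0 a(1), symmetric])
  also have "\<dots> = q" unfolding a(3,4) by (rule G_inverse[OF p0 a(2)])
  finally show "p = q" .
qed

end

subsection \<open>Diffeomorphisms onto the plane\<close>

text \<open>The local derivative witnesses all coincide with \<open>frechet_derivative\<close>,
  which therefore serves as the global witness.\<close>

lemma C_k_on_local: "(\<And>x. x \<in> S \<Longrightarrow> \<exists>W. open W \<and> x \<in> W \<and> C_k_on k W f) \<Longrightarrow> C_k_on k S f"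
proof (induction k arbitrary: f)
  case 0
  show ?case unfolding C_k_on.simps
  proof (rule continuous_at_imp_continuous_on, rule ballI)
    fix x assume "x \<in> S"
    from 0[OF this] obtain W where "open W" "x \<in> W" "continuous_on W f" by auto
    then show "isCont f x" by (simp add: continuous_on_eq_continuous_at)
  qed
next
  case (Suc k)
  define f' where "f' x = frechet_derivative f (at x)" for x
  have loc: "\<exists>W. open W \<and> x \<in> W \<and> (\<forall>y\<in>W. (f has_derivative f' y) (at y)) \<and> (\<forall>v. C_k_on k W (\<lambda>y. f' y v))" if x: "x \<in> S" for x
  proof -
    from Suc.prems[OF x, unfolded C_k_on.simps]
    obtain W g where W: "open W" "x \<in> W" "\<forall>y\<in>W. (f has_derivative g y) (at y)" "\<forall>v. C_k_on k W (\<lambda>y. g y v)"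
      by (elim exE conjE)
    have eq: "g y = f' y" if "y \<in> W" for y unfolding f'_def using frechet_derivative_at W(3) that by blast
    have "C_k_on k W (\<lambda>y. f' y v)" for v
      by (rule C_k_on_cong[OF W(1) _ W(4)[rule_format]]) (simp add: eq)
    moreover have "\<forall>y\<in>W. (f has_derivative f' y) (at y)" using W(3) eq by simp
    ultimately show ?thesis using W(1,2) by (intro exI[of _ W] conjI allI)
  qed
  have "\<forall>x\<in>S. (f has_derivative f' x) (at x)"
  proof
    fix x assume "x \<in> S"
    from loc[OF this] obtain W where "x \<in> W" "\<forall>y\<in>W. (f has_derivative f' y) (at y)" by (elim exE conjE)
    then show "(f has_derivative f' x) (at x)" by simp
  qed
  moreover have "C_k_on k S (\<lambda>x. f' x v)" for v
  proof (rule Suc.IH)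
    fix x assume "x \<in> S"
    from loc[OF this] obtain W where "open W" "x \<in> W" "\<forall>v. C_k_on k W (\<lambda>y. f' y v)" by (elim exE conjE)
    from this(1,2) spec[OF this(3), of v] show "\<exists>W. open W \<and> x \<in> W \<and> C_k_on k W (\<lambda>x. f' x v)"
      by (intro exI[of _ W] conjI)
  qed
  ultimately show ?case unfolding C_k_on.simps by blast
qed

lemma smooth_on_local: "(\<And>x. x \<in> S \<Longrightarrow> \<exists>W. open W \<and> x \<in> W \<and> smooth_on W f) \<Longrightarrow> smooth_on S f"
  unfolding smooth_on_def
proof (rule allI, rule C_k_on_local)
  fix k x assume loc: "\<And>x. x \<in> S \<Longrightarrow> \<exists>W. open W \<and> x \<in> W \<and> (\<forall>k. C_k_on k W f)" and "x \<in> S"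
  from loc[OF this(2)] obtain W where "open W" "x \<in> W" "\<forall>k. C_k_on k W f" by (elim exE conjE)
  then show "\<exists>W. open W \<and> x \<in> W \<and> C_k_on k W f" by (intro exI[of _ W] conjI) simp_all
qed

lemma (in surface) diffeomorphism_plane:
  assumes F: "smooth_fun A F" and bij: "bij_betw F (topspace X) UNIV"
    and regular: "\<And>c u. c \<in> A \<Longrightarrow> u \<in> chart_image c \<Longrightarrow> det2 (partial 1 (in_chart c F) u) (partial 2 (in_chart c F) u) \<noteq> 0"
  shows "diffeomorphism X A euclidean plane_atlas F"
proof -
  define G where "G = inv_into (topspace X) F"
  have GF: "G (F p) = p" if "p \<in> topspace X" for p
    unfolding G_def by (rule bij_betw_inv_into_left[OF bij that])
  have FG: "F (G w) = w" and GX: "G w \<in> topspace X" for w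
    unfolding G_def using bij_betw_inv_into_right[OF bij] bij_betw_apply[OF bij_betw_inv_into[OF bij]] by auto
  have loc: "\<exists>V. open V \<and> w \<in> V \<and> continuous_map (top_of_set V) X G \<and> smooth_on V (\<lambda>w. snd c (G w))"
    if c: "c \<in> A" "G w \<in> fst c" for c w
  proof -
    obtain V \<sigma> where V: "open V" "F (G w) \<in> V" "\<sigma> (F (G w)) = G w" "\<And>w. w \<in> V \<Longrightarrow> \<sigma> w \<in> fst c \<and> F (\<sigma> w) = w"
      "smooth_on V (\<lambda>w. snd c (\<sigma> w))" "openin X (\<sigma> ` V)" "continuous_map (top_of_set V) X \<sigma>"
      by (rule local_inverse[OF F c regular[OF c(1) chart_imageI[OF c(2)]]]) (rule that, assumption+)
    \<comment> \<open>A local section of an injective map is its inverse; continuity and smoothness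
      of the inverse thus come from the local sections.\<close>
    have eq: "\<sigma> w = G w" if "w \<in> V" for w
      
    proof -
      have "\<sigma> w \<in> topspace X" using V(4)[OF that] chart_subset[OF c(1)] by blast
      from GF[OF this] show ?thesis unfolding conjunct2[OF V(4)[OF that]] by (rule sym)
    qed
    have "continuous_map (top_of_set V) X G"
      by (rule continuous_map_eq[OF V(7)]) (simp add: eq)
    moreover have "smooth_on V (\<lambda>w. snd c (G w))"
      by (rule smooth_on_cong[OF V(1) _ V(5)]) (simp add: eq)
    ultimately show ?thesis using V(1,2) unfolding FG by (intro exI[of _ V] conjI)
  qed
  have contG: "continuous_map euclidean X G"
    unfolding continuous_map_def
  proof (intro conjI allI impI)
    show "G \<in> topspace euclidean \<rightarrow> topspace X" using GX by simp
    fix U assume U: "openin X U"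
    show "openin euclidean {w \<in> topspace euclidean. G w \<in> U}"
    proof (subst openin_subopen, intro ballI)
      fix w assume w: "w \<in> {w \<in> topspace euclidean. G w \<in> U}"
      obtain c where c: "c \<in> A" "G w \<in> fst c" using chart_cover[OF GX] by blast
      obtain V where V: "open V" "w \<in> V" "continuous_map (top_of_set V) X G" using loc[OF c] by (elim exE conjE)
      have "openin (top_of_set V) {w \<in> topspace (top_of_set V). G w \<in> U}"
        by (rule openin_continuous_map_preimage[OF V(3) U])
      then have "open {w \<in> V. G w \<in> U}" using openin_open_trans[OF _ V(1)] by simp
      then show "\<exists>T. openin euclidean T \<and> w \<in> T \<and> T \<subseteq> {w \<in> topspace euclidean. G w \<in> U}"
        using V(2) w by (intro exI[of _ "{w \<in> V. G w \<in> U}"]) auto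
    qed
  qed
  have sF: "smooth_map X A euclidean plane_atlas F"
    unfolding smooth_map_def plane_atlas_def
  proof (intro conjI smooth_fun_continuous[OF F])
    have "smooth_on (\<phi> ` {p \<in> U. F p \<in> UNIV}) (in_chart (U, \<phi>) ((\<lambda>p. p) \<circ> F))" if "(U, \<phi>) \<in> A" for U \<phi>
    proof -
      have "smooth_on (chart_image (U, \<phi>)) (in_chart (U, \<phi>) F)" using F that unfolding smooth_fun_def by (rule bspec)
      then show ?thesis by (simp add: chart_image_def o_def)
    qed
    then show "\<forall>(U, \<phi>)\<in>A. \<forall>(V, \<theta>)\<in>{(UNIV, \<lambda>p. p)}. smooth_on (\<phi> ` {p \<in> U. F p \<in> V}) (in_chart (U, \<phi>) (\<theta> \<circ> F))" by auto
  qed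
  have sG: "smooth_map euclidean plane_atlas X A G"
    unfolding smooth_map_def plane_atlas_def
  proof (intro conjI contG)
    have "smooth_on ((\<lambda>p. p) ` {w \<in> UNIV. G w \<in> V}) (in_chart (UNIV, \<lambda>p. p) (\<theta> \<circ> G))" if V: "(V, \<theta>) \<in> A" for V \<theta>
      unfolding in_chart_plane
    proof (rule smooth_on_local)
      fix w assume "w \<in> (\<lambda>p. p) ` {w \<in> UNIV. G w \<in> V}"
      then have "G w \<in> fst (V, \<theta>)" by simp
      from loc[OF V this] obtain W where "open W" "w \<in> W" "smooth_on W (\<lambda>w. snd (V, \<theta>) (G w))" by (elim exE conjE)
      then show "\<exists>W. open W \<and> w \<in> W \<and> smooth_on W (\<theta> \<circ> G)" unfolding o_def snd_conv by (intro exI[of _ W] conjI)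
    qed
    then show "\<forall>(U, \<phi>)\<in>{(UNIV, \<lambda>p. p)}. \<forall>(V, \<theta>)\<in>A. smooth_on (\<phi> ` {p \<in> U. G p \<in> V}) (in_chart (U, \<phi>) (\<theta> \<circ> G))" by auto
  qed
  show ?thesis unfolding diffeomorphism_def using sF sG GF FG by blast
qed

subsection \<open>Null coordinates\<close>

text \<open>The eigenvalues are the two square roots of \<open>- det B\<close>. The rows of
  \<open>Q\<close> are left eigenvectors, and dividing the first by their determinant gives
  \<open>det Q = 1\<close>.\<close>

lemma eigenframe:
  fixes B :: "real^2^2"
  assumes "B $ 1 $ 1 + B $ 2 $ 2 = 0" "det B < 0"
  obtains Q :: "real^2^2" and l where "det Q = 1" "l \<noteq> 0" "\<And>x. (Q *v (B *v x)) $ 1 = l * (Q *v x) $ 1"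
    "\<And>x. (Q *v (B *v x)) $ 2 = - (l * (Q *v x) $ 2)"
proof -
  define a b c where "a = B $ 1 $ 1" and "b = B $ 1 $ 2" and "c = B $ 2 $ 1"
  have d: "B $ 2 $ 2 = - a" using assms(1) by (simp add: a_def)
  have pos: "a * a + b * c > 0" using assms(2) by (simp add: det_2 d a_def[symmetric] b_def[symmetric] c_def[symmetric])
  define l where "l = sqrt (a * a + b * c)"
  have l: "l > 0" "l * l = a * a + b * c" using pos by (simp_all add: l_def)
  have Bx: "(B *v x) $ 1 = a * x $ 1 + b * x $ 2" "(B *v x) $ 2 = c * x $ 1 - a * x $ 2" for x
    by (simp_all add: matrix_vector_mult_def sum_2 d a_def b_def c_def)
  note result = that
  have key: thesis
    if r: "r1 * a + r2 * c = l * r1" "r1 * b - r2 * a = l * r2"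
      and s: "s1 * a + s2 * c = - l * s1" "s1 * b - s2 * a = - l * s2" and D: "r1 * s2 - r2 * s1 \<noteq> 0" for r1 r2 s1 s2
  proof -
    define D where "D = r1 * s2 - r2 * s1"
    define Q :: "real^2^2" where "Q = (\<chi> i j. if i = 1 then (if j = 1 then r1 / D else r2 / D) else (if j = 1 then s1 else s2))"
    have Qx: "(Q *v x) $ 1 = (r1 * x $ 1 + r2 * x $ 2) / D" "(Q *v x) $ 2 = s1 * x $ 1 + s2 * x $ 2" for x
      by (simp_all add: matrix_vector_mult_def sum_2 Q_def add_divide_distrib)
    have "det Q = (r1 * s2 - r2 * s1) / D" by (simp add: det_2 Q_def diff_divide_distrib)
    also have "\<dots> = 1" using that(5) by (simp add: D_def)
    finally have 1: "det Q = 1" .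
    have 2: "(Q *v (B *v x)) $ 1 = l * (Q *v x) $ 1" for x
    proof -
      have "r1 * (a * x $ 1 + b * x $ 2) + r2 * (c * x $ 1 - a * x $ 2) = (r1 * a + r2 * c) * x $ 1 + (r1 * b - r2 * a) * x $ 2"
        by (simp add: algebra_simps)
      also have "\<dots> = l * (r1 * x $ 1 + r2 * x $ 2)" unfolding r by (simp add: algebra_simps)
      finally show ?thesis unfolding Qx Bx by simp
    qed
    have 3: "(Q *v (B *v x)) $ 2 = - (l * (Q *v x) $ 2)" for x
    proof -
      have "s1 * (a * x $ 1 + b * x $ 2) + s2 * (c * x $ 1 - a * x $ 2) = (s1 * a + s2 * c) * x $ 1 + (s1 * b - s2 * a) * x $ 2"
        by (simp add: algebra_simps)
      also have "\<dots> = - (l * (s1 * x $ 1 + s2 * x $ 2))" unfolding s by (simp add: algebra_simps)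
      finally show ?thesis unfolding Qx Bx .
    qed
    show ?thesis by (rule result[OF 1 _ 2 3]) (use l in simp)
  qed
  \<comment> \<open>Each eigenvector can be read off in two ways from the matrix, and one of them
    degenerates when \<open>a = - l\<close>; the two cases use different formulas.\<close>
  show ?thesis
  proof (cases "a + l = 0")
    case False
    have "(l + a) * (- l - a) - b * c = - 2 * (l * (a + l))" using l(2) by (simp add: algebra_simps)
    then have D: "(l + a) * (- l - a) - b * c \<noteq> 0" using False l(1) by simp
    show ?thesis
      by (rule key[of "l + a" b c "- l - a", OF _ _ _ _ D]) (use l(2) in \<open>simp_all add: algebra_simps\<close>)
  next
    case True
    then have a: "a = - l" by simp
    have bc: "b * c = 0" using l(2) unfolding a by simp
    have "c * b - (l - a) * (a - l) = 4 * (l * l)" using bc unfolding a by (simp add: algebra_simps)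
    then have D: "c * b - (l - a) * (a - l) \<noteq> 0" using l(1) by simp
    show ?thesis
      by (rule key[of c "l - a" "a - l" b, OF _ _ _ _ D]) (use bc in \<open>simp_all add: a algebra_simps\<close>)
  qed
qed

lemma det2_matrix: "det2 (Q *v x) (Q *v y) = det Q * det2 x y"
  by (simp add: det2_def det_2 matrix_vector_mult_def sum_2 algebra_simps)

lemma (in surface) positive_on_surface:
  fixes f :: "'p \<Rightarrow> real"
  assumes f: "continuous_map X euclideanreal f" "\<And>p. p \<in> topspace X \<Longrightarrow> f p \<noteq> 0"
    and p: "p \<in> topspace X" "f p > 0" and q: "q \<in> topspace X"
  shows "f q > 0"
proof -
  have "(f q > 0) = (f p > 0)"
  proof (rule locally_constant_imp_constant[of "\<lambda>p. f p > 0", OF _ p(1) q])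
    fix r assume r: "r \<in> topspace X"
    define S :: "real set" where "S = (if f r > 0 then {0<..} else {..<0})"
    define W where "W = {q \<in> topspace X. f q \<in> S}"
    have "openin X W" unfolding W_def by (rule openin_continuous_map_preimage[OF f(1)]) (simp add: S_def)
    moreover have "r \<in> W" using r f(2)[OF r] by (simp add: W_def S_def)
    moreover have "\<forall>q\<in>W. (f q > 0) = (f r > 0)" by (auto simp: W_def S_def split: if_splits)
    ultimately show "\<exists>W. openin X W \<and> r \<in> W \<and> (\<forall>q\<in>W. (f q > 0) = (f r > 0))" by (intro exI[of _ W] conjI)
  qed
  then show ?thesis using p(2) by simp
qed

lemma exp_difference_inj:
  fixes w w' :: real
  assumes "w > 0" "w' > 0" "w * exp (x - b) - w' * exp (b - x) = w * exp (y - b) - w' * exp (b - y)"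
  shows "x = y"
proof -
  have less: "w * exp (x - b) - w' * exp (b - x) < w * exp (y - b) - w' * exp (b - y)" if "x < y" for x y
    using that assms(1,2) by (intro diff_strict_mono mult_strict_left_mono) simp_all
  show ?thesis using less[of x y] less[of y x] assms(3) by linarith
qed

context curved_pair
begin

lemma smooth_fun_E2: "smooth_fun A E2"
  unfolding smooth_fun_def
proof
  fix c assume "c \<in> A"
  have "smooth_on (chart_image c) (\<lambda>u. B *v in_chart c \<beta> u + b2)"
    by (intro smooth_on_add smooth_on_const smooth_on_matrix_vector_mult chart_smooth[OF \<open>c \<in> A\<close>])
  then show "smooth_on (chart_image c) (in_chart c E2)" by (simp add: in_chart_E2[abs_def])
qed

lemma curv2_constant:
  assumes "p \<in> topspace X" "q \<in> topspace X"
  shows "curv2 q = curv2 p"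
proof -
  interpret s: curved_pair X A "\<lambda>p. swap *v \<beta> p" "\<lambda>p. swap *v \<alpha> p" g "swap ** B ** swap" "swap *v b2" "swap *v b1"
    by (rule curved_pair_swap)
  have sE: "s.E1 p = swap *v E2 p" for p unfolding s.E1_def by (rule swap_E)
  have "s.curv1 p = - curv2 p" for p
    unfolding s.curv1_def curv2_def sE swap_E(3) det2_swap ..
  then show ?thesis using s.curv1_constant[OF assms] by simp
qed

lemma null_line_swap:
  assumes "complete_metric X A g" "p \<in> topspace X"
  obtains \<gamma> where "continuous_map euclideanreal X \<gamma>" "\<gamma> 0 = p" "\<And>t. \<alpha> (\<gamma> t) = \<alpha> p"
    "\<And>t. det2 (\<beta> (\<gamma> t)) (E1 p) = det2 (\<beta> p) (E1 p) - t"
proof -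
  interpret s: curved_pair X A "\<lambda>p. swap *v \<beta> p" "\<lambda>p. swap *v \<alpha> p" g "swap ** B ** swap" "swap *v b2" "swap *v b1"
    by (rule curved_pair_swap)
  obtain \<gamma> a' where \<gamma>: "continuous_map euclideanreal X \<gamma>" "\<gamma> 0 = p" "\<And>t. swap *v \<alpha> (\<gamma> t) = swap *v \<alpha> p"
    "\<And>t. det2 (swap *v \<beta> (\<gamma> t)) (s.E2 p) = det2 (swap *v \<beta> p) (s.E2 p) + t"
    "\<And>t. ((\<lambda>t. swap *v \<beta> (\<gamma> t)) has_vector_derivative a' t) (at t)" "\<And>t. det2 (a' t) (s.E1 (\<gamma> t)) = 0"
    by (rule s.null_line[OF assms]) blast
  have e: "s.E2 p = swap *v E1 p" unfolding s.E2_def by (rule swap_E)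
  have a: "\<alpha> (\<gamma> t) = \<alpha> p" for t
    using arg_cong[OF \<gamma>(3)[of t], of "\<lambda>v. swap *v v"] unfolding swap_swap .
  have b: "det2 (\<beta> (\<gamma> t)) (E1 p) = det2 (\<beta> p) (E1 p) - t" for t
    using \<gamma>(4)[of t] unfolding e det2_swap by simp
  show ?thesis by (rule that[OF \<gamma>(1,2) a b])
qed

end

text \<open>Determinant -1 is allowed so that the rows of \<open>Q\<close> may be exchanged; the
  final affine map compensates it in the third coordinate.\<close>

locale hyperbolic_frame = curved_pair X A \<alpha> \<beta> g B b1 b2
  for X :: "'p topology" and A and \<alpha> \<beta> :: "'p \<Rightarrow> real^2" and g :: "'p metric"
    and B :: "real^2^2" and b1 b2 :: "real^2" +
  fixes Q :: "real^2^2" and l :: real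
  assumes detQ: "det Q * det Q = 1" and l: "l \<noteq> 0"
    and QB: "\<And>x. (Q *v (B *v x)) $ 1 = l * (Q *v x) $ 1" "\<And>x. (Q *v (B *v x)) $ 2 = - (l * (Q *v x) $ 2)"
begin

text \<open>Eigencoordinates of \<alpha> relative to the zero of its affine field: since
  \<open>B\<close> is invertible, \<open>E1\<close> is \<open>B\<close> applied to \<alpha> minus
  that zero, and dividing by the eigenvalues \<open>l\<close> and \<open>- l\<close> undoes
  \<open>B\<close>. Likewise \<open>c1\<close> and \<open>c2\<close> for \<beta>.\<close>

definition "a1 p = (Q *v E1 p) $ 1 * (1 / l)"
definition "a2 p = (Q *v E1 p) $ 2 * (- 1 / l)"
definition "c1 p = (Q *v E2 p) $ 1 * (1 / l)"
definition "c2 p = (Q *v E2 p) $ 2 * (- 1 / l)"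

lemma a_affine: "a1 p = (Q *v \<alpha> p) $ 1 + (Q *v b1) $ 1 / l" "a2 p = (Q *v \<alpha> p) $ 2 - (Q *v b1) $ 2 / l"
  and c_affine: "c1 p = (Q *v \<beta> p) $ 1 + (Q *v b2) $ 1 / l" "c2 p = (Q *v \<beta> p) $ 2 - (Q *v b2) $ 2 / l"
  using l by (simp_all add: a1_def a2_def c1_def c2_def E1_def E2_def matrix_vector_right_distrib QB divide_simps)

lemma smooth_ac: "smooth_fun A a1" "smooth_fun A a2" "smooth_fun A c1" "smooth_fun A c2"
proof -
  have "smooth_fun A (\<lambda>p. (Q *v E p) $ i * k)" if "smooth_fun A E" for E :: "'p \<Rightarrow> real^2" and i k
    using that unfolding smooth_fun_def in_chart_fun[of _ "\<lambda>x. (Q *v x) $ i * k"]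
    by (simp add: smooth_on_mult smooth_on_const smooth_on_vec_nth smooth_on_matrix_vector_mult)
  from this[OF smooth_fun_E1] this[OF smooth_fun_E2]
  show "smooth_fun A a1" "smooth_fun A a2" "smooth_fun A c1" "smooth_fun A c2"
    unfolding a1_def[abs_def] a2_def[abs_def] c1_def[abs_def] c2_def[abs_def] by blast+
qed

text \<open>In an eigenframe the quadratic form \<open>det2 x (B x)\<close> is a multiple of the
  product of the coordinates, so a constant curvature means that the curve lies on a
  hyperbola.\<close>

lemma products: "a1 p * a2 p = det Q * curv1 p / (2 * l ^ 3)" "c1 p * c2 p = det Q * curv2 p / (2 * l ^ 3)"
proof -
  have "det Q * det2 e (B *v e) = - 2 * l * ((Q *v e) $ 1 * (Q *v e) $ 2)" for e
    unfolding det2_matrix[symmetric] by (simp add: det2_def QB)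
  then have "(Q *v e) $ 1 * (1 / l) * ((Q *v e) $ 2 * (- 1 / l)) = det Q * det2 e (B *v e) / (2 * l ^ 3)" for e
    using l by (simp add: power3_eq_cube)
  then show "a1 p * a2 p = det Q * curv1 p / (2 * l ^ 3)" "c1 p * c2 p = det Q * curv2 p / (2 * l ^ 3)"
    unfolding a1_def a2_def c1_def c2_def curv1_def curv2_def by simp_all
qed

lemma product_constant:
  assumes "p \<in> topspace X" "q \<in> topspace X"
  shows "a1 p * a2 p = a1 q * a2 q" "c1 p * c2 p = c1 q * c2 q"
  unfolding products curv1_constant[OF assms] curv2_constant[OF assms] by (rule refl)+

lemma ac_nonzero: "p \<in> topspace X \<Longrightarrow> a1 p \<noteq> 0" "p \<in> topspace X \<Longrightarrow> c2 p \<noteq> 0"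
proof -
  have "det Q \<noteq> 0" using detQ by auto
  then show "p \<in> topspace X \<Longrightarrow> a1 p \<noteq> 0" "p \<in> topspace X \<Longrightarrow> c2 p \<noteq> 0"
    using products[of p] curv1_nonzero[of p] curv2_nonzero[of p] l by auto
qed

lemma product_neg:
  assumes "complete_metric X A g" "p \<in> topspace X"
  shows "(a1 p * a2 p) * (c1 p * c2 p) < 0"
proof -
  have "(a1 p * a2 p) * (c1 p * c2 p) = (det Q * det Q) * (curv1 p * curv2 p) / (2 * l ^ 3)\<^sup>2"
    unfolding products by (simp add: power2_eq_square)
  also have "\<dots> < 0"
    unfolding detQ using complete_imp_hyperbolic(2)[OF assms] l by (simp add: divide_neg_pos)
  finally show ?thesis .
qed

end

locale positive_frame = hyperbolic_frame X A \<alpha> \<beta> g B b1 b2 Q l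
  for X :: "'p topology" and A and \<alpha> \<beta> :: "'p \<Rightarrow> real^2" and g :: "'p metric"
    and B :: "real^2^2" and b1 b2 :: "real^2" and Q :: "real^2^2" and l :: real +
  assumes complete: "complete_metric X A g"
    and a1_pos: "\<And>p. p \<in> topspace X \<Longrightarrow> a1 p > 0" and c2_pos: "\<And>p. p \<in> topspace X \<Longrightarrow> c2 p > 0"

text \<open>Exactly one of \<open>a1 * c2\<close> and \<open>a2 * c1\<close> is positive. Exchanging the rows of \<open>Q\<close> exchanges these two
  products, and replacing \<open>Q\<close> by \<open>- Q\<close> changes all signs.\<close>
lemma (in curved_pair) positive_frame_exists:
  assumes complete: "complete_metric X A g"
  obtains Q l where "positive_frame X A \<alpha> \<beta> g B b1 b2 Q l"
proof -
  note result = that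
  obtain p where p: "p \<in> topspace X" using nonempty by blast
  define e f where "e = E1 p" and "f = E2 p"
  have fr: "hyperbolic_frame X A \<alpha> \<beta> g B b1 b2 Q l"
    if "det Q * det Q = 1" "l \<noteq> 0" "\<And>x. (Q *v (B *v x)) $ 1 = l * (Q *v x) $ 1" "\<And>x. (Q *v (B *v x)) $ 2 = - (l * (Q *v x) $ 2)" for Q l
    by (intro hyperbolic_frame.intro curved_pair_axioms hyperbolic_frame_axioms.intro that)
  have pf: "positive_frame X A \<alpha> \<beta> g B b1 b2 Q l"
    if h: "hyperbolic_frame X A \<alpha> \<beta> g B b1 b2 Q l" and s: "(Q *v e) $ 1 * (Q *v f) $ 2 < 0" "(Q *v e) $ 1 * (1 / l) > 0" for Q l
  proof -
    interpret h: hyperbolic_frame X A \<alpha> \<beta> g B b1 b2 Q l by (rule h)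
    have a: "h.a1 p > 0" using s(2) by (simp add: h.a1_def e_def)
    have "h.a1 p * h.c2 p = - ((Q *v e) $ 1 * (Q *v f) $ 2) / (l * l)"
      by (simp add: h.a1_def h.c2_def e_def f_def)
    also have "\<dots> > 0"
    proof (rule divide_pos_pos)
      show "l * l > 0" using h.l by (metis not_real_square_gt_zero)
    qed (use s(1) in simp)
    finally have c: "h.c2 p > 0" using a by (simp add: zero_less_mult_iff)
    show ?thesis
    proof (intro positive_frame.intro positive_frame_axioms.intro h complete)
      fix q assume q: "q \<in> topspace X"
      show "h.a1 q > 0"
        by (rule positive_on_surface[OF smooth_fun_continuous[OF h.smooth_ac(1)] h.ac_nonzero(1) p a q])
      show "h.c2 q > 0"
        by (rule positive_on_surface[OF smooth_fun_continuous[OF h.smooth_ac(4)] h.ac_nonzero(2) p c q])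
    qed
  qed
  \<comment> \<open>The assumption makes \<open>a1\<close> and \<open>c2\<close> have the same sign;
    passing to \<open>- Q\<close> makes both positive.\<close>
  have signed: thesis if h: "hyperbolic_frame X A \<alpha> \<beta> g B b1 b2 Q l" and s: "(Q *v e) $ 1 * (Q *v f) $ 2 < 0" for Q l
  proof -
    interpret h: hyperbolic_frame X A \<alpha> \<beta> g B b1 b2 Q l by (rule h)
    have neg: "(- Q) *v x = - (Q *v x)" for x
      by (simp add: vec_eq_iff matrix_vector_mult_def sum_negf)
    have "hyperbolic_frame X A \<alpha> \<beta> g B b1 b2 (- Q) l"
      using h.detQ by (intro fr h.l) (simp_all add: neg h.QB det_2)
    note n = pf[OF this, unfolded neg]
    have "(Q *v e) $ 1 * (1 / l) \<noteq> 0" using s h.l by auto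
    then consider "(Q *v e) $ 1 * (1 / l) > 0" | "(- (Q *v e)) $ 1 * (1 / l) > 0" by fastforce
    then show ?thesis
    proof cases
      case 1
      show ?thesis by (rule result[OF pf[OF h s 1]])
    next
      case 2
      show ?thesis by (rule result[OF n[OF _ 2]]) (use s in simp)
    qed
  qed
  obtain Q l where Q: "det Q = 1" "l \<noteq> 0" "\<And>x. (Q *v (B *v x)) $ 1 = l * (Q *v x) $ 1"
    "\<And>x. (Q *v (B *v x)) $ 2 = - (l * (Q *v x) $ 2)"
    by (rule eigenframe[OF traceless complete_imp_hyperbolic(1)[OF complete p]]) (rule that, assumption+)
  have h: "hyperbolic_frame X A \<alpha> \<beta> g B b1 b2 Q l" by (rule fr[OF _ Q(2-4)]) (simp add: Q(1))
  interpret h: hyperbolic_frame X A \<alpha> \<beta> g B b1 b2 Q l by (rule h)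
  have sw: "(swap ** Q) *v x = swap *v (Q *v x)" for x by (simp add: matrix_vector_mul_assoc)
  \<comment> \<open>Exchanging the rows exchanges the eigenvalues, hence the sign change of
    \<open>l\<close>.\<close>
  have h': "hyperbolic_frame X A \<alpha> \<beta> g B b1 b2 (swap ** Q) (- l)"
  proof (rule fr)
    have "det swap = -1" by (simp add: det_2 swap_def)
    then show "det (swap ** Q) * det (swap ** Q) = 1" by (simp add: det_mul Q(1))
  qed (use Q(2) in \<open>simp_all add: sw swap_mult Q(3,4)\<close>)
  have "((Q *v e) $ 1 * (Q *v f) $ 2) * ((Q *v e) $ 2 * (Q *v f) $ 1) = (h.a1 p * h.a2 p) * (h.c1 p * h.c2 p) * (l * l * (l * l))"
    using h.l by (simp add: h.a1_def h.a2_def h.c1_def h.c2_def e_def f_def)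
  also have "\<dots> < 0"
  proof (rule mult_neg_pos[OF h.product_neg[OF complete p]])
    have "l * l > 0" using h.l by (metis not_real_square_gt_zero)
    from this this show "l * l * (l * l) > 0" by (rule mult_pos_pos)
  qed
  finally have "(Q *v e) $ 1 * (Q *v f) $ 2 < 0 \<or> (Q *v e) $ 2 * (Q *v f) $ 1 < 0"
    by (auto simp: mult_less_0_iff)
  then show ?thesis
  proof
    assume "(Q *v e) $ 1 * (Q *v f) $ 2 < 0"
    then show ?thesis by (rule signed[OF h])
  next
    assume "(Q *v e) $ 2 * (Q *v f) $ 1 < 0"
    then show ?thesis by (intro signed[OF h']) (simp add: sw swap_mult)
  qed
qed

context positive_frame
begin

definition "base = (SOME p. p \<in> topspace X)"
definition "\<kappa> = a1 base * a2 base"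
definition "\<mu> = c1 base * c2 base"
definition "u p = ln (a1 p)"
text \<open>With this sign the group translates \<open>u\<close> and \<open>v\<close> by the same
  amount, so that \<open>u - v\<close> is invariant.\<close>

definition "v p = - ln (c2 p)"

lemma base: "base \<in> topspace X"
proof -
  have "\<exists>p. p \<in> topspace X" using nonempty by blast
  then show ?thesis unfolding base_def by (rule someI_ex)
qed

lemma \<kappa>\<mu>: "\<kappa> * \<mu> < 0"
  unfolding \<kappa>_def \<mu>_def by (rule product_neg[OF complete base])

lemma exp_uv:
  assumes p: "p \<in> topspace X"
  shows "a1 p = exp (u p)" "a2 p = \<kappa> * exp (- u p)" "c1 p = \<mu> * exp (v p)" "c2 p = exp (- v p)"
proof -
  show a: "a1 p = exp (u p)" and c: "c2 p = exp (- v p)" using a1_pos[OF p] c2_pos[OF p] by (simp_all add: u_def v_def)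
  have "\<kappa> = a1 p * a2 p" "\<mu> = c1 p * c2 p" unfolding \<kappa>_def \<mu>_def by (rule product_constant[OF base p])+
  then show "a2 p = \<kappa> * exp (- u p)" "c1 p = \<mu> * exp (v p)" unfolding a c by (simp_all add: exp_minus)
qed

lemma smooth_uv: "smooth_fun A u" "smooth_fun A v"
proof -
  have pos: "in_chart c a1 x > 0" "in_chart c c2 x > 0" if "c \<in> A" "x \<in> chart_image c" for c x
  proof -
    have "chart_inv c x \<in> topspace X" using chart_inv_in[OF that(2)] chart_subset[OF that(1)] by blast
    from a1_pos[OF this] c2_pos[OF this] show "in_chart c a1 x > 0" "in_chart c c2 x > 0" by (simp_all add: in_chart_def)
  qed
  have sm: "smooth_on (chart_image c) (in_chart c a1)" "smooth_on (chart_image c) (in_chart c c2)" if "c \<in> A" for c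
    using smooth_ac(1,4) that by (simp_all add: smooth_fun_def)
  show "smooth_fun A u"
    unfolding smooth_fun_def u_def[abs_def] in_chart_fun[of _ ln]
    by (rule ballI, rule smooth_on_ln[OF sm(1) chart_homeomorphic(2) pos(1)])
  show "smooth_fun A v"
    unfolding smooth_fun_def v_def[abs_def] in_chart_fun[of _ "\<lambda>x. - ln x"]
    by (rule ballI, rule smooth_on_minus, rule smooth_on_ln[OF sm(2) chart_homeomorphic(2) pos(2)])
qed

lemma partial_frame:
  assumes c: "c \<in> A" and x: "x \<in> chart_image c"
  shows "Q *v partial i (in_chart c \<alpha>) x = partial i (in_chart c u) x *\<^sub>R
      (exp (in_chart c u x) *\<^sub>R axis 1 1 - (\<kappa> * exp (- in_chart c u x)) *\<^sub>R axis 2 1)" (is ?A)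
    "Q *v partial i (in_chart c \<beta>) x = partial i (in_chart c v) x *\<^sub>R
      ((\<mu> * exp (in_chart c v x)) *\<^sub>R axis 1 1 - exp (- in_chart c v x) *\<^sub>R axis 2 1)" (is ?B)
proof -
  note o = chart_homeomorphic(2)[OF c]
  have su: "smooth_on (chart_image c) (in_chart c u)" and sv: "smooth_on (chart_image c) (in_chart c v)"
    using smooth_uv c by (simp_all add: smooth_fun_def)
  define U' where "U' = frechet_derivative (in_chart c u) (at x)"
  define V' where "V' = frechet_derivative (in_chart c v) (at x)"
  have dU: "(in_chart c u has_derivative U') (at x)" and dV: "(in_chart c v has_derivative V') (at x)"
    unfolding U'_def V'_def by (rule smooth_on_has_derivative[OF su x], rule smooth_on_has_derivative[OF sv x])
  define k :: "real^2" where "k = ((Q *v b1) $ 1 / l) *\<^sub>R axis 1 1 - ((Q *v b1) $ 2 / l) *\<^sub>R axis 2 (1::real)"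
  define m :: "real^2" where "m = ((Q *v b2) $ 1 / l) *\<^sub>R axis 1 1 - ((Q *v b2) $ 2 / l) *\<^sub>R axis 2 (1::real)"
  have inX: "chart_inv c y \<in> topspace X" if "y \<in> chart_image c" for y
    using chart_inv_in[OF that] chart_subset[OF c] by blast
  have eA: "Q *v in_chart c \<alpha> y = exp (in_chart c u y) *\<^sub>R axis 1 1 + (\<kappa> * exp (- in_chart c u y)) *\<^sub>R axis 2 1 - k" if "y \<in> chart_image c" for y
    using exp_uv(1,2)[OF inX[OF that]] a_affine[of "chart_inv c y"]
    by (simp add: vec_eq_iff forall_2 k_def in_chart_def axis_def)
  have eB: "Q *v in_chart c \<beta> y = (\<mu> * exp (in_chart c v y)) *\<^sub>R axis 1 1 + exp (- in_chart c v y) *\<^sub>R axis 2 1 - m" if "y \<in> chart_image c" for y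
    using exp_uv(3,4)[OF inX[OF that]] c_affine[of "chart_inv c y"]
    by (simp add: vec_eq_iff forall_2 m_def in_chart_def axis_def)
  have "((\<lambda>y. exp (in_chart c u y) *\<^sub>R axis 1 1 + (\<kappa> * exp (- in_chart c u y)) *\<^sub>R axis 2 1 - k) has_derivative
      (\<lambda>w. U' w *\<^sub>R (exp (in_chart c u x) *\<^sub>R axis 1 1 - (\<kappa> * exp (- in_chart c u x)) *\<^sub>R (axis 2 1 :: real^2)))) (at x)"
    by (rule has_derivative_eq_rhs, (rule derivative_intros dU)+) (simp add: fun_eq_iff algebra_simps)
  from partial_eqI[OF this] partial_cong[OF o x eA]
  show ?A unfolding partial_matrix_vector_mult[OF chart_smooth(1)[OF c] x, symmetric] by (simp add: U'_def partial_def)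
  have "((\<lambda>y. (\<mu> * exp (in_chart c v y)) *\<^sub>R axis 1 1 + exp (- in_chart c v y) *\<^sub>R axis 2 1 - m) has_derivative
      (\<lambda>w. V' w *\<^sub>R ((\<mu> * exp (in_chart c v x)) *\<^sub>R axis 1 1 - exp (- in_chart c v x) *\<^sub>R (axis 2 1 :: real^2)))) (at x)"
    by (rule has_derivative_eq_rhs, (rule derivative_intros dV)+) (simp add: fun_eq_iff algebra_simps)
  from partial_eqI[OF this] partial_cong[OF o x eB]
  show ?B unfolding partial_matrix_vector_mult[OF chart_smooth(2)[OF c] x, symmetric] by (simp add: V'_def partial_def)
qed

lemma uv_regular:
  assumes c: "c \<in> A" and x: "x \<in> chart_image c"
  shows "partial 1 (in_chart c u) x * partial 2 (in_chart c v) x - partial 2 (in_chart c u) x * partial 1 (in_chart c v) x \<noteq> 0"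
proof
  interpret cp: chart_pair "chart_image c" "in_chart c \<alpha>" "in_chart c \<beta>" "g c" by (rule pair[OF c])
  define y z where "y = exp (in_chart c u x) *\<^sub>R axis 1 1 - (\<kappa> * exp (- in_chart c u x)) *\<^sub>R (axis 2 1 :: real^2)"
    and "z = (\<mu> * exp (in_chart c v x)) *\<^sub>R axis 1 1 - exp (- in_chart c v x) *\<^sub>R (axis 2 1 :: real^2)"
  assume zero: "partial 1 (in_chart c u) x * partial 2 (in_chart c v) x - partial 2 (in_chart c u) x * partial 1 (in_chart c v) x = 0"
  have "det Q * (det2 (partial 1 (in_chart c \<alpha>) x) (partial 2 (in_chart c \<beta>) x) - det2 (partial 2 (in_chart c \<alpha>) x) (partial 1 (in_chart c \<beta>) x))
    = det2 (Q *v partial 1 (in_chart c \<alpha>) x) (Q *v partial 2 (in_chart c \<beta>) x) - det2 (Q *v partial 2 (in_chart c \<alpha>) x) (Q *v partial 1 (in_chart c \<beta>) x)"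
    unfolding det2_matrix by (simp add: right_diff_distrib)
  also have "\<dots> = (partial 1 (in_chart c u) x * partial 2 (in_chart c v) x - partial 2 (in_chart c u) x * partial 1 (in_chart c v) x) * det2 y z"
    unfolding partial_frame[OF c x] y_def[symmetric] z_def[symmetric] by (simp add: algebra_simps)
  also have "\<dots> = 0" unfolding zero by simp
  finally have "det Q = 0 \<or> det2 (partial 1 (in_chart c \<alpha>) x) (partial 2 (in_chart c \<beta>) x) - det2 (partial 2 (in_chart c \<alpha>) x) (partial 1 (in_chart c \<beta>) x) = 0"
    by (simp only: mult_eq_0_iff)
  then show False using cp.regular[OF x] detQ by auto
qed

text \<open>On a null line \<open>det2 \<alpha> E2\<close> is an affine function of the parameter and a monotone function of \<open>u\<close>.\<close>
lemma horizontal_line: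
  assumes p: "p \<in> topspace X"
  shows "\<exists>c. continuous_map euclideanreal X c \<and> c (u p) = p \<and> (\<forall>x. u (c x) = x \<and> v (c x) = v p)"
proof -
  obtain \<gamma> a' where \<gamma>: "continuous_map euclideanreal X \<gamma>" "\<gamma> 0 = p" "\<And>t. \<beta> (\<gamma> t) = \<beta> p"
    "\<And>t. det2 (\<alpha> (\<gamma> t)) (E2 p) = det2 (\<alpha> p) (E2 p) + t"
    "\<And>t. ((\<lambda>t. \<alpha> (\<gamma> t)) has_vector_derivative a' t) (at t)" "\<And>t. det2 (a' t) (E1 (\<gamma> t)) = 0"
    by (rule null_line[OF complete p]) blast
  have \<gamma>X: "\<gamma> t \<in> topspace X" for t using \<gamma>(1) by (simp add: continuous_map_def Pi_iff)
  \<comment> \<open>Up to the factor \<open>l\<close> and a constant this is minus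
    \<open>det Q * det2 \<alpha> (E2 p)\<close> as a function of \<open>u\<close>. Both exponentials
    enter increasingly because \<open>\<kappa> * \<mu> < 0\<close>, so \<open>S\<close> is
    injective.\<close>
  define S where "S x = exp (x - v p) - (- (\<kappa> * \<mu>)) * exp (v p - x)" for x
  have S: "l * (S (u p) - S (u (\<gamma> t))) = det Q * t" for t
  proof -
    have "det Q * t = det Q * det2 (\<alpha> (\<gamma> t)) (E2 p) - det Q * det2 (\<alpha> p) (E2 p)"
      unfolding \<gamma>(4)[of t] by (simp add: algebra_simps)
    also have "\<dots> = det2 (Q *v \<alpha> (\<gamma> t)) (Q *v E2 p) - det2 (Q *v \<alpha> p) (Q *v E2 p)" by (simp only: det2_matrix)
    also have "\<dots> = (a1 (\<gamma> t) - a1 p) * (Q *v E2 p) $ 2 - (a2 (\<gamma> t) - a2 p) * (Q *v E2 p) $ 1"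
      unfolding a_affine by (simp add: det2_def algebra_simps)
    also have "(Q *v E2 p) $ 2 = - (l * c2 p)" using l by (simp add: c2_def)
    also have "(Q *v E2 p) $ 1 = l * c1 p" using l by (simp add: c1_def)
    finally show ?thesis
      unfolding exp_uv[OF p] exp_uv[OF \<gamma>X] S_def by (simp add: exp_diff exp_minus divide_inverse algebra_simps)
  qed
  \<comment> \<open>The affine relation between \<open>S\<close> and the parameter solved for the
    parameter, with \<open>det Q\<close> its own inverse. Completeness enters here: the null line is
    defined at this parameter for every \<open>x\<close>.\<close>
  define c where "c x = \<gamma> (det Q * (l * (S (u p) - S x)))" for x
  have "u (c x) = x" for x
  proof -
    have "l * (S (u p) - S (u (c x))) = det Q * det Q * (l * (S (u p) - S x))" unfolding c_def S by simp
    then have "S (u (c x)) = S x" using l unfolding detQ by simp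
    then show ?thesis
      using exp_difference_inj[of 1 "- (\<kappa> * \<mu>)" "u (c x)" "v p" x] \<kappa>\<mu> by (simp add: S_def)
  qed
  moreover have "v (c x) = v p" for x unfolding v_def c2_def E2_def c_def \<gamma>(3) ..
  moreover have "c (u p) = p" by (simp add: c_def \<gamma>(2))
  moreover have "continuous_map euclideanreal X (\<gamma> \<circ> (\<lambda>x. det Q * (l * (S (u p) - S x))))"
    by (rule continuous_map_compose[OF _ \<gamma>(1)]) (auto simp: S_def intro!: continuous_intros)
  then have "continuous_map euclideanreal X c" by (simp add: c_def[abs_def] o_def)
  ultimately show ?thesis by (intro exI[of _ c] conjI allI)
qed

lemma vertical_line:
  assumes p: "p \<in> topspace X"
  shows "\<exists>c. continuous_map euclideanreal X c \<and> c (v p) = p \<and> (\<forall>y. u (c y) = u p \<and> v (c y) = y)"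
proof -
  obtain \<gamma> where \<gamma>: "continuous_map euclideanreal X \<gamma>" "\<gamma> 0 = p" "\<And>t. \<alpha> (\<gamma> t) = \<alpha> p"
    "\<And>t. det2 (\<beta> (\<gamma> t)) (E1 p) = det2 (\<beta> p) (E1 p) - t"
    by (rule null_line_swap[OF complete p]) blast
  have \<gamma>X: "\<gamma> t \<in> topspace X" for t using \<gamma>(1) by (simp add: continuous_map_def Pi_iff)
  define S where "S y = (- (\<kappa> * \<mu>)) * exp (y - u p) - exp (u p - y)" for y
  have S: "l * (S (v p) - S (v (\<gamma> t))) = det Q * t" for t
  proof -
    have "det Q * t = det Q * det2 (\<beta> p) (E1 p) - det Q * det2 (\<beta> (\<gamma> t)) (E1 p)"
      unfolding \<gamma>(4)[of t] by (simp add: algebra_simps)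
    also have "\<dots> = det2 (Q *v \<beta> p) (Q *v E1 p) - det2 (Q *v \<beta> (\<gamma> t)) (Q *v E1 p)" by (simp only: det2_matrix)
    also have "\<dots> = (c1 p - c1 (\<gamma> t)) * (Q *v E1 p) $ 2 - (c2 p - c2 (\<gamma> t)) * (Q *v E1 p) $ 1"
      unfolding c_affine by (simp add: det2_def algebra_simps)
    also have "(Q *v E1 p) $ 2 = - (l * a2 p)" using l by (simp add: a2_def)
    also have "(Q *v E1 p) $ 1 = l * a1 p" using l by (simp add: a1_def)
    finally show ?thesis
      unfolding exp_uv[OF p] exp_uv[OF \<gamma>X] S_def by (simp add: exp_diff exp_minus divide_inverse algebra_simps)
  qed
  define c where "c y = \<gamma> (det Q * (l * (S (v p) - S y)))" for y
  have "v (c y) = y" for y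
  proof -
    have "l * (S (v p) - S (v (c y))) = det Q * det Q * (l * (S (v p) - S y))" unfolding c_def S by simp
    then have "S (v (c y)) = S y" using l unfolding detQ by simp
    then show ?thesis
      using exp_difference_inj[of "- (\<kappa> * \<mu>)" 1 "v (c y)" "u p" y] \<kappa>\<mu> by (simp add: S_def)
  qed
  moreover have "u (c y) = u p" for y unfolding u_def a1_def E1_def c_def \<gamma>(3) ..
  moreover have "c (v p) = p" by (simp add: c_def \<gamma>(2))
  moreover have "continuous_map euclideanreal X (\<gamma> \<circ> (\<lambda>y. det Q * (l * (S (v p) - S y))))"
    by (rule continuous_map_compose[OF _ \<gamma>(1)]) (auto simp: S_def intro!: continuous_intros)
  then have "continuous_map euclideanreal X c" by (simp add: c_def[abs_def] o_def)
  ultimately show ?thesis by (intro exI[of _ c] conjI allI)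
qed

end

subsection \<open>Normal form\<close>

text \<open>At t = 0 the model contains the orbit with planar part ((A + C) e^s, (B + D) e^(-s)). So
  \<open>B + D = 1\<close> normalizes the second coordinate, \<open>c\<close> is
  \<open>A + C\<close>, \<open>a\<close> is the pitch, and \<open>m\<close> is the metric
  coefficient 2AD - 2BC at t = 0, the value of h on the orbit's velocity.\<close>

lemma psi_acm_of_model:
  assumes model: "A * D > 0" "B * C < 0" and BD: "B + D = 1" and AC: "A + C > 0"
  obtains a c m where "admissible a c m" "psi_acm a c m = model_surface.x A B C D"
proof -
  define a c m where "a = 2 * (A * B - C * D)" and "c = A + C" and "m = 2 * (A * D - B * C)"
  have D: "D = 1 - B" using BD by simp
  have p: "a + 2*c + m = 4 * A" "a + 2*c - m = 4 * c * B" "2*c - a - m = 4 * C" "2*c - a + m = 4 * c * D"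
    unfolding a_def c_def m_def D by (simp_all add: algebra_simps)
  have c: "c > 0" using AC by (simp add: c_def)
  have m: "m > 0" using model by (simp add: m_def)
  have "4 * c * m + (4*c\<^sup>2 + m\<^sup>2 - a\<^sup>2) = (a + 2*c + m) * (2*c - a + m)" by (simp add: power2_eq_square algebra_simps)
  also have "\<dots> = 16 * c * (A * D)" unfolding p by simp
  finally have 1: "4 * c * m + (4*c\<^sup>2 + m\<^sup>2 - a\<^sup>2) > 0" using c model(1) by simp
  have "4 * c * m - (4*c\<^sup>2 + m\<^sup>2 - a\<^sup>2) = - ((a + 2*c - m) * (2*c - a - m))" by (simp add: power2_eq_square algebra_simps)
  also have "\<dots> = 16 * c * (- (B * C))" unfolding p by simp
  also have "\<dots> > 0" using c model(2) by (intro mult_pos_pos) simp_all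
  finally have 2: "4 * c * m - (4*c\<^sup>2 + m\<^sup>2 - a\<^sup>2) > 0" .
  have "\<bar>4*c\<^sup>2 + m\<^sup>2 - a\<^sup>2\<bar> < 4 * c * m" unfolding abs_less_iff using 1 2 by linarith
  then have adm: "admissible a c m" using c m by (simp add: admissible_def)
  moreover have "psi_acm a c m = model_surface.x A B C D"
    unfolding psi_acm_eq_model[OF adm] p using c by simp
  ultimately show ?thesis by (rule that)
qed

context positive_frame
begin

lemma coordinates_bijective:
  "\<exists>q\<in>topspace X. u q = x \<and> v q = y"
  "p \<in> topspace X \<Longrightarrow> q \<in> topspace X \<Longrightarrow> u p = u q \<Longrightarrow> v p = v q \<Longrightarrow> p = q"
proof -
  note cont = smooth_fun_continuous[OF smooth_uv(1)] smooth_fun_continuous[OF smooth_uv(2)]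
  define W where "W p = u p *\<^sub>R axis 1 1 + v p *\<^sub>R (axis 2 1 :: real^2)" for p
  have W: "W p $ 1 = u p" "W p $ 2 = v p" for p by (simp_all add: W_def axis_def)
  have cW: "in_chart c W = (\<lambda>x. in_chart c u x *\<^sub>R axis 1 1 + in_chart c v x *\<^sub>R axis 2 1)" for c
    by (simp add: in_chart_def W_def fun_eq_iff)
  have sc: "smooth_on (chart_image c) (in_chart c u)" "smooth_on (chart_image c) (in_chart c v)" if "c \<in> A" for c
    using smooth_uv that by (simp_all add: smooth_fun_def)
  have sW: "smooth_on (chart_image c) (in_chart c W)" if "c \<in> A" for c
    unfolding cW by (intro smooth_on_add smooth_on_scaleR smooth_on_const sc that)
  then have smW: "smooth_fun A W" by (simp add: smooth_fun_def)
  have regW: "det2 (partial 1 (in_chart c W) x) (partial 2 (in_chart c W) x) \<noteq> 0" if c: "c \<in> A" and x: "x \<in> chart_image c" for c x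
  proof -
    have "partial i (in_chart c W) x $ 1 = partial i (in_chart c u) x" "partial i (in_chart c W) x $ 2 = partial i (in_chart c v) x" for i
      unfolding partial_vec_nth[OF sW[OF c] x, symmetric] by (simp_all add: cW axis_def)
    then show ?thesis using uv_regular[OF c x] by (simp add: det2_def mult.commute)
  qed
  define pt where "pt w = fst w *\<^sub>R axis 1 1 + snd w *\<^sub>R (axis 2 1 :: real^2)" for w :: "real \<times> real"
  have pt: "pt w $ 1 = fst w" "pt w $ 2 = snd w" for w by (simp_all add: pt_def axis_def)
  have Wpt: "W p = pt (u p, v p)" for p by (simp add: W_def pt_def)
  \<comment> \<open>The radius and the local inverse are packed into one pair so that a single
    choice over all points provides both.\<close>
  define sec where "sec p z \<longleftrightarrow> fst z > 0 \<and> snd z (u p, v p) = p \<and>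
      (\<forall>w\<in>ball (u p) (fst z) \<times> ball (v p) (fst z). u (snd z w) = fst w \<and> v (snd z w) = snd w) \<and>
      continuous_map (top_of_set (ball (u p) (fst z) \<times> ball (v p) (fst z))) X (snd z) \<and>
      openin X (snd z ` (ball (u p) (fst z) \<times> ball (v p) (fst z)))" for p and z :: "real \<times> (real \<times> real \<Rightarrow> 'p)"
  have "\<forall>p\<in>topspace X. \<exists>z. sec p z"
  proof
    fix p assume p: "p \<in> topspace X"
    then obtain c where c: "c \<in> A" "p \<in> fst c" using chart_cover by blast
    obtain V \<sigma> where V: "open V" "W p \<in> V" "\<sigma> (W p) = p" "\<And>w. w \<in> V \<Longrightarrow> \<sigma> w \<in> fst c \<and> W (\<sigma> w) = w"
      "smooth_on V (\<lambda>w. snd c (\<sigma> w))" "openin X (\<sigma> ` V)" "continuous_map (top_of_set V) X \<sigma>"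
      by (rule local_inverse[OF smW c regW[OF c(1) chart_imageI[OF c(2)]]]) (rule that, assumption+)
    have ptc: "continuous_on UNIV pt" unfolding pt_def[abs_def] by (intro continuous_intros)
    have "open (pt -` V)" using open_vimage[OF V(1)] ptc by blast
    moreover have "(u p, v p) \<in> pt -` V" using V(2) by (simp add: Wpt)
    ultimately obtain a b where ab: "open a" "open b" "u p \<in> a" "v p \<in> b" "a \<times> b \<subseteq> pt -` V"
      by (auto elim: open_prod_elim)
    obtain d1 where d1: "d1 > 0" "ball (u p) d1 \<subseteq> a" using openE[OF ab(1,3)] .
    obtain d2 where d2: "d2 > 0" "ball (v p) d2 \<subseteq> b" using openE[OF ab(2,4)] .
    define d where "d = min d1 d2"
    define S where "S = ball (u p) d \<times> ball (v p) d"
    have "ball (u p) d \<subseteq> a" "ball (v p) d \<subseteq> b" using d1(2) d2(2) by (auto simp: d_def)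
    then have SV: "pt w \<in> V" if "w \<in> S" for w using that ab(5) by (auto simp: S_def)
    have coord: "u (\<sigma> (pt w)) = fst w" "v (\<sigma> (pt w)) = snd w" if "w \<in> S" for w
      using conjunct2[OF V(4)[OF SV[OF that]]] W[of "\<sigma> (pt w)"] by (simp_all add: pt)
    have "continuous_map (top_of_set S) (top_of_set V) pt"
      using continuous_on_subset[OF ptc, of S] SV by (auto simp: continuous_map_in_subtopology)
    then have "continuous_map (top_of_set S) X (\<sigma> \<circ> pt)" by (rule continuous_map_compose[OF _ V(7)])
    moreover have "openin X ((\<sigma> \<circ> pt) ` S)"
    proof -
      \<comment> \<open>The image of a coordinate box under the local inverse, rewritten as an open
        set cut down by continuous conditions on \<open>u\<close> and \<open>v\<close>; this shows
        that it is open.\<close>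
      define N where "N = \<sigma> ` V \<inter> ({q \<in> topspace X. u q \<in> ball (u p) d} \<inter> {q \<in> topspace X. v q \<in> ball (v p) d})"
      have "openin X N" unfolding N_def
        by (intro openin_Int V(6) openin_continuous_map_preimage[OF cont(1)] openin_continuous_map_preimage[OF cont(2)]) simp_all
      moreover have "N = (\<sigma> \<circ> pt) ` S"
      proof (intro equalityI subsetI)
        fix q assume q: "q \<in> N"
        then obtain w where w: "w \<in> V" "q = \<sigma> w" by (auto simp: N_def)
        have "W q = w" unfolding w(2) by (rule conjunct2[OF V(4)[OF w(1)]])
        then have "w = pt (u q, v q)" by (simp only: Wpt)
        moreover have "(u q, v q) \<in> S" using q by (simp add: N_def S_def)
        ultimately show "q \<in> (\<sigma> \<circ> pt) ` S" using w(2) by (intro image_eqI[of _ _ "(u q, v q)"]) simp_all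
      next
        fix q assume "q \<in> (\<sigma> \<circ> pt) ` S"
        then obtain w where w: "w \<in> S" "q = \<sigma> (pt w)" by auto
        have "q \<in> topspace X" using conjunct1[OF V(4)[OF SV[OF w(1)]]] chart_subset[OF c(1)] w(2) by blast
        then show "q \<in> N" using coord[OF w(1)] w(1) imageI[OF SV[OF w(1)], of \<sigma>] unfolding N_def w(2)
          by (simp add: S_def mem_Times_iff)
      qed
      ultimately show ?thesis by simp
    qed
    ultimately have "sec p (d, \<sigma> \<circ> pt)"
      unfolding sec_def using d1(1) d2(1) coord V(3) by (simp add: S_def Wpt d_def)
    then show "\<exists>z. sec p z" ..
  qed
  from bchoice[OF this] obtain z where z: "\<And>p. p \<in> topspace X \<Longrightarrow> sec p (z p)" by blast
  have "\<forall>p\<in>topspace X. \<exists>c. continuous_map euclideanreal X c \<and> c (u p) = p \<and> (\<forall>x. u (c x) = x \<and> v (c x) = v p)"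
    using horizontal_line by (rule ballI)
  from bchoice[OF this] obtain H where H: "\<And>p. p \<in> topspace X \<Longrightarrow>
      continuous_map euclideanreal X (H p) \<and> H p (u p) = p \<and> (\<forall>x. u (H p x) = x \<and> v (H p x) = v p)" by blast
  have "\<forall>p\<in>topspace X. \<exists>c. continuous_map euclideanreal X c \<and> c (v p) = p \<and> (\<forall>y. u (c y) = u p \<and> v (c y) = y)"
    using vertical_line by (rule ballI)
  from bchoice[OF this] obtain K where K: "\<And>p. p \<in> topspace X \<Longrightarrow>
      continuous_map euclideanreal X (K p) \<and> K p (v p) = p \<and> (\<forall>y. u (K p y) = u p \<and> v (K p y) = y)" by blast
  have ll: "line_lifting X u v (\<lambda>p. fst (z p)) (\<lambda>p. snd (z p)) H K"
  proof (rule line_lifting.intro)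
    fix p assume p: "p \<in> topspace X"
    note zp = z[OF p, unfolded sec_def]
    show "fst (z p) > 0" by (rule conjunct1[OF zp])
    show "snd (z p) (u p, v p) = p" by (rule conjunct1[OF conjunct2[OF zp]])
    show "u (snd (z p) w) = fst w \<and> v (snd (z p) w) = snd w" if "w \<in> ball (u p) (fst (z p)) \<times> ball (v p) (fst (z p))" for w
      by (rule bspec[OF conjunct1[OF conjunct2[OF conjunct2[OF zp]]] that])
    show "continuous_map (top_of_set (ball (u p) (fst (z p)) \<times> ball (v p) (fst (z p)))) X (snd (z p))"
      by (rule conjunct1[OF conjunct2[OF conjunct2[OF conjunct2[OF zp]]]])
    show "openin X (snd (z p) ` (ball (u p) (fst (z p)) \<times> ball (v p) (fst (z p))))"
      by (rule conjunct2[OF conjunct2[OF conjunct2[OF conjunct2[OF zp]]]])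
    show "continuous_map euclideanreal X (H p) \<and> H p (u p) = p" "continuous_map euclideanreal X (K p) \<and> K p (v p) = p"
      using H[OF p] K[OF p] by blast+
    show "u (H p x) = x \<and> v (H p x) = v p" "u (K p x) = u p \<and> v (K p x) = x" for x
      using H[OF p] K[OF p] by simp_all
  qed (rule Hausdorff connected cont)+
  show "\<exists>q\<in>topspace X. u q = x \<and> v q = y" by (rule line_lifting.bijective(1)[OF ll nonempty])
  show "p \<in> topspace X \<Longrightarrow> q \<in> topspace X \<Longrightarrow> u p = u q \<Longrightarrow> v p = v q \<Longrightarrow> p = q"
    by (rule line_lifting.bijective(2)[OF ll nonempty])
qed

definition k :: "real^2" where "k = ((Q *v b1) $ 1 / l) *\<^sub>R axis 1 1 - ((Q *v b1) $ 2 / l) *\<^sub>R axis 2 1"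
definition m :: "real^2" where "m = ((Q *v b2) $ 1 / l) *\<^sub>R axis 1 1 - ((Q *v b2) $ 2 / l) *\<^sub>R axis 2 1"

lemma frame_eq:
  assumes "p \<in> topspace X"
  shows "Q *v \<alpha> p = exp (u p) *\<^sub>R axis 1 1 + (\<kappa> * exp (- u p)) *\<^sub>R axis 2 1 - k"
    "Q *v \<beta> p = (\<mu> * exp (v p)) *\<^sub>R axis 1 1 + exp (- v p) *\<^sub>R axis 2 1 - m"
  using exp_uv[OF assms] a_affine[of p] c_affine[of p]
  by (simp_all add: vec_eq_iff forall_2 k_def m_def axis_def)

text \<open>The third coordinate of the model with A = D = 1, B = \<kappa> and C = \<mu>, written in
  the null coordinates s + t and s - t.\<close>

definition height :: "real \<Rightarrow> real \<Rightarrow> real" where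
  "height x y = 2 * \<kappa> * x - 2 * \<mu> * y - exp (x - y) + \<kappa> * \<mu> * exp (y - x)"

text \<open>Centring \<alpha> and \<beta> at the zeros of their affine fields shifts the conormal by
  the constant \<open>k - m\<close>. The term with \<open>det2 (k - m)\<close> is the corresponding
  linear correction of \<zeta>, and \<open>det Q\<close> is the factor by which \<open>Q\<close>
  scales areas.\<close>

lemma height_formula:
  assumes \<zeta>: "smooth_fun A \<zeta>"
    and d\<zeta>: "\<And>c x i. c \<in> A \<Longrightarrow> x \<in> chart_image c \<Longrightarrow> partial i (in_chart c \<zeta>) x =
      - det2 (in_chart c \<alpha> x - in_chart c \<beta> x) (partial i (in_chart c \<alpha>) x + partial i (in_chart c \<beta>) x)"
  obtains h where "\<And>p. p \<in> topspace X \<Longrightarrow> det Q * \<zeta> p - det2 (k - m) (Q *v (\<alpha> p + \<beta> p)) = height (u p) (v p) + h"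
proof -
  define f where "f p = det Q * \<zeta> p - det2 (k - m) (Q *v (\<alpha> p + \<beta> p)) - height (u p) (v p)" for p
  have cf: "in_chart c f = (\<lambda>x. det Q * in_chart c \<zeta> x - det2 (k - m) (Q *v (in_chart c \<alpha> x + in_chart c \<beta> x))
      - height (in_chart c u x) (in_chart c v x))" for c
    by (simp add: in_chart_def f_def fun_eq_iff)
  have bl: "bounded_linear (\<lambda>y. det2 (k - m) (Q *v y))"
    by (rule bounded_linear_compose[OF bounded_bilinear.bounded_linear_right[OF bounded_bilinear_det2] matrix_vector_mul_bounded_linear])
  have sm: "smooth_on (chart_image c) (in_chart c \<zeta>)" "smooth_on (chart_image c) (\<lambda>x. in_chart c \<alpha> x + in_chart c \<beta> x)"
    "smooth_on (chart_image c) (\<lambda>x. det Q * in_chart c \<zeta> x)" "smooth_on (chart_image c) (\<lambda>x. det2 (k - m) (Q *v (in_chart c \<alpha> x + in_chart c \<beta> x)))"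
    "smooth_on (chart_image c) (in_chart c u)" "smooth_on (chart_image c) (in_chart c v)"
    "smooth_on (chart_image c) (\<lambda>x. height (in_chart c u x) (in_chart c v x))" if c: "c \<in> A" for c
  proof -
    show 1: "smooth_on (chart_image c) (in_chart c \<zeta>)" using \<zeta> c by (simp add: smooth_fun_def)
    show 2: "smooth_on (chart_image c) (\<lambda>x. in_chart c \<alpha> x + in_chart c \<beta> x)"
      by (rule smooth_on_add[OF chart_smooth(1)[OF c] chart_smooth(2)[OF c]])
    show "smooth_on (chart_image c) (\<lambda>x. det Q * in_chart c \<zeta> x)" by (rule smooth_on_mult[OF smooth_on_const 1])
    show "smooth_on (chart_image c) (\<lambda>x. det2 (k - m) (Q *v (in_chart c \<alpha> x + in_chart c \<beta> x)))"
      by (rule smooth_on_bounded_linear[OF bl 2])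
    show 3: "smooth_on (chart_image c) (in_chart c u)" "smooth_on (chart_image c) (in_chart c v)"
      using smooth_uv c by (simp_all add: smooth_fun_def)
    show "smooth_on (chart_image c) (\<lambda>x. height (in_chart c u x) (in_chart c v x))"
      unfolding height_def
      by (intro smooth_on_add smooth_on_diff smooth_on_mult smooth_on_const smooth_on_exp 3 chart_homeomorphic(2)[OF c])
  qed
  have "smooth_fun A f"
    unfolding smooth_fun_def cf by (rule ballI) (intro smooth_on_diff sm)
  moreover have "partial i (in_chart c f) x = 0" if c: "c \<in> A" and x: "x \<in> chart_image c" for c x i
  proof -
    have inX: "chart_inv c x \<in> topspace X" using chart_inv_in[OF x] chart_subset[OF c] by blast
    define U V Ui Vi where "U = in_chart c u x" and "V = in_chart c v x"
      and "Ui = partial i (in_chart c u) x" and "Vi = partial i (in_chart c v) x"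
    define dU where "dU = frechet_derivative (in_chart c u) (at x)"
    define dV where "dV = frechet_derivative (in_chart c v) (at x)"
    have dUV: "(in_chart c u has_derivative dU) (at x)" "(in_chart c v has_derivative dV) (at x)"
      unfolding dU_def dV_def by (rule smooth_on_has_derivative[OF sm(5)[OF c] x] smooth_on_has_derivative[OF sm(6)[OF c] x])+
    have "((\<lambda>x. height (in_chart c u x) (in_chart c v x)) has_derivative (\<lambda>w. 2 * \<kappa> * dU w - 2 * \<mu> * dV w
        - (dU w - dV w) * exp (U - V) + \<kappa> * \<mu> * ((dV w - dU w) * exp (V - U)))) (at x)"
      unfolding height_def U_def V_def
      by (rule has_derivative_eq_rhs, (rule derivative_intros dUV)+) (simp add: fun_eq_iff algebra_simps)
    from partial_eqI[OF this, of i]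
    have ph: "partial i (\<lambda>x. height (in_chart c u x) (in_chart c v x)) x
        = 2 * \<kappa> * Ui - 2 * \<mu> * Vi - (Ui - Vi) * exp (U - V) + \<kappa> * \<mu> * ((Vi - Ui) * exp (V - U))"
      by (simp add: Ui_def Vi_def dU_def dV_def partial_def)
    define y where "y = Q *v partial i (in_chart c \<alpha>) x + Q *v partial i (in_chart c \<beta>) x"
    have y: "y = (Ui * exp U + Vi * (\<mu> * exp V)) *\<^sub>R axis 1 1 - (Ui * (\<kappa> * exp (- U)) + Vi * exp (- V)) *\<^sub>R axis 2 1"
      unfolding y_def partial_frame[OF c x] by (simp add: vec_eq_iff forall_2 Ui_def Vi_def U_def V_def algebra_simps)
    have ab: "Q *v in_chart c \<alpha> x - Q *v in_chart c \<beta> x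
        = (exp U - \<mu> * exp V) *\<^sub>R axis 1 1 + (\<kappa> * exp (- U) - exp (- V)) *\<^sub>R axis 2 1 - (k - m)"
      unfolding in_chart_def o_def U_def V_def frame_eq[OF inX] by (simp add: algebra_simps)
    have p1: "partial i (\<lambda>x. det Q * in_chart c \<zeta> x) x = - det2 (Q *v in_chart c \<alpha> x - Q *v in_chart c \<beta> x) y"
      unfolding partial_linear[OF bounded_linear_mult_right sm(1)[OF c] x] d\<zeta>[OF c x] y_def
        matrix_vector_right_distrib[symmetric] matrix_vector_mult_diff_distrib[symmetric] det2_matrix by (simp only: mult_minus_right)
    have p2: "partial i (\<lambda>x. det2 (k - m) (Q *v (in_chart c \<alpha> x + in_chart c \<beta> x))) x = det2 (k - m) y"
      unfolding partial_linear[OF bl sm(2)[OF c] x] partial_add[OF chart_smooth(1)[OF c] chart_smooth(2)[OF c] x] y_def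
      unfolding matrix_vector_right_distrib ..
    have e: "exp (- U) * exp U = 1" "exp (- V) * exp V = 1" "exp U * exp (- V) = exp (U - V)" "exp V * exp (- U) = exp (V - U)"
      by (simp_all add: exp_add[symmetric])
    have "partial i (in_chart c f) x = partial i (\<lambda>x. det Q * in_chart c \<zeta> x) x
        - partial i (\<lambda>x. det2 (k - m) (Q *v (in_chart c \<alpha> x + in_chart c \<beta> x))) x
        - partial i (\<lambda>x. height (in_chart c u x) (in_chart c v x)) x"
      unfolding cf by (simp only: partial_diff[OF smooth_on_diff[OF sm(3)[OF c] sm(4)[OF c]] sm(7)[OF c] x] partial_diff[OF sm(3)[OF c] sm(4)[OF c] x])
    also have "\<dots> = - det2 ((exp U - \<mu> * exp V) *\<^sub>R axis 1 1 + (\<kappa> * exp (- U) - exp (- V)) *\<^sub>R axis 2 1) y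
        - (2 * \<kappa> * Ui - 2 * \<mu> * Vi - (Ui - Vi) * exp (U - V) + \<kappa> * \<mu> * ((Vi - Ui) * exp (V - U)))"
      unfolding p1 p2 ab ph by (simp add: det2_def algebra_simps)
    also have "\<dots> = (exp U - \<mu> * exp V) * (Ui * (\<kappa> * exp (- U)) + Vi * exp (- V)) + (\<kappa> * exp (- U) - exp (- V)) * (Ui * exp U + Vi * (\<mu> * exp V))
        - (2 * \<kappa> * Ui - 2 * \<mu> * Vi - (Ui - Vi) * exp (U - V) + \<kappa> * \<mu> * ((Vi - Ui) * exp (V - U)))"
      unfolding y by (simp add: det2_def axis_def algebra_simps)
    also have "\<dots> = 2 * \<kappa> * Ui * (exp (- U) * exp U - 1) - 2 * \<mu> * Vi * (exp (- V) * exp V - 1)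
        + (Vi - Ui) * (exp U * exp (- V) - exp (U - V)) + \<kappa> * \<mu> * (Vi - Ui) * (exp V * exp (- U) - exp (V - U))"
      by (simp add: algebra_simps)
    also have "\<dots> = 0" unfolding e by simp
    finally show ?thesis .
  qed
  ultimately have "f p = f base" if "p \<in> topspace X" for p
    by (rule constant_if_partial_zero[OF _ _ base that])
  then show ?thesis using that[of "f base"] by (simp add: f_def algebra_simps)
qed

lemma normal_form:
  assumes \<zeta>: "smooth_fun A \<zeta>"
    and d\<zeta>: "\<And>c x i. c \<in> A \<Longrightarrow> x \<in> chart_image c \<Longrightarrow> partial i (in_chart c \<zeta>) x =
      - det2 (in_chart c \<alpha> x - in_chart c \<beta> x) (partial i (in_chart c \<alpha>) x + partial i (in_chart c \<beta>) x)"
  obtains a c m' N w F where "admissible a c m'" "det (N :: real^3^3) = 1" "diffeomorphism X A euclidean plane_atlas F"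
    "\<And>p. p \<in> topspace X \<Longrightarrow> N *v vector [(\<alpha> p + \<beta> p) $ 1, (\<alpha> p + \<beta> p) $ 2, \<zeta> p] + w = psi_acm a c m' (F p)"
proof -
  obtain h where h: "\<And>p. p \<in> topspace X \<Longrightarrow> det Q * \<zeta> p - det2 (k - m) (Q *v (\<alpha> p + \<beta> p)) = height (u p) (v p) + h"
    by (rule height_formula[OF assms]) (assumption, assumption, rule that)
  txt \<open>The translations of \<open>u - v\<close> by \<open>2 d\<close> and of \<open>u + v\<close> by \<open>2 r\<close> serve to make \<open>A0 + C0 > 0\<close> and
    \<open>B0 + D0 = 1\<close>, as required by the parametrization of \<open>psi_acm\<close>.\<close>
  define d where "d = ln (1 + \<bar>\<mu>\<bar> + \<bar>\<kappa>\<bar>) / 2"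
  have d: "exp (2 * d) = 1 + \<bar>\<mu>\<bar> + \<bar>\<kappa>\<bar>" by (simp add: d_def)
  have dd: "exp d = exp (- d) * exp (2 * d)" by (simp add: exp_add[symmetric])
  have "exp d + \<kappa> * exp (- d) = exp (- d) * (1 + \<bar>\<mu>\<bar> + (\<bar>\<kappa>\<bar> + \<kappa>))" unfolding dd d by (simp add: algebra_simps)
  also have "\<dots> > 0" by (intro mult_pos_pos) (simp, smt (verit))
  finally have \<kappa>pos: "exp d + \<kappa> * exp (- d) > 0" .
  have "exp d + \<mu> * exp (- d) = exp (- d) * (1 + \<bar>\<kappa>\<bar> + (\<bar>\<mu>\<bar> + \<mu>))" unfolding dd d by (simp add: algebra_simps)
  also have "\<dots> > 0" by (intro mult_pos_pos) (simp, smt (verit))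
  finally have \<mu>pos: "exp d + \<mu> * exp (- d) > 0" .
  define r where "r = ln (exp d + \<kappa> * exp (- d))"
  have r: "exp r = exp d + \<kappa> * exp (- d)" using \<kappa>pos by (simp add: r_def)
  \<comment> \<open>The coefficients obtained by substituting u = s + t + r + d and v = s - t + r -
    d into the eigencoordinates e^u, \<kappa> e^(-u), \<mu> e^v, e^(-v).\<close>
  define A0 B0 C0 D0 where "A0 = exp (r + d)" and "B0 = \<kappa> * exp (- r - d)" and "C0 = \<mu> * exp (r - d)" and "D0 = exp (d - r)"
  have AD: "A0 * D0 > 0" by (simp add: A0_def D0_def)
  have "B0 * C0 = (\<kappa> * \<mu>) * (exp (- r - d) * exp (r - d))" by (simp add: B0_def C0_def)
  also have "\<dots> < 0" by (rule mult_neg_pos[OF \<kappa>\<mu>]) simp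
  finally have BC: "B0 * C0 < 0" .
  have "B0 + D0 = exp (- r) * (exp d + \<kappa> * exp (- d))" by (simp add: B0_def D0_def exp_diff exp_minus divide_inverse algebra_simps)
  also have "\<dots> = 1" unfolding r[symmetric] by (simp add: exp_minus)
  finally have BD: "B0 + D0 = 1" .
  have "A0 + C0 = exp r * (exp d + \<mu> * exp (- d))" by (simp add: A0_def C0_def exp_add exp_diff exp_minus divide_inverse algebra_simps)
  then have AC: "A0 + C0 > 0" using \<mu>pos by simp
  interpret ms: model_surface A0 B0 C0 D0 by (rule model_surface.intro[OF AD BC])
  obtain a c m' where acm: "admissible a c m'" "psi_acm a c m' = ms.x" by (rule psi_acm_of_model[OF AD BC BD AC])
  define s t where "s p = (u p + v p) / 2 - r" and "t p = (u p - v p) / 2 - d" for p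
  define F where "F p = s p *\<^sub>R axis 1 1 + t p *\<^sub>R (axis 2 1 :: real^2)" for p
  have F: "F p $ 1 = s p" "F p $ 2 = t p" for p by (simp_all add: F_def axis_def)
  have cs: "in_chart c s = (\<lambda>x. (in_chart c u x + in_chart c v x) * (1/2) - r)" and ct: "in_chart c t = (\<lambda>x. (in_chart c u x - in_chart c v x) * (1/2) - d)" for c
    by (simp_all add: in_chart_def s_def t_def fun_eq_iff)
  have cF: "in_chart c F = (\<lambda>x. in_chart c s x *\<^sub>R axis 1 1 + in_chart c t x *\<^sub>R axis 2 1)" for c
    by (simp add: in_chart_def F_def fun_eq_iff)
  have sc: "smooth_on (chart_image c) (in_chart c u)" "smooth_on (chart_image c) (in_chart c v)" if "c \<in> A" for c
    using smooth_uv that by (simp_all add: smooth_fun_def)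
  have sst: "smooth_on (chart_image c) (in_chart c s)" "smooth_on (chart_image c) (in_chart c t)" if "c \<in> A" for c
    unfolding cs ct by (intro smooth_on_add smooth_on_diff smooth_on_mult smooth_on_const sc that)+
  have sF: "smooth_on (chart_image c) (in_chart c F)" if "c \<in> A" for c
    unfolding cF by (intro smooth_on_add smooth_on_scaleR smooth_on_const sst that)
  have regF: "det2 (partial 1 (in_chart c F) x) (partial 2 (in_chart c F) x) \<noteq> 0" if c: "c \<in> A" and x: "x \<in> chart_image c" for c x
  proof -
    note du = smooth_on_has_derivative[OF sc(1)[OF c] x] and dv = smooth_on_has_derivative[OF sc(2)[OF c] x]
    have "(in_chart c s has_derivative (\<lambda>w. (frechet_derivative (in_chart c u) (at x) w + frechet_derivative (in_chart c v) (at x) w) * (1/2))) (at x)"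
      "(in_chart c t has_derivative (\<lambda>w. (frechet_derivative (in_chart c u) (at x) w - frechet_derivative (in_chart c v) (at x) w) * (1/2))) (at x)"
      unfolding cs ct by (rule has_derivative_eq_rhs, (rule derivative_intros du dv)+, simp)+
    from partial_eqI[OF this(1)] partial_eqI[OF this(2)]
    have pst: "partial i (in_chart c s) x = (partial i (in_chart c u) x + partial i (in_chart c v) x) * (1/2)"
      "partial i (in_chart c t) x = (partial i (in_chart c u) x - partial i (in_chart c v) x) * (1/2)" for i
      by (simp_all add: partial_def)
    have "partial i (in_chart c F) x $ 1 = partial i (in_chart c s) x" "partial i (in_chart c F) x $ 2 = partial i (in_chart c t) x" for i
      unfolding partial_vec_nth[OF sF[OF c] x, symmetric] by (simp_all add: cF axis_def)
    note pF = this
    have "det2 (partial 1 (in_chart c F) x) (partial 2 (in_chart c F) x)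
        = - (partial 1 (in_chart c u) x * partial 2 (in_chart c v) x - partial 2 (in_chart c u) x * partial 1 (in_chart c v) x) * (1/2)"
      unfolding det2_def pF pst by (simp add: algebra_simps)
    then show ?thesis using uv_regular[OF c x] by simp
  qed
  have bij: "bij_betw F (topspace X) UNIV"
    unfolding bij_betw_def
  proof
    show "inj_on F (topspace X)"
    proof (rule inj_onI)
      fix p q assume pq: "p \<in> topspace X" "q \<in> topspace X" and eq: "F p = F q"
      have "s p = s q" "t p = t q" using arg_cong[OF eq, of "\<lambda>y. y $ 1"] arg_cong[OF eq, of "\<lambda>y. y $ 2"] by (simp_all add: F)
      then have "u p = u q" "v p = v q" by (simp_all add: s_def t_def)
      then show "p = q" by (rule coordinates_bijective(2)[OF pq])
    qed
    have "y \<in> F ` topspace X" for y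
    proof -
      obtain q where q: "q \<in> topspace X" "u q = y $ 1 + y $ 2 + r + d" "v q = y $ 1 - y $ 2 + r - d"
        using coordinates_bijective(1)[of "y $ 1 + y $ 2 + r + d" "y $ 1 - y $ 2 + r - d"] by blast
      have "F q = y" by (simp add: vec_eq_iff forall_2 F s_def t_def q field_simps)
      then show ?thesis using q(1) by blast
    qed
    then show "F ` topspace X = UNIV" by blast
  qed
  have diffeo: "diffeomorphism X A euclidean plane_atlas F"
    by (rule diffeomorphism_plane[OF _ bij regF]) (simp_all add: smooth_fun_def sF)
  define n where "n = k - m"
  \<comment> \<open>\<open>Q\<close> on the plane, followed by the shear that subtracts
    \<open>det2 n (Q z)\<close> from the height. The corner entry \<open>det Q\<close> scales the
    height as in \<open>height_formula\<close> and makes \<open>det N\<close> the square of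
    \<open>det Q\<close>, which is 1.\<close>
  define N :: "real^3^3" where "N = vector [vector [Q $ 1 $ 1, Q $ 1 $ 2, 0], vector [Q $ 2 $ 1, Q $ 2 $ 2, 0],
      vector [n $ 2 * Q $ 1 $ 1 - n $ 1 * Q $ 2 $ 1, n $ 2 * Q $ 1 $ 2 - n $ 1 * Q $ 2 $ 2, det Q]]"
  \<comment> \<open>The constant by which the linear part of \<open>height\<close> changes under the
    translations by \<open>r\<close> and \<open>d\<close>, together with the integration constant;
    it is removed by a vertical translation.\<close>
  define H where "H = 2 * \<kappa> * (r + d) - 2 * \<mu> * (r - d) + h"
  define w :: "real^3" where "w = vector [(k + m) $ 1, (k + m) $ 2, - H]"
  have "det N = (Q $ 1 $ 1 * Q $ 2 $ 2 - Q $ 1 $ 2 * Q $ 2 $ 1) * det Q"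
    by (simp add: det_3 N_def algebra_simps)
  also have "\<dots> = 1" using detQ by (simp add: det_2)
  finally have detN: "det N = 1" .
  have Nv: "(N *v vector [z $ 1, z $ 2, y] + w) $ 1 = (Q *v z) $ 1 + (k + m) $ 1"
    "(N *v vector [z $ 1, z $ 2, y] + w) $ 2 = (Q *v z) $ 2 + (k + m) $ 2"
    "(N *v vector [z $ 1, z $ 2, y] + w) $ 3 = det Q * y - det2 n (Q *v z) - H" for z :: "real^2" and y
    by (simp_all add: matrix_vector_mult_def sum_3 sum_2 N_def w_def det2_def algebra_simps)
  have eq: "N *v vector [(\<alpha> p + \<beta> p) $ 1, (\<alpha> p + \<beta> p) $ 2, \<zeta> p] + w = psi_acm a c m' (F p)" if p: "p \<in> topspace X" for p
  proof -
    have st: "s p + t p = u p - r - d" "s p - t p = v p - r + d" "2 * t p = u p - v p - 2 * d" by (simp_all add: s_def t_def field_simps)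
    have pe: "A0 * plane_exp 1 1 (F p) = exp (u p)" "C0 * plane_exp 1 (-1) (F p) = \<mu> * exp (v p)"
      "B0 * plane_exp (-1) (-1) (F p) = \<kappa> * exp (- u p)" "D0 * plane_exp (-1) 1 (F p) = exp (- v p)"
      "A0 * D0 * plane_exp 0 2 (F p) = exp (u p - v p)" "B0 * C0 * plane_exp 0 (-2) (F p) = \<kappa> * \<mu> * exp (v p - u p)"
      "A0 * B0 = \<kappa>" "C0 * D0 = \<mu>"
      by (simp_all add: plane_exp_def F A0_def B0_def C0_def D0_def s_def t_def exp_add[symmetric] algebra_simps)
        (simp_all add: exp_add[symmetric] field_simps)
    have Qz: "Q *v (\<alpha> p + \<beta> p) = (exp (u p) + \<mu> * exp (v p)) *\<^sub>R axis 1 1 + (\<kappa> * exp (- u p) + exp (- v p)) *\<^sub>R axis 2 1 - (k + m)"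
      unfolding matrix_vector_right_distrib frame_eq[OF p] by (simp add: algebra_simps)
    have "ms.x (F p) $ 3 = 2 * \<kappa> * (s p + t p) - 2 * \<mu> * (s p - t p) - exp (u p - v p) + \<kappa> * \<mu> * exp (v p - u p)"
      unfolding ms.x_nth F pe by (simp add: algebra_simps)
    also have "\<dots> = height (u p) (v p) + h - H"
      unfolding st height_def H_def by (simp add: algebra_simps)
    also have "\<dots> = det Q * \<zeta> p - det2 n (Q *v (\<alpha> p + \<beta> p)) - H" unfolding n_def h[OF p] ..
    finally have 3: "ms.x (F p) $ 3 = det Q * \<zeta> p - det2 n (Q *v (\<alpha> p + \<beta> p)) - H" .
    have 1: "ms.x (F p) $ 1 = (Q *v (\<alpha> p + \<beta> p)) $ 1 + (k + m) $ 1" "ms.x (F p) $ 2 = (Q *v (\<alpha> p + \<beta> p)) $ 2 + (k + m) $ 2"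
      unfolding ms.x_nth pe Qz by (simp_all add: axis_def)
    show ?thesis
      unfolding acm(2) vec_eq_iff[of _ "ms.x (F p)"] forall_3 Nv 1 3 by simp
  qed
  show ?thesis by (rule that[OF acm(1) detN diffeo eq])
qed

end

theorem theorem5p2:
  shows "(\<forall>a c m. admissible a c m \<longrightarrow>
            complete_nonflat_helicoidal_IAS euclidean plane_atlas (psi_acm a c m)) \<and>
         (\<forall>(X :: 'p topology) A \<psi>. complete_nonflat_helicoidal_IAS X A \<psi> \<longrightarrow>
            (\<exists>a c m T. admissible a c m \<and> equiaffine T \<and>
               is_reparametrization X A (T \<circ> \<psi>) euclidean plane_atlas (psi_acm a c m)))"
proof (intro conjI allI impI)
  show "complete_nonflat_helicoidal_IAS euclidean plane_atlas (psi_acm a c m)" if "admissible a c m" for a c m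
    by (rule complete_nonflat_helicoidal_psi_acm[OF that])
  fix X :: "'p topology" and A \<psi> assume "complete_nonflat_helicoidal_IAS X A \<psi>"
  then obtain L :: "real^3^3" and \<alpha> \<beta> \<zeta> g B b1 b2 where L: "det L = 1" and pair: "curved_pair X A \<alpha> \<beta> g B b1 b2"
    and complete: "complete_metric X A g" and \<zeta>: "smooth_fun A \<zeta>"
    "\<And>c u i. c \<in> A \<Longrightarrow> u \<in> chart_image c \<Longrightarrow> partial i (in_chart c \<zeta>) u =
      - det2 (in_chart c \<alpha> u - in_chart c \<beta> u) (partial i (in_chart c \<alpha>) u + partial i (in_chart c \<beta>) u)"
    and \<psi>: "\<And>p. L *v \<psi> p = vector [(\<alpha> p + \<beta> p) $ 1, (\<alpha> p + \<beta> p) $ 2, \<zeta> p]"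
    by (rule complete_nonflat_helicoidal_IAS_reduction) (rule that, assumption+)
  obtain Q l where "positive_frame X A \<alpha> \<beta> g B b1 b2 Q l"
    by (rule curved_pair.positive_frame_exists[OF pair complete])
  then interpret positive_frame X A \<alpha> \<beta> g B b1 b2 Q l .
  obtain a c m' N w F where nf: "admissible a c m'" "det (N :: real^3^3) = 1" "diffeomorphism X A euclidean plane_atlas F"
    "\<And>p. p \<in> topspace X \<Longrightarrow> N *v vector [(\<alpha> p + \<beta> p) $ 1, (\<alpha> p + \<beta> p) $ 2, \<zeta> p] + w = psi_acm a c m' (F p)"
    by (rule normal_form[OF \<zeta>]) (assumption, assumption, rule that, assumption+)
  define T where "T v = (N ** L) *v v + w" for v
  have "equiaffine T"
    unfolding equiaffine_def T_def[abs_def] using L nf(2) by (intro exI[of _ "N ** L"] exI[of _ w]) (simp add: det_mul)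
  moreover have "is_reparametrization X A (T \<circ> \<psi>) euclidean plane_atlas (psi_acm a c m')"
    unfolding is_reparametrization_def
  proof (intro exI[of _ F] conjI nf(3) ballI)
    fix p assume "p \<in> topspace X"
    from nf(4)[OF this] show "(T \<circ> \<psi>) p = psi_acm a c m' (F p)"
      by (simp add: T_def matrix_vector_mul_assoc[symmetric] \<psi>)
  qed
  ultimately show "\<exists>a c m T. admissible a c m \<and> equiaffine T \<and>
      is_reparametrization X A (T \<circ> \<psi>) euclidean plane_atlas (psi_acm a c m)"
    using nf(1) by (intro exI[of _ a] exI[of _ c] exI[of _ m'] exI[of _ T] conjI)
qed

end
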